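(* Let $\beta>0$. For $(n,k,j)\in\mathbf N\times\mathbf Z\times\{-1,0,1\}$ let $\tau(n,k,j)$ and the unit vectors $\Psi_{n,k,j}$ be as defined in the context. Then $(\Psi_{n,k,j})_{(n,k,j)\in\mathbf N\times\mathbf Z\times\{-1,0,1\}}$ is a Hilbertian basis of $L^2(\mathbf R\times\mathbf T)$ (three-component fields) constituted of eigenvectors of $L$: $$\forall(n,k,j)\in\mathbf N\times\mathbf Z\times\{-1,0,1\},\qquad L\Psi_{n,k,j}=i\tau(n,k,j)\Psi_{n,k,j}.$$ Furthermore, for all $s\ge0$ there exists a nonnegative constant $C_s$ such that, for all $(n,k,j)\in\mathbf N\times\mathbf Z\times\{-1,0,1\}$, $$\|\Psi_{n,k,j}\|_{L^\infty(\mathbf R\times\mathbf T)}\le C_0,\qquad\|\Psi_{n,k,j}\|_{W^{s,\infty}(\mathbf R\times\mathbf T)}\le C_s(1+|k|^2+n)^{s/2},$$ $$C_s^{-1}(1+|k|^2+n)^{s/2}\le\|\Psi_{n,k,j}\|_{H^s(\mathbf R\times\mathbf T)}\le C_s(1+|k|^2+n)^{s/2}.$$ Moreover the eigenspace of $L$ associated with any non zero eigenvalue is of finite dimension.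
   Context: $\mathbf T=\mathbf R/2\pi\mathbf Z$ and $L(\eta,u)=(\nabla\cdot u,\ \beta x_1u^\perp+\nabla\eta)$ on $L^2(\mathbf R\times\mathbf T)^3$, with $u^\perp=(u_2,-u_1)$. $H^s$ and $W^{s,\infty}$ are the usual Sobolev spaces. Hermite functions: $(\psi_n)_{n\ge0}$ is the orthonormal basis of $L^2(\mathbf R)$ with $\psi_n(x_1)=e^{-\beta x_1^2/2}P_n(\sqrt\beta x_1)$, $\deg P_n=n$, $-\psi_n''+\beta^2x_1^2\psi_n=\beta(2n+1)\psi_n$, $\psi_n'+\beta x_1\psi_n=\sqrt{2\beta n}\,\psi_{n-1}$, $\psi_n'-\beta x_1\psi_n=-\sqrt{2\beta(n+1)}\,\psi_{n+1}$, and $\psi_{-1}=0$. Eigenvalues: for $n\ge1$, $k\in\mathbf Z$, $\tau(n,k,-1)<\tau(n,k,0)<\tau(n,k,1)$ are the three roots of $\tau^3-(k^2+\beta(2n+1))\tau-\beta k=0$; for $n=0$, $\tau(0,k,0)=k$ and $\tau(0,k,\pm1)=\frac k2\pm\frac12\sqrt{k^2+4\beta}$. Eigenvectors: if $j\ne0$ (any $n\ge0$, $k\in\mathbf Z$), or if $j=0$, $n\ge1$, $k\neq0$, then with $\tau=\tau(n,k,j)$ (terms containing $\sqrt n$ or $n$ being absent when $n=0$) $$\Psi_{n,k,j}(x_1,x_2)=C_{n,k,j}e^{ikx_2}\begin{pmatrix}\frac{-i}{\tau+k}\sqrt{\frac{\beta n}2}\,\psi_{n-1}(x_1)+\frac{i}{\tau-k}\sqrt{\frac{\beta(n+1)}2}\,\psi_{n+1}(x_1)\\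 \psi_n(x_1)\\ \frac{i}{\tau+k}\sqrt{\frac{\beta n}2}\,\psi_{n-1}(x_1)+\frac{i}{\tau-k}\sqrt{\frac{\beta(n+1)}2}\,\psi_{n+1}(x_1)\end{pmatrix},$$ $$C_{n,k,j}=(2\pi)^{-1/2}\left(\frac{\beta n}{(\tau+k)^2}+\frac{\beta(n+1)}{(\tau-k)^2}+1\right)^{-1/2}.$$ For $n\ge1$, $$\Psi_{n,0,0}=\frac1{\sqrt{2\pi(2n+1)}}\begin{pmatrix}-\sqrt{\frac{n+1}2}\,\psi_{n-1}-\sqrt{\frac n2}\,\psi_{n+1}\\0\\ \sqrt{\frac{n+1}2}\,\psi_{n-1}-\sqrt{\frac n2}\,\psi_{n+1}\end{pmatrix},$$ and for all $k\in\mathbf Z$, $\Psi_{0,k,0}=\frac1{\sqrt{4\pi}}e^{ikx_2}(\psi_0,0,\psi_0)$. *)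

theory Defs
  imports
    "HOL-Analysis.Analysis"
    "HOL-Probability.Essential_Supremum"
    "HOL-Computational_Algebra.Polynomial"
begin

section \<open>Function spaces on $\mathbf R\times\mathbf T$\<close>

text \<open>
  Functions on $\mathbf R\times\mathbf T$, with $\mathbf T=\mathbf R/2\pi\mathbf Z$, are functions
  on the plane that are $2\pi$-periodic in the second variable; integrals are taken over the
  fundamental domain $\mathbf R\times[0,2\pi)$. Elements of the Lebesgue spaces are represented by
  Borel functions, and equality in these spaces is equality almost everywhere on the fundamental
  domain.
\<close>

type_synonym vfield = "real \<times> real \<Rightarrow> complex ^ 3"

definition RT :: "(real \<times> real) measure" where
  "RT = restrict_space lborel (UNIV \<times> {0..<2 * pi})"

definition periodic_snd :: "(real \<times> real \<Rightarrow> 'a) \<Rightarrow> bool" where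
  "periodic_snd f \<longleftrightarrow> (\<forall>x y. f (x, y + 2 * pi) = f (x, y))"

definition L2 :: "vfield set" where
  "L2 = {f. periodic_snd f \<and> f \<in> borel_measurable borel \<and> integrable RT (\<lambda>x. (norm (f x))\<^sup>2)}"

definition L2_norm :: "vfield \<Rightarrow> real" where
  "L2_norm f = sqrt (\<integral>x. (norm (f x))\<^sup>2 \<partial>RT)"

definition L2_inner :: "vfield \<Rightarrow> vfield \<Rightarrow> complex" where
  "L2_inner f g = (\<integral>x. (\<Sum>i\<in>UNIV. f x $ i * cnj (g x $ i)) \<partial>RT)"

definition Linf_norm :: "vfield \<Rightarrow> ennreal" where
  "Linf_norm f = esssup RT (\<lambda>x. ennreal (norm (f x)))"

definition Linf :: "vfield set" where
  "Linf = {f. periodic_snd f \<and> f \<in> borel_measurable borel \<and> Linf_norm f < \<infinity>}"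

definition hilbert_basis :: "'i set \<Rightarrow> ('i \<Rightarrow> vfield) \<Rightarrow> bool" where
  "hilbert_basis I e \<longleftrightarrow>
     (\<forall>i\<in>I. e i \<in> L2) \<and>
     (\<forall>i\<in>I. \<forall>j\<in>I. L2_inner (e i) (e j) = (if i = j then 1 else 0)) \<and>
     (\<forall>f\<in>L2. \<forall>\<epsilon>>0. \<exists>F c. finite F \<and> F \<subseteq> I \<and> L2_norm (\<lambda>x. f x - (\<Sum>i\<in>F. c i *s e i x)) < \<epsilon>)"


section \<open>Test functions and weak derivatives\<close>

text \<open>
  Identities between distributions are identities of tempered distributions on
  $\mathbf R\times\mathbf T$: the test functions are smooth, $2\pi$-periodic in the second variable,
  and rapidly decreasing in the first one together with all their derivatives. Since the fields
  are complex-valued, it is enough to test against real functions. If all the iterated partial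
  derivatives \<open>pd a b \<phi>\<close> are (Frechet) differentiable, then the partial derivatives of \<open>\<phi>\<close> commute
  and \<open>\<phi>\<close> is smooth.
\<close>

definition pd1 :: "(real \<times> real \<Rightarrow> real) \<Rightarrow> real \<times> real \<Rightarrow> real" where
  "pd1 \<phi> = (\<lambda>(x, y). deriv (\<lambda>t. \<phi> (t, y)) x)"

definition pd2 :: "(real \<times> real \<Rightarrow> real) \<Rightarrow> real \<times> real \<Rightarrow> real" where
  "pd2 \<phi> = (\<lambda>(x, y). deriv (\<lambda>t. \<phi> (x, t)) y)"

definition pd :: "nat \<Rightarrow> nat \<Rightarrow> (real \<times> real \<Rightarrow> real) \<Rightarrow> real \<times> real \<Rightarrow> real" where
  "pd a b \<phi> = (pd1 ^^ a) ((pd2 ^^ b) \<phi>)"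

definition schwartz_RT :: "(real \<times> real \<Rightarrow> real) set" where
  "schwartz_RT = {\<phi>. periodic_snd \<phi> \<and>
     (\<forall>a b. pd a b \<phi> differentiable_on UNIV) \<and>
     (\<forall>a b p. bounded (range (\<lambda>x. fst x ^ p * pd a b \<phi> x)))}"

definition is_weak_deriv :: "nat \<Rightarrow> nat \<Rightarrow> vfield \<Rightarrow> vfield \<Rightarrow> bool" where
  "is_weak_deriv a b f g \<longleftrightarrow> f \<in> Linf \<and> g \<in> Linf \<and>
     (\<forall>\<phi>\<in>schwartz_RT. (\<integral>x. pd a b \<phi> x *\<^sub>R f x \<partial>RT) = (- 1) ^ (a + b) *\<^sub>R (\<integral>x. \<phi> x *\<^sub>R g x \<partial>RT))"


section \<open>Sobolev norms\<close>

text \<open>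
  For a nonnegative real $s=m+\theta$ with $m$ an integer and $0\le\theta<1$, the space
  $W^{s,\infty}$ consists of the functions whose weak derivatives of order at most $m$ are bounded
  and, if $\theta>0$, whose derivatives of order $m$ are moreover Hoelder continuous of exponent
  $\theta$. The infima range over the representatives of one class modulo
  almost everywhere equality. If there is no bounded weak derivative, then the infimum is over
  the empty set and the norm is infinite.
\<close>

definition hoelder_seminorm :: "real \<Rightarrow> vfield \<Rightarrow> ennreal" where
  "hoelder_seminorm \<theta> g =
     (SUP (x, y)\<in>{(x, y). x \<noteq> y}. ennreal (norm (g x - g y) / dist x y powr \<theta>))"

definition Wsinf_norm :: "real \<Rightarrow> vfield \<Rightarrow> ennreal" where
  "Wsinf_norm s f =
     (let m = nat \<lfloor>s\<rfloor>; \<theta> = frac s in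
      \<Sum>(a, b)\<in>{(a, b). a + b \<le> m}. INF g\<in>{g. is_weak_deriv a b f g}.
        Linf_norm g + (if a + b = m \<and> 0 < \<theta> then hoelder_seminorm \<theta> g else 0))"

text \<open>
  The Fourier transform of a square integrable field is the function on $\mathbf R\times\mathbf Z$
  given formally by $\hat f(\xi,k)=\frac1{2\pi}\int e^{-i(\xi x_1+kx_2)}f(x)\,dx$. As this integral need
  not converge, the transform is taken in the sense of tempered distributions, that is, it is put
  on the test function. It is unique up to almost everywhere equality, and unitary with the factor
  $\frac1{2\pi}$.
\<close>

definition schwartz_R :: "(real \<Rightarrow> real) set" where
  "schwartz_R = {\<phi>. (\<forall>m. (deriv ^^ m) \<phi> differentiable_on UNIV) \<and>
     (\<forall>m p. bounded (range (\<lambda>x. x ^ p * (deriv ^^ m) \<phi> x)))}"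

definition is_fourier :: "vfield \<Rightarrow> (real \<Rightarrow> int \<Rightarrow> complex ^ 3) \<Rightarrow> bool" where
  "is_fourier f F \<longleftrightarrow> f \<in> L2 \<and>
     (\<forall>k. (\<lambda>\<xi>. F \<xi> k) \<in> borel_measurable borel \<and> integrable lborel (\<lambda>\<xi>. (norm (F \<xi> k))\<^sup>2) \<and>
       (\<forall>\<phi>\<in>schwartz_R. (\<integral>\<xi>. \<phi> \<xi> *\<^sub>R F \<xi> k \<partial>lborel) =
          (\<integral>x. (1 / (2 * pi) * (\<integral>\<xi>. \<phi> \<xi> *\<^sub>R cis (- \<xi> * fst x) \<partial>lborel) * cis (- of_int k * snd x))
                 *s f x \<partial>RT)))"

definition ennreal_sqrt :: "ennreal \<Rightarrow> ennreal" where
  "ennreal_sqrt X = (if X = \<infinity> then \<infinity> else ennreal (sqrt (enn2real X)))"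

text \<open>
  The set of Fourier transforms below is empty exactly if \<open>f\<close> is not square integrable; otherwise
  all its members yield the same value.
\<close>

definition Hs_norm :: "real \<Rightarrow> vfield \<Rightarrow> ennreal" where
  "Hs_norm s f = ennreal_sqrt (INF F\<in>{F. is_fourier f F}.
     \<integral>\<^sup>+k. (\<integral>\<^sup>+\<xi>. ennreal ((1 + \<xi>\<^sup>2 + (of_int k)\<^sup>2) powr s * (norm (F \<xi> k))\<^sup>2) \<partial>lborel) \<partial>count_space UNIV)"


section \<open>The operator\<close>

text \<open>
  The components 1, 2, 3 of a field are $\eta$, $u_1$, $u_2$. Written out,
  $L(\eta,u)=(\partial_1u_1+\partial_2u_2,\ \beta x_1u_2+\partial_1\eta,\ -\beta x_1u_1+\partial_2\eta)$.
  As an unbounded operator on $L^2$ with its maximal domain, $L$ is given by its graph: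
  \<open>L_graph \<beta> f g\<close> says that \<open>f\<close> and \<open>g\<close> are square integrable and $Lf=g$ as distributions.
\<close>

definition L_graph :: "real \<Rightarrow> vfield \<Rightarrow> vfield \<Rightarrow> bool" where
  "L_graph \<beta> f g \<longleftrightarrow> f \<in> L2 \<and> g \<in> L2 \<and>
     (\<forall>\<phi>\<in>schwartz_RT.
        (\<integral>x. - (pd 1 0 \<phi> x *\<^sub>R f x $ 2) - pd 0 1 \<phi> x *\<^sub>R f x $ 3 \<partial>RT) = (\<integral>x. \<phi> x *\<^sub>R g x $ 1 \<partial>RT) \<and>
        (\<integral>x. (\<beta> * fst x * \<phi> x) *\<^sub>R f x $ 3 - pd 1 0 \<phi> x *\<^sub>R f x $ 1 \<partial>RT) = (\<integral>x. \<phi> x *\<^sub>R g x $ 2 \<partial>RT) \<and>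
        (\<integral>x. - ((\<beta> * fst x * \<phi> x) *\<^sub>R f x $ 2) - pd 0 1 \<phi> x *\<^sub>R f x $ 1 \<partial>RT) = (\<integral>x. \<phi> x *\<^sub>R g x $ 3 \<partial>RT))"

definition eigenspace :: "real \<Rightarrow> complex \<Rightarrow> vfield set" where
  "eigenspace \<beta> \<mu> = {f. L_graph \<beta> f (\<lambda>x. \<mu> *s f x)}"

definition is_eigenvector :: "real \<Rightarrow> complex \<Rightarrow> vfield \<Rightarrow> bool" where
  "is_eigenvector \<beta> \<mu> f \<longleftrightarrow> f \<in> eigenspace \<beta> \<mu> \<and> \<not> (AE x in RT. f x = 0)"

definition is_eigenvalue :: "real \<Rightarrow> complex \<Rightarrow> bool" where
  "is_eigenvalue \<beta> \<mu> \<longleftrightarrow> (\<exists>f. is_eigenvector \<beta> \<mu> f)"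

definition finite_dim :: "vfield set \<Rightarrow> bool" where
  "finite_dim E \<longleftrightarrow> (\<exists>B. finite B \<and> B \<subseteq> E \<and>
     (\<forall>f\<in>E. \<exists>c. AE x in RT. f x = (\<Sum>b\<in>B. c b *s b x)))"


section \<open>Hermite functions\<close>

fun hermite_poly :: "nat \<Rightarrow> real poly" where
  "hermite_poly 0 = 1"
| "hermite_poly (Suc n) = [:0, 2:] * hermite_poly n - pderiv (hermite_poly n)"

definition psi :: "real \<Rightarrow> nat \<Rightarrow> real \<Rightarrow> real" where
  "psi \<beta> n x = (\<beta> / pi) powr (1 / 4) / sqrt (2 ^ n * fact n) *
     exp (- \<beta> * x\<^sup>2 / 2) * poly (hermite_poly n) (sqrt \<beta> * x)"

lemma degree_hermite_poly: "degree (hermite_poly n) = n \<and> lead_coeff (hermite_poly n) = 2 ^ n"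
proof (induction n)
  case 0
  show ?case by simp
next
  case (Suc n)
  let ?H = "hermite_poly n"
  have H0: "?H \<noteq> 0"
    using Suc by fastforce
  have eq: "hermite_poly (Suc n) = pCons 0 (smult 2 ?H) - pderiv ?H"
    by simp
  have "degree (pderiv ?H) < Suc n"
    using Suc by (simp add: degree_pderiv)
  moreover have "degree (pCons 0 (smult 2 ?H)) = Suc n"
    using Suc H0 by simp
  ultimately have "degree (hermite_poly (Suc n)) = Suc n"
    unfolding eq diff_conv_add_uminus by (subst degree_add_eq_left) auto
  moreover have "coeff (hermite_poly (Suc n)) (Suc n) = 2 ^ Suc n"
    unfolding eq using conjunct1[OF Suc] conjunct2[OF Suc] \<open>degree (pderiv ?H) < Suc n\<close>
    by (simp add: coeff_eq_0 del: hermite_poly.simps)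
  ultimately show ?case by simp
qed

lemma pderiv_hermite_poly: "pderiv (hermite_poly n) = smult (2 * real n) (hermite_poly (n - 1))"
proof (induction n)
  case 0
  show ?case by simp
next
  case (Suc n)
  have "pderiv [:0, 2::real:] = [:2:]"
    by (simp add: pderiv_pCons)
  then have "pderiv (hermite_poly (Suc n)) =
      smult 2 (hermite_poly n) + [:0, 2:] * pderiv (hermite_poly n) - pderiv (pderiv (hermite_poly n))"
    by (simp add: pderiv_diff pderiv_mult pderiv_pCons pderiv_smult)
  also have "\<dots> = smult (2 * real (Suc n)) (hermite_poly n)"
  proof (cases n)
    case 0
    then show ?thesis by simp
  next
    case (Suc m)
    have "[:0, 2:] * pderiv (hermite_poly n) - pderiv (pderiv (hermite_poly n)) =
        smult (2 * real n) ([:0, 2:] * hermite_poly m - pderiv (hermite_poly m))"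
      unfolding Suc.IH using Suc by (simp add: pderiv_smult smult_diff_right)
    also have "\<dots> = smult (2 * real n) (hermite_poly n)"
      using Suc by simp
    finally show ?thesis
      by (simp add: algebra_simps flip: smult_add_left)
  qed
  finally show ?case by simp
qed

text \<open>The following two identities determine the family up to the sign of \<open>psi \<beta> 0\<close>.\<close>

lemma psi_deriv_raise:
  assumes "\<beta> > 0"
  shows "(psi \<beta> n has_real_derivative
           \<beta> * x * psi \<beta> n x - sqrt (2 * \<beta> * (real n + 1)) * psi \<beta> (Suc n) x) (at x)"
proof -
  let ?c = "(\<beta> / pi) powr (1 / 4)"
  let ?e = "exp (- \<beta> * x\<^sup>2 / 2)"
  have sq: "sqrt (2 * \<beta> * (real n + 1)) / sqrt (2 ^ Suc n * fact (Suc n)) = sqrt \<beta> / sqrt (2 ^ n * fact n)"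
  proof -
    have "sqrt (2 ^ Suc n * fact (Suc n)) = sqrt (2 * (real n + 1)) * sqrt (2 ^ n * fact n)"
      unfolding real_sqrt_mult[symmetric] by (simp add: algebra_simps)
    moreover have "sqrt (2 * \<beta> * (real n + 1)) = sqrt \<beta> * sqrt (2 * (real n + 1))"
      unfolding real_sqrt_mult[symmetric] by (simp add: algebra_simps)
    ultimately show ?thesis by simp
  qed
  have "sqrt (2 * \<beta> * (real n + 1)) * psi \<beta> (Suc n) x =
      ?c * (sqrt (2 * \<beta> * (real n + 1)) / sqrt (2 ^ Suc n * fact (Suc n))) * ?e *
        poly (hermite_poly (Suc n)) (sqrt \<beta> * x)"
    unfolding psi_def by simp
  also have "\<dots> = ?c * (sqrt \<beta> / sqrt (2 ^ n * fact n)) * ?e *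
        (2 * (sqrt \<beta> * x) * poly (hermite_poly n) (sqrt \<beta> * x)
          - poly (pderiv (hermite_poly n)) (sqrt \<beta> * x))"
    unfolding sq by simp
  also have "\<dots> = ?c / sqrt (2 ^ n * fact n) * ?e *
        (2 * \<beta> * x * poly (hermite_poly n) (sqrt \<beta> * x)
          - sqrt \<beta> * poly (pderiv (hermite_poly n)) (sqrt \<beta> * x))"
    using assms by (simp add: algebra_simps flip: real_sqrt_mult)
  finally have rec: "sqrt (2 * \<beta> * (real n + 1)) * psi \<beta> (Suc n) x =
      ?c / sqrt (2 ^ n * fact n) * ?e *
        (2 * \<beta> * x * poly (hermite_poly n) (sqrt \<beta> * x)
          - sqrt \<beta> * poly (pderiv (hermite_poly n)) (sqrt \<beta> * x))" .
  have "((\<lambda>x. poly (hermite_poly n) (sqrt \<beta> * x)) has_real_derivative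
      poly (pderiv (hermite_poly n)) (sqrt \<beta> * x) * sqrt \<beta>) (at x)"
    by (rule DERIV_chain2[OF poly_DERIV]) (auto intro!: derivative_eq_intros)
  then have "(psi \<beta> n has_real_derivative
      ?c / sqrt (2 ^ n * fact n) * (?e * (- \<beta> * x)) * poly (hermite_poly n) (sqrt \<beta> * x)
      + ?c / sqrt (2 ^ n * fact n) * ?e * (poly (pderiv (hermite_poly n)) (sqrt \<beta> * x) * sqrt \<beta>)) (at x)"
    unfolding psi_def[abs_def]
    by (intro DERIV_cong[OF DERIV_mult[OF DERIV_cmult]])
       (auto intro!: derivative_eq_intros simp: power2_eq_square ac_simps)
  then show ?thesis
    by (rule DERIV_cong) (simp only: rec, simp add: psi_def algebra_simps add_divide_distrib diff_divide_distrib)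
qed

lemma psi_deriv_lower:
  assumes "\<beta> > 0"
  shows "(psi \<beta> n has_real_derivative
           - \<beta> * x * psi \<beta> n x + sqrt (2 * \<beta> * real n) * psi \<beta> (n - 1) x) (at x)"
proof -
  let ?H = "\<lambda>n. poly (hermite_poly n) (sqrt \<beta> * x)"
  let ?c = "(\<beta> / pi) powr (1 / 4)"
  let ?e = "exp (- \<beta> * x\<^sup>2 / 2)"
  have low: "sqrt (2 * \<beta> * real n) * psi \<beta> (n - 1) x =
      ?c / sqrt (2 ^ n * fact n) * ?e * (sqrt \<beta> * (2 * real n) * ?H (n - 1))"
  proof (cases n)
    case 0
    then show ?thesis by simp
  next
    case (Suc m)
    have "sqrt (2 * \<beta> * real n) * psi \<beta> m x =
      ?c * (sqrt (2 * \<beta> * real n) / sqrt (2 ^ m * fact m)) * ?e * ?H m"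
      unfolding psi_def by simp
    also have "sqrt (2 * \<beta> * real n) / sqrt (2 ^ m * fact m) =
        sqrt \<beta> * (2 * real n) / sqrt (2 ^ n * fact n)"
    proof -
      have "sqrt (2 ^ n * fact n) = sqrt (2 * real n) * sqrt (2 ^ m * fact m)"
        unfolding real_sqrt_mult[symmetric] by (simp add: Suc algebra_simps)
      moreover have "sqrt (2 * \<beta> * real n) = sqrt \<beta> * sqrt (2 * real n)"
        unfolding real_sqrt_mult[symmetric] by (simp add: algebra_simps)
      moreover have "sqrt (2 * real n) * sqrt (2 * real n) = 2 * real n"
        by simp
      moreover have "sqrt (2 * real n) > 0"
        using Suc by simp
      ultimately show ?thesis
        by (simp add: nonzero_eq_divide_eq)
    qed
    finally show ?thesis
      using Suc by simp
  qed
  have "((\<lambda>x. poly (hermite_poly n) (sqrt \<beta> * x)) has_real_derivative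
      poly (pderiv (hermite_poly n)) (sqrt \<beta> * x) * sqrt \<beta>) (at x)"
    by (rule DERIV_chain2[OF poly_DERIV]) (auto intro!: derivative_eq_intros)
  then have "(psi \<beta> n has_real_derivative
      ?c / sqrt (2 ^ n * fact n) * (?e * (- \<beta> * x)) * ?H n
      + ?c / sqrt (2 ^ n * fact n) * ?e * (poly (pderiv (hermite_poly n)) (sqrt \<beta> * x) * sqrt \<beta>)) (at x)"
    unfolding psi_def[abs_def]
    by (intro DERIV_cong[OF DERIV_mult[OF DERIV_cmult]])
       (auto intro!: derivative_eq_intros simp: power2_eq_square ac_simps)
  then show ?thesis
    by (rule DERIV_cong) (simp only: low pderiv_hermite_poly, simp add: psi_def algebra_simps)
qed


section \<open>Eigenvalues and eigenvectors\<close>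

definition cubic_roots :: "real \<Rightarrow> nat \<Rightarrow> int \<Rightarrow> real set" where
  "cubic_roots \<beta> n k = {t. t ^ 3 - ((of_int k)\<^sup>2 + \<beta> * (2 * real n + 1)) * t - \<beta> * of_int k = 0}"

lemma card_cubic_roots:
  assumes "\<beta> > 0" "n \<ge> 1"
  shows "finite (cubic_roots \<beta> n k)" "card (cubic_roots \<beta> n k) = 3"
proof -
  define K where "K = real_of_int k"
  define p where "p = K\<^sup>2 + \<beta> * (2 * real n + 1)"
  define f where "f t = t ^ 3 - p * t - \<beta> * K" for t :: real
  define P where "P = [:- \<beta> * K, - p, 0, 1:]"
  have roots: "cubic_roots \<beta> n k = {t. f t = 0}"
    by (simp add: cubic_roots_def f_def p_def K_def)
  have P: "poly P t = f t" for t
    by (simp add: P_def f_def algebra_simps power3_eq_cube)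
  have "P \<noteq> 0" "degree P = 3"
    by (simp_all add: P_def)
  then have fin: "finite {t. f t = 0}" and le: "card {t. f t = 0} \<le> 3"
    using poly_roots_finite[of P] card_poly_roots_bound[of P] by (simp_all add: P)
  have cont: "continuous_on A f" for A
    unfolding f_def by (intro continuous_intros)
  have p: "p > 0"
    using assms by (auto simp: p_def intro: add_nonneg_pos)
  define M where "M = 1 + p + \<bar>\<beta> * K\<bar> + \<bar>K\<bar>"
  have M: "M \<ge> 1" "M > \<bar>K\<bar>"
    using p by (auto simp: M_def)
  have sq: "M\<^sup>2 - p \<ge> 1 + \<bar>\<beta> * K\<bar>"
  proof -
    have "M * 1 \<le> M * M"
      using M by (intro mult_left_mono) auto
    moreover have "M \<ge> 1 + p + \<bar>\<beta> * K\<bar>"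
      by (simp add: M_def)
    ultimately show ?thesis
      by (simp add: power2_eq_square)
  qed
  have "M * (M\<^sup>2 - p) \<ge> 1 * (1 + \<bar>\<beta> * K\<bar>)"
    using M sq by (intro mult_mono) auto
  then have fM: "f M > 0" "f (- M) < 0"
    by (auto simp: f_def power3_eq_cube power2_eq_square algebra_simps)
  have fK: "f K = - (2 * \<beta> * (real n + 1)) * K" "f (- K) = 2 * \<beta> * real n * K"
    by (simp_all add: f_def p_def power3_eq_cube power2_eq_square algebra_simps)
  have "\<exists>a b c. a < b \<and> b < c \<and> f a = 0 \<and> f b = 0 \<and> f c = 0"
  proof (cases "K = 0")
    case True
    have "f (sqrt p) = 0" "f (- sqrt p) = 0" "f 0 = 0" "sqrt p > 0"
      using p True by (auto simp: f_def power3_eq_cube)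
    then show ?thesis
      by (intro exI[of _ "- sqrt p"] exI[of _ 0] exI[of _ "sqrt p"]) auto
  next
    case False
    have "f (- \<bar>K\<bar>) > 0 \<and> f \<bar>K\<bar> < 0"
      using False assms fK by (cases "K > 0") (auto simp: mult_pos_neg mult_pos_pos mult_neg_pos)
    then have sgn: "f (- \<bar>K\<bar>) > 0" "f \<bar>K\<bar> < 0" by auto
    obtain a where a: "- M \<le> a" "a \<le> - \<bar>K\<bar>" "f a = 0"
      using IVT'[of f "- M" 0 "- \<bar>K\<bar>"] sgn fM M cont by force
    obtain b where b: "- \<bar>K\<bar> \<le> b" "b \<le> \<bar>K\<bar>" "f b = 0"
      using IVT2'[of f "\<bar>K\<bar>" 0 "- \<bar>K\<bar>"] sgn cont by force
    obtain c where c: "\<bar>K\<bar> \<le> c" "c \<le> M" "f c = 0"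
      using IVT'[of f "\<bar>K\<bar>" 0 M] sgn fM M cont by force
    have "a \<noteq> - \<bar>K\<bar>" "b \<noteq> \<bar>K\<bar>" "b \<noteq> - \<bar>K\<bar>"
      using a b sgn by (metis less_irrefl)+
    then show ?thesis
      using a b c by (intro exI[of _ a] exI[of _ b] exI[of _ c]) auto
  qed
  then obtain a b c where abc: "a < b" "b < c" "f a = 0" "f b = 0" "f c = 0"
    by blast
  then have "card {a, b, c} \<le> card {t. f t = 0}"
    by (intro card_mono fin) auto
  then show "finite (cubic_roots \<beta> n k)" "card (cubic_roots \<beta> n k) = 3"
    using abc le fin by (auto simp: roots)
qed

definition modes :: "(nat \<times> int \<times> int) set" where
  "modes = UNIV \<times> UNIV \<times> {-1, 0, 1}"

text \<open>
  For $n\ge1$ the three roots of the cubic are enumerated in increasing order by $j=-1,0,1$.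
\<close>

definition tau :: "real \<Rightarrow> nat \<Rightarrow> int \<Rightarrow> int \<Rightarrow> real" where
  "tau \<beta> n k j =
     (if n = 0 then
        (if j = 0 then of_int k
         else of_int k / 2 + of_int j / 2 * sqrt ((of_int k)\<^sup>2 + 4 * \<beta>))
      else sorted_list_of_set (cubic_roots \<beta> n k) ! nat (j + 1))"

definition Cnorm :: "real \<Rightarrow> nat \<Rightarrow> int \<Rightarrow> int \<Rightarrow> real" where
  "Cnorm \<beta> n k j =
     (let t = tau \<beta> n k j; K = of_int k in
      (2 * pi) powr (- 1 / 2) *
      (\<beta> * real n / (t + K)\<^sup>2 + \<beta> * (real n + 1) / (t - K)\<^sup>2 + 1) powr (- 1 / 2))"

text \<open>
  For $n=0$ the terms with \<open>psi \<beta> (n - 1)\<close>, and the term with \<open>real n\<close> in \<open>Cnorm\<close>, vanish because of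
  their factor $0$, even where $\tau+k=0$.
\<close>

definition Psi :: "real \<Rightarrow> nat \<Rightarrow> int \<Rightarrow> int \<Rightarrow> vfield" where
  "Psi \<beta> n k j = (\<lambda>(x1, x2).
     (if n = 0 \<and> j = 0 then
        (of_real (1 / sqrt (4 * pi)) * cis (of_int k * x2)) *s
          vector [of_real (psi \<beta> 0 x1), 0, of_real (psi \<beta> 0 x1)]
      else if k = 0 \<and> j = 0 then
        of_real (1 / sqrt (2 * pi * (2 * real n + 1))) *s
          vector [of_real (- sqrt ((real n + 1) / 2) * psi \<beta> (n - 1) x1 - sqrt (real n / 2) * psi \<beta> (n + 1) x1),
                  0,
                  of_real (sqrt ((real n + 1) / 2) * psi \<beta> (n - 1) x1 - sqrt (real n / 2) * psi \<beta> (n + 1) x1)]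
      else
        let t = tau \<beta> n k j; K = of_int k;
            A = \<i> / of_real (t + K) * of_real (sqrt (\<beta> * real n / 2) * psi \<beta> (n - 1) x1);
            B = \<i> / of_real (t - K) * of_real (sqrt (\<beta> * (real n + 1) / 2) * psi \<beta> (n + 1) x1)
        in (of_real (Cnorm \<beta> n k j) * cis (K * x2)) *s
             vector [- A + B, of_real (psi \<beta> n x1), A + B]))"

end

theory Submission
  imports
    Defs
    "HOL-Complex_Analysis.Complex_Analysis"
    "HOL-Probability.Probability"
    "HOL-Real_Asymp.Real_Asymp"
begin

text \<open>
  For fixed $n$ and $k$, the operator $L$ preserves the span of three orthonormal fields, the slots
  (a Hermite function times a character times a fixed direction), on which it acts as a skew-Hermitian
  $3\times3$ matrix whose characteristic polynomial is, for $n\ge1$, the given cubic. So the $\Psi_{n,k,j}$,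
  $j\in\{-1,0,1\}$, arise from the slots by a unitary $3\times3$ matrix, and it suffices to know that
  the Hermite functions times characters are complete. Their closed span contains the Gaussian times all
  trigonometric polynomials in both variables, hence, by Stone--Weierstrass, the Gaussian times bounded
  continuous functions.

  The sup norm of $\psi_n$ is estimated by Cauchy's formula for the generating function of the Hermite
  polynomials on a circle of radius comparable to $\sqrt n$. Differentiation in $x_1$ shifts the Hermite index and costs a factor
  $\sqrt n$, which gives the bounds in $W^{s,\infty}$. The Fourier transform of $\psi_n$ is a Hermite
  function with parameter $1/\beta$, so the $H^s$ norms are moments of Hermite functions: they are bounded above
  by the recursion for $x\psi_n$, and below by the exact second moment together with an upper bound for the fourth.

  As $L$ is skew-adjoint and the components of $\Psi_{n,k,j}$ are test functions, an eigenvector for $\mu$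
  is orthogonal to all $\Psi_{n,k,j}$ with $i\tau(n,k,j)\ne\mu$, and $\tau$ takes each non-zero value only
  finitely often.
\<close>

section \<open>Hermite functions\<close>

text \<open>At n = 0 the pattern breaks: there is no psi of index -1, and the cubic factors as (t +
  k)(t^2 - k t - beta), whose root -k belongs to no eigenfield. Its place is taken by the field with
  eigenvalue k in the direction eta + u_2. The slot -1 is redefined accordingly, so that one 3x3
  argument serves all n and every Hermite index occurs with every direction. Stone--Weierstrass
  needs a compact domain while x_1 ranges over a line. So x_1 is wrapped around a circle of growing
  length, and a factor vanishing at the seams restores continuity. Its part in x_2 survives the
  limit and is divided out at the end, being nonzero almost everywhere. The uniform bound for psi n
  rests on an exact balance: Stirling's formula leaves n^(1/4), and the integral over the circle,
  whose exponent has at worst a zero of order four, gives n^(-1/4). For the lower H^s bound with s <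
  1 the second moment alone is not enough, as it could come from little mass far away; the fourth
  moment excludes this.\<close>

lemma
  assumes "c > 0"
  shows exp_neg_square_integrable: "integrable lborel (\<lambda>x::real. exp (- c * x\<^sup>2))"
    and integral_exp_neg_square: "(\<integral>x. exp (- c * x\<^sup>2) \<partial>lborel) = sqrt (pi / c)"
proof -
  define s where "s = 1 / sqrt (2 * c)"
  have s: "s > 0" "2 * s\<^sup>2 = 1 / c"
    using assms by (auto simp: s_def power_divide)
  have eq: "exp (- c * x\<^sup>2) = sqrt (2 * pi * s\<^sup>2) * normal_density 0 s x" for x
  proof -
    have "- (x\<^sup>2 / (2 * s\<^sup>2)) = - c * x\<^sup>2"
      unfolding s(2) by simp
    then show ?thesis
      using s(1) by (simp add: normal_density_def)
  qed
  have "integrable lborel (normal_density 0 s)"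
    using s by simp
  then show "integrable lborel (\<lambda>x::real. exp (- c * x\<^sup>2))"
    unfolding eq by (rule integrable_mult_right)
  have "2 * pi * s\<^sup>2 = pi / c"
    using s(2) by (simp add: field_simps)
  then show "(\<integral>x. exp (- c * x\<^sup>2) \<partial>lborel) = sqrt (pi / c)"
    unfolding eq using integral_normal_density[OF s(1), of 0] by simp
qed

lemma integrable_gaussian_bound:
  fixes f :: "real \<Rightarrow> 'a::{banach, second_countable_topology}"
  assumes "c > 0" "f \<in> borel_measurable borel" "\<And>x. norm (f x) \<le> K * exp (- c * x\<^sup>2)"
  shows "integrable lborel f"
proof (rule Bochner_Integration.integrable_bound)
  show "integrable lborel (\<lambda>x. K * exp (- c * x\<^sup>2))"
    by (intro integrable_mult_right exp_neg_square_integrable assms)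
  show "AE x in lborel. norm (f x) \<le> norm (K * exp (- c * x\<^sup>2))"
    using assms(3) by (intro AE_I2) (use order_trans[OF _ abs_ge_self] in fastforce)
qed (use assms in auto)

lemma exp_neg_square_at_top: "c > 0 \<Longrightarrow> ((\<lambda>x::real. exp (- c * x\<^sup>2)) \<longlongrightarrow> 0) at_top"
  by real_asymp

lemma exp_neg_square_at_bot: "c > 0 \<Longrightarrow> ((\<lambda>x::real. exp (- c * x\<^sup>2)) \<longlongrightarrow> 0) at_bot"
  by real_asymp

text \<open>The boundary terms at both infinities vanish by Gaussian decay. Applied to a product,
  this is integration by parts on the line.\<close>

lemma integral_deriv_gaussian_bound:
  fixes F f :: "real \<Rightarrow> 'a::euclidean_space"
  assumes c: "c > 0" and F: "\<And>x. (F has_vector_derivative f x) (at x)"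
    and f: "continuous_on UNIV f" "integrable lborel f"
    and K: "\<And>x. norm (F x) \<le> K * exp (- c * x\<^sup>2)"
  shows "(\<integral>x. f x \<partial>lborel) = 0"
proof -
  have top: "(F \<longlongrightarrow> 0) at_top"
    by (rule Lim_null_comparison[OF always_eventually]) (use K tendsto_mult_right_zero[OF exp_neg_square_at_top[OF c], of K] in auto)
  have bot: "(F \<longlongrightarrow> 0) at_bot"
    by (rule Lim_null_comparison[OF always_eventually]) (use K tendsto_mult_right_zero[OF exp_neg_square_at_bot[OF c], of K] in auto)
  have "(LBINT x=-\<infinity>..\<infinity>. f x) = 0 - 0"
  proof (rule interval_integral_FTC_integrable)
    show "isCont f x" for x
      using f(1) by (simp add: continuous_on_eq_continuous_at)
    show "set_integrable lborel (einterval (- \<infinity>) \<infinity>) f"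
      using f(2) by (simp add: set_integrable_def)
    show "((F \<circ> real_of_ereal) \<longlongrightarrow> 0) (at_right (- \<infinity>))"
      using bot by (simp only: ereal_tendsto_simps)
    show "((F \<circ> real_of_ereal) \<longlongrightarrow> 0) (at_left \<infinity>)"
      using top by (simp only: ereal_tendsto_simps)
  qed (use F in auto)
  then show ?thesis
    by (simp add: interval_lebesgue_integral_def set_lebesgue_integral_def)
qed

text \<open>Induction on the coefficients. The rate c varies in the induction because half of the
  exponent pays for the new factor x and the other half for the remaining polynomial.\<close>

lemma poly_times_gaussian_bounded:
  fixes p :: "real poly"
  assumes "c > 0"
  shows "\<exists>K\<ge>0. \<forall>x. \<bar>poly p x\<bar> * exp (- c * x\<^sup>2) \<le> K"
  using assms
proof (induction p arbitrary: c)
  case 0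
  then show ?case by auto
next
  case (pCons a p)
  obtain K where K: "K \<ge> 0" "\<And>x. \<bar>poly p x\<bar> * exp (- (c / 2) * x\<^sup>2) \<le> K"
    using pCons.IH[of "c / 2"] pCons.prems by auto
  have x: "\<bar>x\<bar> * exp (- (c / 2) * x\<^sup>2) \<le> 1 + 2 / c" for x
  proof -
    have "\<bar>x\<bar> \<le> 1 + x\<^sup>2"
      using zero_le_power2[of "\<bar>x\<bar> - 1"] by (simp add: power2_diff)
    also have "\<dots> \<le> (1 + 2 / c) * (1 + (c / 2) * x\<^sup>2)"
      using pCons.prems by (simp add: field_simps)
    also have "\<dots> \<le> (1 + 2 / c) * exp ((c / 2) * x\<^sup>2)"
      using pCons.prems by (intro mult_left_mono exp_ge_add_one_self) auto
    finally show ?thesis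
      by (simp add: exp_minus field_simps)
  qed
  have "\<bar>poly (pCons a p) x\<bar> * exp (- c * x\<^sup>2) \<le> \<bar>a\<bar> + (1 + 2 / c) * K" for x
  proof -
    have "exp (- c * x\<^sup>2) = exp (- (c / 2) * x\<^sup>2) * exp (- (c / 2) * x\<^sup>2)"
      by (simp flip: exp_add)
    then have "\<bar>poly (pCons a p) x\<bar> * exp (- c * x\<^sup>2)
       \<le> \<bar>a\<bar> * exp (- c * x\<^sup>2) + (\<bar>x\<bar> * exp (- (c / 2) * x\<^sup>2)) * (\<bar>poly p x\<bar> * exp (- (c / 2) * x\<^sup>2))"
      using mult_right_mono[OF abs_triangle_ineq[of a "x * poly p x"], of "exp (- c * x\<^sup>2)"]
      by (simp add: abs_mult algebra_simps)
    also have "\<dots> \<le> \<bar>a\<bar> * 1 + (1 + 2 / c) * K"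
      using pCons.prems K x by (intro add_mono mult_mono) auto
    finally show ?thesis by simp
  qed
  then show ?case
    using K pCons.prems by (intro exI[of _ "\<bar>a\<bar> + (1 + 2 / c) * K"]) auto
qed

text \<open>The rate beta/4 is what remains of the exponent beta/2 after half of it has absorbed the
  Hermite polynomial. Only K depends on n, so combinations of Hermite functions keep the same
  rate.\<close>

lemma psi_gaussian_bound:
  assumes "\<beta> > 0"
  shows "\<exists>K\<ge>0. \<forall>x. \<bar>psi \<beta> n x\<bar> \<le> K * exp (- (\<beta> / 4) * x\<^sup>2)"
proof -
  obtain K where K: "K \<ge> 0" "\<And>x. \<bar>poly (hermite_poly n) x\<bar> * exp (- (1 / 4) * x\<^sup>2) \<le> K"
    using poly_times_gaussian_bounded[of "1 / 4"] by auto
  let ?c = "(\<beta> / pi) powr (1 / 4) / sqrt (2 ^ n * fact n)"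
  have "\<bar>psi \<beta> n x\<bar> \<le> (?c * K) * exp (- (\<beta> / 4) * x\<^sup>2)" for x
  proof -
    have "exp (- \<beta> * x\<^sup>2 / 2) = exp (- (1 / 4) * (sqrt \<beta> * x)\<^sup>2) * exp (- (\<beta> / 4) * x\<^sup>2)"
      using assms by (simp add: power_mult_distrib flip: exp_add)
    then have "\<bar>psi \<beta> n x\<bar> = ?c * (\<bar>poly (hermite_poly n) (sqrt \<beta> * x)\<bar> * exp (- (1 / 4) * (sqrt \<beta> * x)\<^sup>2))
        * exp (- (\<beta> / 4) * x\<^sup>2)"
      unfolding psi_def by (simp add: abs_mult)
    also have "\<dots> \<le> ?c * K * exp (- (\<beta> / 4) * x\<^sup>2)"
      by (intro mult_right_mono mult_left_mono K) auto
    finally show ?thesis .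
  qed
  then show ?thesis
    using K by (intro exI[of _ "?c * K"]) auto
qed

text \<open>The derivative of order a, in closed form: the mean of the raising and the lowering
  identity contains no x and leaves a combination of the two neighbours. At n = 0 the truncated
  index n - 1 has coefficient 0.\<close>

fun dpsi :: "real \<Rightarrow> nat \<Rightarrow> nat \<Rightarrow> real \<Rightarrow> real" where
  "dpsi \<beta> 0 n x = psi \<beta> n x"
| "dpsi \<beta> (Suc a) n x =
     sqrt (\<beta> * real n / 2) * dpsi \<beta> a (n - 1) x - sqrt (\<beta> * (real n + 1) / 2) * dpsi \<beta> a (Suc n) x"

lemma sqrt_two_mult: "sqrt (2 * \<beta> * t) = 2 * sqrt (\<beta> * t / 2)"
proof -
  have "sqrt (2 * \<beta> * t) = sqrt (2\<^sup>2 * (\<beta> * t / 2))" by simp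
  then show ?thesis
    by (simp only: real_sqrt_mult real_sqrt_abs abs_numeral)
qed

text \<open>Raising and lowering identity express the same derivative; equating them isolates x psi
  n. This three-term recursion turns every factor x into a shift of the index.\<close>

lemma mult_psi:
  assumes "\<beta> > 0"
  shows "\<beta> * x * psi \<beta> n x =
    sqrt (\<beta> * real n / 2) * psi \<beta> (n - 1) x + sqrt (\<beta> * (real n + 1) / 2) * psi \<beta> (Suc n) x"
proof -
  have "\<beta> * x * psi \<beta> n x - 2 * sqrt (\<beta> * (real n + 1) / 2) * psi \<beta> (Suc n) x =
    - \<beta> * x * psi \<beta> n x + 2 * sqrt (\<beta> * real n / 2) * psi \<beta> (n - 1) x"
    using DERIV_unique[OF psi_deriv_raise[OF assms, of n x] psi_deriv_lower[OF assms, of n x]]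
    unfolding sqrt_two_mult .
  then show ?thesis
    by linarith
qed

lemma dpsi_has_derivative:
  assumes "\<beta> > 0"
  shows "(dpsi \<beta> a n has_real_derivative dpsi \<beta> (Suc a) n x) (at x)"
proof (induction a arbitrary: n)
  case 0
  have eq: "dpsi \<beta> 0 n = psi \<beta> n"
    by (simp add: fun_eq_iff)
  have "\<beta> * x * psi \<beta> n x - sqrt (2 * \<beta> * (real n + 1)) * psi \<beta> (Suc n) x = dpsi \<beta> (Suc 0) n x"
    unfolding dpsi.simps sqrt_two_mult using mult_psi[OF assms, of x n] by linarith
  then show ?case
    unfolding eq using psi_deriv_raise[OF assms, of n x] by metis
next
  case (Suc a)
  have eq: "dpsi \<beta> (Suc a) n = (\<lambda>x. sqrt (\<beta> * real n / 2) * dpsi \<beta> a (n - 1) x - sqrt (\<beta> * (real n + 1) / 2) * dpsi \<beta> a (Suc n) x)"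
    by (rule ext) (simp only: dpsi.simps)
  show ?case
    using DERIV_diff[OF DERIV_cmult[OF Suc[of "n - 1"]] DERIV_cmult[OF Suc[of "Suc n"]]]
    unfolding eq dpsi.simps(2)[of \<beta> "Suc a" n x] .
qed

lemma dpsi_gaussian_bound:
  assumes "\<beta> > 0"
  shows "\<exists>K\<ge>0. \<forall>x. \<bar>dpsi \<beta> a n x\<bar> \<le> K * exp (- (\<beta> / 4) * x\<^sup>2)"
proof (induction a arbitrary: n)
  case 0
  then show ?case
    using psi_gaussian_bound[OF assms] by simp
next
  case (Suc a)
  obtain K1 where K1: "K1 \<ge> 0" "\<And>x. \<bar>dpsi \<beta> a (n - 1) x\<bar> \<le> K1 * exp (- (\<beta> / 4) * x\<^sup>2)"
    using Suc by blast
  obtain K2 where K2: "K2 \<ge> 0" "\<And>x. \<bar>dpsi \<beta> a (Suc n) x\<bar> \<le> K2 * exp (- (\<beta> / 4) * x\<^sup>2)"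
    using Suc by blast
  define p q where "p = sqrt (\<beta> * real n / 2)" and "q = sqrt (\<beta> * (real n + 1) / 2)"
  have pq: "p \<ge> 0" "q \<ge> 0"
    using assms by (auto simp: p_def q_def)
  have "\<bar>dpsi \<beta> (Suc a) n x\<bar> \<le> (p * K1 + q * K2) * exp (- (\<beta> / 4) * x\<^sup>2)" for x
  proof -
    have "\<bar>dpsi \<beta> (Suc a) n x\<bar> \<le> \<bar>p * dpsi \<beta> a (n - 1) x\<bar> + \<bar>q * dpsi \<beta> a (Suc n) x\<bar>"
      unfolding dpsi.simps p_def q_def by (rule abs_triangle_ineq4)
    also have "\<dots> = p * \<bar>dpsi \<beta> a (n - 1) x\<bar> + q * \<bar>dpsi \<beta> a (Suc n) x\<bar>"
      using pq by (simp only: abs_mult abs_of_nonneg)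
    also have "\<dots> \<le> p * (K1 * exp (- (\<beta> / 4) * x\<^sup>2)) + q * (K2 * exp (- (\<beta> / 4) * x\<^sup>2))"
      by (intro add_mono mult_left_mono K1 K2 pq)
    also have "\<dots> = (p * K1 + q * K2) * exp (- (\<beta> / 4) * x\<^sup>2)"
      by (simp only: distrib_right mult.assoc)
    finally show ?thesis .
  qed
  moreover have "p * K1 + q * K2 \<ge> 0"
    using K1 K2 pq by (intro add_nonneg_nonneg mult_nonneg_nonneg)
  ultimately show ?case
    by blast
qed

lemma psi_eq_dpsi: "psi \<beta> n = dpsi \<beta> 0 n"
  by (rule ext) simp

lemma continuous_on_dpsi:
  assumes "\<beta> > 0"
  shows "continuous_on A (dpsi \<beta> a n)"
  by (rule continuous_at_imp_continuous_on) (blast intro: DERIV_isCont dpsi_has_derivative[OF assms])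

lemma continuous_on_psi: "\<beta> > 0 \<Longrightarrow> continuous_on A (psi \<beta> n)"
  unfolding psi_eq_dpsi by (rule continuous_on_dpsi)

lemma borel_measurable_dpsi [measurable]: "dpsi \<beta> a n \<in> borel_measurable borel"
proof (induction a arbitrary: n)
  case 0
  have "continuous_on UNIV (\<lambda>x. poly (hermite_poly n) (sqrt \<beta> * x))"
    by (intro continuous_intros)
  then have [measurable]: "(\<lambda>x. poly (hermite_poly n) (sqrt \<beta> * x)) \<in> borel_measurable borel"
    by (rule borel_measurable_continuous_onI)
  show ?case
    unfolding dpsi.simps psi_def by measurable
next
  case (Suc a)
  note Suc[measurable]
  show ?case
    unfolding dpsi.simps by measurable
qed

lemma borel_measurable_psi [measurable]: "psi \<beta> n \<in> borel_measurable borel"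
  unfolding psi_eq_dpsi by (rule borel_measurable_dpsi)

section \<open>Orthonormality of the Hermite functions\<close>

lemma square_sum_le: "(p + q)\<^sup>2 \<le> 2 * (p\<^sup>2 + q\<^sup>2)" for p q :: real
  using zero_le_power2[of "p - q"] unfolding power2_diff power2_sum by simp

lemma mult_le_sum_squares:
  fixes a b :: real
  assumes "a \<ge> 0" "b \<ge> 0"
  shows "a * b \<le> a\<^sup>2 + b\<^sup>2"
  using sum_squares_bound[of a b] mult_nonneg_nonneg[OF assms] by linarith

lemma dpsi_product_integrable:
  assumes "\<beta> > 0"
  shows "integrable lborel (\<lambda>x. poly p x * dpsi \<beta> a m x * dpsi \<beta> b n x)"
proof -
  obtain K0 where K0: "K0 \<ge> 0" "\<And>x. \<bar>poly p x\<bar> * exp (- (\<beta> / 4) * x\<^sup>2) \<le> K0"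
    using poly_times_gaussian_bounded[of "\<beta> / 4" p] assms by auto
  obtain K1 where K1: "K1 \<ge> 0" "\<And>x. \<bar>dpsi \<beta> a m x\<bar> \<le> K1 * exp (- (\<beta> / 4) * x\<^sup>2)"
    using dpsi_gaussian_bound[OF assms] by blast
  obtain K2 where K2: "K2 \<ge> 0" "\<And>x. \<bar>dpsi \<beta> b n x\<bar> \<le> K2 * exp (- (\<beta> / 4) * x\<^sup>2)"
    using dpsi_gaussian_bound[OF assms] by blast
  show ?thesis
  proof (rule integrable_gaussian_bound)
    fix x :: real
    let ?e = "exp (- (\<beta> / 4) * x\<^sup>2)"
    have "norm (poly p x * dpsi \<beta> a m x * dpsi \<beta> b n x) \<le> \<bar>poly p x\<bar> * (K1 * ?e) * (K2 * ?e)"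
      unfolding real_norm_def abs_mult using K1 K2 by (intro mult_mono mult_nonneg_nonneg) auto
    \<comment> \<open>One of the two Gaussians absorbs the polynomial, the other one is kept for
      integrability.\<close>
    also have "\<dots> = (\<bar>poly p x\<bar> * ?e) * (K1 * K2) * ?e"
      by (simp only: ac_simps)
    also have "\<dots> \<le> K0 * (K1 * K2) * ?e"
      using K0 K1 K2 by (intro mult_right_mono) auto
    finally show "norm (poly p x * dpsi \<beta> a m x * dpsi \<beta> b n x) \<le> (K0 * (K1 * K2)) * exp (- (\<beta> / 4) * x\<^sup>2)" .
    show "(\<lambda>x. poly p x * dpsi \<beta> a m x * dpsi \<beta> b n x) \<in> borel_measurable borel"
      by (intro borel_measurable_times borel_measurable_dpsi borel_measurable_continuous_onI continuous_intros)
  qed (use assms in auto)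
qed

lemma psi_product_integrable:
  assumes "\<beta> > 0"
  shows "integrable lborel (\<lambda>x. psi \<beta> m x * psi \<beta> n x)"
  using dpsi_product_integrable[OF assms, of 1 0 m 0 n] by simp

text \<open>The lowering and the raising operator are adjoint up to sign. In the derivative of psi m
  psi n, lowering the first factor and raising the second cancels the terms with x, and the total
  integral is 0.\<close>

lemma psi_integral_shift:
  assumes "\<beta> > 0"
  shows "sqrt (real m) * (\<integral>x. psi \<beta> (m - 1) x * psi \<beta> n x \<partial>lborel) =
    sqrt (real n + 1) * (\<integral>x. psi \<beta> m x * psi \<beta> (Suc n) x \<partial>lborel)"
proof -
  define p q where "p = sqrt (2 * \<beta> * real m)" and "q = sqrt (2 * \<beta> * (real n + 1))"
  obtain K1 where K1: "K1 \<ge> 0" "\<And>x. \<bar>psi \<beta> m x\<bar> \<le> K1 * exp (- (\<beta> / 4) * x\<^sup>2)"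
    using psi_gaussian_bound[OF assms] by blast
  obtain K2 where K2: "K2 \<ge> 0" "\<And>x. \<bar>psi \<beta> n x\<bar> \<le> K2 * exp (- (\<beta> / 4) * x\<^sup>2)"
    using psi_gaussian_bound[OF assms] by blast
  let ?f = "\<lambda>x. p * (psi \<beta> (m - 1) x * psi \<beta> n x) - q * (psi \<beta> m x * psi \<beta> (Suc n) x)"
  note int = psi_product_integrable[OF assms]
  have "(\<integral>x. ?f x \<partial>lborel) = 0"
  proof (rule integral_deriv_gaussian_bound[where F = "\<lambda>x. psi \<beta> m x * psi \<beta> n x"])
    fix x :: real
    have "((\<lambda>x. psi \<beta> m x * psi \<beta> n x) has_real_derivative
      ((- \<beta> * x * psi \<beta> m x + p * psi \<beta> (m - 1) x) * psi \<beta> n x +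
       (\<beta> * x * psi \<beta> n x - q * psi \<beta> (Suc n) x) * psi \<beta> m x)) (at x)"
      using DERIV_mult[OF psi_deriv_lower[OF assms] psi_deriv_raise[OF assms]] unfolding p_def q_def .
    then show "((\<lambda>x. psi \<beta> m x * psi \<beta> n x) has_vector_derivative ?f x) (at x)"
      unfolding has_real_derivative_iff_has_vector_derivative[symmetric]
      by (rule DERIV_cong) (simp add: algebra_simps)
    have "norm (psi \<beta> m x * psi \<beta> n x) \<le> (K1 * exp (- (\<beta> / 4) * x\<^sup>2)) * (K2 * exp (- (\<beta> / 4) * x\<^sup>2))"
      unfolding real_norm_def abs_mult using K1 K2 by (intro mult_mono) auto
    also have "\<dots> = (K1 * K2) * exp (- (\<beta> / 2) * x\<^sup>2)"
      by (simp add: algebra_simps flip: exp_add)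
    finally show "norm (psi \<beta> m x * psi \<beta> n x) \<le> (K1 * K2) * exp (- (\<beta> / 2) * x\<^sup>2)" .
  qed (use assms int in \<open>auto intro!: continuous_intros continuous_on_psi\<close>)
  then have "p * (\<integral>x. psi \<beta> (m - 1) x * psi \<beta> n x \<partial>lborel) = q * (\<integral>x. psi \<beta> m x * psi \<beta> (Suc n) x \<partial>lborel)"
    using int by simp
  moreover have "p = sqrt (2 * \<beta>) * sqrt (real m)" "q = sqrt (2 * \<beta>) * sqrt (real n + 1)" "sqrt (2 * \<beta>) \<noteq> 0"
    unfolding p_def q_def using assms by (simp_all add: real_sqrt_mult)
  ultimately show ?thesis
    by simp
qed

lemma psi_0_norm:
  assumes "\<beta> > 0"
  shows "(\<integral>x. psi \<beta> 0 x * psi \<beta> 0 x \<partial>lborel) = 1"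
proof -
  define s where "s = 1 / sqrt (2 * \<beta>)"
  have s: "s > 0" "2 * s\<^sup>2 = 1 / \<beta>"
    using assms by (auto simp: s_def power_divide)
  have "psi \<beta> 0 x * psi \<beta> 0 x = normal_density 0 s x" for x
  proof -
    have "psi \<beta> 0 x * psi \<beta> 0 x = ((\<beta> / pi) powr (1 / 4) * (\<beta> / pi) powr (1 / 4)) * (exp (- \<beta> * x\<^sup>2 / 2) * exp (- \<beta> * x\<^sup>2 / 2))"
      by (simp add: psi_def)
    also have "\<dots> = sqrt (\<beta> / pi) * exp (- \<beta> * x\<^sup>2)"
      using assms by (simp add: powr_half_sqrt flip: powr_add exp_add)
    also have "\<dots> = normal_density 0 s x"
    proof -
      have "2 * pi * s\<^sup>2 = pi / \<beta>" "- x\<^sup>2 / (2 * s\<^sup>2) = - \<beta> * x\<^sup>2"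
        unfolding s(2) using s(2) by (auto simp: field_simps)
      then show ?thesis
        using assms by (simp add: normal_density_def real_sqrt_divide)
    qed
    finally show ?thesis .
  qed
  then show ?thesis
    using integral_normal_density[OF s(1), of 0] by simp
qed

text \<open>\<open>psi_integral_shift\<close> lowers both indices at once. If one index reaches 0
  before the other, the factor sqrt 0 makes the integral vanish; equal indices end at the normalised
  Gaussian.\<close>

lemma psi_orthonormal:
  assumes "\<beta> > 0"
  shows "(\<integral>x. psi \<beta> m x * psi \<beta> n x \<partial>lborel) = (if m = n then 1 else 0)"
proof (induction n arbitrary: m)
  case 0
  show ?case
  proof (cases m)
    case 0
    then show ?thesis using psi_0_norm[OF assms] by simp
  next
    case (Suc l)
    have "(\<integral>x. psi \<beta> 0 x * psi \<beta> (Suc l) x \<partial>lborel) = 0"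
      using psi_integral_shift[OF assms, of 0 l] by (simp add: add_nonneg_eq_0_iff)
    then show ?thesis
      by (simp add: Suc mult.commute)
  qed
next
  case (Suc n)
  have "sqrt (real n + 1) * (\<integral>x. psi \<beta> m x * psi \<beta> (Suc n) x \<partial>lborel) =
      sqrt (real m) * (if m - 1 = n then 1 else 0)"
    using psi_integral_shift[OF assms, of m n] Suc by simp
  also have "\<dots> = sqrt (real n + 1) * (if m = Suc n then 1 else 0)"
    by (cases m) (auto simp: add.commute)
  finally show ?case
    by (simp add: add_nonneg_eq_0_iff)
qed

section \<open>Moments of the Hermite functions\<close>

lemma psi_moment_integrable:
  assumes "\<beta> > 0"
  shows "integrable lborel (\<lambda>x. x ^ p * (psi \<beta> n x)\<^sup>2)"
  using dpsi_product_integrable[OF assms, of "monom 1 p" 0 n 0 n] by (simp add: poly_monom power2_eq_square mult.assoc)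

text \<open>By \<open>mult_psi\<close>, x psi n is a combination of its neighbours with coefficients
  of order sqrt n, so each factor x^2 costs one factor 1 + n.\<close>

lemma psi_moment_bound:
  assumes "\<beta> > 0"
  shows "\<exists>C>0. \<forall>n. (\<integral>x. x ^ (2 * p) * (psi \<beta> n x)\<^sup>2 \<partial>lborel) \<le> C * (1 + real n) ^ p"
proof (induction p)
  case 0
  show ?case
    using psi_orthonormal[OF assms] by (intro exI[of _ 1]) (simp add: power2_eq_square)
next
  case (Suc p)
  then obtain C where C: "C > 0" "\<And>n. (\<integral>x. x ^ (2 * p) * (psi \<beta> n x)\<^sup>2 \<partial>lborel) \<le> C * (1 + real n) ^ p"
    by blast
  have "(\<integral>x. x ^ (2 * Suc p) * (psi \<beta> n x)\<^sup>2 \<partial>lborel) \<le> (2 ^ Suc p * C / \<beta>) * (1 + real n) ^ Suc p" for n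
  proof -
    let ?M = "\<lambda>n x. x ^ (2 * p) * (psi \<beta> n x)\<^sup>2"
    note int = psi_moment_integrable[OF assms]
    have pt: "x ^ (2 * Suc p) * (psi \<beta> n x)\<^sup>2 \<le> (real n * ?M (n - 1) x + (real n + 1) * ?M (Suc n) x) / \<beta>" for x
    proof -
      let ?p = "sqrt (\<beta> * real n / 2) * psi \<beta> (n - 1) x" and ?q = "sqrt (\<beta> * (real n + 1) / 2) * psi \<beta> (Suc n) x"
      have "(\<beta> * x * psi \<beta> n x)\<^sup>2 = (?p + ?q)\<^sup>2"
        using mult_psi[OF assms, of x n] by simp
      also have "\<dots> \<le> 2 * (?p\<^sup>2 + ?q\<^sup>2)"
        by (rule square_sum_le)
      also have "\<dots> = \<beta> * (real n * (psi \<beta> (n - 1) x)\<^sup>2 + (real n + 1) * (psi \<beta> (Suc n) x)\<^sup>2)"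
        using assms by (simp add: power_mult_distrib algebra_simps)
      finally have "\<beta> * (x\<^sup>2 * (psi \<beta> n x)\<^sup>2) \<le> real n * (psi \<beta> (n - 1) x)\<^sup>2 + (real n + 1) * (psi \<beta> (Suc n) x)\<^sup>2"
        using assms by (simp add: power_mult_distrib power2_eq_square[of \<beta>] mult.assoc)
      then have "x ^ (2 * p) * (\<beta> * (x\<^sup>2 * (psi \<beta> n x)\<^sup>2)) \<le> x ^ (2 * p) * (real n * (psi \<beta> (n - 1) x)\<^sup>2 + (real n + 1) * (psi \<beta> (Suc n) x)\<^sup>2)"
        by (intro mult_left_mono) (auto simp: power_mult)
      then show ?thesis
        using assms by (simp add: field_simps power2_eq_square)
    qed
    have "(\<integral>x. x ^ (2 * Suc p) * (psi \<beta> n x)\<^sup>2 \<partial>lborel) \<le>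
        (\<integral>x. (real n * ?M (n - 1) x + (real n + 1) * ?M (Suc n) x) / \<beta> \<partial>lborel)"
      using pt int by (intro integral_mono integrable_divide Bochner_Integration.integrable_add integrable_mult_right)
    also have "\<dots> = (real n * (\<integral>x. ?M (n - 1) x \<partial>lborel) + (real n + 1) * (\<integral>x. ?M (Suc n) x \<partial>lborel)) / \<beta>"
      using int by simp
    \<comment> \<open>Both neighbouring indices m satisfy 1 + m <= 2 (1 + n); this is the origin of
      the power of 2 in the constant.\<close>
    also have "\<dots> \<le> ((real n + 1) * (C * (2 * (1 + real n)) ^ p) + (real n + 1) * (C * (2 * (1 + real n)) ^ p)) / \<beta>"
    proof -
      have 1: "(\<integral>x. ?M (n - 1) x \<partial>lborel) \<le> C * (2 * (1 + real n)) ^ p"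
        by (rule order_trans[OF C(2)]) (use C(1) in \<open>auto intro!: mult_left_mono power_mono\<close>)
      have 2: "(\<integral>x. ?M (Suc n) x \<partial>lborel) \<le> C * (2 * (1 + real n)) ^ p"
        by (rule order_trans[OF C(2)]) (use C(1) in \<open>auto intro!: mult_left_mono power_mono\<close>)
      have 3: "0 \<le> C * (2 * (1 + real n)) ^ p"
        using C(1) by simp
      show ?thesis
        using assms by (intro divide_right_mono add_mono mult_mono 1 2 3) (auto simp: integral_nonneg_AE power_mult)
    qed
    also have "\<dots> = (2 ^ Suc p * C / \<beta>) * (1 + real n) ^ Suc p"
      unfolding power_mult_distrib by (simp add: field_simps)
    finally show ?thesis .
  qed
  then show ?case
    using C(1) assms by (intro exI[of _ "2 ^ Suc p * C / \<beta>"]) auto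
qed

text \<open>Squaring \<open>mult_psi\<close> gives two squares and a cross term between the indices
  n - 1 and n + 1, which vanishes by orthogonality. An exact value is needed because it has to serve
  as a lower bound.\<close>

lemma psi_second_moment:
  assumes "\<beta> > 0"
  shows "(\<integral>x. x\<^sup>2 * (psi \<beta> n x)\<^sup>2 \<partial>lborel) = (2 * real n + 1) / (2 * \<beta>)"
proof -
  define p q where "p = sqrt (\<beta> * real n / 2)" and "q = sqrt (\<beta> * (real n + 1) / 2)"
  have pq: "p\<^sup>2 = \<beta> * real n / 2" "q\<^sup>2 = \<beta> * (real n + 1) / 2"
    using assms by (auto simp: p_def q_def)
  let ?I = "\<lambda>m n x. psi \<beta> m x * psi \<beta> n x"
  note int = psi_product_integrable[OF assms]
  have "\<beta>\<^sup>2 * (x\<^sup>2 * (psi \<beta> n x)\<^sup>2) = p\<^sup>2 * ?I (n - 1) (n - 1) x + 2 * p * q * ?I (n - 1) (Suc n) x + q\<^sup>2 * ?I (Suc n) (Suc n) x" for x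
  proof -
    have "\<beta>\<^sup>2 * (x\<^sup>2 * (psi \<beta> n x)\<^sup>2) = (\<beta> * x * psi \<beta> n x)\<^sup>2"
      by (simp add: power_mult_distrib)
    also have "\<dots> = (p * psi \<beta> (n - 1) x + q * psi \<beta> (Suc n) x)\<^sup>2"
      unfolding mult_psi[OF assms] p_def q_def ..
    finally show ?thesis
      by (simp add: power2_eq_square algebra_simps)
  qed
  then have "\<beta>\<^sup>2 * (\<integral>x. x\<^sup>2 * (psi \<beta> n x)\<^sup>2 \<partial>lborel) =
     (\<integral>x. p\<^sup>2 * ?I (n - 1) (n - 1) x + 2 * p * q * ?I (n - 1) (Suc n) x + q\<^sup>2 * ?I (Suc n) (Suc n) x \<partial>lborel)"
    by (simp flip: integral_mult_right_zero)
  also have "\<dots> = p\<^sup>2 + q\<^sup>2"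
    using int by (simp add: psi_orthonormal[OF assms])
  finally have "\<beta>\<^sup>2 * (\<integral>x. x\<^sup>2 * (psi \<beta> n x)\<^sup>2 \<partial>lborel) = \<beta>\<^sup>2 * ((2 * real n + 1) / (2 * \<beta>))"
    unfolding pq using assms by (simp add: field_simps power2_eq_square[of \<beta>])
  then show ?thesis
    by (rule mult_left_cancel[THEN iffD1, rotated]) (use assms in simp)
qed

text \<open>The weight of the squared H^s norm at the frequency (x, K). The variable x is a
  frequency here: these moments are later taken of the Fourier transform of a Hermite function,
  which is again one.\<close>

definition sobolev_weight :: "real \<Rightarrow> real \<Rightarrow> real \<Rightarrow> real" where
  "sobolev_weight s K x = (1 + x\<^sup>2 + K\<^sup>2) powr s"

text \<open>Moments are known for even integer powers only. With p = ceiling s and y = w / N >= 0,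
  the inequality y^s <= 1 + y^p reduces the real exponent to them, and the scaling by N makes the
  bound homogeneous.\<close>

lemma sobolev_weight_moment:
  fixes K s :: real
  assumes "\<beta> > 0" "s \<ge> 0"
  shows "\<exists>C>0. \<forall>n K. integrable lborel (\<lambda>x. sobolev_weight s K x * (psi \<beta> n x)\<^sup>2) \<and>
      (\<integral>x. sobolev_weight s K x * (psi \<beta> n x)\<^sup>2 \<partial>lborel) \<le> C * (1 + K\<^sup>2 + real n) powr s"
proof -
  define p where "p = nat \<lceil>s\<rceil>"
  have sp: "s \<le> real p" by (simp add: p_def assms(2) of_nat_ceiling)
  obtain C where C: "C > 0" "\<And>n. (\<integral>x. x ^ (2 * p) * (psi \<beta> n x)\<^sup>2 \<partial>lborel) \<le> C * (1 + real n) ^ p"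
    using psi_moment_bound[OF assms(1)] by blast
  have "integrable lborel (\<lambda>x. sobolev_weight s K x * (psi \<beta> n x)\<^sup>2) \<and>
      (\<integral>x. sobolev_weight s K x * (psi \<beta> n x)\<^sup>2 \<partial>lborel) \<le> (1 + 2 ^ p * (1 + C)) * (1 + K\<^sup>2 + real n) powr s" for n K
  proof -
    define N where "N = 1 + K\<^sup>2 + real n"
    have N: "N > 0" "1 + K\<^sup>2 \<le> N" "1 + real n \<le> N" by (auto simp: N_def add_pos_nonneg)
    have K0: "1 + K\<^sup>2 > 0" by (auto simp: add_pos_nonneg)
    define g where "g x = N powr s * ((1 + 2 ^ p) * (psi \<beta> n x * psi \<beta> n x) + (2 ^ p / N ^ p) * (x ^ (2 * p) * (psi \<beta> n x)\<^sup>2))" for x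
    have ptw: "sobolev_weight s K x * (psi \<beta> n x)\<^sup>2 \<le> g x" for x
    proof -
      define w where "w = 1 + x\<^sup>2 + K\<^sup>2"
      have w: "w > 0" by (auto simp: w_def add_pos_nonneg)
      have "(w / N) powr s \<le> 1 + (w / N) ^ p"
      proof (cases "w / N \<le> 1")
        case True
        then have "(w / N) powr s \<le> 1"
          using w N assms(2) powr_mono2[of s "w / N" 1] by simp
        moreover have "(w / N) ^ p \<ge> 0" using w N by simp
        ultimately show ?thesis by linarith
      next
        case False
        then have "(w / N) powr s \<le> (w / N) powr real p"
          by (intro powr_mono sp) auto
        also have "\<dots> = (w / N) ^ p"
          using w N by (simp add: powr_realpow)
        finally show ?thesis by simp
      qed
      also have "w ^ p \<le> 2 ^ p * (N ^ p + x ^ (2 * p))"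
      proof -
        have "w \<le> 2 * max N (x\<^sup>2)"
          using N by (auto simp: w_def)
        then have "w ^ p \<le> (2 * max N (x\<^sup>2)) ^ p"
          using w by (intro power_mono) auto
        also have "\<dots> = 2 ^ p * (max N (x\<^sup>2)) ^ p"
          by (simp add: power_mult_distrib)
        also have "(max N (x\<^sup>2)) ^ p \<le> N ^ p + x ^ (2 * p)"
          using N by (auto simp: max_def power_mult)
        finally show ?thesis by simp
      qed
      then have "w ^ p / N ^ p \<le> 2 ^ p * (N ^ p + x ^ (2 * p)) / N ^ p"
        using N by (intro divide_right_mono) auto
      then have "1 + (w / N) ^ p \<le> (1 + 2 ^ p) + (2 ^ p / N ^ p) * x ^ (2 * p)"
        using N by (simp add: power_divide distrib_left add_divide_distrib)
      finally have "w powr s \<le> N powr s * ((1 + 2 ^ p) + (2 ^ p / N ^ p) * x ^ (2 * p))"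
        using w N by (simp add: powr_divide field_simps)
      then have "w powr s * (psi \<beta> n x)\<^sup>2 \<le> N powr s * ((1 + 2 ^ p) + (2 ^ p / N ^ p) * x ^ (2 * p)) * (psi \<beta> n x)\<^sup>2"
        by (rule mult_right_mono) simp
      also have "\<dots> = g x"
        unfolding g_def power2_eq_square[of "psi \<beta> n x"] by (simp only: distrib_right distrib_left mult.assoc)
      finally show ?thesis
        by (simp add: w_def sobolev_weight_def)
    qed
    have intg: "integrable lborel g"
      unfolding g_def by (intro integrable_mult_right Bochner_Integration.integrable_add psi_product_integrable psi_moment_integrable assms)
    have nn: "sobolev_weight s K x * (psi \<beta> n x)\<^sup>2 \<ge> 0" for x
      by (simp add: sobolev_weight_def)
    have [measurable]: "sobolev_weight s K \<in> borel_measurable borel"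
      unfolding sobolev_weight_def by measurable
    have int: "integrable lborel (\<lambda>x. sobolev_weight s K x * (psi \<beta> n x)\<^sup>2)"
    proof (rule Bochner_Integration.integrable_bound[OF intg])
      show "AE x in lborel. norm (sobolev_weight s K x * (psi \<beta> n x)\<^sup>2) \<le> norm (g x)"
        using ptw nn by (intro AE_I2) (metis abs_of_nonneg order_trans real_norm_def)
    qed measurable
    have "(\<integral>x. sobolev_weight s K x * (psi \<beta> n x)\<^sup>2 \<partial>lborel) \<le> (\<integral>x. g x \<partial>lborel)"
      by (intro integral_mono int intg ptw)
    also have "\<dots> = N powr s * ((1 + 2 ^ p) + (2 ^ p / N ^ p) * (\<integral>x. x ^ (2 * p) * (psi \<beta> n x)\<^sup>2 \<partial>lborel))"
      unfolding g_def using psi_product_integrable[OF assms(1)] psi_moment_integrable[OF assms(1)]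
      by (simp add: psi_orthonormal[OF assms(1)])
    also have "\<dots> \<le> N powr s * ((1 + 2 ^ p) + (2 ^ p / N ^ p) * (C * N ^ p))"
    proof -
      have "(\<integral>x. x ^ (2 * p) * (psi \<beta> n x)\<^sup>2 \<partial>lborel) \<le> C * N ^ p"
        by (rule order_trans[OF C(2)]) (use C(1) N in \<open>auto intro!: mult_left_mono power_mono\<close>)
      then show ?thesis
        using N by (intro mult_left_mono add_left_mono) auto
    qed
    also have "\<dots> = (1 + 2 ^ p * (1 + C)) * N powr s"
      using N by (simp add: algebra_simps)
    finally show ?thesis
      using int unfolding N_def by blast
  qed
  then show ?thesis
    using C(1) by (intro exI[of _ "1 + 2 ^ p * (1 + C)"]) (auto simp: add_pos_nonneg)
qed

text \<open>The power y^s is bounded below by functions whose means are known: y - 1 if s >= 1, and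
  y - y^2/4 if 0 <= s < 1. Here y = r w, and r is chosen of order 1/N so that the mean of the lower
  function stays away from 0. The second case uses an upper bound for the mean of w^2.\<close>

lemma sobolev_weight_moment_lower:
  fixes s :: real
  assumes "\<beta> > 0" "s \<ge> 0"
  shows "\<exists>c>0. \<forall>n K. c * (1 + K\<^sup>2 + real n) powr s \<le> (\<integral>x. sobolev_weight s K x * (psi \<beta> n x)\<^sup>2 \<partial>lborel)"
proof -
  \<comment> \<open>The mean of w is exactly 1 + K^2 + (2n+1)/(2 beta), hence at least c0 N.\<close>
  define c0 where "c0 = min 1 (1 / (2 * \<beta>))"
  have c0: "c0 > 0" "c0 \<le> 1" "c0 \<le> 1 / (2 * \<beta>)" using assms by (auto simp: c0_def)
  obtain M where M: "M > 0" "\<And>n K. (\<integral>x. sobolev_weight 2 K x * (psi \<beta> n x)\<^sup>2 \<partial>lborel) \<le> M * (1 + K\<^sup>2 + real n) powr 2"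
    using sobolev_weight_moment[OF assms(1), of 2] by auto
  have int: "integrable lborel (\<lambda>x. sobolev_weight s K x * (psi \<beta> n x)\<^sup>2)" if "s \<ge> 0" for s K n
    using sobolev_weight_moment[OF assms(1) that] by blast
  \<comment> \<open>With r = e/N the lower bound for the mean is c0 e - 1 = 1 if s >= 1. If s < 1 it
    is c0 e - M e^2/4, which is largest at e = 2 c0/M and has there the value c0^2/M.\<close>
  define e where "e = (if s \<ge> 1 then 2 / c0 else 2 * c0 / M)"
  define b where "b = (if s \<ge> 1 then 1 else c0\<^sup>2 / M)"
  have e: "e > 0" "b > 0" using c0 M by (auto simp: e_def b_def)
  have "e powr (- s) * b * (1 + K\<^sup>2 + real n) powr s \<le> (\<integral>x. sobolev_weight s K x * (psi \<beta> n x)\<^sup>2 \<partial>lborel)" for n K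
  proof -
    define N where "N = 1 + K\<^sup>2 + real n"
    have N: "N > 0" by (auto simp: N_def add_pos_nonneg)
    define r where "r = e / N"
    have r: "r > 0" using e N by (simp add: r_def)
    let ?E = "\<lambda>s. \<integral>x. sobolev_weight s K x * (psi \<beta> n x)\<^sup>2 \<partial>lborel"
    have w: "sobolev_weight t K x \<ge> 0" "sobolev_weight 0 K x = 1" for t x
      using add_pos_nonneg[of 1 "x\<^sup>2 + K\<^sup>2"] by (auto simp: sobolev_weight_def)
    have E0: "?E 0 = 1"
      using psi_orthonormal[OF assms(1)] by (simp add: w power2_eq_square)
    have E1: "?E 1 \<ge> c0 * N"
    proof -
      have "?E 1 = (\<integral>x. (1 + K\<^sup>2) * (psi \<beta> n x * psi \<beta> n x) + x\<^sup>2 * (psi \<beta> n x)\<^sup>2 \<partial>lborel)"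
        by (intro Bochner_Integration.integral_cong refl) (simp add: sobolev_weight_def add_nonneg_nonneg power2_eq_square algebra_simps)
      also have "\<dots> = 1 + K\<^sup>2 + (2 * real n + 1) / (2 * \<beta>)"
        using psi_product_integrable[OF assms(1)] psi_moment_integrable[OF assms(1)]
        by (simp add: psi_orthonormal[OF assms(1)] psi_second_moment[OF assms(1)])
      also have "\<dots> \<ge> c0 * (1 + K\<^sup>2) + (2 * real n + 1) * c0"
      proof (rule add_mono)
        show "c0 * (1 + K\<^sup>2) \<le> 1 + K\<^sup>2" using c0 mult_right_mono[of c0 1 "1 + K\<^sup>2"] by simp
        have "(2 * real n + 1) * c0 \<le> (2 * real n + 1) * (1 / (2 * \<beta>))"
          using c0 by (intro mult_left_mono) auto
        then show "(2 * real n + 1) * c0 \<le> (2 * real n + 1) / (2 * \<beta>)" by simp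
      qed
      moreover have "c0 * N \<le> c0 * (1 + K\<^sup>2) + (2 * real n + 1) * c0"
        using c0 by (simp add: N_def algebra_simps)
      ultimately show ?thesis by linarith
    qed
    have E2: "?E 2 \<le> M * N\<^sup>2"
      using M(2)[of K n] N by (simp add: N_def powr_numeral)
    have "b \<le> (\<integral>x. (r powr s * sobolev_weight s K x) * (psi \<beta> n x)\<^sup>2 \<partial>lborel)"
    proof (cases "s \<ge> 1")
      case True
      have "(\<integral>x. r * (sobolev_weight 1 K x * (psi \<beta> n x)\<^sup>2) - sobolev_weight 0 K x * (psi \<beta> n x)\<^sup>2 \<partial>lborel)
         \<le> (\<integral>x. (r powr s * sobolev_weight s K x) * (psi \<beta> n x)\<^sup>2 \<partial>lborel)"
      proof (rule integral_mono)
        fix x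
        define v where "v = 1 + x\<^sup>2 + K\<^sup>2"
        have v: "v > 0" by (auto simp: v_def add_pos_nonneg)
        have "r * v - 1 \<le> (r * v) powr s"
        proof (cases "r * v \<le> 1")
          case True
          then show ?thesis using powr_ge_zero[of "r * v" s] by linarith
        next
          case False
          then show ?thesis using powr_mono[OF True, of "r * v"] by simp
        qed
        then have "(r * v - 1) * (psi \<beta> n x)\<^sup>2 \<le> (r powr s * v powr s) * (psi \<beta> n x)\<^sup>2"
          using v r by (intro mult_right_mono) (auto simp: powr_mult)
        then show "r * (sobolev_weight 1 K x * (psi \<beta> n x)\<^sup>2) - sobolev_weight 0 K x * (psi \<beta> n x)\<^sup>2
            \<le> (r powr s * sobolev_weight s K x) * (psi \<beta> n x)\<^sup>2"
          using v unfolding sobolev_weight_def v_def[symmetric] by (simp add: algebra_simps)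
      qed (use int assms in \<open>auto simp: mult.assoc simp del: w\<close>)
      moreover have "r * (c0 * N) \<le> r * ?E 1"
        using E1 r by (intro mult_left_mono) auto
      moreover have "r * (c0 * N) = 2"
        using N c0 True by (simp add: r_def e_def)
      ultimately show ?thesis
        using int[of 1] int[of 0] E0 True by (simp add: b_def)
    next
      case False
      have "(\<integral>x. r * (sobolev_weight 1 K x * (psi \<beta> n x)\<^sup>2) - (r\<^sup>2 / 4) * (sobolev_weight 2 K x * (psi \<beta> n x)\<^sup>2) \<partial>lborel)
         \<le> (\<integral>x. (r powr s * sobolev_weight s K x) * (psi \<beta> n x)\<^sup>2 \<partial>lborel)"
      proof (rule integral_mono)
        fix x
        define v where "v = 1 + x\<^sup>2 + K\<^sup>2"
        have v: "v > 0" by (auto simp: v_def add_pos_nonneg)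
        have "r * v - (r * v)\<^sup>2 / 4 \<le> (r * v) powr s"
        proof (cases "r * v \<le> 1")
          case True
          have "(r * v) powr 1 \<le> (r * v) powr s"
            using True False v r by (intro powr_mono') auto
          then have "r * v \<le> (r * v) powr s"
            using v r by simp
          then show ?thesis using zero_le_power2[of "r * v"] by linarith
        next
          case C: False
          have "r * v - (r * v)\<^sup>2 / 4 \<le> 1"
            using zero_le_power2[of "r * v / 2 - 1"] by (simp add: power2_diff power_divide)
          also have "1 \<le> (r * v) powr s"
            using C assms(2) by (intro ge_one_powr_ge_zero) auto
          finally show ?thesis .
        qed
        then have "(r * v - (r * v)\<^sup>2 / 4) * (psi \<beta> n x)\<^sup>2 \<le> (r powr s * v powr s) * (psi \<beta> n x)\<^sup>2"
          using v r by (intro mult_right_mono) (auto simp: powr_mult)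
        then show "r * (sobolev_weight 1 K x * (psi \<beta> n x)\<^sup>2) - (r\<^sup>2 / 4) * (sobolev_weight 2 K x * (psi \<beta> n x)\<^sup>2)
            \<le> (r powr s * sobolev_weight s K x) * (psi \<beta> n x)\<^sup>2"
          using v unfolding sobolev_weight_def v_def[symmetric] by (simp add: algebra_simps power_mult_distrib powr_numeral)
      qed (use int assms in \<open>auto simp: mult.assoc\<close>)
      also have "(\<integral>x. r * (sobolev_weight 1 K x * (psi \<beta> n x)\<^sup>2) - (r\<^sup>2 / 4) * (sobolev_weight 2 K x * (psi \<beta> n x)\<^sup>2) \<partial>lborel)
         = r * ?E 1 - (r\<^sup>2 / 4) * ?E 2"
        using int[of 1] int[of 2] by simp
      finally have *: "r * ?E 1 - (r\<^sup>2 / 4) * ?E 2 \<le> (\<integral>x. (r powr s * sobolev_weight s K x) * (psi \<beta> n x)\<^sup>2 \<partial>lborel)" .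
      have "r * (c0 * N) \<le> r * ?E 1"
        using E1 r by (intro mult_left_mono) auto
      moreover have "(r\<^sup>2 / 4) * ?E 2 \<le> (r\<^sup>2 / 4) * (M * N\<^sup>2)"
        using E2 r by (intro mult_left_mono) auto
      moreover have "r * (c0 * N) - (r\<^sup>2 / 4) * (M * N\<^sup>2) = b"
        using N c0 M False by (simp add: r_def e_def b_def power_divide power2_eq_square field_simps)
      ultimately show ?thesis using * by linarith
    qed
    also have "\<dots> = r powr s * ?E s"
      using int[OF assms(2)] by (simp add: mult.assoc)
    finally have "b \<le> r powr s * ?E s" .
    moreover have "r powr s = e powr s / N powr s"
      using e N by (simp add: r_def powr_divide)
    ultimately have "b * N powr s \<le> e powr s * ?E s"
      using N by (simp add: field_simps)
    then show ?thesis
      using e unfolding N_def by (simp add: powr_minus field_simps)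
  qed
  then show ?thesis
    using e by (intro exI[of _ "e powr (- s) * b"]) auto
qed

section \<open>A uniform bound for the Hermite functions\<close>

text \<open>The derivative of ln (1 + x) - 2x/(2 + x) is x^2/((1 + x)(2 + x)^2) >= 0. In the form (t
  + 1/2) ln (1 + 1/t) >= 1 this is the induction step of Stirling's bound.\<close>

lemma ln_one_plus_inverse_ge:
  fixes t :: real
  assumes "t > 0"
  shows "2 / (2 * t + 1) \<le> ln (1 + 1 / t)"
proof -
  define f where "f x = ln (1 + x) - 2 * x / (2 + x)" for x :: real
  have "f 0 \<le> f (1 / t)"
  proof (rule DERIV_nonneg_imp_nondecreasing[of 0 "1 / t"])
    fix x assume x: "0 \<le> x" "x \<le> 1 / t"
    have "(f has_real_derivative 1 / (1 + x) - 4 / (2 + x)\<^sup>2) (at x)"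
      unfolding f_def using x by (auto intro!: derivative_eq_intros simp: field_simps power2_eq_square)
    moreover have "1 / (1 + x) - 4 / (2 + x)\<^sup>2 = x\<^sup>2 / ((1 + x) * (2 + x)\<^sup>2)"
      using x by (simp add: divide_simps power2_eq_square) (simp add: algebra_simps)
    ultimately show "\<exists>y. DERIV f x :> y \<and> 0 \<le> y"
      using x by (intro exI[of _ "x\<^sup>2 / ((1 + x) * (2 + x)\<^sup>2)"]) auto
  qed (use assms in auto)
  moreover have "2 * (1 / t) / (2 + 1 / t) = 2 / (2 * t + 1)"
    using assms by (simp add: field_simps)
  ultimately show ?thesis
    by (simp add: f_def)
qed

text \<open>The power sqrt n is sharp, and only it matters: its square root n^(1/4) has to be
  cancelled exactly later. The constant e, in place of sqrt (2 pi), gives equality at n = 1 and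
  starts the induction.\<close>

lemma fact_le_Stirling:
  assumes "n \<ge> 1"
  shows "fact n \<le> exp 1 * sqrt (real n) * real n ^ n * exp (- real n)"
  using assms
proof (induction n rule: dec_induct)
  case base
  show ?case by (simp flip: exp_add)
next
  case (step n)
  define x where "x = real n"
  have x: "x > 0" using step by (simp add: x_def)
  have "exp 1 * sqrt x * x ^ n \<le> sqrt (x + 1) * (x + 1) ^ n"
  proof -
    have "1 \<le> (x + 1 / 2) * ln (1 + 1 / x)"
      using ln_one_plus_inverse_ge[OF x] x by (simp add: field_simps)
    also have "ln (1 + 1 / x) = ln (x + 1) - ln x"
      using x by (simp add: add_divide_distrib flip: ln_divide_pos)
    finally have "1 + (1 / 2) * ln x + x * ln x \<le> (1 / 2) * ln (x + 1) + x * ln (x + 1)"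
      by (simp add: algebra_simps)
    then have "exp (1 + (1 / 2) * ln x + x * ln x) \<le> exp ((1 / 2) * ln (x + 1) + x * ln (x + 1))"
      by simp
    moreover have "exp ((1 / 2) * ln y) = sqrt y" if "y > 0" for y :: real
      using that powr_half_sqrt[of y] by (simp add: powr_def)
    moreover have "exp (x * ln y) = y ^ n" if "y > 0" for y :: real
      using that powr_realpow[of y n] by (simp add: powr_def x_def)
    ultimately show ?thesis
      using x by (simp add: exp_add)
  qed
  then have "exp (- x) * (x + 1) * (exp 1 * sqrt x * x ^ n) \<le> exp (- x) * (x + 1) * (sqrt (x + 1) * (x + 1) ^ n)"
    using x by (intro mult_left_mono) auto
  moreover have "fact (Suc n) \<le> (x + 1) * (exp 1 * sqrt x * x ^ n * exp (- x))"
    using mult_left_mono[OF step.IH, of "x + 1"] x by (simp add: x_def algebra_simps)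
  moreover have "exp 1 * exp (- (x + 1)) = exp (- x)"
    by (simp flip: exp_add)
  then have "exp (- x) * (x + 1) * (sqrt (x + 1) * (x + 1) ^ n) = exp 1 * sqrt (x + 1) * (x + 1) ^ Suc n * exp (- (x + 1))"
    by (metis (no_types, opaque_lifting) mult.assoc mult.commute mult.left_commute power_Suc)
  ultimately show ?case
    by (simp add: x_def algebra_simps)
qed

section \<open>The generating function of the Hermite polynomials\<close>

abbreviation complex_hermite :: "nat \<Rightarrow> complex poly" where
  "complex_hermite n \<equiv> map_poly of_real (hermite_poly n)"

lemma pderiv_map_poly_of_real: "pderiv (map_poly of_real p) = (map_poly of_real (pderiv p) :: complex poly)"
  by (rule poly_eqI) (simp add: coeff_pderiv coeff_map_poly)

lemma complex_hermite_Suc: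
  "complex_hermite (Suc n) = [:0, 2:] * complex_hermite n - pderiv (complex_hermite n)"
proof (rule poly_eqI)
  fix i
  show "coeff (complex_hermite (Suc n)) i = coeff ([:0, 2:] * complex_hermite n - pderiv (complex_hermite n)) i"
    unfolding pderiv_map_poly_of_real by (cases i) (auto simp: coeff_map_poly coeff_pCons)
qed

text \<open>Differentiation in w gives -H_n'(x - w) from the polynomial and 2(x - w) H_n(x - w) from
  the exponent, which together are H_(n+1)(x - w). The derivative at w = 0 is H_n(x), but the
  induction needs all w.\<close>

lemma hermite_generating_deriv:
  "(deriv ^^ n) (\<lambda>w. exp (2 * x * w - w\<^sup>2)) = (\<lambda>w. poly (complex_hermite n) (x - w) * exp (2 * x * w - w\<^sup>2))"
proof (induction n)
  case 0
  show ?case by (simp add: map_poly_1)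
next
  case (Suc n)
  show ?case
  proof
    fix w
    let ?E = "\<lambda>w. exp (2 * x * w - w\<^sup>2)"
    have 1: "((\<lambda>w. poly (complex_hermite n) (x - w)) has_field_derivative poly (pderiv (complex_hermite n)) (x - w) * (- 1)) (at w)"
      by (rule DERIV_chain2[OF poly_DERIV]) (auto intro!: derivative_eq_intros)
    have 2: "(?E has_field_derivative ?E w * (2 * x - 2 * w)) (at w)"
      by (auto intro!: derivative_eq_intros)
    have "((\<lambda>w. poly (complex_hermite n) (x - w) * ?E w) has_field_derivative
        poly (complex_hermite (Suc n)) (x - w) * ?E w) (at w)"
      by (rule DERIV_cong[OF DERIV_mult[OF 1 2]]) (simp only: complex_hermite_Suc, simp add: algebra_simps)
    then show "(deriv ^^ Suc n) (\<lambda>w. exp (2 * x * w - w\<^sup>2)) w = poly (complex_hermite (Suc n)) (x - w) * ?E w"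
      using Suc by (simp only: funpow.simps o_apply DERIV_imp_deriv)
  qed
qed

lemma poly_complex_hermite: "poly (complex_hermite n) (of_real x) = of_real (poly (hermite_poly n) x)"
proof -
  have "poly (map_poly of_real p) (of_real x) = (of_real (poly p x) :: complex)" for p
    by (induction p) (auto simp: map_poly_pCons)
  then show ?thesis .
qed

text \<open>Completing the square in cos t. The factor exp (x^2/2) so produced is exactly cancelled
  by the Gaussian in psi, which makes the bound uniform in x.\<close>

lemma norm_hermite_generating:
  fixes x r t :: real
  assumes "r > 0"
  shows "norm (exp (2 * of_real x * (of_real r * cis t) - (of_real r * cis t)\<^sup>2)) =
    exp (x\<^sup>2 / 2 + r\<^sup>2) * exp (- 2 * r\<^sup>2 * (cos t - x / (2 * r))\<^sup>2)"
proof -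
  have "Re ((of_real r * cis t)\<^sup>2) = r\<^sup>2 * (2 * (cos t)\<^sup>2 - 1)"
  proof -
    have "Re ((of_real r * cis t)\<^sup>2) = r\<^sup>2 * ((cos t)\<^sup>2 - (sin t)\<^sup>2)"
      by (simp add: power2_eq_square algebra_simps)
    then show ?thesis
      by (simp add: sin_squared_eq)
  qed
  then have "Re (2 * of_real x * (of_real r * cis t) - (of_real r * cis t)\<^sup>2) =
      2 * x * r * cos t - r\<^sup>2 * (2 * (cos t)\<^sup>2 - 1)"
    by simp
  also have "\<dots> = (x\<^sup>2 / 2 + r\<^sup>2) + (- 2 * r\<^sup>2 * (cos t - x / (2 * r))\<^sup>2)"
    using assms by (simp add: field_simps power2_eq_square)
  finally show ?thesis
    by (simp only: norm_exp_eq_Re exp_add)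
qed

text \<open>Jordan's inequality: by concavity the sine lies above its chord between 0 and
  pi/2.\<close>

lemma sin_ge_linear:
  assumes "\<bar>v\<bar> \<le> 1 / 2"
  shows "2 * \<bar>v\<bar> \<le> \<bar>sin (pi * v)\<bar>"
proof -
  have "2 * v \<le> sin (pi * v)" if "0 \<le> v" "v \<le> 1 / 2" for v :: real
  proof -
    have "concave_on {0..pi} sin"
    proof (rule f''_le0_imp_concave)
      show "(sin has_real_derivative cos x) (at x)" "(cos has_real_derivative - sin x) (at x)" for x :: real
        by (auto intro!: derivative_eq_intros)
    qed (auto simp: sin_ge_zero)
    from concave_onD[OF this, of "2 * v" 0 "pi / 2"] that show ?thesis
      by (simp add: mult.commute)
  qed
  from this[of "\<bar>v\<bar>"] assms show ?thesis
    by (cases "v \<ge> 0") (auto simp: sin_ge_zero)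
qed

text \<open>A quartic exponent is traded for a quadratic one: from (8 sqrt m v^2 - 1)^2 >= 0 follows
  16 sqrt m v^2 <= 1 + 64 m v^4. The resulting Gaussian has width of order m^(-1/4).\<close>

lemma exp_neg_sin_power4_le:
  assumes "\<bar>v\<bar> \<le> 1 / 2" "m > 0"
  shows "exp (- 4 * m * sin (pi * v) ^ 4) \<le> exp 1 * exp (- (16 * sqrt m) * v\<^sup>2)"
proof -
  have "(2 * \<bar>v\<bar>) ^ 4 \<le> \<bar>sin (pi * v)\<bar> ^ 4"
    by (intro power_mono sin_ge_linear assms) auto
  then have "16 * v ^ 4 \<le> sin (pi * v) ^ 4"
    by (simp add: power_mult_distrib power_even_abs)
  then have "64 * m * v ^ 4 \<le> 4 * m * sin (pi * v) ^ 4"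
    using mult_left_mono[of "16 * v ^ 4" "sin (pi * v) ^ 4" "4 * m"] assms by simp
  moreover have "16 * sqrt m * v\<^sup>2 \<le> 1 + 64 * m * v ^ 4"
  proof -
    have "0 \<le> (8 * sqrt m * v\<^sup>2 - 1)\<^sup>2" by simp
    also have "\<dots> = 64 * (sqrt m)\<^sup>2 * v ^ 4 - 16 * sqrt m * v\<^sup>2 + 1"
      by (simp add: power2_eq_square power4_eq_xxxx algebra_simps)
    finally show ?thesis using assms by simp
  qed
  ultimately show ?thesis
    by (simp flip: exp_add)
qed

text \<open>
  For \<open>a = cos \<alpha>\<close>, the difference \<open>cos (2 \<pi> t) - a\<close> is a product of two sines, the smaller of which
  controls it. Its quadratic zeros at \<open>a = \<plusminus>1\<close> are responsible for the exponent \<open>1/4\<close>.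
\<close>

lemma integral_exp_cos_le:
  fixes a :: real
  assumes "m > 0"
  shows "(\<integral>t\<in>{0..1}. exp (- m * (cos (2 * pi * t) - a)\<^sup>2) \<partial>lborel) \<le> 4 * exp 1 * sqrt (pi / (16 * sqrt m))"
proof -
  \<comment> \<open>If a lies outside [-1, 1], the nearest cosine b is used instead; this only
    decreases the distance to cos (2 pi t).\<close>
  define b where "b = max (- 1) (min 1 a)"
  define \<alpha> where "\<alpha> = arccos b / (2 * pi)"
  have b: "- 1 \<le> b" "b \<le> 1" by (auto simp: b_def)
  have \<alpha>: "0 \<le> \<alpha>" "\<alpha> \<le> 1 / 2" "cos (2 * pi * \<alpha>) = b"
    using arccos_bounded[OF b] b by (auto simp: \<alpha>_def cos_arccos field_simps)
  define G where "G v = exp 1 * exp (- (16 * sqrt m) * v\<^sup>2)" for v :: real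
  have G0: "G v \<ge> 0" for v by (simp add: G_def)
  have Gint: "integrable lborel (\<lambda>t. G (c + t))" "(\<integral>t. G (c + t) \<partial>lborel) = exp 1 * sqrt (pi / (16 * sqrt m))" for c
  proof -
    have G: "integrable lborel G" "(\<integral>t. G t \<partial>lborel) = exp 1 * sqrt (pi / (16 * sqrt m))"
      unfolding G_def using exp_neg_square_integrable[of "16 * sqrt m"] integral_exp_neg_square[of "16 * sqrt m"] assms by auto
    show "integrable lborel (\<lambda>t. G (c + t))"
      using lborel_integrable_real_affine[OF G(1), of 1 c] by simp
    show "(\<integral>t. G (c + t) \<partial>lborel) = exp 1 * sqrt (pi / (16 * sqrt m))"
      using lborel_integral_real_affine[of 1 G c] G(2) by simp
  qed
  \<comment> \<open>For t in [0, 1] the arguments t + \<alpha> and t - \<alpha> range over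
    [-1/2, 3/2], which contains the two zeros 0 and 1 of the sine; each zero needs its own
    Gaussian.\<close>
  have near: "exp (- 4 * m * sin (pi * v) ^ 4) \<le> G v + G (v - 1)" if "- 1 / 2 \<le> v" "v \<le> 3 / 2" for v
  proof (cases "v \<le> 1 / 2")
    case True
    then have "\<bar>v\<bar> \<le> 1 / 2" using that by linarith
    then have "exp (- 4 * m * sin (pi * v) ^ 4) \<le> G v"
      unfolding G_def by (rule exp_neg_sin_power4_le[OF _ assms])
    then show ?thesis
      using G0[of "v - 1"] by linarith
  next
    case False
    have "sin (pi * v) ^ 4 = sin (pi * (v - 1)) ^ 4"
      by (simp add: right_diff_distrib sin_diff power_even_abs)
    moreover have "\<bar>v - 1\<bar> \<le> 1 / 2" using that False by linarith
    ultimately have "exp (- 4 * m * sin (pi * v) ^ 4) \<le> G (v - 1)"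
      using exp_neg_sin_power4_le[of "v - 1" m] assms unfolding G_def by metis
    then show ?thesis
      using G0[of v] by linarith
  qed
  have pt: "exp (- m * (cos (2 * pi * t) - a)\<^sup>2) \<le> (G (\<alpha> + t) + G (\<alpha> - 1 + t)) + (G (- \<alpha> + t) + G (- \<alpha> - 1 + t))"
    if t: "t \<in> {0..1}" for t
  proof -
    define p q where "p = \<bar>sin (pi * (t + \<alpha>))\<bar>" and "q = \<bar>sin (pi * (t - \<alpha>))\<bar>"
    have pq: "p \<ge> 0" "q \<ge> 0" by (auto simp: p_def q_def)
    have clamp: "\<bar>c - b\<bar> \<le> \<bar>c - a\<bar>" if "- 1 \<le> c" "c \<le> 1" for c
      using that unfolding b_def by (smt (verit))
    have "\<bar>cos (2 * pi * t) - b\<bar> \<le> \<bar>cos (2 * pi * t) - a\<bar>"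
      by (rule clamp[OF cos_ge_minus_one cos_le_one])
    moreover have "\<bar>cos (2 * pi * t) - b\<bar> = 2 * (p * q)"
    proof -
      have "cos (2 * pi * t) - cos (2 * pi * \<alpha>) = 2 * sin (pi * (t + \<alpha>)) * sin (pi * (\<alpha> - t))"
        using cos_diff_cos[of "2 * pi * t" "2 * pi * \<alpha>"] by (simp add: algebra_simps add_divide_distrib diff_divide_distrib)
      moreover have "sin (pi * (\<alpha> - t)) = - sin (pi * (t - \<alpha>))"
        by (simp flip: sin_minus add: algebra_simps)
      ultimately show ?thesis
        unfolding \<alpha>(3) by (simp add: p_def q_def abs_mult)
    qed
    ultimately have "(2 * (p * q))\<^sup>2 \<le> (cos (2 * pi * t) - a)\<^sup>2"
      using abs_le_square_iff[of "2 * (p * q)" "cos (2 * pi * t) - a"] pq by simp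
    then have sq: "4 * (p * q)\<^sup>2 \<le> (cos (2 * pi * t) - a)\<^sup>2"
      by (simp add: power_mult_distrib)
    have "exp (- m * (cos (2 * pi * t) - a)\<^sup>2) \<le> exp (- 4 * m * p ^ 4) + exp (- 4 * m * q ^ 4)"
    proof (cases "p \<le> q")
      case True
      then have "p ^ 4 \<le> (p * q)\<^sup>2"
        using pq power_mono[of p q 2] mult_left_mono[of "p\<^sup>2" "q\<^sup>2" "p\<^sup>2"]
        by (simp add: power_mult_distrib flip: power_add)
      then have "4 * p ^ 4 \<le> (cos (2 * pi * t) - a)\<^sup>2"
        using sq by linarith
      then have "exp (- m * (cos (2 * pi * t) - a)\<^sup>2) \<le> exp (- 4 * m * p ^ 4)"
        using assms mult_left_mono[of "4 * p ^ 4" "(cos (2 * pi * t) - a)\<^sup>2" m] by simp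
      then show ?thesis
        using exp_gt_zero[of "- 4 * m * q ^ 4"] by linarith
    next
      case False
      then have "q ^ 4 \<le> (p * q)\<^sup>2"
        using pq power_mono[of q p 2] mult_right_mono[of "q\<^sup>2" "p\<^sup>2" "q\<^sup>2"]
        by (simp add: power_mult_distrib flip: power_add)
      then have "4 * q ^ 4 \<le> (cos (2 * pi * t) - a)\<^sup>2"
        using sq by linarith
      then have "exp (- m * (cos (2 * pi * t) - a)\<^sup>2) \<le> exp (- 4 * m * q ^ 4)"
        using assms mult_left_mono[of "4 * q ^ 4" "(cos (2 * pi * t) - a)\<^sup>2" m] by simp
      then show ?thesis
        using exp_gt_zero[of "- 4 * m * p ^ 4"] by linarith
    qed
    also have "\<dots> \<le> (G (t + \<alpha>) + G (t + \<alpha> - 1)) + (G (t - \<alpha>) + G (t - \<alpha> - 1))"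
      using near[of "t + \<alpha>"] near[of "t - \<alpha>"] t \<alpha> unfolding p_def q_def
      by (intro add_mono) (auto simp: power_even_abs)
    finally show ?thesis
      by (simp add: algebra_simps)
  qed
  have "(\<integral>t\<in>{0..1}. exp (- m * (cos (2 * pi * t) - a)\<^sup>2) \<partial>lborel) \<le>
     (\<integral>t. (G (\<alpha> + t) + G (\<alpha> - 1 + t)) + (G (- \<alpha> + t) + G (- \<alpha> - 1 + t)) \<partial>lborel)"
    unfolding set_lebesgue_integral_def
  proof (rule integral_mono)
    show "integrable lborel (\<lambda>t. indicator {0..1} t *\<^sub>R exp (- m * (cos (2 * pi * t) - a)\<^sup>2))"
      by (rule borel_integrable_compact) (auto intro!: continuous_intros)
    show "indicator {0..1} t *\<^sub>R exp (- m * (cos (2 * pi * t) - a)\<^sup>2) \<le>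
        (G (\<alpha> + t) + G (\<alpha> - 1 + t)) + (G (- \<alpha> + t) + G (- \<alpha> - 1 + t))" for t
      using pt[of t] G0 by (auto simp: indicator_def intro!: add_nonneg_nonneg)
    show "integrable lborel (\<lambda>t. (G (\<alpha> + t) + G (\<alpha> - 1 + t)) + (G (- \<alpha> + t) + G (- \<alpha> - 1 + t)))"
      by (intro Bochner_Integration.integrable_add Gint(1))
  qed
  also have "\<dots> = 4 * exp 1 * sqrt (pi / (16 * sqrt m))"
    by (simp only: Bochner_Integration.integral_add Gint Bochner_Integration.integrable_add)
  finally show ?thesis .
qed

text \<open>Cauchy's formula with the integrand replaced by its norm; the radius stays free for
  \<open>psi_bounded\<close>. The centre x/(2r) can be any real number, which is why
  \<open>integral_exp_cos_le\<close> admits every a.\<close>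

lemma hermite_poly_cauchy_bound:
  assumes "r > 0"
  shows "\<bar>poly (hermite_poly n) x\<bar> / fact n \<le>
    exp (x\<^sup>2 / 2 + r\<^sup>2) / r ^ n * (\<integral>t\<in>{0..1}. exp (- (2 * r\<^sup>2) * (cos (2 * pi * t) - x / (2 * r))\<^sup>2) \<partial>lborel)"
proof -
  define f where "f w = exp (2 * of_real x * w - w\<^sup>2)" for w :: complex
  define h where "h = of_real (poly (hermite_poly n) x) * ((2 * pi * \<i>) / (fact n))"
  have "((\<lambda>u. f u / (u - 0) ^ Suc n) has_contour_integral ((2 * pi * \<i>) / (fact n) * (deriv ^^ n) f 0)) (circlepath 0 r)"
    by (rule Cauchy_has_contour_integral_higher_derivative_circlepath)
       (use assms in \<open>auto simp: f_def intro!: continuous_intros holomorphic_intros\<close>)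
  moreover have "(deriv ^^ n) f 0 = of_real (poly (hermite_poly n) x)"
    unfolding f_def hermite_generating_deriv by (simp add: poly_complex_hermite)
  ultimately have "((\<lambda>u. f u / u ^ Suc n) has_contour_integral h) (circlepath 0 r)"
    by (simp add: h_def mult.commute)
  then have hi: "((\<lambda>t. f (circlepath 0 r t) / circlepath 0 r t ^ Suc n * vector_derivative (circlepath 0 r) (at t)) has_integral h) {0..1}"
    unfolding has_contour_integral by simp
  define g where "g t = exp (x\<^sup>2 / 2 + r\<^sup>2) / r ^ n * (2 * pi) * exp (- (2 * r\<^sup>2) * (cos (2 * pi * t) - x / (2 * r))\<^sup>2)" for t
  have cp: "circlepath 0 r t = of_real r * cis (2 * pi * t)" for t
    by (simp add: circlepath cis_conv_exp mult_ac)
  have norm_eq: "norm (f (circlepath 0 r t) / circlepath 0 r t ^ Suc n * vector_derivative (circlepath 0 r) (at t)) = g t" for t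
  proof -
    have "norm (f (circlepath 0 r t)) = exp (x\<^sup>2 / 2 + r\<^sup>2) * exp (- 2 * r\<^sup>2 * (cos (2 * pi * t) - x / (2 * r))\<^sup>2)"
      unfolding f_def cp by (rule norm_hermite_generating[OF assms])
    moreover have "norm (vector_derivative (circlepath 0 r) (at t)) = 2 * pi * r"
      using assms by (simp add: vector_derivative_circlepath norm_mult norm_exp_eq_Re)
    moreover have "norm (circlepath 0 r t) = r"
      using assms by (simp add: cp norm_mult)
    ultimately show ?thesis
      using assms unfolding g_def by (simp only: norm_mult norm_divide norm_power) (simp add: field_simps)
  qed
  have gc: "continuous_on {0..1} g"
    unfolding g_def by (intro continuous_intros) (use assms in auto)
  have "set_integrable lborel {0..1} g"
    unfolding set_integrable_def by (rule borel_integrable_compact) (use gc in auto)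
  note gi = set_borel_integral_eq_integral[OF this]
  have "norm h \<le> integral {0..1} g"
    using integral_norm_bound_integral[of _ "{0..1}" g] hi gi(1) norm_eq
    by (metis (no_types, lifting) has_integral_integrable integral_unique order_refl)
  also have "\<dots> = exp (x\<^sup>2 / 2 + r\<^sup>2) / r ^ n * (2 * pi) *
      (\<integral>t\<in>{0..1}. exp (- (2 * r\<^sup>2) * (cos (2 * pi * t) - x / (2 * r))\<^sup>2) \<partial>lborel)"
    unfolding gi(2)[symmetric] g_def by (rule set_integral_mult_right)
  also have "norm h = 2 * pi * (\<bar>poly (hermite_poly n) x\<bar> / fact n)"
    by (simp add: h_def norm_mult norm_divide)
  finally have "2 * pi * (\<bar>poly (hermite_poly n) x\<bar> / fact n) \<le> 2 * pi * (exp (x\<^sup>2 / 2 + r\<^sup>2) / r ^ n *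
      (\<integral>t\<in>{0..1}. exp (- (2 * r\<^sup>2) * (cos (2 * pi * t) - x / (2 * r))\<^sup>2) \<partial>lborel))"
    by (simp only: mult_ac)
  then show ?thesis
    by (rule mult_left_le_imp_le) simp
qed

lemma psi_bounded:
  assumes "\<beta> > 0"
  shows "\<exists>C>0. \<forall>n x. \<bar>psi \<beta> n x\<bar> \<le> C"
proof -
  define B where "B = (\<beta> / pi) powr (1 / 4)"
  define D where "D = sqrt (exp 1) * (4 * exp 1 * sqrt (pi / 16))"
  have BD: "B > 0" "D > 0" using assms by (auto simp: B_def D_def)
  have "\<bar>psi \<beta> n x\<bar> \<le> B * (D + 1)" for n x
  proof (cases "n = 0")
    case True
    have "exp (- \<beta> * x\<^sup>2 / 2) \<le> 1" using assms by simp
    then have "exp (- \<beta> * x\<^sup>2 / 2) \<le> D + 1" using BD by linarith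
    then have "B * exp (- \<beta> * x\<^sup>2 / 2) \<le> B * (D + 1)"
      using BD by (intro mult_left_mono) auto
    then show ?thesis
      using True by (simp add: psi_def B_def abs_mult)
  next
    case False
    define m where "m = real n"
    have m: "m > 0" using False by (simp add: m_def)
    \<comment> \<open>This radius minimises exp (r^2) / r^n; it degenerates for n = 0, whence the
      separate case.\<close>
    define r where "r = sqrt (m / 2)"
    have r: "r > 0" "r\<^sup>2 = m / 2" "2 * r\<^sup>2 = m" using m by (auto simp: r_def)
    define y where "y = sqrt \<beta> * x"
    define J where "J = (\<integral>t\<in>{0..1}. exp (- m * (cos (2 * pi * t) - y / (2 * r))\<^sup>2) \<partial>lborel)"
    define q where "q = sqrt (pi / (16 * sqrt m))"
    have J: "J \<le> 4 * exp 1 * q"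
      unfolding J_def q_def by (rule integral_exp_cos_le[OF m])
    have "\<bar>poly (hermite_poly n) y\<bar> / fact n \<le> exp (y\<^sup>2 / 2 + m / 2) / r ^ n * J"
      using hermite_poly_cauchy_bound[OF r(1), of n y] unfolding r(3) unfolding r(2) J_def .
    also have "\<dots> \<le> exp (y\<^sup>2 / 2 + m / 2) / r ^ n * (4 * exp 1 * q)"
      using J r by (intro mult_left_mono) auto
    finally have H: "\<bar>poly (hermite_poly n) y\<bar> \<le> fact n * (exp (y\<^sup>2 / 2 + m / 2) / r ^ n * (4 * exp 1 * q))"
      by (simp add: pos_divide_le_eq mult.commute)
    have e: "exp (- \<beta> * x\<^sup>2 / 2) = exp (- (y\<^sup>2 / 2))"
      using assms by (simp add: y_def power_mult_distrib)
    have "\<bar>psi \<beta> n x\<bar> = B / sqrt (2 ^ n * fact n) * exp (- (y\<^sup>2 / 2)) * \<bar>poly (hermite_poly n) y\<bar>"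
      unfolding psi_def e by (simp add: abs_mult B_def y_def)
    also have "\<dots> \<le> B / sqrt (2 ^ n * fact n) * exp (- (y\<^sup>2 / 2)) * (fact n * (exp (y\<^sup>2 / 2 + m / 2) / r ^ n * (4 * exp 1 * q)))"
      using H BD by (intro mult_left_mono) auto
    also have "\<dots> = B * (exp (m / 2) * (fact n / (sqrt (2 ^ n * fact n) * r ^ n)) * (4 * exp 1 * q)) * (exp (- (y\<^sup>2 / 2)) * exp (y\<^sup>2 / 2))"
      by (simp add: exp_add)
    also have "exp (- (y\<^sup>2 / 2)) * exp (y\<^sup>2 / 2) = 1"
      by (simp flip: exp_add)
    also have "fact n / (sqrt (2 ^ n * fact n) * r ^ n) = sqrt (fact n / m ^ n)"
    proof -
      have "sqrt (2 ^ n * fact n) * r ^ n = sqrt (fact n) * sqrt (m ^ n)"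
        unfolding r_def by (simp add: real_sqrt_mult real_sqrt_divide real_sqrt_power power_divide)
      then show ?thesis
        by (simp add: real_sqrt_divide real_div_sqrt divide_divide_eq_left[symmetric])
    qed
    \<comment> \<open>Stirling bounds the first two factors by a constant times m^(1/4), and q is a
      constant times m^(-1/4).\<close>
    also have "exp (m / 2) * sqrt (fact n / m ^ n) * (4 * exp 1 * q) \<le> D"
    proof -
      have "fact n \<le> exp 1 * sqrt m * m ^ n * exp (- m)"
        using fact_le_Stirling[of n] False by (simp add: m_def)
      then have "fact n / m ^ n \<le> exp 1 * sqrt m * exp (- m)"
        using m by (simp add: divide_le_eq mult_ac)
      then have "exp m * (fact n / m ^ n) \<le> exp m * (exp 1 * sqrt m * exp (- m))"
        by (intro mult_left_mono) auto
      also have "\<dots> = exp 1 * sqrt m"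
        by (simp add: exp_minus)
      finally have "sqrt (exp m * (fact n / m ^ n)) \<le> sqrt (exp 1 * sqrt m)"
        by (rule real_sqrt_le_mono)
      moreover have "sqrt (exp m) = exp (m / 2)"
      proof (rule real_sqrt_unique)
        show "(exp (m / 2))\<^sup>2 = exp m" by (simp add: power2_eq_square flip: exp_add)
      qed simp
      ultimately have "exp (m / 2) * sqrt (fact n / m ^ n) \<le> sqrt (exp 1) * sqrt (sqrt m)"
        unfolding real_sqrt_mult[of "exp m"] real_sqrt_mult[of "exp 1"] by (simp only:)
      then have "exp (m / 2) * sqrt (fact n / m ^ n) * (4 * exp 1 * q) \<le> sqrt (exp 1) * sqrt (sqrt m) * (4 * exp 1 * q)"
        by (rule mult_right_mono) (use m in \<open>simp add: q_def\<close>)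
      also have "\<dots> = sqrt (exp 1) * (4 * exp 1 * (sqrt (sqrt m) * q))"
        by (simp only: mult_ac)
      also have "sqrt (sqrt m) * q = sqrt (pi / 16)"
        using m by (simp add: q_def real_sqrt_mult real_sqrt_divide)
      finally show ?thesis by (simp add: D_def)
    qed
    finally show ?thesis
      using BD by (simp add: distrib_left)
  qed
  then show ?thesis
    using BD by (intro exI[of _ "B * (D + 1)"]) auto
qed

section \<open>Fourier transforms of Hermite functions\<close>

lemma norm_cis_diff_le: "norm (cis a - cis b) \<le> \<bar>a - b\<bar>"
proof -
  have "norm (cis a - cis b) = norm (cis b * (cis (a - b) - 1))"
    by (simp add: right_diff_distrib cis_mult)
  also have "\<dots> = norm (exp (\<i> * of_real (a - b)) - 1)"
    by (simp add: norm_mult cis_conv_exp)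
  also have "\<dots> \<le> \<bar>a - b\<bar>"
    using iexp_approx1[of "a - b" 0] by (simp add: mult.commute)
  finally show ?thesis .
qed

lemma has_vector_derivative_cis:
  "((\<lambda>t. cis (a * t)) has_vector_derivative \<i> * a * cis (a * t)) (at t)"
proof -
  have "((\<lambda>z. exp (\<i> * of_real a * z)) has_field_derivative \<i> * of_real a * exp (\<i> * of_real a * of_real t)) (at (of_real t))"
    by (auto intro!: derivative_eq_intros)
  from has_vector_derivative_real_field[OF this] show ?thesis
    by (simp add: cis_conv_exp mult.assoc)
qed

text \<open>Puts the derivative into the form of a limit of quotients along sequences, to which
  dominated convergence applies.\<close>

lemma has_vector_derivative_iff_quotient:
  "(f has_vector_derivative D) (at x) \<longleftrightarrow> ((\<lambda>y. (f y - f x) /\<^sub>R (y - x)) \<longlongrightarrow> D) (at x)"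
proof -
  have "(f has_vector_derivative D) (at x) \<longleftrightarrow>
      ((\<lambda>y. norm (f y - f x - (y - x) *\<^sub>R D) / norm (y - x)) \<longlongrightarrow> 0) (at x)"
    by (simp add: has_vector_derivative_def has_derivative_iff_norm bounded_linear_scaleR_left)
  also have "\<dots> \<longleftrightarrow> ((\<lambda>y. norm ((f y - f x) /\<^sub>R (y - x) - D)) \<longlongrightarrow> 0) (at x)"
  proof (rule tendsto_cong)
    have "norm (f y - f x - (y - x) *\<^sub>R D) / norm (y - x) = norm ((f y - f x) /\<^sub>R (y - x) - D)" if "y \<noteq> x" for y
    proof -
      have "(f y - f x) /\<^sub>R (y - x) - D = (f y - f x - (y - x) *\<^sub>R D) /\<^sub>R (y - x)"
        using that by (simp add: scaleR_diff_right)
      then show ?thesis by (simp add: divide_inverse_commute)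
    qed
    then show "\<forall>\<^sub>F y in at x. norm (f y - f x - (y - x) *\<^sub>R D) / norm (y - x) = norm ((f y - f x) /\<^sub>R (y - x) - D)"
      by (auto simp: eventually_at_filter)
  qed
  also have "\<dots> \<longleftrightarrow> ((\<lambda>y. (f y - f x) /\<^sub>R (y - x)) \<longlongrightarrow> D) (at x)"
    unfolding tendsto_norm_zero_iff by (rule LIM_zero_iff)
  finally show ?thesis .
qed

text \<open>Differentiation under the integral by dominated convergence: the difference quotients of
  the character are bounded by |x|, so |x g| is a majorant.\<close>

lemma fourier_integral_deriv:
  fixes g :: "real \<Rightarrow> complex"
  assumes g: "integrable lborel g" and xg: "integrable lborel (\<lambda>x. x *\<^sub>R g x)"
  shows "((\<lambda>\<xi>. \<integral>x. g x * cis (- \<xi> * x) \<partial>lborel) has_vector_derivative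
    - \<i> * (\<integral>x. (x *\<^sub>R g x) * cis (- \<xi> * x) \<partial>lborel)) (at \<xi>)"
proof -
  let ?\<Phi> = "\<lambda>\<xi>. \<integral>x. g x * cis (- \<xi> * x) \<partial>lborel"
  have [measurable]: "g \<in> borel_measurable borel"
    using g by simp
  have int: "integrable lborel (\<lambda>x. g x * cis (- \<xi> * x))" for \<xi>
    by (rule Bochner_Integration.integrable_bound[OF g]) (auto simp: norm_mult cis_conv_exp)
  have "((\<lambda>\<eta>. (?\<Phi> \<eta> - ?\<Phi> \<xi>) /\<^sub>R (\<eta> - \<xi>)) \<longlongrightarrow> - \<i> * (\<integral>x. (x *\<^sub>R g x) * cis (- \<xi> * x) \<partial>lborel)) (at \<xi>)"
    unfolding tendsto_at_iff_sequentially
  proof (intro allI impI)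
    fix X :: "nat \<Rightarrow> real" assume X: "\<forall>i. X i \<in> UNIV - {\<xi>}" "X \<longlonglongrightarrow> \<xi>"
    then have Xn: "X i \<noteq> \<xi>" for i by auto
    define h where "h i x = g x * ((cis (- X i * x) - cis (- \<xi> * x)) /\<^sub>R (X i - \<xi>))" for i x
    have "(\<lambda>i. \<integral>x. h i x \<partial>lborel) \<longlonglongrightarrow> (\<integral>x. g x * (- \<i> * x * cis (- \<xi> * x)) \<partial>lborel)"
    proof (rule integral_dominated_convergence)
      show "integrable lborel (\<lambda>x. norm (x *\<^sub>R g x))"
        using xg by (rule integrable_norm)
      show "AE x in lborel. (\<lambda>i. h i x) \<longlonglongrightarrow> g x * (- \<i> * x * cis (- \<xi> * x))"
      proof (rule AE_I2)
        fix x
        have "((\<lambda>\<eta>. cis (- \<eta> * x)) has_vector_derivative - \<i> * x * cis (- \<xi> * x)) (at \<xi>)"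
          using has_vector_derivative_cis[of "- x" \<xi>] by (simp add: mult.commute)
        then have "((\<lambda>\<eta>. (cis (- \<eta> * x) - cis (- \<xi> * x)) /\<^sub>R (\<eta> - \<xi>)) \<longlongrightarrow> - \<i> * x * cis (- \<xi> * x)) (at \<xi>)"
          unfolding has_vector_derivative_iff_quotient .
        then have "(\<lambda>i. (cis (- X i * x) - cis (- \<xi> * x)) /\<^sub>R (X i - \<xi>)) \<longlonglongrightarrow> - \<i> * x * cis (- \<xi> * x)"
          unfolding tendsto_at_iff_sequentially using X by (auto simp: o_def)
        then show "(\<lambda>i. h i x) \<longlonglongrightarrow> g x * (- \<i> * x * cis (- \<xi> * x))"
          unfolding h_def by (intro tendsto_mult tendsto_const)
      qed
      show "AE x in lborel. norm (h i x) \<le> norm (x *\<^sub>R g x)" for i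
      proof (rule AE_I2)
        fix x
        have "norm (cis (- X i * x) - cis (- \<xi> * x)) \<le> \<bar>X i - \<xi>\<bar> * \<bar>x\<bar>"
          using norm_cis_diff_le[of "- X i * x" "- \<xi> * x"] by (simp add: algebra_simps flip: abs_mult)
        then have "norm ((cis (- X i * x) - cis (- \<xi> * x)) /\<^sub>R (X i - \<xi>)) \<le> \<bar>x\<bar>"
          using Xn[of i] unfolding norm_scaleR abs_inverse
          by (simp add: pos_divide_le_eq mult.commute flip: divide_inverse_commute)
        then have "norm (g x) * norm ((cis (- X i * x) - cis (- \<xi> * x)) /\<^sub>R (X i - \<xi>)) \<le> norm (g x) * \<bar>x\<bar>"
          by (rule mult_left_mono) simp
        then show "norm (h i x) \<le> norm (x *\<^sub>R g x)"
          unfolding h_def norm_mult by (simp add: mult.commute)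
      qed
    qed (auto simp: h_def cis_conv_exp)
    moreover have "(\<integral>x. h i x \<partial>lborel) = (?\<Phi> (X i) - ?\<Phi> \<xi>) /\<^sub>R (X i - \<xi>)" for i
    proof -
      have "(?\<Phi> (X i) - ?\<Phi> \<xi>) /\<^sub>R (X i - \<xi>) = (\<integral>x. (g x * cis (- X i * x) - g x * cis (- \<xi> * x)) /\<^sub>R (X i - \<xi>) \<partial>lborel)"
        using int by simp
      also have "\<dots> = (\<integral>x. h i x \<partial>lborel)"
        by (simp add: h_def right_diff_distrib)
      finally show ?thesis ..
    qed
    moreover have "(\<integral>x. g x * (- \<i> * x * cis (- \<xi> * x)) \<partial>lborel) = - \<i> * (\<integral>x. (x *\<^sub>R g x) * cis (- \<xi> * x) \<partial>lborel)"
      by (subst integral_mult_right_zero[symmetric]) (simp add: scaleR_conv_of_real mult_ac)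
    ultimately show "((\<lambda>\<eta>. (?\<Phi> \<eta> - ?\<Phi> \<xi>) /\<^sub>R (\<eta> - \<xi>)) \<circ> X) \<longlonglongrightarrow> - \<i> * (\<integral>x. (x *\<^sub>R g x) * cis (- \<xi> * x) \<partial>lborel)"
      by (simp add: o_def)
  qed
  then show ?thesis
    unfolding has_vector_derivative_iff_quotient .
qed

lemma fourier_integral_of_deriv:
  fixes g g' :: "real \<Rightarrow> complex"
  assumes "c > 0" "\<And>x. (g has_vector_derivative g' x) (at x)" "continuous_on UNIV g'"
    and "\<And>x. norm (g x) \<le> K * exp (- c * x\<^sup>2)" "\<And>x. norm (g' x) \<le> K' * exp (- c * x\<^sup>2)"
  shows "(\<integral>x. g' x * cis (- \<xi> * x) \<partial>lborel) = \<i> * \<xi> * (\<integral>x. g x * cis (- \<xi> * x) \<partial>lborel)"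
proof -
  have g: "continuous_on UNIV g"
    by (intro continuous_at_imp_continuous_on ballI has_vector_derivative_continuous[OF assms(2)])
  let ?f = "\<lambda>x. g' x * cis (- \<xi> * x) - \<i> * \<xi> * (g x * cis (- \<xi> * x))"
  have E: "integrable lborel (\<lambda>x. h x * cis (- \<xi> * x))" if "continuous_on UNIV h" "\<And>x. norm (h x) \<le> L * exp (- c * x\<^sup>2)" for h L
  proof (rule integrable_gaussian_bound[OF assms(1)])
    show "(\<lambda>x. h x * cis (- \<xi> * x)) \<in> borel_measurable borel"
      using that(1) by (intro borel_measurable_continuous_onI continuous_intros)
    show "norm (h x * cis (- \<xi> * x)) \<le> L * exp (- c * x\<^sup>2)" for x
      using that(2)[of x] by (simp add: norm_mult)
  qed
  note int = E[OF assms(3,5)] E[OF g assms(4)]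
  have "(\<integral>x. ?f x \<partial>lborel) = 0"
  proof (rule integral_deriv_gaussian_bound[OF assms(1), where F = "\<lambda>x. g x * cis (- \<xi> * x)"])
    fix x
    have "((\<lambda>x. cis (- \<xi> * x)) has_vector_derivative - \<i> * \<xi> * cis (- \<xi> * x)) (at x)"
      using has_vector_derivative_cis[of "- \<xi>" x] by simp
    from has_vector_derivative_mult[OF assms(2) this]
    show "((\<lambda>x. g x * cis (- \<xi> * x)) has_vector_derivative ?f x) (at x)"
      by (simp add: algebra_simps)
    show "norm (g x * cis (- \<xi> * x)) \<le> K * exp (- c * x\<^sup>2)"
      using assms(4)[of x] by (simp add: norm_mult)
    show "continuous_on UNIV ?f"
      by (intro continuous_intros assms g)
    show "integrable lborel ?f"
      by (intro Bochner_Integration.integrable_diff integrable_mult_right int)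
  qed
  then show ?thesis
    using int by simp
qed

text \<open>The Fourier transform intertwines raising operators: it turns x into i d/dxi and d/dx
  into i xi, so beta x - d/dx becomes, up to the factor -i beta, the raising operator with parameter
  1/beta. Each step contributes one factor -i; the Gaussian starts the induction.\<close>

lemma psi_fourier:
  assumes "\<beta> > 0"
  shows "(\<integral>x. of_real (psi \<beta> n x) * cis (- \<xi> * x) \<partial>lborel) = (- \<i>) ^ n * of_real (sqrt (2 * pi) * psi (1 / \<beta>) n \<xi>)"
proof (induction n arbitrary: \<xi>)
  case 0
  have "(\<integral>x. of_real (psi \<beta> 0 x) * cis (- \<xi> * x) \<partial>lborel) =
      (\<integral>x. of_real ((\<beta> / pi) powr (1 / 4)) * (of_real (exp (- \<beta> * x\<^sup>2 / 2)) * cis (- \<xi> * x)) \<partial>lborel)"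
    by (intro Bochner_Integration.integral_cong refl) (simp add: psi_def)
  also have "\<dots> = of_real ((\<beta> / pi) powr (1 / 4)) * (\<integral>x. of_real (exp (- \<beta> * x\<^sup>2 / 2)) * cis (- \<xi> * x) \<partial>lborel)"
    by simp
  also have "(\<integral>x. of_real (exp (- \<beta> * x\<^sup>2 / 2)) * cis (- \<xi> * x) \<partial>lborel) =
     of_real (1 / sqrt \<beta>) * (\<integral>y. of_real (exp (- y\<^sup>2 / 2)) * cis (- (\<xi> / sqrt \<beta>) * y) \<partial>lborel)"
    using lborel_integral_real_affine[of "1 / sqrt \<beta>" "\<lambda>x. of_real (exp (- \<beta> * x\<^sup>2 / 2)) * cis (- \<xi> * x)" 0] assms
    by (simp add: power_divide scaleR_conv_of_real)
  \<comment> \<open>After the substitution x = y / sqrt beta the integral is the characteristic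
    function of the standard normal law.\<close>
  also have "(\<integral>y. of_real (exp (- y\<^sup>2 / 2)) * cis (- (\<xi> / sqrt \<beta>) * y) \<partial>lborel) =
     of_real (sqrt (2 * pi)) * char std_normal_distribution (- (\<xi> / sqrt \<beta>))"
  proof -
    have "char std_normal_distribution t = (\<integral>y. of_real (std_normal_density y) * cis (t * y) \<partial>lborel)" for t
      unfolding char_def by (subst integral_density) (auto simp: scaleR_conv_of_real cis_conv_exp normal_density_nonneg mult_ac)
    also have "\<dots> t = (\<integral>y. of_real (1 / sqrt (2 * pi)) * (of_real (exp (- y\<^sup>2 / 2)) * cis (t * y)) \<partial>lborel)" for t
      by (intro Bochner_Integration.integral_cong refl) (simp add: std_normal_density_def)
    finally show ?thesis by simp
  qed
  also have "char std_normal_distribution (- (\<xi> / sqrt \<beta>)) = of_real (exp (- (1 / \<beta>) * \<xi>\<^sup>2 / 2))"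
    using assms by (simp add: char_std_normal_distribution power_divide)
  finally have "(\<integral>x. of_real (psi \<beta> 0 x) * cis (- \<xi> * x) \<partial>lborel) =
      of_real (((\<beta> / pi) powr (1 / 4) / sqrt \<beta>) * (sqrt (2 * pi) * exp (- (1 / \<beta>) * \<xi>\<^sup>2 / 2)))"
    by simp
  \<comment> \<open>The factor beta^(-1/2) from the substitution turns the normalising power
    beta^(1/4) into beta^(-1/4), the one belonging to 1/beta.\<close>
  moreover have "(\<beta> / pi) powr (1 / 4) / sqrt \<beta> = (1 / \<beta> / pi) powr (1 / 4)"
  proof -
    have "sqrt \<beta> = \<beta> powr (1 / 4) * \<beta> powr (1 / 4)"
      using assms by (simp add: powr_half_sqrt flip: powr_add)
    then show ?thesis
      using assms by (simp add: powr_divide powr_mult)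
  qed
  ultimately show ?case
    by (simp add: psi_def)
next
  case (Suc n)
  define G where "G m \<xi> = (- \<i>) ^ m * of_real (sqrt (2 * pi) * psi (1 / \<beta>) m \<xi>)" for m \<xi>
  define q where "q = sqrt (2 * \<beta> * (real n + 1))"
  have q: "q > 0" using assms by (auto simp: q_def)
  let ?E = "\<lambda>g. \<integral>x. of_real (g x) * cis (- \<xi> * x) \<partial>lborel"
  obtain K where K: "\<And>x. \<bar>psi \<beta> n x\<bar> \<le> K * exp (- (\<beta> / 4) * x\<^sup>2)"
    using psi_gaussian_bound[OF assms] by blast
  obtain K' where K': "\<And>x. \<bar>dpsi \<beta> (Suc 0) n x\<bar> \<le> K' * exp (- (\<beta> / 4) * x\<^sup>2)"
    using dpsi_gaussian_bound[OF assms] by blast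
  have c: "\<beta> / 4 > 0" using assms by simp
  have intd: "integrable lborel (\<lambda>x. dpsi \<beta> a m x)" for a m
  proof -
    obtain L where "\<And>x. \<bar>dpsi \<beta> a m x\<bar> \<le> L * exp (- (\<beta> / 4) * x\<^sup>2)"
      using dpsi_gaussian_bound[OF assms] by blast
    then show ?thesis
      by (intro integrable_gaussian_bound[OF c, of _ L]) auto
  qed
  have intx: "integrable lborel (\<lambda>x. x * psi \<beta> n x)"
  proof -
    have "x * psi \<beta> n x = (sqrt (\<beta> * real n / 2) * dpsi \<beta> 0 (n - 1) x + sqrt (\<beta> * (real n + 1) / 2) * dpsi \<beta> 0 (Suc n) x) / \<beta>" for x
      using mult_psi[OF assms, of x n] assms by (simp add: field_simps)
    then show ?thesis
      using intd by (simp only:) (intro integrable_divide Bochner_Integration.integrable_add integrable_mult_right)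
  qed
  have E_int: "integrable lborel (\<lambda>x. of_real (g x) * cis (- \<xi> * x))" if "integrable lborel g" for g
    by (rule Bochner_Integration.integrable_bound[OF that]) (use that in \<open>auto simp: norm_mult cis_conv_exp\<close>)
  have raise: "q * psi \<beta> (Suc n) x = \<beta> * (x * psi \<beta> n x) - dpsi \<beta> (Suc 0) n x" for x
    using DERIV_unique[OF psi_deriv_raise[OF assms, of n x] dpsi_has_derivative[OF assms, of 0 n x, folded psi_eq_dpsi]]
    by (simp add: q_def)
  have "of_real q * ?E (psi \<beta> (Suc n)) = (\<integral>x. of_real q * (of_real (psi \<beta> (Suc n) x) * cis (- \<xi> * x)) \<partial>lborel)"
    by simp
  also have "\<dots> = (\<integral>x. of_real \<beta> * (of_real (x * psi \<beta> n x) * cis (- \<xi> * x)) - of_real (dpsi \<beta> (Suc 0) n x) * cis (- \<xi> * x) \<partial>lborel)"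
  proof (intro Bochner_Integration.integral_cong refl)
    fix x
    have "of_real q * (of_real (psi \<beta> (Suc n) x) * cis (- \<xi> * x)) = of_real (q * psi \<beta> (Suc n) x) * cis (- \<xi> * x)"
      by simp
    then show "of_real q * (of_real (psi \<beta> (Suc n) x) * cis (- \<xi> * x)) =
        of_real \<beta> * (of_real (x * psi \<beta> n x) * cis (- \<xi> * x)) - of_real (dpsi \<beta> (Suc 0) n x) * cis (- \<xi> * x)"
      unfolding raise by (simp add: algebra_simps)
  qed
  also have "\<dots> = of_real \<beta> * ?E (\<lambda>x. x * psi \<beta> n x) - ?E (dpsi \<beta> (Suc 0) n)"
    by (subst Bochner_Integration.integral_diff)
       (intro integrable_mult_right E_int intx intd, intro E_int intd, simp)
  also have "?E (dpsi \<beta> (Suc 0) n) = \<i> * \<xi> * G n \<xi>"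
  proof -
    have "?E (dpsi \<beta> (Suc 0) n) = \<i> * \<xi> * ?E (psi \<beta> n)"
    proof (rule fourier_integral_of_deriv[OF c])
      show "((\<lambda>x. complex_of_real (psi \<beta> n x)) has_vector_derivative of_real (dpsi \<beta> (Suc 0) n x)) (at x)" for x
        using dpsi_has_derivative[OF assms, of 0 n x, folded psi_eq_dpsi]
        by (intro has_vector_derivative_of_real) (simp add: has_real_derivative_iff_has_vector_derivative)
    qed (use K K' assms in \<open>auto intro!: continuous_intros continuous_on_dpsi simp del: dpsi.simps\<close>)
    then show ?thesis unfolding Suc G_def .
  qed
  also have "?E (\<lambda>x. x * psi \<beta> n x) = \<i> * of_real (1 / \<beta> * \<xi> * psi (1 / \<beta>) n \<xi> - q / \<beta> * psi (1 / \<beta>) (Suc n) \<xi>) * ((- \<i>) ^ n * of_real (sqrt (2 * pi)))"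
  proof -
    have "integrable lborel (\<lambda>x. complex_of_real (x * psi \<beta> n x))"
      by (rule integrable_bounded_linear[OF bounded_linear_of_real intx])
    then have "((\<lambda>\<xi>. \<integral>x. of_real (psi \<beta> n x) * cis (- \<xi> * x) \<partial>lborel) has_vector_derivative - \<i> * ?E (\<lambda>x. x * psi \<beta> n x)) (at \<xi>)"
      using fourier_integral_deriv[of "\<lambda>x. of_real (psi \<beta> n x)" \<xi>] intd[of 0 n]
      by (simp add: scaleR_conv_of_real)
    moreover have "((\<lambda>\<xi>. (- \<i>) ^ n * of_real (sqrt (2 * pi) * psi (1 / \<beta>) n \<xi>)) has_vector_derivative
       (- \<i>) ^ n * of_real (sqrt (2 * pi) * (1 / \<beta> * \<xi> * psi (1 / \<beta>) n \<xi> - sqrt (2 * (1 / \<beta>) * (real n + 1)) * psi (1 / \<beta>) (Suc n) \<xi>))) (at \<xi>)"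
      using psi_deriv_raise[of "1 / \<beta>" n \<xi>] assms
      by (intro has_vector_derivative_mult_right has_vector_derivative_of_real)
         (auto simp flip: has_real_derivative_iff_has_vector_derivative intro!: DERIV_cmult)
    ultimately have "- \<i> * ?E (\<lambda>x. x * psi \<beta> n x) =
       (- \<i>) ^ n * of_real (sqrt (2 * pi) * (1 / \<beta> * \<xi> * psi (1 / \<beta>) n \<xi> - sqrt (2 * (1 / \<beta>) * (real n + 1)) * psi (1 / \<beta>) (Suc n) \<xi>))"
      unfolding Suc by (rule vector_derivative_unique_at)
    moreover have "sqrt (2 * (1 / \<beta>) * (real n + 1)) = q / \<beta>"
    proof -
      have "sqrt (2 * (1 / \<beta>) * (real n + 1)) = sqrt (2 * \<beta> * (real n + 1) / \<beta>\<^sup>2)"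
        using assms by (simp add: power2_eq_square field_simps)
      then show ?thesis
        using assms by (simp add: q_def real_sqrt_divide)
    qed
    ultimately have "\<i> * (- \<i> * ?E (\<lambda>x. x * psi \<beta> n x)) = \<i> * ((- \<i>) ^ n * of_real (sqrt (2 * pi) * (1 / \<beta> * \<xi> * psi (1 / \<beta>) n \<xi> - q / \<beta> * psi (1 / \<beta>) (Suc n) \<xi>)))"
      by (simp only:)
    then show ?thesis
      by (simp add: mult_ac)
  qed
  also have "of_real \<beta> * (\<i> * of_real (1 / \<beta> * \<xi> * psi (1 / \<beta>) n \<xi> - q / \<beta> * psi (1 / \<beta>) (Suc n) \<xi>) * ((- \<i>) ^ n * of_real (sqrt (2 * pi)))) - \<i> * \<xi> * G n \<xi> = of_real q * G (Suc n) \<xi>"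
    unfolding G_def using assms by (simp add: field_simps)
  finally have "of_real q * ?E (psi \<beta> (Suc n)) = of_real q * G (Suc n) \<xi>" .
  moreover have "complex_of_real q \<noteq> 0"
    using q by simp
  ultimately show ?case
    unfolding G_def by (simp only: mult_left_cancel not_False_eq_True)
qed

section \<open>Integration on $\mathbf R\times\mathbf T$\<close>

abbreviation strip :: "(real \<times> real) set" where
  "strip \<equiv> UNIV \<times> {0..<2 * pi}"

lemma strip_sets [measurable, simp]: "strip \<in> sets borel"
  by (simp add: borel_Times)

lemma space_RT: "space RT = strip"
  by (simp add: RT_def space_restrict_space)

lemma borel_measurable_RT [measurable (raw)]: "f \<in> borel_measurable borel \<Longrightarrow> f \<in> borel_measurable RT"
  unfolding RT_def by (rule measurable_restrict_space1) simp

lemma AE_RT_iff: "(AE z in RT. P z) \<longleftrightarrow> (AE z in lborel. z \<in> strip \<longrightarrow> P z)"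
  unfolding RT_def by (rule AE_restrict_space_iff) simp

lemma integrable_RT_iff:
  fixes f :: "real \<times> real \<Rightarrow> 'a::{banach, second_countable_topology}"
  shows "integrable RT f \<longleftrightarrow> integrable lborel (\<lambda>z. indicator strip z *\<^sub>R f z)"
  unfolding RT_def by (rule integrable_restrict_space) simp

lemma integral_RT_eq:
  fixes f :: "real \<times> real \<Rightarrow> 'a::{banach, second_countable_topology}"
  shows "(\<integral>z. f z \<partial>RT) = (\<integral>z. indicator strip z *\<^sub>R f z \<partial>lborel)"
  unfolding RT_def by (rule integral_restrict_space) simp

lemma integral_RT_iterated:
  fixes f :: "real \<times> real \<Rightarrow> 'a::{banach, second_countable_topology}"
  assumes "integrable RT f"
  shows "(\<integral>z. f z \<partial>RT) = (\<integral>x. (\<integral>y\<in>{0..<2 * pi}. f (x, y) \<partial>lborel) \<partial>lborel)"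
    and "(\<integral>z. f z \<partial>RT) = (\<integral>y\<in>{0..<2 * pi}. (\<integral>x. f (x, y) \<partial>lborel) \<partial>lborel)"
proof -
  have ind: "indicator strip (x, y) = (indicator {0..<2 * pi} y :: real)" for x y
    by (simp add: indicator_def)
  have int: "integrable (lborel \<Otimes>\<^sub>M lborel) (\<lambda>z. indicator strip z *\<^sub>R f z)"
    using assms by (simp add: integrable_RT_iff lborel_prod)
  show "(\<integral>z. f z \<partial>RT) = (\<integral>x. (\<integral>y\<in>{0..<2 * pi}. f (x, y) \<partial>lborel) \<partial>lborel)"
    using lborel_pair.integral_fst'[OF int]
    by (simp add: integral_RT_eq lborel_prod set_lebesgue_integral_def ind)
  have "(\<integral>z. f z \<partial>RT) = (\<integral>y. (\<integral>x. indicator strip (x, y) *\<^sub>R f (x, y) \<partial>lborel) \<partial>lborel)"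
    using lborel_pair.integral_snd[of "\<lambda>x y. indicator strip (x, y) *\<^sub>R f (x, y)"] int
    by (simp add: integral_RT_eq lborel_prod split_beta')
  then show "(\<integral>z. f z \<partial>RT) = (\<integral>y\<in>{0..<2 * pi}. (\<integral>x. f (x, y) \<partial>lborel) \<partial>lborel)"
    by (simp add: ind set_lebesgue_integral_def)
qed

lemma integrable_RT_fst:
  fixes h :: "real \<Rightarrow> real"
  assumes "integrable lborel h"
  shows "integrable RT (\<lambda>z. h (fst z))"
proof -
  have [measurable]: "h \<in> borel_measurable borel"
    using assms by auto
  have "integrable (lborel \<Otimes>\<^sub>M lborel) (\<lambda>z. h (fst z) * indicator {0..<2 * pi} (snd z) :: real)"
  proof (rule lborel_pair.Fubini_integrable)
    have "(\<integral>y. norm (h x * indicator {0..<2 * pi} y) \<partial>lborel) = 2 * pi * \<bar>h x\<bar>" for x :: real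
      by (simp add: abs_mult)
    then show "integrable lborel (\<lambda>x. \<integral>y. norm (h (fst (x, y)) * indicator {0..<2 * pi} (snd (x, y :: real)) :: real) \<partial>lborel)"
      using assms by simp
    show "AE x in lborel. integrable lborel (\<lambda>y. h (fst (x, y)) * indicator {0..<2 * pi} (snd (x, y :: real)) :: real)"
      by (intro AE_I2) auto
  qed measurable
  moreover have "indicator strip z *\<^sub>R h (fst z) = h (fst z) * indicator {0..<2 * pi} (snd z)" for z :: "real \<times> real"
    by (auto simp: indicator_def mem_Times_iff)
  ultimately show ?thesis
    unfolding integrable_RT_iff by (simp only: lborel_prod)
qed

lemma integrable_RT_exp: "c > 0 \<Longrightarrow> integrable RT (\<lambda>z. exp (- c * (fst z)\<^sup>2))"
  by (rule integrable_RT_fst[OF exp_neg_square_integrable])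

lemma integrable_RT_gaussian_bound:
  fixes f :: "real \<times> real \<Rightarrow> 'a::{banach, second_countable_topology}"
  assumes "c > 0" "f \<in> borel_measurable borel" "\<And>z. norm (f z) \<le> K * exp (- c * (fst z)\<^sup>2)"
  shows "integrable RT f"
proof (rule Bochner_Integration.integrable_bound)
  show "integrable RT (\<lambda>z. K * exp (- c * (fst z)\<^sup>2))"
    by (intro integrable_mult_right integrable_RT_exp assms)
  show "AE z in RT. norm (f z) \<le> norm (K * exp (- c * (fst z)\<^sup>2))"
    using assms(3) by (intro AE_I2) (use order_trans[OF _ abs_ge_self] in fastforce)
qed (use assms in measurable)

text \<open>A class that is stable under multiplication by bounded continuous functions and in which
  every integration by parts is legitimate. The rate c is an explicit parameter so that sums stay in
  the class.\<close>

definition gaussian_field :: "real \<Rightarrow> (real \<times> real \<Rightarrow> 'a::real_normed_vector) \<Rightarrow> bool" where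
  "gaussian_field c f \<longleftrightarrow> continuous_on UNIV f \<and> (\<exists>K. \<forall>z. norm (f z) \<le> K * exp (- c * (fst z)\<^sup>2))"

lemma gaussian_field_integrable:
  fixes f :: "real \<times> real \<Rightarrow> 'a::{banach, second_countable_topology}"
  assumes "gaussian_field c f" "c > 0"
  shows "integrable RT f"
proof -
  obtain K where "\<And>z. norm (f z) \<le> K * exp (- c * (fst z)\<^sup>2)"
    using assms(1) unfolding gaussian_field_def by blast
  then show ?thesis
    using assms by (intro integrable_RT_gaussian_bound[OF assms(2), of _ K] borel_measurable_continuous_onI)
      (auto simp: gaussian_field_def)
qed

lemma integral_RT_deriv1:
  fixes f f1 :: "real \<times> real \<Rightarrow> 'a::euclidean_space"
  assumes c: "c > 0" and f: "gaussian_field c f" "gaussian_field c f1"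
    and d: "\<And>x y. ((\<lambda>x. f (x, y)) has_vector_derivative f1 (x, y)) (at x)"
  shows "(\<integral>z. f1 z \<partial>RT) = 0"
proof -
  obtain K K1 where K: "\<And>z. norm (f z) \<le> K * exp (- c * (fst z)\<^sup>2)" "\<And>z. norm (f1 z) \<le> K1 * exp (- c * (fst z)\<^sup>2)"
    using f unfolding gaussian_field_def by blast
  have cont: "continuous_on UNIV (\<lambda>x. f1 (x, y))" for y
    using f(2) by (auto simp: gaussian_field_def intro!: continuous_on_compose2[of UNIV f1] continuous_intros)
  have "(\<integral>x. f1 (x, y) \<partial>lborel) = 0" for y
  proof (rule integral_deriv_gaussian_bound[OF c d cont])
    show "integrable lborel (\<lambda>x. f1 (x, y))"
      using K(2)[of "(_, y)"] by (intro integrable_gaussian_bound[OF c, of _ K1] borel_measurable_continuous_onI cont) auto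
    show "norm (f (x, y)) \<le> K * exp (- c * x\<^sup>2)" for x
      using K(1)[of "(x, y)"] by simp
  qed
  then show ?thesis
    unfolding integral_RT_iterated(2)[OF gaussian_field_integrable[OF f(2) c]] by simp
qed

text \<open>In the second variable periodicity takes the place of decay: the two boundary values
  agree.\<close>

lemma integral_RT_deriv2:
  fixes f f2 :: "real \<times> real \<Rightarrow> 'a::euclidean_space"
  assumes c: "c > 0" and f: "periodic_snd f" "gaussian_field c f2"
    and d: "\<And>x y. ((\<lambda>y. f (x, y)) has_vector_derivative f2 (x, y)) (at y)"
  shows "(\<integral>z. f2 z \<partial>RT) = 0"
proof -
  have "(\<integral>y\<in>{0..<2 * pi}. f2 (x, y) \<partial>lborel) = 0" for x
  proof -
    have cont: "continuous_on A (\<lambda>y. f2 (x, y))" for A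
      using f(2) by (auto simp: gaussian_field_def intro!: continuous_on_compose2[of UNIV f2] continuous_intros)
    have [measurable]: "(\<lambda>y. f2 (x, y)) \<in> borel_measurable borel"
      by (intro borel_measurable_continuous_onI cont)
    \<comment> \<open>The fundamental domain is half-open, the fundamental theorem of calculus wants
      a closed interval; they differ by a null point.\<close>
    have "(\<integral>y\<in>{0..<2 * pi}. f2 (x, y) \<partial>lborel) = (\<integral>y. indicator {0..2 * pi} y *\<^sub>R f2 (x, y) \<partial>lborel)"
      unfolding set_lebesgue_integral_def
    proof (rule integral_cong_AE)
      show "AE y in lborel. indicator {0..<2 * pi} y *\<^sub>R f2 (x, y) = indicator {0..2 * pi} y *\<^sub>R f2 (x, y)"
        using AE_lborel_singleton[of "2 * pi"] by eventually_elim (auto simp: indicator_def)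
    qed measurable
    also have "\<dots> = f (x, 2 * pi) - f (x, 0)"
      by (rule integral_FTC_Icc[OF _ _ cont]) (auto intro: has_vector_derivative_at_within d)
    also have "\<dots> = 0"
      using f(1)[unfolded periodic_snd_def, rule_format, of x 0] by simp
    finally show ?thesis .
  qed
  then show ?thesis
    unfolding integral_RT_iterated(1)[OF gaussian_field_integrable[OF f(2) c]] by simp
qed

lemma gaussian_field_scaleR:
  fixes f :: "real \<times> real \<Rightarrow> 'a::real_normed_vector"
  assumes "continuous_on UNIV g" "bounded (range g)" "gaussian_field c f"
  shows "gaussian_field c (\<lambda>z. g z *\<^sub>R f z)"
proof -
  obtain B where B: "B > 0" "\<And>z. \<bar>g z\<bar> \<le> B"
    using assms(2) by (auto simp: bounded_pos)
  obtain K where K: "\<And>z. norm (f z) \<le> K * exp (- c * (fst z)\<^sup>2)"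
    using assms(3) unfolding gaussian_field_def by blast
  have "norm (g z *\<^sub>R f z) \<le> (B * K) * exp (- c * (fst z)\<^sup>2)" for z
    using mult_mono[OF B(2) K, of z z] B by simp
  then show ?thesis
    using assms unfolding gaussian_field_def by (blast intro: continuous_intros)
qed

lemma gaussian_field_add:
  assumes "gaussian_field c f" "gaussian_field c g"
  shows "gaussian_field c (\<lambda>z. f z + g z)"
proof -
  obtain K L where K: "\<And>z. norm (f z) \<le> K * exp (- c * (fst z)\<^sup>2)" "\<And>z. norm (g z) \<le> L * exp (- c * (fst z)\<^sup>2)"
    using assms unfolding gaussian_field_def by blast
  have "norm (f z + g z) \<le> (K + L) * exp (- c * (fst z)\<^sup>2)" for z
    using norm_triangle_le[OF add_mono[OF K(1)[of z] K(2)[of z]]] by (simp add: algebra_simps)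
  then show ?thesis
    using assms unfolding gaussian_field_def by (blast intro: continuous_intros)
qed

text \<open>In \<open>pd\<close> the derivatives in the second variable are applied first, so one
  more of them is directly available only when a = 0. Integrations by parts therefore have to remove
  the first-variable derivatives before the others.\<close>

lemma schwartz_RT_pd:
  assumes "\<phi> \<in> schwartz_RT"
  shows "continuous_on UNIV (pd a b \<phi>)" and "bounded (range (pd a b \<phi>))"
    and "((\<lambda>t. pd a b \<phi> (t, y)) has_real_derivative pd (Suc a) b \<phi> (x, y)) (at x)"
    and "((\<lambda>t. pd 0 b \<phi> (x, t)) has_real_derivative pd 0 (Suc b) \<phi> (x, y)) (at y)"
    and "periodic_snd (pd 0 b \<phi>)"
proof -
  have diff: "pd a b \<phi> differentiable (at z)" for a b z
    using assms unfolding schwartz_RT_def differentiable_on_def by blast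
  show "continuous_on UNIV (pd a b \<phi>)"
    by (meson diff continuous_at_imp_continuous_on differentiable_imp_continuous_within)
  have "bounded (range (\<lambda>x. fst x ^ 0 * pd a b \<phi> x))"
    using assms unfolding schwartz_RT_def by blast
  then show "bounded (range (pd a b \<phi>))"
    by simp
  have "(\<lambda>t. pd a b \<phi> (t, y)) differentiable (at x)"
    using differentiable_chain_at[of "\<lambda>t. (t, y)" x "pd a b \<phi>"] diff by (auto simp: o_def)
  then have "((\<lambda>t. pd a b \<phi> (t, y)) has_real_derivative deriv (\<lambda>t. pd a b \<phi> (t, y)) x) (at x)"
    by (simp add: DERIV_deriv_iff_real_differentiable)
  then show "((\<lambda>t. pd a b \<phi> (t, y)) has_real_derivative pd (Suc a) b \<phi> (x, y)) (at x)"
    by (simp add: pd_def pd1_def)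
  have "(\<lambda>t. pd 0 b \<phi> (x, t)) differentiable (at y)" for b x y
    using differentiable_chain_at[of "\<lambda>t. (x, t)" y "pd 0 b \<phi>"] diff by (auto simp: o_def)
  then have d2: "((\<lambda>t. pd 0 b \<phi> (x, t)) has_real_derivative pd 0 (Suc b) \<phi> (x, y)) (at y)" for b x y
    by (simp add: pd_def pd2_def DERIV_deriv_iff_real_differentiable)
  show "((\<lambda>t. pd 0 b \<phi> (x, t)) has_real_derivative pd 0 (Suc b) \<phi> (x, y)) (at y)"
    by (rule d2)
  show "periodic_snd (pd 0 b \<phi>)"
  proof (induction b)
    case 0
    then show ?case using assms by (simp add: pd_def schwartz_RT_def)
  next
    case (Suc b)
    show ?case
      unfolding periodic_snd_def
    proof (intro allI)
      fix x y
      have "((\<lambda>t. pd 0 b \<phi> (x, t + 2 * pi)) has_real_derivative pd 0 (Suc b) \<phi> (x, y + 2 * pi)) (at y)"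
        using d2[of b x "y + 2 * pi"] by (simp add: DERIV_shift)
      moreover have "(\<lambda>t. pd 0 b \<phi> (x, t + 2 * pi)) = (\<lambda>t. pd 0 b \<phi> (x, t))"
        using Suc by (simp add: periodic_snd_def)
      ultimately show "pd 0 (Suc b) \<phi> (x, y + 2 * pi) = pd 0 (Suc b) \<phi> (x, y)"
        using d2[of b x y] DERIV_unique by metis
    qed
  qed
qed

section \<open>Integration by parts against test functions\<close>

lemma pd_zero [simp]: "pd 0 0 \<phi> = \<phi>"
  by (simp add: pd_def)

lemma test_integral_by_parts1:
  fixes f f1 :: "real \<times> real \<Rightarrow> 'a::euclidean_space"
  assumes c: "c > 0" and \<phi>: "\<phi> \<in> schwartz_RT" and f: "gaussian_field c f" "gaussian_field c f1"
    and d: "\<And>x y. ((\<lambda>x. f (x, y)) has_vector_derivative f1 (x, y)) (at x)"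
  shows "(\<integral>z. pd (Suc a) b \<phi> z *\<^sub>R f z \<partial>RT) = - (\<integral>z. pd a b \<phi> z *\<^sub>R f1 z \<partial>RT)"
proof -
  note s = schwartz_RT_pd[OF \<phi>]
  have g: "gaussian_field c (\<lambda>z. pd (Suc a) b \<phi> z *\<^sub>R f z)" "gaussian_field c (\<lambda>z. pd a b \<phi> z *\<^sub>R f1 z)"
    "gaussian_field c (\<lambda>z. pd a b \<phi> z *\<^sub>R f z)"
    by (intro gaussian_field_scaleR s f)+
  have "(\<integral>z. pd a b \<phi> z *\<^sub>R f1 z + pd (Suc a) b \<phi> z *\<^sub>R f z \<partial>RT) = 0"
    by (rule integral_RT_deriv1[OF c g(3) gaussian_field_add[OF g(2,1)]])
       (rule has_vector_derivative_scaleR[OF s(3) d])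
  then show ?thesis
    using g[THEN gaussian_field_integrable[OF _ c]] by (simp add: add_eq_0_iff)
qed

lemma test_integral_by_parts2:
  fixes f f2 :: "real \<times> real \<Rightarrow> 'a::euclidean_space"
  assumes c: "c > 0" and \<phi>: "\<phi> \<in> schwartz_RT" and f: "periodic_snd f" "gaussian_field c f" "gaussian_field c f2"
    and d: "\<And>x y. ((\<lambda>y. f (x, y)) has_vector_derivative f2 (x, y)) (at y)"
  shows "(\<integral>z. pd 0 (Suc b) \<phi> z *\<^sub>R f z \<partial>RT) = - (\<integral>z. pd 0 b \<phi> z *\<^sub>R f2 z \<partial>RT)"
proof -
  note s = schwartz_RT_pd[OF \<phi>]
  have g: "gaussian_field c (\<lambda>z. pd 0 (Suc b) \<phi> z *\<^sub>R f z)" "gaussian_field c (\<lambda>z. pd 0 b \<phi> z *\<^sub>R f2 z)"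
    by (intro gaussian_field_scaleR s f)+
  have "periodic_snd (\<lambda>z. pd 0 b \<phi> z *\<^sub>R f z)"
    using f(1) s(5)[of b] by (simp add: periodic_snd_def)
  then have "(\<integral>z. pd 0 b \<phi> z *\<^sub>R f2 z + pd 0 (Suc b) \<phi> z *\<^sub>R f z \<partial>RT) = 0"
    by (rule integral_RT_deriv2[OF c _ gaussian_field_add[OF g(2,1)]])
       (rule has_vector_derivative_scaleR[OF s(4) d])
  then show ?thesis
    using g[THEN gaussian_field_integrable[OF _ c]] by (simp add: add_eq_0_iff)
qed

section \<open>Density of Hermite functions times characters\<close>

text \<open>Unlike \<open>L2\<close> it admits every codomain and does not ask for periodicity, so
  that it covers the components of a field and the non-periodic intermediate approximants.\<close>

definition square_integrable :: "(real \<times> real \<Rightarrow> 'a::{real_normed_vector}) \<Rightarrow> bool" where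
  "square_integrable f \<longleftrightarrow> f \<in> borel_measurable borel \<and> integrable RT (\<lambda>z. (norm (f z))\<^sup>2)"

lemma norm_add_square_le: "(norm (a + b))\<^sup>2 \<le> 2 * ((norm a)\<^sup>2 + (norm b)\<^sup>2)"
proof -
  have "(norm (a + b))\<^sup>2 \<le> (norm a + norm b)\<^sup>2"
    by (intro power_mono norm_triangle_ineq) simp
  also have "\<dots> \<le> 2 * ((norm a)\<^sup>2 + (norm b)\<^sup>2)"
    by (rule square_sum_le)
  finally show ?thesis .
qed

lemma square_integrable_add:
  fixes f g :: "real \<times> real \<Rightarrow> 'a::{real_normed_vector, second_countable_topology}"
  assumes "square_integrable f" "square_integrable g"
  shows "square_integrable (\<lambda>z. f z + g z)"
proof -
  have [measurable]: "f \<in> borel_measurable borel" "g \<in> borel_measurable borel"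
    using assms by (auto simp: square_integrable_def)
  have "integrable RT (\<lambda>z. (norm (f z + g z))\<^sup>2)"
  proof (rule Bochner_Integration.integrable_bound)
    show "integrable RT (\<lambda>z. 2 * ((norm (f z))\<^sup>2 + (norm (g z))\<^sup>2))"
      using assms by (auto simp: square_integrable_def)
    show "AE z in RT. norm ((norm (f z + g z))\<^sup>2) \<le> norm (2 * ((norm (f z))\<^sup>2 + (norm (g z))\<^sup>2))"
      using norm_add_square_le by (intro AE_I2) simp
  qed measurable
  then show ?thesis
    by (simp add: square_integrable_def)
qed

lemma square_integrable_bound:
  assumes "f \<in> borel_measurable borel" "integrable RT (\<lambda>z. (w z)\<^sup>2)" "\<And>z. z \<in> strip \<Longrightarrow> norm (f z) \<le> w z"
  shows "square_integrable f"
proof -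
  have [measurable]: "f \<in> borel_measurable borel"
    by (rule assms)
  have "integrable RT (\<lambda>z. (norm (f z))\<^sup>2)"
    by (rule Bochner_Integration.integrable_bound[OF assms(2)])
       (use assms(3) in \<open>auto intro!: AE_I2 power_mono simp: space_RT\<close>)
  then show ?thesis
    using assms(1) by (simp add: square_integrable_def)
qed

lemma square_integrable_mult:
  fixes u :: "real \<times> real \<Rightarrow> complex"
  assumes "square_integrable u"
  shows "square_integrable (\<lambda>z. c * u z)"
  using assms unfolding square_integrable_def by (auto simp: norm_mult power_mult_distrib)

lemma square_integrable_gaussian_bound:
  fixes f :: "real \<times> real \<Rightarrow> 'a::{banach, second_countable_topology}"
  assumes "c > 0" "f \<in> borel_measurable borel" "\<And>z. norm (f z) \<le> K * exp (- c * (fst z)\<^sup>2)"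
  shows "square_integrable f"
proof (rule square_integrable_bound[OF assms(2) _ assms(3)])
  have "(K * exp (- c * (fst z)\<^sup>2))\<^sup>2 = K\<^sup>2 * exp (- (2 * c) * (fst z)\<^sup>2)" for z :: "real \<times> real"
    by (simp add: power_mult_distrib flip: exp_of_nat_mult)
  then show "integrable RT (\<lambda>z. (K * exp (- c * (fst z)\<^sup>2))\<^sup>2)"
    using integrable_RT_exp[of "2 * c"] assms(1) by simp
qed

definition hermite_exp :: "real \<Rightarrow> nat \<Rightarrow> int \<Rightarrow> real \<times> real \<Rightarrow> complex" where
  "hermite_exp \<beta> m k = (\<lambda>(x, y). of_real (psi \<beta> m x) * cis (of_int k * y))"

lemma hermite_exp_measurable [measurable]: "hermite_exp \<beta> m k \<in> borel_measurable borel"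
proof -
  have 1: "(\<lambda>z :: real \<times> real. cis (of_int k * snd z)) \<in> borel_measurable borel"
    by (intro borel_measurable_continuous_onI continuous_intros)
  have "(fst :: real \<times> real \<Rightarrow> real) \<in> borel_measurable borel"
    by (intro borel_measurable_continuous_onI continuous_intros)
  then have "(\<lambda>z :: real \<times> real. psi \<beta> m (fst z)) \<in> borel_measurable borel"
    by (rule measurable_compose) simp
  then have 2: "(\<lambda>z :: real \<times> real. complex_of_real (psi \<beta> m (fst z))) \<in> borel_measurable borel"
    by (rule measurable_compose) (intro borel_measurable_continuous_onI continuous_intros)
  show ?thesis
    unfolding hermite_exp_def split_beta' by (intro borel_measurable_times 1 2)
qed

lemma square_integrable_hermite_exp:
  assumes "\<beta> > 0"
  shows "square_integrable (hermite_exp \<beta> m k)"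
proof -
  obtain K where "\<And>x. \<bar>psi \<beta> m x\<bar> \<le> K * exp (- (\<beta> / 4) * x\<^sup>2)"
    using psi_gaussian_bound[OF assms] by blast
  then show ?thesis
    using assms by (intro square_integrable_gaussian_bound[of "\<beta> / 4" _ K] hermite_exp_measurable)
      (auto simp: hermite_exp_def norm_mult)
qed

inductive_set hermite_span :: "real \<Rightarrow> (real \<times> real \<Rightarrow> complex) set" for \<beta> where
  hermite_span_base: "hermite_exp \<beta> m k \<in> hermite_span \<beta>"
| hermite_span_add: "u \<in> hermite_span \<beta> \<Longrightarrow> v \<in> hermite_span \<beta> \<Longrightarrow> (\<lambda>z. u z + v z) \<in> hermite_span \<beta>"
| hermite_span_mult: "u \<in> hermite_span \<beta> \<Longrightarrow> (\<lambda>z. c * u z) \<in> hermite_span \<beta>"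

lemma square_integrable_hermite_span:
  assumes "\<beta> > 0" "u \<in> hermite_span \<beta>"
  shows "square_integrable u"
  using assms(2)
  by induction (auto intro: square_integrable_hermite_exp square_integrable_add square_integrable_mult assms(1))

text \<open>A consequence of the recursion \<open>mult_psi\<close>. Starting from the Gaussian, the
  span thus contains every monomial in x_1 times the Gaussian times a character in x_2.\<close>

lemma hermite_span_mult_fst:
  assumes "\<beta> > 0" "u \<in> hermite_span \<beta>"
  shows "(\<lambda>z. of_real (fst z) * u z) \<in> hermite_span \<beta>"
  using assms(2)
proof induction
  case (hermite_span_base m k)
  have "(\<lambda>z. of_real (fst z) * hermite_exp \<beta> m k z) = (\<lambda>z. of_real (sqrt (\<beta> * real m / 2) / \<beta>) * hermite_exp \<beta> (m - 1) k z
      + of_real (sqrt (\<beta> * (real m + 1) / 2) / \<beta>) * hermite_exp \<beta> (Suc m) k z)"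
  proof
    fix z :: "real \<times> real"
    have "fst z * psi \<beta> m (fst z) = sqrt (\<beta> * real m / 2) / \<beta> * psi \<beta> (m - 1) (fst z) + sqrt (\<beta> * (real m + 1) / 2) / \<beta> * psi \<beta> (Suc m) (fst z)"
      using mult_psi[OF assms(1), of "fst z" m] assms(1) by (simp add: field_simps)
    from arg_cong[OF this, of "\<lambda>t. of_real t * cis (of_int k * snd z)"]
    show "of_real (fst z) * hermite_exp \<beta> m k z = of_real (sqrt (\<beta> * real m / 2) / \<beta>) * hermite_exp \<beta> (m - 1) k z
      + of_real (sqrt (\<beta> * (real m + 1) / 2) / \<beta>) * hermite_exp \<beta> (Suc m) k z"
      by (simp add: hermite_exp_def split_beta' distrib_right mult.assoc)
  qed
  then show ?case
    by (simp only:) (intro hermite_span.intros)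
next
  case (hermite_span_add u v)
  then show ?case
    by (simp only: distrib_left) (rule hermite_span.intros)
next
  case (hermite_span_mult u c)
  then show ?case
    by (simp only: mult.left_commute) (rule hermite_span.intros)
qed

definition hermite_approx :: "real \<Rightarrow> (real \<times> real \<Rightarrow> complex) \<Rightarrow> bool" where
  "hermite_approx \<beta> u \<longleftrightarrow> square_integrable u \<and>
     (\<forall>\<epsilon>>0. \<exists>g\<in>hermite_span \<beta>. (\<integral>z. (norm (u z - g z))\<^sup>2 \<partial>RT) < \<epsilon>)"

lemma hermite_approx_span: "\<beta> > 0 \<Longrightarrow> u \<in> hermite_span \<beta> \<Longrightarrow> hermite_approx \<beta> u"
  unfolding hermite_approx_def by (auto intro!: square_integrable_hermite_span bexI[of _ u])

lemma integral_norm_add_square_le: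
  fixes f g :: "real \<times> real \<Rightarrow> 'a::{real_normed_vector, second_countable_topology}"
  assumes "square_integrable f" "square_integrable g"
  shows "(\<integral>z. (norm (f z + g z))\<^sup>2 \<partial>RT) \<le> 2 * ((\<integral>z. (norm (f z))\<^sup>2 \<partial>RT) + (\<integral>z. (norm (g z))\<^sup>2 \<partial>RT))"
proof -
  have i: "integrable RT (\<lambda>z. (norm (f z))\<^sup>2)" "integrable RT (\<lambda>z. (norm (g z))\<^sup>2)"
    using assms by (auto simp: square_integrable_def)
  have "(\<integral>z. (norm (f z + g z))\<^sup>2 \<partial>RT) \<le> (\<integral>z. 2 * ((norm (f z))\<^sup>2 + (norm (g z))\<^sup>2) \<partial>RT)"
    using square_integrable_add[OF assms] i
    by (intro integral_mono norm_add_square_le integrable_mult_right Bochner_Integration.integrable_add)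
       (auto simp: square_integrable_def)
  also have "\<dots> = 2 * ((\<integral>z. (norm (f z))\<^sup>2 \<partial>RT) + (\<integral>z. (norm (g z))\<^sup>2 \<partial>RT))"
    using i by simp
  finally show ?thesis .
qed

lemma square_integrable_diff:
  fixes f g :: "real \<times> real \<Rightarrow> 'a::{real_normed_vector, second_countable_topology}"
  assumes "square_integrable f" "square_integrable g"
  shows "square_integrable (\<lambda>z. f z - g z)"
proof -
  have "square_integrable (\<lambda>z. - g z)"
    using assms(2) by (auto simp: square_integrable_def)
  from square_integrable_add[OF assms(1) this] show ?thesis
    by simp
qed

lemma hermite_approx_add:
  assumes "\<beta> > 0" "hermite_approx \<beta> u" "hermite_approx \<beta> v"
  shows "hermite_approx \<beta> (\<lambda>z. u z + v z)"
  unfolding hermite_approx_def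
proof (intro conjI allI impI)
  show "square_integrable (\<lambda>z. u z + v z)"
    using assms by (intro square_integrable_add) (auto simp: hermite_approx_def)
  fix \<epsilon> :: real assume "\<epsilon> > 0"
  then have "\<epsilon> / 4 > 0" by simp
  then obtain g h where gh: "g \<in> hermite_span \<beta>" "h \<in> hermite_span \<beta>"
    "(\<integral>z. (norm (u z - g z))\<^sup>2 \<partial>RT) < \<epsilon> / 4" "(\<integral>z. (norm (v z - h z))\<^sup>2 \<partial>RT) < \<epsilon> / 4"
    using assms unfolding hermite_approx_def by meson
  have "(\<integral>z. (norm ((u z - g z) + (v z - h z)))\<^sup>2 \<partial>RT) \<le>
      2 * ((\<integral>z. (norm (u z - g z))\<^sup>2 \<partial>RT) + (\<integral>z. (norm (v z - h z))\<^sup>2 \<partial>RT))"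
    using assms gh by (intro integral_norm_add_square_le square_integrable_diff)
      (auto simp: hermite_approx_def intro: square_integrable_hermite_span)
  also have "\<dots> < \<epsilon>" using gh(3,4) by simp
  finally show "\<exists>g\<in>hermite_span \<beta>. (\<integral>z. (norm (u z + v z - g z))\<^sup>2 \<partial>RT) < \<epsilon>"
    by (intro bexI[OF _ hermite_span_add[OF gh(1,2)]]) (simp add: algebra_simps)
qed

lemma hermite_approx_mult:
  assumes "hermite_approx \<beta> u"
  shows "hermite_approx \<beta> (\<lambda>z. c * u z)"
  unfolding hermite_approx_def
proof (intro conjI allI impI)
  show "square_integrable (\<lambda>z. c * u z)"
    using assms by (intro square_integrable_mult) (auto simp: hermite_approx_def)
  fix \<epsilon> :: real assume e: "\<epsilon> > 0"
  have c: "(norm c)\<^sup>2 + 1 > 0" by (simp add: add_nonneg_pos)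
  then have "\<epsilon> / ((norm c)\<^sup>2 + 1) > 0" using e by simp
  then obtain g where g: "g \<in> hermite_span \<beta>" "(\<integral>z. (norm (u z - g z))\<^sup>2 \<partial>RT) < \<epsilon> / ((norm c)\<^sup>2 + 1)"
    using assms unfolding hermite_approx_def by meson
  have "(\<integral>z. (norm (c * u z - c * g z))\<^sup>2 \<partial>RT) = (norm c)\<^sup>2 * (\<integral>z. (norm (u z - g z))\<^sup>2 \<partial>RT)"
    by (simp add: norm_mult power_mult_distrib flip: right_diff_distrib)
  also have "\<dots> \<le> ((norm c)\<^sup>2 + 1) * (\<integral>z. (norm (u z - g z))\<^sup>2 \<partial>RT)"
    by (intro mult_right_mono) auto
  also have "\<dots> < \<epsilon>"
    using g(2) c by (simp add: pos_less_divide_eq mult.commute)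
  finally show "\<exists>g\<in>hermite_span \<beta>. (\<integral>z. (norm (c * u z - g z))\<^sup>2 \<partial>RT) < \<epsilon>"
    by (intro bexI[OF _ hermite_span_mult[OF g(1)]])
qed

text \<open>The closed span is stable under dominated almost everywhere convergence. This one
  closure property carries every extension below: Taylor series, Stone--Weierstrass, growing
  periods, measurable functions and truncation.\<close>

lemma hermite_approx_limit:
  fixes u :: "nat \<Rightarrow> real \<times> real \<Rightarrow> complex"
  assumes "\<beta> > 0" and u: "\<And>i. hermite_approx \<beta> (u i)" and lim: "AE z in RT. (\<lambda>i. u i z) \<longlonglongrightarrow> v z"
    and w: "integrable RT (\<lambda>z. (w z)\<^sup>2)" "\<And>i z. z \<in> strip \<Longrightarrow> norm (u i z) \<le> w z"
    and v: "v \<in> borel_measurable borel"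
  shows "hermite_approx \<beta> v"
proof -
  have [measurable]: "u i \<in> borel_measurable borel" "v \<in> borel_measurable borel" for i
    using u v by (auto simp: hermite_approx_def square_integrable_def)
  have vw: "AE z in RT. norm (v z) \<le> w z"
    using lim AE_space
  proof eventually_elim
    case (elim z)
    show ?case
      by (rule LIMSEQ_le_const2[OF tendsto_norm[OF elim(1)]]) (use w(2) elim(2) in \<open>auto simp: space_RT\<close>)
  qed
  have "integrable RT (\<lambda>z. (norm (v z))\<^sup>2)"
  proof (rule Bochner_Integration.integrable_bound[OF w(1)])
    show "AE z in RT. norm ((norm (v z))\<^sup>2) \<le> norm ((w z)\<^sup>2)"
      using vw by eventually_elim (simp add: power_mono)
  qed measurable
  then have sv: "square_integrable v"
    by (simp add: square_integrable_def)
  have "(\<lambda>i. \<integral>z. (norm (v z - u i z))\<^sup>2 \<partial>RT) \<longlonglongrightarrow> (\<integral>z. 0 \<partial>RT)"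
  proof (rule integral_dominated_convergence)
    show "integrable RT (\<lambda>z. 4 * (w z)\<^sup>2)"
      using w(1) by simp
    show "AE z in RT. (\<lambda>i. (norm (v z - u i z))\<^sup>2) \<longlonglongrightarrow> 0"
      using lim
    proof eventually_elim
      case (elim z)
      have "(\<lambda>i. (norm (v z - u i z))\<^sup>2) \<longlonglongrightarrow> (norm (v z - v z))\<^sup>2"
        by (intro tendsto_intros elim)
      then show ?case by simp
    qed
    show "AE z in RT. norm ((norm (v z - u i z))\<^sup>2) \<le> 4 * (w z)\<^sup>2" for i
      using vw AE_space
    proof eventually_elim
      case (elim z)
      have "norm (v z - u i z) \<le> 2 * w z"
        using norm_triangle_ineq4[of "v z" "u i z"] elim(1) w(2)[of z i] elim(2) by (simp add: space_RT)
      then have "(norm (v z - u i z))\<^sup>2 \<le> (2 * w z)\<^sup>2"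
        by (rule power_mono) simp
      then show ?case by (simp add: power_mult_distrib)
    qed
  qed measurable
  then have conv: "(\<lambda>i. \<integral>z. (norm (v z - u i z))\<^sup>2 \<partial>RT) \<longlonglongrightarrow> 0"
    by simp
  show ?thesis
    unfolding hermite_approx_def
  proof (intro conjI allI impI sv)
    fix \<epsilon> :: real assume "\<epsilon> > 0"
    then have e: "\<epsilon> / 4 > 0" by simp
    obtain i where i: "(\<integral>z. (norm (v z - u i z))\<^sup>2 \<partial>RT) < \<epsilon> / 4"
      using order_tendstoD(2)[OF conv e] by (auto simp: eventually_sequentially)
    obtain g where g: "g \<in> hermite_span \<beta>" "(\<integral>z. (norm (u i z - g z))\<^sup>2 \<partial>RT) < \<epsilon> / 4"
      using u[of i] e unfolding hermite_approx_def by meson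
    have "(\<integral>z. (norm ((v z - u i z) + (u i z - g z)))\<^sup>2 \<partial>RT) \<le>
        2 * ((\<integral>z. (norm (v z - u i z))\<^sup>2 \<partial>RT) + (\<integral>z. (norm (u i z - g z))\<^sup>2 \<partial>RT))"
      using u g sv assms(1) by (intro integral_norm_add_square_le square_integrable_diff)
        (auto simp: hermite_approx_def intro: square_integrable_hermite_span)
    then show "\<exists>g\<in>hermite_span \<beta>. (\<integral>z. (norm (v z - g z))\<^sup>2 \<partial>RT) < \<epsilon>"
      using i g(2) by (intro bexI[OF _ g(1)]) simp
  qed
qed

lemma hermite_approx_power:
  assumes "\<beta> > 0"
  shows "hermite_approx \<beta> (\<lambda>z. of_real (fst z) ^ j * hermite_exp \<beta> 0 k z)"
proof -
  have "(\<lambda>z. of_real (fst z) ^ j * hermite_exp \<beta> 0 k z) \<in> hermite_span \<beta>"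
  proof (induction j)
    case 0
    then show ?case by (simp add: hermite_span_base)
  next
    case (Suc j)
    then show ?case
      using hermite_span_mult_fst[OF assms Suc] by (simp add: mult.assoc)
  qed
  then show ?thesis
    by (rule hermite_approx_span[OF assms])
qed

lemma hermite_approx_sum:
  assumes "\<beta> > 0" "finite A" "\<And>i. i \<in> A \<Longrightarrow> hermite_approx \<beta> (u i)"
  shows "hermite_approx \<beta> (\<lambda>z. \<Sum>i\<in>A. u i z)"
  using assms(2,3)
proof (induction A)
  case empty
  have "hermite_approx \<beta> (\<lambda>z. 0 * hermite_exp \<beta> 0 0 z)"
    by (intro hermite_approx_mult hermite_approx_span hermite_span_base assms)
  then show ?case by simp
next
  case (insert i A)
  then show ?case
    using hermite_approx_add[OF assms(1)] by simp
qed

text \<open>The Taylor series of the character converges in the weighted space, as its partial sums are bounded by $e^{|\xi x|}$.\<close>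

lemma hermite_approx_cis:
  assumes "\<beta> > 0"
  shows "hermite_approx \<beta> (\<lambda>z. cis (\<xi> * fst z) * hermite_exp \<beta> 0 k z)"
proof -
  define B where "B = (\<beta> / pi) powr (1 / 4)"
  have B: "B \<ge> 0" by (simp add: B_def)
  have h0: "norm (hermite_exp \<beta> 0 k z) = B * exp (- \<beta> * (fst z)\<^sup>2 / 2)" for z
    by (simp add: hermite_exp_def split_beta' norm_mult psi_def B_def)
  define w where "w z = (B * exp (\<xi>\<^sup>2 / \<beta>)) * exp (- (\<beta> / 4) * (fst z)\<^sup>2)" for z :: "real \<times> real"
  \<comment> \<open>Completing the square: half of the Gaussian exponent beta/2 absorbs the bound
    exp |xi x| of the partial sums, and the other half remains as majorant.\<close>
  have exp_le: "exp \<bar>\<xi> * x\<bar> * exp (- \<beta> * x\<^sup>2 / 2) \<le> exp (\<xi>\<^sup>2 / \<beta>) * exp (- (\<beta> / 4) * x\<^sup>2)" for x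
  proof -
    have "0 \<le> (\<bar>\<xi>\<bar> - \<beta> / 2 * \<bar>x\<bar>)\<^sup>2 / \<beta>"
      using assms by simp
    also have "\<dots> = \<xi>\<^sup>2 / \<beta> - \<bar>\<xi> * x\<bar> + \<beta> / 4 * x\<^sup>2"
      using assms by (simp add: power2_diff abs_mult field_simps power2_eq_square)
    finally show ?thesis
      by (simp add: algebra_simps flip: exp_add)
  qed
  let ?t = "\<lambda>j z. (\<i> * of_real (\<xi> * fst z)) ^ j / fact j"
  show ?thesis
  proof (rule hermite_approx_limit[OF assms, where w = w])
    show "hermite_approx \<beta> (\<lambda>z. \<Sum>j<N. (\<i> * of_real \<xi>) ^ j / fact j * (of_real (fst z) ^ j * hermite_exp \<beta> 0 k z))" for N
      by (intro hermite_approx_sum hermite_approx_mult hermite_approx_power assms) auto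
    have eq: "(\<Sum>j<N. (\<i> * of_real \<xi>) ^ j / fact j * (of_real (fst z) ^ j * hermite_exp \<beta> 0 k z)) = (\<Sum>j<N. ?t j z) * hermite_exp \<beta> 0 k z" for N z
      by (simp add: sum_distrib_right sum_distrib_left power_mult_distrib mult_ac)
    have ser: "(\<lambda>j. ?t j z) sums cis (\<xi> * fst z)" for z
      using exp_converges[of "\<i> * of_real (\<xi> * fst z)"] by (simp add: cis_conv_exp scaleR_conv_of_real divide_inverse mult.commute)
    show "AE z in RT. (\<lambda>N. \<Sum>j<N. (\<i> * of_real \<xi>) ^ j / fact j * (of_real (fst z) ^ j * hermite_exp \<beta> 0 k z)) \<longlonglongrightarrow> cis (\<xi> * fst z) * hermite_exp \<beta> 0 k z"
      unfolding eq using ser by (intro AE_I2 tendsto_mult tendsto_const) (simp add: sums_def)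
    show "norm (\<Sum>j<N. (\<i> * of_real \<xi>) ^ j / fact j * (of_real (fst z) ^ j * hermite_exp \<beta> 0 k z)) \<le> w z" for N z
    proof -
      have s: "(\<lambda>j. \<bar>\<xi> * fst z\<bar> ^ j / fact j) sums exp \<bar>\<xi> * fst z\<bar>"
        using exp_converges[of "\<bar>\<xi> * fst z\<bar>"] by (simp add: divide_inverse mult.commute)
      have "norm (\<Sum>j<N. ?t j z) \<le> (\<Sum>j<N. norm (?t j z))"
        by (rule norm_sum)
      also have "\<dots> = (\<Sum>j<N. \<bar>\<xi> * fst z\<bar> ^ j / fact j)"
        by (simp only: norm_divide norm_power norm_mult norm_ii norm_of_real norm_fact mult_1)
      also have "\<dots> \<le> exp \<bar>\<xi> * fst z\<bar>"
        unfolding sums_unique[OF s] by (rule sum_le_suminf) (use s in \<open>auto simp: sums_iff\<close>)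
      finally have "norm (\<Sum>j<N. ?t j z) * norm (hermite_exp \<beta> 0 k z) \<le> exp \<bar>\<xi> * fst z\<bar> * (B * exp (- \<beta> * (fst z)\<^sup>2 / 2))"
        unfolding h0 using B by (intro mult_right_mono) auto
      also have "\<dots> = B * (exp \<bar>\<xi> * fst z\<bar> * exp (- \<beta> * (fst z)\<^sup>2 / 2))"
        by (simp only: mult_ac)
      also have "\<dots> \<le> B * (exp (\<xi>\<^sup>2 / \<beta>) * exp (- (\<beta> / 4) * (fst z)\<^sup>2))"
        by (intro mult_left_mono exp_le B)
      finally show ?thesis
        unfolding eq norm_mult w_def by (simp only: mult_ac)
    qed
    have "(w z)\<^sup>2 = (B * exp (\<xi>\<^sup>2 / \<beta>))\<^sup>2 * exp (- (\<beta> / 2) * (fst z)\<^sup>2)" for z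
      unfolding w_def power_mult_distrib by (simp flip: exp_of_nat_mult)
    then show "integrable RT (\<lambda>z. (w z)\<^sup>2)"
      using integrable_RT_exp[of "\<beta> / 2"] assms by simp
    have "(\<lambda>z :: real \<times> real. cis (\<xi> * fst z)) \<in> borel_measurable borel"
      by (intro borel_measurable_continuous_onI continuous_intros)
    then show "(\<lambda>z. cis (\<xi> * fst z) * hermite_exp \<beta> 0 k z) \<in> borel_measurable borel"
      by (intro borel_measurable_times hermite_exp_measurable)
  qed
qed

section \<open>Trigonometric polynomials and functions on the torus\<close>

inductive_set trig_span :: "(real \<times> real \<Rightarrow> complex) set" where
  trig_span_base: "(\<lambda>z. cis (\<xi> * fst z) * cis (of_int k * snd z)) \<in> trig_span"
| trig_span_add: "u \<in> trig_span \<Longrightarrow> v \<in> trig_span \<Longrightarrow> (\<lambda>z. u z + v z) \<in> trig_span"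
| trig_span_mult: "u \<in> trig_span \<Longrightarrow> (\<lambda>z. c * u z) \<in> trig_span"

lemma trig_span_times:
  assumes "u \<in> trig_span" "v \<in> trig_span"
  shows "(\<lambda>z. u z * v z) \<in> trig_span"
  using assms(1)
proof induction
  case (trig_span_base \<xi> k)
  show ?case
    using assms(2)
  proof induction
    case (trig_span_base \<eta> l)
    have "cis (\<xi> * x) * cis (of_int k * y) * (cis (\<eta> * x) * cis (of_int l * y)) = cis ((\<xi> + \<eta>) * x) * cis (of_int (k + l) * y)" for x y
      by (simp add: distrib_right flip: cis_mult)
    then show ?case
      by (simp only:) (rule trig_span.intros)
  next
    case (trig_span_add u v)
    then show ?case
      by (simp only: distrib_left) (rule trig_span.intros)
  next
    case (trig_span_mult u c)
    then show ?case
      by (simp only: mult.left_commute[of _ c]) (rule trig_span.intros)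
  qed
next
  case (trig_span_add u v)
  then show ?case
    by (simp only: distrib_right) (rule trig_span.intros)
next
  case (trig_span_mult u c)
  then show ?case
    by (simp only: mult.assoc) (rule trig_span.intros)
qed

text \<open>Stone--Weierstrass delivers polynomials in the four real coordinates of two complex
  numbers. On the torus these coordinates are combinations of a character and its inverse, and
  products of characters are characters.\<close>

lemma trig_span_real_polynomial:
  assumes "real_polynomial_function q"
  shows "(\<lambda>z. complex_of_real (q (cis (\<xi> * fst z), cis (snd z)))) \<in> trig_span"
  using assms
proof induction
  case (linear f)
  interpret f: bounded_linear f by fact
  have f: "f (z, w) = Re z * f (1, 0) + Im z * f (\<i>, 0) + Re w * f (0, 1) + Im w * f (0, \<i>)" for z w
  proof -
    have "(z, w) = Re z *\<^sub>R (1, 0) + Im z *\<^sub>R (\<i>, 0) + Re w *\<^sub>R (0, 1) + Im w *\<^sub>R (0, \<i>)"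
      by (simp add: complex_eq_iff)
    then have "f (z, w) = f (Re z *\<^sub>R (1, 0) + Im z *\<^sub>R (\<i>, 0) + Re w *\<^sub>R (0, 1) + Im w *\<^sub>R (0, \<i>))"
      by (rule arg_cong)
    then show ?thesis
      by (simp only: f.add f.scaleR real_scaleR_def)
  qed
  have t: "(\<lambda>z. cis (\<xi> * fst z)) \<in> trig_span" "(\<lambda>z. cis (- \<xi> * fst z)) \<in> trig_span"
    "(\<lambda>z. cis (snd z)) \<in> trig_span" "(\<lambda>z. cis (- snd z)) \<in> trig_span"
    using trig_span_base[of \<xi> 0] trig_span_base[of "- \<xi>" 0] trig_span_base[of 0 1] trig_span_base[of 0 "-1"] by simp_all
  have cs: "complex_of_real (Re (cis a)) = (1 / 2) * cis a + (1 / 2) * cis (- a)"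
    "complex_of_real (Im (cis a)) = (- \<i> / 2) * cis a + (\<i> / 2) * cis (- a)" for a
    by (simp_all add: complex_eq_iff)
  have tRe: "(\<lambda>z. complex_of_real (Re (cis (\<xi> * fst z)))) \<in> trig_span" "(\<lambda>z. complex_of_real (Im (cis (\<xi> * fst z)))) \<in> trig_span"
    "(\<lambda>z. complex_of_real (Re (cis (snd z)))) \<in> trig_span" "(\<lambda>z. complex_of_real (Im (cis (snd z)))) \<in> trig_span"
    unfolding cs mult_minus_left[symmetric] by (intro trig_span_add trig_span_mult t)+
  have "(\<lambda>z. complex_of_real (f (1, 0)) * complex_of_real (Re (cis (\<xi> * fst z))) + complex_of_real (f (\<i>, 0)) * complex_of_real (Im (cis (\<xi> * fst z)))
      + complex_of_real (f (0, 1)) * complex_of_real (Re (cis (snd z))) + complex_of_real (f (0, \<i>)) * complex_of_real (Im (cis (snd z)))) \<in> trig_span"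
    by (intro trig_span_add trig_span_mult tRe)
  moreover have "complex_of_real (f (cis a, cis b)) = complex_of_real (f (1, 0)) * complex_of_real (Re (cis a)) + complex_of_real (f (\<i>, 0)) * complex_of_real (Im (cis a))
      + complex_of_real (f (0, 1)) * complex_of_real (Re (cis b)) + complex_of_real (f (0, \<i>)) * complex_of_real (Im (cis b))" for a b
    by (subst f) (simp only: of_real_add of_real_mult mult.commute)
  ultimately show ?case
    by (simp only:)
next
  case (const c)
  show ?case
    using trig_span_mult[OF trig_span_base[of 0 0], of "of_real c"] by simp
next
  case (add f g)
  then show ?case
    by (simp only: of_real_add) (rule trig_span_add)
next
  case (mult f g)
  then show ?case
    by (simp only: of_real_mult) (rule trig_span_times)
qed

lemma trig_span_polynomial:
  fixes g :: "complex \<times> complex \<Rightarrow> complex"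
  assumes "polynomial_function g"
  shows "(\<lambda>z. g (cis (\<xi> * fst z), cis (snd z))) \<in> trig_span"
proof -
  have "real_polynomial_function (\<lambda>z. Re (g z))" "real_polynomial_function (\<lambda>z. Im (g z))"
    using assms bounded_linear_Re bounded_linear_Im unfolding polynomial_function_def o_def by blast+
  then have "(\<lambda>z. of_real (Re (g (cis (\<xi> * fst z), cis (snd z)))) + \<i> * of_real (Im (g (cis (\<xi> * fst z), cis (snd z))))) \<in> trig_span"
    by (intro trig_span_add trig_span_mult trig_span_real_polynomial)
  then show ?thesis
    by (simp only: complex_eq[symmetric])
qed

lemma hermite_approx_trig:
  assumes "\<beta> > 0" "u \<in> trig_span"
  shows "hermite_approx \<beta> (\<lambda>z. u z * hermite_exp \<beta> 0 0 z)"
  using assms(2)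
proof induction
  case (trig_span_base \<xi> k)
  have "cis (\<xi> * fst z) * cis (of_int k * snd z) * hermite_exp \<beta> 0 0 z = cis (\<xi> * fst z) * hermite_exp \<beta> 0 k z" for z
    by (simp add: hermite_exp_def split_beta')
  then show ?case
    using hermite_approx_cis[OF assms(1), of \<xi> k] by (simp only:)
next
  case (trig_span_add u v)
  then show ?case
    using hermite_approx_add[OF assms(1)] by (simp add: distrib_right)
next
  case (trig_span_mult u c)
  then show ?case
    using hermite_approx_mult by (simp add: mult.assoc)
qed

lemma square_integrable_hermite_exp_zero:
  assumes "\<beta> > 0"
  shows "integrable RT (\<lambda>z. (M * norm (hermite_exp \<beta> 0 0 z))\<^sup>2)"
  using square_integrable_hermite_exp[OF assms, of 0 0] by (simp add: square_integrable_def power_mult_distrib)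

text \<open>For a fixed frequency the function is periodic in both variables and lives on the
  compact torus. Uniform approximation there becomes L^2 approximation on the strip because the
  Gaussian factor is square integrable.\<close>

lemma hermite_approx_torus:
  fixes F :: "complex \<times> complex \<Rightarrow> complex"
  assumes "\<beta> > 0" and F: "continuous_on (sphere 0 1 \<times> sphere 0 1) F"
  shows "hermite_approx \<beta> (\<lambda>z. F (cis (\<xi> * fst z), cis (snd z)) * hermite_exp \<beta> 0 0 z)"
proof -
  let ?T = "sphere 0 1 \<times> sphere 0 1 :: (complex \<times> complex) set"
  let ?e = "\<lambda>z. (cis (\<xi> * fst z), cis (snd z))"
  have T: "compact ?T" "?e z \<in> ?T" for z
    by (auto intro: compact_Times)
  have "\<exists>g. polynomial_function g \<and> (\<forall>x\<in>?T. norm (F x - g x) < 1 / Suc i)" for i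
    by (rule Stone_Weierstrass_polynomial_function[OF T(1) F]) simp
  then obtain g where g: "\<And>i. polynomial_function (g i)" "\<And>i x. x \<in> ?T \<Longrightarrow> norm (F x - g i x) < 1 / Suc i"
    by metis
  obtain M where M: "\<And>x. x \<in> ?T \<Longrightarrow> norm (F x) \<le> M"
    using compact_imp_bounded[OF compact_continuous_image[OF F T(1)]] by (auto simp: bounded_iff)
  show ?thesis
  proof (rule hermite_approx_limit[OF assms(1), where w = "\<lambda>z. (M + 1) * norm (hermite_exp \<beta> 0 0 z)"])
    show "hermite_approx \<beta> (\<lambda>z. g i (?e z) * hermite_exp \<beta> 0 0 z)" for i
      by (intro hermite_approx_trig trig_span_polynomial g assms)
    have "(\<lambda>i. g i x) \<longlonglongrightarrow> F x" if "x \<in> ?T" for x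
    proof -
      have "(\<lambda>i. F x - g i x) \<longlonglongrightarrow> 0"
        using LIMSEQ_inverse_real_of_nat
        by (rule Lim_null_comparison[rotated]) (use g(2)[OF that] in \<open>auto intro!: always_eventually less_imp_le simp: inverse_eq_divide\<close>)
      then show ?thesis
        using tendsto_diff[OF tendsto_const[of "F x"]] by fastforce
    qed
    then show "AE z in RT. (\<lambda>i. g i (?e z) * hermite_exp \<beta> 0 0 z) \<longlonglongrightarrow> F (?e z) * hermite_exp \<beta> 0 0 z"
      using T(2) by (intro AE_I2 tendsto_mult tendsto_const) blast
    show "norm (g i (?e z) * hermite_exp \<beta> 0 0 z) \<le> (M + 1) * norm (hermite_exp \<beta> 0 0 z)" for i z
    proof -
      have "norm (F (?e z) - g i (?e z)) \<le> 1"
        using less_imp_le[OF g(2)[OF T(2), of z i]] by (rule order_trans) simp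
      then have "norm (g i (?e z)) \<le> M + 1"
        using M[OF T(2), of z] norm_triangle_ineq3[of "g i (?e z)" "F (?e z)"] by (simp add: norm_minus_commute)
      then show ?thesis
        unfolding norm_mult by (intro mult_right_mono) auto
    qed
    have "continuous_on UNIV (\<lambda>z. F (?e z))"
      by (rule continuous_on_compose2[OF F]) (auto intro!: continuous_intros)
    then show "(\<lambda>z. F (?e z) * hermite_exp \<beta> 0 0 z) \<in> borel_measurable borel"
      by (intro borel_measurable_times borel_measurable_continuous_onI hermite_exp_measurable)
  qed (rule square_integrable_hermite_exp_zero[OF assms(1)])
qed

text \<open>The branch cut of \<open>Arg\<close> meets the unit circle in a single point, so it
  suffices that the cut-off factors vanish there.\<close>

lemma sphere_nonpos_Reals: "z \<in> sphere 0 1 \<Longrightarrow> z \<in> \<real>\<^sub>\<le>\<^sub>0 \<Longrightarrow> z = - (1 :: complex)"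
  by (auto simp: complex_nonpos_Reals_iff complex_eq_iff cmod_eq_Re)

text \<open>The factor $(1+\Re z)(1-\Re w)$ makes the inverse of the parametrisation of the torus continuous.\<close>

lemma continuous_on_torus_lift:
  fixes g :: "real \<times> real \<Rightarrow> complex"
  assumes g: "continuous_on UNIV g" "\<And>x. norm (g x) \<le> M"
  shows "continuous_on (sphere 0 1 \<times> sphere 0 1)
    (\<lambda>p. of_real ((1 + Re (fst p)) * (1 - Re (snd p))) * g (a * Arg (fst p), pi + Arg (- snd p)))"
  unfolding continuous_on_def
proof
  fix p :: "complex \<times> complex" assume p: "p \<in> sphere 0 1 \<times> sphere 0 1"
  let ?c = "\<lambda>p :: complex \<times> complex. (1 + Re (fst p)) * (1 - Re (snd p))"
  let ?F = "\<lambda>p. of_real (?c p) * g (a * Arg (fst p), pi + Arg (- snd p))"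
  have c: "(?c \<longlongrightarrow> ?c p) (at p within S)" for S
    by (intro tendsto_intros)
  show "(?F \<longlongrightarrow> ?F p) (at p within sphere 0 1 \<times> sphere 0 1)"
  proof (cases "fst p \<in> \<real>\<^sub>\<le>\<^sub>0 \<or> - snd p \<in> \<real>\<^sub>\<le>\<^sub>0")
    case False
    have *: "((\<lambda>p. Arg (fst p)) \<longlongrightarrow> Arg (fst p)) (at p)" "((\<lambda>p. Arg (- snd p)) \<longlongrightarrow> Arg (- snd p)) (at p)"
      using False by (intro isCont_tendsto_compose[OF continuous_at_Arg] tendsto_intros; simp)+
    have "((\<lambda>p. (a * Arg (fst p), pi + Arg (- snd p))) \<longlongrightarrow> (a * Arg (fst p), pi + Arg (- snd p))) (at p)"
      by (intro tendsto_Pair tendsto_mult tendsto_add tendsto_const *)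
    then have "((\<lambda>p. g (a * Arg (fst p), pi + Arg (- snd p))) \<longlongrightarrow> g (a * Arg (fst p), pi + Arg (- snd p))) (at p)"
      using g(1) by (intro isCont_tendsto_compose[where g = g]) (auto simp: continuous_on_eq_continuous_at)
    then have "(?F \<longlongrightarrow> ?F p) (at p)"
      by (intro tendsto_mult tendsto_of_real c)
    then show ?thesis
      by (rule tendsto_within_subset) simp
  next
    case True
    \<comment> \<open>On the seams the cut-off vanishes, and since g is bounded the product is
      squeezed to 0 whatever \<open>Arg\<close> does.\<close>
    then have c0: "?c p = 0"
      using p sphere_nonpos_Reals[of "fst p"] sphere_nonpos_Reals[of "- snd p"] by (auto simp: mem_Times_iff)
    have "((\<lambda>q. \<bar>?c q\<bar> * M) \<longlongrightarrow> \<bar>?c p\<bar> * M) (at p within sphere 0 1 \<times> sphere 0 1)"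
      by (intro tendsto_mult tendsto_rabs tendsto_const c)
    then have lim0: "((\<lambda>q. \<bar>?c q\<bar> * M) \<longlongrightarrow> 0) (at p within sphere 0 1 \<times> sphere 0 1)"
      unfolding c0 by simp
    have "norm (?F q) \<le> \<bar>?c q\<bar> * M" for q
      unfolding norm_mult norm_of_real by (intro mult_left_mono g) simp
    then have "\<forall>\<^sub>F q in at p within sphere 0 1 \<times> sphere 0 1. norm (?F q) \<le> \<bar>?c q\<bar> * M"
      by (intro always_eventually allI)
    then have "(?F \<longlongrightarrow> 0) (at p within sphere 0 1 \<times> sphere 0 1)"
      by (rule Lim_null_comparison[OF _ lim0])
    then show ?thesis
      unfolding c0 by simp
  qed
qed

text \<open>The restriction of g to |x_1| < N + 1 is extended with period 2(N + 1) and damped by (1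
  + cos (pi x_1/(N+1))) (1 - cos x_2). As N grows, the first factor tends to 2 and every point
  eventually lies inside the period, which explains the factor left in the statement.\<close>

lemma hermite_approx_bounded_continuous:
  fixes g :: "real \<times> real \<Rightarrow> complex"
  assumes "\<beta> > 0" and g: "continuous_on UNIV g" "\<And>x. norm (g x) \<le> M"
  shows "hermite_approx \<beta> (\<lambda>z. of_real (2 * (1 - cos (snd z))) * g z * hermite_exp \<beta> 0 0 z)"
proof -
  define F where "F N p = complex_of_real ((1 + Re (fst p)) * (1 - Re (snd p))) * g (real (Suc N) / pi * Arg (fst p), pi + Arg (- snd p))"
    for N :: nat and p
  define e where "e N z = (cis (pi / real (Suc N) * fst z), cis (snd z))" for N :: nat and z :: "real \<times> real"
  have M: "M \<ge> 0" using norm_ge_zero[of "g 0"] g(2)[of 0] by linarith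
  show ?thesis
  proof (rule hermite_approx_limit[OF assms(1), where w = "\<lambda>z. (4 * M) * norm (hermite_exp \<beta> 0 0 z)"])
    show "hermite_approx \<beta> (\<lambda>z. F N (e N z) * hermite_exp \<beta> 0 0 z)" for N
      unfolding e_def by (intro hermite_approx_torus assms) (simp only: F_def continuous_on_torus_lift[OF g])
    show "norm (F N (e N z) * hermite_exp \<beta> 0 0 z) \<le> 4 * M * norm (hermite_exp \<beta> 0 0 z)" for N z
    proof -
      have "\<bar>1 + cos x\<bar> \<le> 2" "\<bar>1 - cos x\<bar> \<le> 2" for x :: real
        using cos_le_one[of x] cos_ge_minus_one[of x] by linarith+
      then have c: "\<bar>1 + cos x\<bar> * \<bar>1 - cos y\<bar> \<le> 2 * 2" for x y :: real
        by (intro mult_mono) auto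
      have "norm (F N (e N z)) \<le> 2 * 2 * M"
        unfolding F_def e_def norm_mult norm_of_real abs_mult fst_conv snd_conv cis.simps
        by (rule mult_mono[OF c g(2)]) auto
      then show ?thesis
        unfolding norm_mult[of "F N (e N z)"] by (intro mult_right_mono) auto
    qed
    show "AE z in RT. (\<lambda>N. F N (e N z) * hermite_exp \<beta> 0 0 z) \<longlonglongrightarrow> of_real (2 * (1 - cos (snd z))) * g z * hermite_exp \<beta> 0 0 z"
      using AE_space
    proof eventually_elim
      case (elim z)
      then have y: "0 \<le> snd z" "snd z < 2 * pi"
        by (auto simp: space_RT)
      have "(\<lambda>N. F N (e N z)) \<longlonglongrightarrow> of_real (2 * (1 - cos (snd z))) * g z"
      proof (cases "snd z = 0")
        case True
        then show ?thesis by (simp add: F_def e_def)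
      next
        case False
        \<comment> \<open>The rotation by pi moves the jump of the argument to x_2 = 0, the edge of
          the fundamental domain.\<close>
        have "- cis (snd z) = cis (snd z - pi)"
          by (simp add: complex_eq_iff cos_diff sin_diff)
        then have y': "pi + Arg (- cis (snd z)) = snd z"
          using False y by (simp add: Arg_cis)
        obtain N0 :: nat where N0: "\<bar>fst z\<bar> < real N0"
          using reals_Archimedean2 by blast
        \<comment> \<open>Once |x_1| < N + 1, the angle pi x_1/(N + 1) lies within (-pi, pi) and
          \<open>Arg\<close> recovers it.\<close>
        have x': "real (Suc N) / pi * Arg (cis (pi / real (Suc N) * fst z)) = fst z" if "N \<ge> N0" for N
        proof -
          have r: "\<bar>fst z\<bar> < real (Suc N)"
            using N0 that by simp
          define q where "q = fst z / real (Suc N)"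
          have "\<bar>q\<bar> < 1"
            using r by (simp add: q_def abs_divide)
          then have "pi * \<bar>q\<bar> < pi * 1"
            by (intro mult_strict_left_mono) auto
          then have "\<bar>pi * q\<bar> < pi"
            by (simp add: abs_mult)
          then have "Arg (cis (pi * q)) = pi * q"
            by (intro Arg_cis) (auto simp: abs_less_iff)
          moreover have "pi / real (Suc N) * fst z = pi * q"
            by (simp add: q_def)
          ultimately have "real (Suc N) / pi * Arg (cis (pi / real (Suc N) * fst z)) = real (Suc N) / pi * (pi * q)"
            by (simp only:)
          then show ?thesis by (simp add: q_def)
        qed
        have "(\<lambda>N. complex_of_real ((1 + cos (pi / real (Suc N) * fst z)) * (1 - cos (snd z))) * g z) \<longlonglongrightarrow>
            of_real ((1 + cos (0 * fst z)) * (1 - cos (snd z))) * g z"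
        proof (intro tendsto_intros)
          have "(\<lambda>N. pi * inverse (real (Suc N))) \<longlonglongrightarrow> pi * 0"
            by (intro tendsto_mult tendsto_const LIMSEQ_inverse_real_of_nat)
          then show "(\<lambda>N. pi / real (Suc N)) \<longlonglongrightarrow> 0"
            by (simp add: divide_inverse)
        qed
        moreover have "\<forall>\<^sub>F N in sequentially. complex_of_real ((1 + cos (pi / real (Suc N) * fst z)) * (1 - cos (snd z))) * g z = F N (e N z)"
          using eventually_ge_at_top[of N0]
        proof eventually_elim
          case (elim N)
          then show ?case
            unfolding F_def e_def by (simp only: fst_conv snd_conv x' y' prod.collapse cis.simps)
        qed
        ultimately have "(\<lambda>N. F N (e N z)) \<longlonglongrightarrow> of_real ((1 + cos (0 * fst z)) * (1 - cos (snd z))) * g z"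
          by (rule Lim_transform_eventually)
        then show ?thesis
          by simp
      qed
      then show ?case
        by (intro tendsto_mult tendsto_const)
    qed
    show "(\<lambda>z. of_real (2 * (1 - cos (snd z))) * g z * hermite_exp \<beta> 0 0 z) \<in> borel_measurable borel"
      by (intro borel_measurable_times[OF _ hermite_exp_measurable] borel_measurable_continuous_onI continuous_intros g)
  qed (rule square_integrable_hermite_exp_zero[OF assms(1)])
qed

section \<open>From bounded continuous to all square integrable functions\<close>

lemma abs_one_minus_cos_le: "\<bar>2 * (1 - cos x)\<bar> \<le> 4" for x :: real
proof -
  have "\<bar>1 - cos x\<bar> \<le> \<bar>1\<bar> + \<bar>cos x\<bar>"
    by (rule abs_triangle_ineq4)
  then have "\<bar>1 - cos x\<bar> \<le> 2"
    using abs_cos_le_one[of x] by simp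
  then have "2 * \<bar>1 - cos x\<bar> \<le> 2 * 2"
    by (rule mult_left_mono) simp
  then show ?thesis
    unfolding abs_mult abs_numeral by linarith
qed

text \<open>A measurable function is an almost everywhere limit of continuous ones. These need not
  be bounded uniformly, as dominated convergence requires, so they are first retracted to a
  ball.\<close>

lemma hermite_approx_bounded_measurable:
  fixes h :: "real \<times> real \<Rightarrow> complex"
  assumes "\<beta> > 0" and h: "h \<in> borel_measurable borel" "\<And>x. norm (h x) \<le> M"
  shows "hermite_approx \<beta> (\<lambda>z. of_real (2 * (1 - cos (snd z))) * h z * hermite_exp \<beta> 0 0 z)"
proof -
  define M' where "M' = max M 1"
  have M': "M' > 0" "\<And>x. norm (h x) \<le> M'" using h(2) by (auto simp: M'_def intro: order_trans[OF _ max.cobounded1])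
  have "h measurable_on UNIV"
    using h(1) by (intro lebesgue_measurable_imp_measurable_on) (auto intro: measurable_completion)
  then obtain N g where g: "negligible N" "\<And>n. continuous_on UNIV (g n)" "\<And>x. x \<notin> N \<Longrightarrow> (\<lambda>n. g n x) \<longlonglongrightarrow> h x"
    unfolding measurable_on_def by auto
  \<comment> \<open>Radial retraction onto the ball of radius M': it is continuous and fixes the
    values of h, so the limit is unchanged. The positivity of M' allows the division.\<close>
  define c where "c n x = g n x /\<^sub>R max 1 (norm (g n x) / M')" for n x
  have c: "continuous_on UNIV (c n)" for n
    unfolding c_def using M' by (intro continuous_intros g) auto
  have cM: "norm (c n x) \<le> M'" for n x
    using M'(1) by (auto simp: c_def max_def field_simps)
  have lim: "(\<lambda>n. c n x) \<longlonglongrightarrow> h x" if "x \<notin> N" for x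
  proof -
    have "(\<lambda>n. c n x) \<longlonglongrightarrow> h x /\<^sub>R max 1 (norm (h x) / M')"
      unfolding c_def using M' by (intro tendsto_intros g that) auto
    moreover have "norm (h x) / M' \<le> 1"
      using M' by simp
    ultimately show ?thesis
      by (simp add: max_absorb1)
  qed
  have "AE x in lborel. x \<notin> N"
    using g(1) AE_not_in[of N "completion lborel"] by (simp add: negligible_iff_null_sets AE_completion_iff)
  then have N: "AE x in RT. x \<notin> N"
    unfolding AE_RT_iff by auto
  show ?thesis
  proof (rule hermite_approx_limit[OF assms(1), where w = "\<lambda>z. (4 * M') * norm (hermite_exp \<beta> 0 0 z)"])
    show "hermite_approx \<beta> (\<lambda>z. of_real (2 * (1 - cos (snd z))) * c n z * hermite_exp \<beta> 0 0 z)" for n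
      by (rule hermite_approx_bounded_continuous[OF assms(1) c cM])
    show "AE z in RT. (\<lambda>n. of_real (2 * (1 - cos (snd z))) * c n z * hermite_exp \<beta> 0 0 z) \<longlonglongrightarrow> of_real (2 * (1 - cos (snd z))) * h z * hermite_exp \<beta> 0 0 z"
      using N by eventually_elim (intro tendsto_intros lim)
    show "norm (of_real (2 * (1 - cos (snd z))) * c n z * hermite_exp \<beta> 0 0 z) \<le> 4 * M' * norm (hermite_exp \<beta> 0 0 z)" for n z
    proof -
      have "\<bar>2 * (1 - cos (snd z))\<bar> \<le> 4"
        by (rule abs_one_minus_cos_le)
      then have "norm (complex_of_real (2 * (1 - cos (snd z))) * c n z) \<le> 4 * M'"
        unfolding norm_mult norm_of_real using cM M' by (intro mult_mono) auto
      then show ?thesis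
        unfolding norm_mult[of _ "hermite_exp \<beta> 0 0 z"] by (intro mult_right_mono) auto
    qed
    show "(\<lambda>z. of_real (2 * (1 - cos (snd z))) * h z * hermite_exp \<beta> 0 0 z) \<in> borel_measurable borel"
    proof (intro borel_measurable_times hermite_exp_measurable h)
      show "(\<lambda>z :: real \<times> real. complex_of_real (2 * (1 - cos (snd z)))) \<in> borel_measurable borel"
        by (intro borel_measurable_continuous_onI continuous_intros)
    qed
  qed (rule square_integrable_hermite_exp_zero[OF assms(1)])
qed

text \<open>The damping factor d vanishes only on the null set x_2 = 0, so u = d (u/d) almost
  everywhere. The quotient is truncated at height N, and |u| itself is the majorant.\<close>

lemma hermite_approx_all:
  assumes "\<beta> > 0" "square_integrable u"
  shows "hermite_approx \<beta> u"
proof -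
  define d where "d z = of_real (2 * (1 - cos (snd z))) * hermite_exp \<beta> 0 0 z" for z
  have [measurable]: "u \<in> borel_measurable borel"
    using assms(2) by (simp add: square_integrable_def)
  have "(\<lambda>z :: real \<times> real. complex_of_real (2 * (1 - cos (snd z)))) \<in> borel_measurable borel"
    by (intro borel_measurable_continuous_onI continuous_intros)
  then have [measurable]: "d \<in> borel_measurable borel"
    unfolding d_def by (intro borel_measurable_times hermite_exp_measurable)
  define h where "h N z = (if norm (u z / d z) \<le> real N then u z / d z else 0)" for N :: nat and z
  have hm: "h N \<in> borel_measurable borel" for N
    unfolding h_def by measurable
  have eq: "complex_of_real (2 * (1 - cos (snd z))) * h N z * hermite_exp \<beta> 0 0 z = (if norm (u z / d z) \<le> real N \<and> d z \<noteq> 0 then u z else 0)" for N z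
    by (auto simp: h_def d_def)
  \<comment> \<open>The Gaussian never vanishes, and on the strip 1 - cos x_2 vanishes only for x_2
    = 0, a line of measure 0.\<close>
  have d0: "AE z in RT. d z \<noteq> 0"
  proof -
    have "AE z in (lborel :: real measure) \<Otimes>\<^sub>M (lborel :: real measure). snd z \<noteq> 0"
    proof (rule lborel_pair.AE_pair_measure)
      have "open {z :: real \<times> real. snd z \<noteq> 0}"
        by (intro open_Collect_neq continuous_intros)
      then have "{z :: real \<times> real. snd z \<noteq> 0} \<in> sets borel"
        by (rule borel_open)
      then show "{z \<in> space ((lborel :: real measure) \<Otimes>\<^sub>M (lborel :: real measure)). snd z \<noteq> 0} \<in> sets (lborel \<Otimes>\<^sub>M lborel)"
        unfolding lborel_prod by simp
      show "AE x in (lborel :: real measure). AE y in lborel. snd (x, y) \<noteq> (0 :: real)"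
        unfolding snd_conv by (intro AE_I2 AE_lborel_singleton)
    qed
    then have "AE z in RT. snd z \<noteq> (0 :: real)"
      unfolding AE_RT_iff lborel_prod by (rule eventually_mono) simp
    then show ?thesis
      using AE_space
    proof eventually_elim
      case (elim z)
      then have "sin (snd z / 2) > 0"
        by (intro sin_gt_zero) (auto simp: space_RT)
      then have "cos (snd z) \<noteq> 1"
        using cos_double_sin[of "snd z / 2"] by simp
      moreover have "psi \<beta> 0 (fst z) \<noteq> 0"
        using assms(1) by (simp add: psi_def)
      ultimately show ?case
        by (simp add: d_def hermite_exp_def split_beta')
    qed
  qed
  show ?thesis
  proof (rule hermite_approx_limit[OF assms(1), where w = "\<lambda>z. norm (u z)"])
    show "hermite_approx \<beta> (\<lambda>z. of_real (2 * (1 - cos (snd z))) * h N z * hermite_exp \<beta> 0 0 z)" for N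
      by (rule hermite_approx_bounded_measurable[OF assms(1) hm, of _ "real N"]) (simp add: h_def)
    show "AE z in RT. (\<lambda>N. of_real (2 * (1 - cos (snd z))) * h N z * hermite_exp \<beta> 0 0 z) \<longlonglongrightarrow> u z"
      using d0
    proof eventually_elim
      case (elim z)
      obtain N0 :: nat where "norm (u z / d z) \<le> real N0"
        using real_arch_simple by blast
      then have "\<forall>\<^sub>F N in sequentially. u z = (if norm (u z / d z) \<le> real N \<and> d z \<noteq> 0 then u z else 0)"
        using elim by (intro eventually_sequentiallyI[of N0]) auto
      then show ?case
        unfolding eq by (rule Lim_transform_eventually[OF tendsto_const])
    qed
    show "norm (complex_of_real (2 * (1 - cos (snd z))) * h N z * hermite_exp \<beta> 0 0 z) \<le> norm (u z)" for N z
      unfolding eq by simp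
  qed (use assms(2) in \<open>simp_all add: square_integrable_def\<close>)
qed

section \<open>Eigenvalues and the reduction to a $3\times3$ matrix\<close>

abbreviation signs :: "int set" where
  "signs \<equiv> {-1, 0, 1}"

section \<open>Roots of the cubic\<close>

lemma tau_cubic:
  assumes "\<beta> > 0" "n \<ge> 1" "j \<in> signs"
  shows "tau \<beta> n k j \<in> cubic_roots \<beta> n k"
proof -
  note c = card_cubic_roots[OF assms(1,2), of k]
  have "nat (j + 1) < length (sorted_list_of_set (cubic_roots \<beta> n k))"
    using c assms by auto
  then show ?thesis
    using c(1) assms(2) nth_mem[of "nat (j + 1)" "sorted_list_of_set (cubic_roots \<beta> n k)"] by (simp add: tau_def)
qed

lemma tau_less:
  assumes "\<beta> > 0" "n \<ge> 1" "i \<in> signs" "j \<in> signs" "i < j"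
  shows "tau \<beta> n k i < tau \<beta> n k j"
proof -
  note c = card_cubic_roots[OF assms(1,2), of k]
  have "sorted_wrt (<) (sorted_list_of_set (cubic_roots \<beta> n k))"
    by (rule strict_sorted_list_of_set)
  moreover have "nat (i + 1) < nat (j + 1)" "nat (j + 1) < length (sorted_list_of_set (cubic_roots \<beta> n k))"
    using c assms by auto
  ultimately have "sorted_list_of_set (cubic_roots \<beta> n k) ! nat (i + 1) < sorted_list_of_set (cubic_roots \<beta> n k) ! nat (j + 1)"
    by (rule sorted_wrt_nth_less)
  then show ?thesis
    using assms(2) by (simp add: tau_def)
qed

lemma tau_inj:
  assumes "\<beta> > 0" "i \<in> signs" "j \<in> signs" "i \<noteq> j" "n = 0 \<Longrightarrow> i \<noteq> 0 \<and> j \<noteq> 0"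
  shows "tau \<beta> n k i \<noteq> tau \<beta> n k j"
proof (cases "n = 0")
  case True
  have "sqrt ((real_of_int k)\<^sup>2 + 4 * \<beta>) > 0"
    using assms(1) by (simp add: add_nonneg_pos)
  then show ?thesis
    using True assms by (auto simp: tau_def)
next
  case False
  then show ?thesis
    using tau_less[OF assms(1) _ assms(2,3), of n k] tau_less[OF assms(1) _ assms(3,2), of n k] assms(4)
    by (cases "i < j") force+
qed

lemma tau_eq:
  assumes "\<beta> > 0" "n \<ge> 1" "j \<in> signs"
  shows "tau \<beta> n k j * ((tau \<beta> n k j)\<^sup>2 - (of_int k)\<^sup>2) = \<beta> * (2 * real n + 1) * tau \<beta> n k j + \<beta> * of_int k"
  using tau_cubic[OF assms, of k] by (simp add: cubic_roots_def algebra_simps power3_eq_cube power2_eq_square)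

text \<open>For n = 0 the cubic is (t + k)(t^2 - k t - beta), and the modes j = -1, 1 are the roots
  of the quadratic factor.\<close>

lemma tau_eq_0:
  assumes "\<beta> > 0" "j \<in> {-1, 1}"
  shows "tau \<beta> 0 k j * (tau \<beta> 0 k j - of_int k) = \<beta>"
proof -
  define r where "r = sqrt ((real_of_int k)\<^sup>2 + 4 * \<beta>)"
  have "r * r = (real_of_int k)\<^sup>2 + 4 * \<beta>"
    using assms by (simp add: r_def)
  then show ?thesis
    using assms by (auto simp: tau_def r_def[symmetric] field_simps power2_eq_square)
qed

text \<open>For k = 0 the cubic is an odd function, so its three distinct roots are symmetric about
  0 and the middle one is 0.\<close>

lemma tau_zero:
  assumes "\<beta> > 0" "n \<ge> 1"
  shows "tau \<beta> n 0 0 = 0"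
proof -
  show ?thesis
  proof (rule ccontr)
    assume ne: "tau \<beta> n 0 0 \<noteq> 0"
    define a b c where "a = tau \<beta> n 0 (-1)" and "b = tau \<beta> n 0 0" and "c = tau \<beta> n 0 1"
    have less: "a < b" "b < c"
      using tau_less[OF assms, of "-1" 0 0] tau_less[OF assms, of 0 1 0] by (auto simp: a_def b_def c_def)
    have mem: "a \<in> cubic_roots \<beta> n 0" "b \<in> cubic_roots \<beta> n 0" "c \<in> cubic_roots \<beta> n 0"
      using tau_cubic[OF assms] by (auto simp: a_def b_def c_def)
    have neg: "- t \<in> cubic_roots \<beta> n 0" if "t \<in> cubic_roots \<beta> n 0" for t
      using that by (simp add: cubic_roots_def power3_eq_cube)
    have "0 \<in> cubic_roots \<beta> n 0"
      by (simp add: cubic_roots_def)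
    note card = card_cubic_roots[OF assms, of 0]
    have "{b, - b, 0} \<union> {a, c} \<subseteq> cubic_roots \<beta> n 0"
      using mem neg \<open>0 \<in> _\<close> by auto
    moreover have "card {b, - b, 0} = 3"
      using ne by (auto simp: b_def card_insert_if)
    ultimately have eq: "cubic_roots \<beta> n 0 = {b, - b, 0}"
      using card by (metis card_subset_eq le_sup_iff)
    then have "a \<in> {- b, 0}" "c \<in> {- b, 0}"
      using mem less by auto
    then show False
      using less ne by (auto simp: b_def)
  qed
qed

text \<open>Guards the denominators in \<open>Psi\<close>. Inserting t = k or t = -k into the cubic
  leaves a nonzero multiple of k; for k = 0 only the middle root is 0.\<close>

lemma tau_ne_k:
  assumes "\<beta> > 0" "j \<in> signs" "\<not> (n = 0 \<and> j = 0)" "\<not> (k = 0 \<and> j = 0)"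
  shows "tau \<beta> n k j - of_int k \<noteq> 0" and "n \<ge> 1 \<Longrightarrow> tau \<beta> n k j + of_int k \<noteq> 0"
proof -
  have n1: "tau \<beta> n k j - of_int k \<noteq> 0 \<and> tau \<beta> n k j + of_int k \<noteq> 0" if n: "n \<ge> 1"
  proof (cases "k = 0")
    case True
    then have "tau \<beta> n k j \<noteq> 0"
      using tau_inj[OF assms(1,2), of 0 n 0] tau_zero[OF assms(1) n] assms n by auto
    then show ?thesis
      using True by simp
  next
    case False
    note e = tau_eq[OF assms(1) n assms(2), of k]
    show ?thesis
    proof (intro conjI notI)
      assume "tau \<beta> n k j - of_int k = 0"
      then have "tau \<beta> n k j = of_int k" by simp
      with e have "\<beta> * (2 * real n + 2) * of_int k = 0" by (simp add: algebra_simps)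
      then show False using False assms(1) by simp
    next
      assume "tau \<beta> n k j + of_int k = 0"
      then have "tau \<beta> n k j = - of_int k" by simp
      with e have "\<beta> * (2 * real n) * of_int k = 0" by (simp add: algebra_simps)
      then show False using False assms(1) n by simp
    qed
  qed
  show "n \<ge> 1 \<Longrightarrow> tau \<beta> n k j + of_int k \<noteq> 0"
    using n1 by blast
  show "tau \<beta> n k j - of_int k \<noteq> 0"
  proof (cases "n = 0")
    case True
    then have "tau \<beta> n k j * (tau \<beta> n k j - of_int k) = \<beta>"
      using tau_eq_0[OF assms(1), of j k] assms by auto
    then show ?thesis using assms(1) by auto
  qed (use n1 in auto)
qed

text \<open>After division by t the cubic reads t^2 = k^2 + beta (2n + 1) + beta k/t. For fixed t
  the right-hand side tends to infinity with |k| or n, since k^2 dominates the linear term.\<close>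

lemma finite_tau_fiber:
  assumes "\<beta> > 0" "t \<noteq> 0"
  shows "finite {(n, k, j). (n, k, j) \<in> modes \<and> tau \<beta> n k j = t}"
proof -
  \<comment> \<open>The threshold beyond which k^2 outweighs t^2 + beta |k|/|t|. It also covers n =
    0, where k is t or t - beta/t.\<close>
  define r where "r = \<bar>t\<bar> + \<beta> / \<bar>t\<bar>"
  have r: "r > 0" "\<bar>t\<bar> \<le> r" "r * \<bar>t\<bar> = t\<^sup>2 + \<beta>" using assms by (auto simp: r_def add_pos_pos distrib_right power2_eq_square)
  have bound: "\<bar>real_of_int k\<bar> \<le> r \<and> real n \<le> (t\<^sup>2 + r * r) / \<beta>"
    if m: "(n, k, j) \<in> modes" "tau \<beta> n k j = t" for n k j
  proof (cases "n = 0")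
    case True
    have "\<bar>real_of_int k\<bar> \<le> r"
    proof (cases "j = 0")
      case True
      then have "t = of_int k"
        using m \<open>n = 0\<close> by (simp add: tau_def)
      then show ?thesis using r(2) by simp
    next
      case False
      then have "t * (t - of_int k) = \<beta>"
        using m tau_eq_0[OF assms(1), of j k] True by (auto simp: modes_def)
      then have "of_int k * t = t\<^sup>2 - \<beta>"
        by (simp add: algebra_simps power2_eq_square)
      then have "\<bar>real_of_int k\<bar> * \<bar>t\<bar> \<le> r * \<bar>t\<bar>"
        unfolding r(3) abs_mult[symmetric] using assms(1) by (auto intro: abs_leI)
      then show ?thesis using assms(2) by simp
    qed
    then show ?thesis using True assms r by simp
  next
    case False
    then have "t * (t\<^sup>2 - (of_int k)\<^sup>2) = \<beta> * (2 * real n + 1) * t + \<beta> * of_int k"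
      using tau_eq[OF assms(1), of n j k] m by (auto simp: modes_def)
    then have e: "t\<^sup>2 = (of_int k)\<^sup>2 + \<beta> * (2 * real n + 1) + \<beta> * of_int k / t"
      using assms(2) by (simp add: field_simps power2_eq_square)
    have kt: "\<bar>\<beta> * of_int k / t\<bar> = (r - \<bar>t\<bar>) * \<bar>real_of_int k\<bar>"
      using assms by (simp add: r_def abs_mult)
    \<comment> \<open>Otherwise k^2 > r |k| = |t| |k| + (beta/|t|) |k| >= t^2 + |beta k/t|, against
      the divided cubic.\<close>
    have "\<bar>real_of_int k\<bar> \<le> r"
    proof (rule ccontr)
      assume "\<not> \<bar>real_of_int k\<bar> \<le> r"
      then have "\<bar>real_of_int k\<bar> > r" by simp
      then have "\<bar>t\<bar> * \<bar>t\<bar> \<le> \<bar>t\<bar> * \<bar>real_of_int k\<bar>" "\<bar>real_of_int k\<bar> * \<bar>real_of_int k\<bar> > r * \<bar>real_of_int k\<bar>"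
        using r by (intro mult_left_mono mult_strict_right_mono; linarith)+
      then have "t\<^sup>2 + (r - \<bar>t\<bar>) * \<bar>real_of_int k\<bar> < (real_of_int k)\<^sup>2"
        by (simp add: power2_eq_square algebra_simps)
      moreover have "\<beta> * (2 * real n + 1) > 0"
        using assms(1) by (intro mult_pos_pos) auto
      ultimately show False using e kt by linarith
    qed
    moreover have "\<beta> * real n \<le> t\<^sup>2 + r * r"
    proof -
      have "(r - \<bar>t\<bar>) * \<bar>real_of_int k\<bar> \<le> r * r"
        using r calculation by (intro mult_mono) auto
      moreover have "\<beta> * (2 * real n + 1) \<ge> \<beta> * real n"
        using assms(1) by (intro mult_left_mono) auto
      ultimately show ?thesis
        using e kt zero_le_power2[of "real_of_int k"] by linarith
    qed
    ultimately show ?thesis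
      using assms(1) by (simp add: pos_le_divide_eq mult.commute)
  qed
  have "{(n, k, j). (n, k, j) \<in> modes \<and> tau \<beta> n k j = t} \<subseteq>
      {.. nat \<lfloor>(t\<^sup>2 + r * r) / \<beta>\<rfloor>} \<times> {- \<lfloor>r\<rfloor>..\<lfloor>r\<rfloor>} \<times> signs"
  proof (rule subsetI)
    fix z assume z: "z \<in> {(n, k, j). (n, k, j) \<in> modes \<and> tau \<beta> n k j = t}"
    obtain n k j where zeq: "z = (n, k, j)" by (cases z)
    then have m: "(n, k, j) \<in> modes" "tau \<beta> n k j = t"
      using z by auto
    then have "\<bar>real_of_int k\<bar> \<le> r" "real n \<le> (t\<^sup>2 + r * r) / \<beta>"
      using bound by blast+
    then have "\<bar>k\<bar> \<le> \<lfloor>r\<rfloor>" "int n \<le> \<lfloor>(t\<^sup>2 + r * r) / \<beta>\<rfloor>"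
      by (simp_all add: le_floor_iff)
    then show "z \<in> {.. nat \<lfloor>(t\<^sup>2 + r * r) / \<beta>\<rfloor>} \<times> {- \<lfloor>r\<rfloor>..\<lfloor>r\<rfloor>} \<times> signs"
      using m(1) unfolding zeq modes_def by (simp add: abs_le_iff le_nat_iff)
  qed
  then show ?thesis
    by (rule finite_subset) auto
qed

text \<open>
  In each of the three slots a Hermite function is multiplied by a fixed vector of length $(2\pi)^{-1/2}$: the slots
  \<open>-1\<close>, \<open>0\<close> and \<open>1\<close> correspond to $u_2-\eta$, $u_1$ and $u_2+\eta$. For \<open>n = 0\<close> there is no Hermite
  function of index \<open>n - 1\<close>, and the slot \<open>-1\<close> is used for the remaining field in the direction
  $\eta+u_2$, with $\psi_0$.
\<close>

definition slot_dir :: "nat \<Rightarrow> int \<Rightarrow> complex ^ 3" where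
  "slot_dir n s =
     (if s = 0 then of_real (1 / sqrt (2 * pi)) *s vector [0, 1, 0]
      else if s = -1 \<and> n \<noteq> 0 then of_real (1 / sqrt (4 * pi)) *s vector [-1, 0, 1]
      else of_real (1 / sqrt (4 * pi)) *s vector [1, 0, 1])"

text \<open>The conversion \<open>nat\<close> sends the missing index -1 to 0, which is the Hermite
  function carried by the slot -1 when n = 0.\<close>

definition slot_index :: "nat \<Rightarrow> int \<Rightarrow> nat" where
  "slot_index n s = nat (int n + s)"

lemma slot_index_simps [simp]:
  "slot_index n 0 = n" "slot_index n 1 = Suc n" "slot_index n (-1) = n - 1"
  by (auto simp: slot_index_def)

definition slot :: "real \<Rightarrow> nat \<Rightarrow> int \<Rightarrow> int \<Rightarrow> vfield" where
  "slot \<beta> n k s = (\<lambda>(x, y). (of_real (psi \<beta> (slot_index n s) x) * cis (of_int k * y)) *s slot_dir n s)"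

text \<open>Row j of the change of basis from slots to eigenvectors, with the cases of
  \<open>Psi\<close>. The number D is \<open>Cnorm\<close> without its factor (2 pi)^(-1/2), which
  is part of the slots.\<close>

definition slot_coef :: "real \<Rightarrow> nat \<Rightarrow> int \<Rightarrow> int \<Rightarrow> int \<Rightarrow> complex" where
  "slot_coef \<beta> n k j s =
     (if n = 0 \<and> j = 0 then (if s = -1 then 1 else 0)
      else if k = 0 \<and> j = 0 then
        (if s = 0 then 0
         else if s = -1 then of_real (sqrt ((real n + 1) / (2 * real n + 1)))
         else of_real (- sqrt (real n / (2 * real n + 1))))
      else
        let t = tau \<beta> n k j; K = of_int k;
            D = (\<beta> * real n / (t + K)\<^sup>2 + \<beta> * (real n + 1) / (t - K)\<^sup>2 + 1) powr (- 1 / 2)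
        in if s = 0 then of_real D
           else if s = -1 then \<i> * of_real (D * sqrt (\<beta> * real n) / (t + K))
           else \<i> * of_real (D * sqrt (\<beta> * (real n + 1)) / (t - K)))"

lemma Psi_eq_sum_slots:
  assumes "\<beta> > 0"
  shows "Psi \<beta> n k j z = (\<Sum>s\<in>signs. slot_coef \<beta> n k j s *s slot \<beta> n k s z)"
proof -
  obtain x y where z: "z = (x, y)" by force
  have p4: "sqrt (4 * pi) = sqrt 2 * sqrt (2 * pi)" "sqrt (2 * pi) > 0"
    by (subst real_sqrt_mult[symmetric]) simp_all
  consider "n = 0 \<and> j = 0" | "\<not> (n = 0 \<and> j = 0)" "k = 0 \<and> j = 0" | "\<not> (n = 0 \<and> j = 0)" "\<not> (k = 0 \<and> j = 0)"
    by blast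
  then show ?thesis
  proof cases
    case 1
    then show ?thesis
      by (simp add: z Psi_def slot_def slot_coef_def slot_dir_def vec_eq_iff forall_3 mult_ac)
  next
    case 2
    define m where "m = 2 * real n + 1"
    have m: "m > 0" "sqrt (2 * pi * m) = sqrt (2 * pi) * sqrt m"
      by (auto simp: m_def real_sqrt_mult)
    define X S M A B where "X = sqrt (2 * pi)" and "S = sqrt 2" and "M = sqrt m" and "A = sqrt (real n + 1)" and "B = sqrt (real n)"
    have nz: "X \<noteq> 0" "S \<noteq> 0" "M \<noteq> 0"
      using m by (simp_all add: X_def S_def M_def)
    have j: "slot_coef \<beta> n k j 0 = 0" "slot_coef \<beta> n k j (-1) = of_real (A / M)" "slot_coef \<beta> n k j 1 = of_real (- (B / M))"
      using 2 by (simp_all add: slot_coef_def A_def B_def M_def m_def real_sqrt_divide)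
    define P Q where "P = psi \<beta> (n - 1) x" and "Q = psi \<beta> (Suc n) x"
    have lhs: "Psi \<beta> n k j z = of_real (1 / (X * M)) *s vector [of_real (- (A / S) * P - B / S * Q), 0, of_real (A / S * P - B / S * Q)]"
      using 2 m by (simp add: z Psi_def m_def[symmetric] real_sqrt_divide X_def M_def A_def B_def S_def P_def Q_def)
    have rhs: "slot \<beta> n k (-1) z = of_real P *s (of_real (1 / (S * X)) *s vector [-1, 0, 1])"
      "slot \<beta> n k 1 z = of_real Q *s (of_real (1 / (S * X)) *s vector [1, 0, 1])"
      using 2 by (simp_all add: z slot_def slot_dir_def p4 X_def S_def P_def Q_def)
    show ?thesis
      using nz unfolding lhs by (simp add: j rhs vec_eq_iff forall_3 field_simps)
  next
    case 3
    define t K D where "t = tau \<beta> n k j" and "K = real_of_int k"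
      and "D = (\<beta> * real n / (t + K)\<^sup>2 + \<beta> * (real n + 1) / (t - K)\<^sup>2 + 1) powr (- 1 / 2)"
    have C: "Cnorm \<beta> n k j = D / sqrt (2 * pi)"
    proof -
      have "(2 * pi) powr (- 1 / 2) = 1 / sqrt (2 * pi)"
        using powr_minus_divide[of "2 * pi" "1 / 2"] powr_half_sqrt[of "2 * pi"] by simp
      then show ?thesis
        unfolding Cnorm_def Let_def D_def t_def K_def by simp
    qed
    define a b where "a = sqrt (\<beta> * real n / 2)" and "b = sqrt (\<beta> * (real n + 1) / 2)"
    have ab: "sqrt (\<beta> * real n) = sqrt 2 * a" "sqrt (\<beta> * (real n + 1)) = sqrt 2 * b"
      by (simp_all add: a_def b_def real_sqrt_divide)
    have coef: "slot_coef \<beta> n k j 0 = of_real (sqrt (2 * pi)) * of_real (D / sqrt (2 * pi))"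
      "slot_coef \<beta> n k j (-1) = of_real (sqrt (4 * pi)) * (of_real (D / sqrt (2 * pi)) * (\<i> / of_real (t + K) * of_real a))"
      "slot_coef \<beta> n k j 1 = of_real (sqrt (4 * pi)) * (of_real (D / sqrt (2 * pi)) * (\<i> / of_real (t - K) * of_real b))"
    proof -
      define X S where "X = sqrt (2 * pi)" and "S = sqrt 2"
      have "X \<noteq> 0" by (simp add: X_def)
      then show "slot_coef \<beta> n k j 0 = of_real (sqrt (2 * pi)) * of_real (D / sqrt (2 * pi))"
        "slot_coef \<beta> n k j (-1) = of_real (sqrt (4 * pi)) * (of_real (D / sqrt (2 * pi)) * (\<i> / of_real (t + K) * of_real a))"
        "slot_coef \<beta> n k j 1 = of_real (sqrt (4 * pi)) * (of_real (D / sqrt (2 * pi)) * (\<i> / of_real (t - K) * of_real b))"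
        unfolding slot_coef_def if_not_P[OF 3(1)] if_not_P[OF 3(2)] Let_def t_def[symmetric] K_def[symmetric]
          D_def[symmetric] ab p4(1) X_def[symmetric] S_def[symmetric]
        by simp_all
    qed
    define X Y E where "X = complex_of_real (sqrt (2 * pi))" and "Y = complex_of_real (sqrt (4 * pi))" and "E = cis (K * y)"
    have nz: "X \<noteq> 0" "Y \<noteq> 0" by (simp_all add: X_def Y_def)
    define P Q R where "P = complex_of_real (psi \<beta> (n - 1) x)" and "Q = complex_of_real (psi \<beta> (Suc n) x)" and "R = complex_of_real (psi \<beta> n x)"
    define p q d where "p = \<i> / of_real (t + K) * of_real a" and "q = \<i> / of_real (t - K) * of_real b" and "d = complex_of_real (D / sqrt (2 * pi))"
    \<comment> \<open>At n = 0 the slot -1 points in another direction than the first term of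
      \<open>Psi\<close>; this is harmless because its coefficient p is 0.\<close>
    have p0: "n = 0 \<Longrightarrow> p = 0" by (simp add: p_def a_def)
    have lhs: "Psi \<beta> n k j z = (d * E) *s vector [- (p * P) + q * Q, R, p * P + q * Q]"
      unfolding Psi_def z prod.case if_not_P[OF 3(1)] if_not_P[OF 3(2)]
      by (simp add: Let_def C t_def[symmetric] K_def[symmetric] a_def[symmetric] b_def[symmetric]
          p_def q_def d_def P_def Q_def R_def E_def mult.assoc)
    have rhs: "slot \<beta> n k (-1) z = (P * E) *s ((1 / Y) *s vector [if n = 0 then 1 else -1, 0, 1])"
      "slot \<beta> n k 0 z = (R * E) *s ((1 / X) *s vector [0, 1, 0])"
      "slot \<beta> n k 1 z = (Q * E) *s ((1 / Y) *s vector [1, 0, 1])"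
      by (simp_all add: z slot_def slot_dir_def X_def Y_def P_def Q_def R_def E_def K_def)
    have "(\<Sum>s\<in>signs. slot_coef \<beta> n k j s *s slot \<beta> n k s z) =
        slot_coef \<beta> n k j (-1) *s slot \<beta> n k (-1) z + (slot_coef \<beta> n k j 0 *s slot \<beta> n k 0 z + slot_coef \<beta> n k j 1 *s slot \<beta> n k 1 z)"
      by simp
    then show ?thesis
      using nz p0 unfolding lhs coef[folded X_def Y_def p_def q_def d_def] rhs
      by (cases "n = 0") (simp_all add: vec_eq_iff forall_3 field_simps)
  qed
qed

text \<open>
  On the slots, $L$ acts by a skew-Hermitian matrix; these are the rows of the corresponding
  eigenvector equation. They imply the orthogonality for distinct eigenvalues.
\<close>

lemma slot_coef_relations:
  fixes n :: nat and k :: int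
  assumes "\<beta> > 0" "j \<in> signs"
  defines "\<epsilon> \<equiv> if n = 0 then - 1 else 1 :: real"
  shows "\<i> * of_real (tau \<beta> n k j - of_int k) * slot_coef \<beta> n k j 1 = - of_real (sqrt (\<beta> * (real n + 1))) * slot_coef \<beta> n k j 0"
    and "\<i> * of_real (tau \<beta> n k j + \<epsilon> * of_int k) * slot_coef \<beta> n k j (-1) = - of_real (sqrt (\<beta> * real n)) * slot_coef \<beta> n k j 0"
    and "\<i> * of_real (tau \<beta> n k j) * slot_coef \<beta> n k j 0 =
      of_real (sqrt (\<beta> * real n)) * slot_coef \<beta> n k j (-1) + of_real (sqrt (\<beta> * (real n + 1))) * slot_coef \<beta> n k j 1"
    and "(\<Sum>s\<in>signs. slot_coef \<beta> n k j s * cnj (slot_coef \<beta> n k j s)) = 1"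
proof -
  let ?R = "\<lambda>c1 c0 c2. \<i> * of_real (tau \<beta> n k j - of_int k) * c2 = - of_real (sqrt (\<beta> * (real n + 1))) * c0 \<and>
    \<i> * of_real (tau \<beta> n k j + \<epsilon> * of_int k) * c1 = - of_real (sqrt (\<beta> * real n)) * c0 \<and>
    \<i> * of_real (tau \<beta> n k j) * c0 = of_real (sqrt (\<beta> * real n)) * c1 + of_real (sqrt (\<beta> * (real n + 1))) * c2 \<and>
    c1 * cnj c1 + c0 * cnj c0 + c2 * cnj c2 = 1"
  have "?R (slot_coef \<beta> n k j (-1)) (slot_coef \<beta> n k j 0) (slot_coef \<beta> n k j 1)"
  proof -
    consider "n = 0 \<and> j = 0" | "n \<noteq> 0" "k = 0 \<and> j = 0" | "\<not> (n = 0 \<and> j = 0)" "\<not> (k = 0 \<and> j = 0)"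
      by blast
    then show ?thesis
    proof cases
      \<comment> \<open>Here tau = k, and \<epsilon> = -1 makes the factor tau + \<epsilon> k
        vanish; so the only nonzero coefficient may stand in the slot -1.\<close>
      case 1
      then show ?thesis by (simp add: slot_coef_def \<epsilon>_def tau_def)
    next
      case 2
      define m where "m = 2 * real n + 1"
      have m: "m > 0" "(real n + 1) / m + real n / m = 1" by (auto simp: m_def simp flip: add_divide_distrib)
      define u v where "u = sqrt ((real n + 1) / m)" and "v = sqrt (real n / m)"
      have "sqrt (\<beta> * real n) * u = sqrt (\<beta> * (real n + 1)) * v" "u * u + v * v = 1"
        using m by (simp_all add: u_def v_def mult_ac flip: real_sqrt_mult)
      then have "of_real (sqrt (\<beta> * real n)) * complex_of_real u = of_real (sqrt (\<beta> * (real n + 1))) * complex_of_real v"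
        "complex_of_real u * complex_of_real u + complex_of_real v * complex_of_real v = 1"
        by (metis of_real_mult of_real_add of_real_1)+
      moreover have "tau \<beta> n k j = 0"
        using tau_zero[OF assms(1), of n] 2 by simp
      ultimately show ?thesis
        using 2 unfolding slot_coef_def m_def[symmetric] u_def[symmetric] v_def[symmetric] by simp
    next
      case 3
      define t K where "t = tau \<beta> n k j" and "K = real_of_int k"
      define X where "X = \<beta> * real n / (t + K)\<^sup>2 + \<beta> * (real n + 1) / (t - K)\<^sup>2 + 1"
      define D where "D = X powr (- 1 / 2)"
      define p q where "p = sqrt (\<beta> * real n)" and "q = sqrt (\<beta> * (real n + 1))"
      have pq: "p * p = \<beta> * real n" "q * q = \<beta> * (real n + 1)"
        using assms(1) by (auto simp: p_def q_def)
      have p0: "p = 0" if "n = 0" using that by (simp add: p_def)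
      have X: "X > 0"
        using assms(1) unfolding X_def by (intro add_nonneg_pos add_nonneg_nonneg divide_nonneg_nonneg) auto
      have D: "D * D * X = 1"
      proof -
        have "D = 1 / sqrt X"
          using X powr_minus_divide[of X "1 / 2"] powr_half_sqrt[of X] by (simp add: D_def)
        then show ?thesis using X by simp
      qed
      have tK: "t - K \<noteq> 0" "n \<ge> 1 \<Longrightarrow> t + K \<noteq> 0"
        using tau_ne_k[OF assms(1,2) 3] by (auto simp: t_def K_def)
      \<comment> \<open>The characteristic equation in partial fractions, obtained by dividing the
        cubic by (t + K)(t - K).\<close>
      have sum: "t = p * (p / (t + K)) + q * (q / (t - K))"
      proof (cases "n = 0")
        case True
        then have "t * (t - K) = \<beta>"
          using tau_eq_0[OF assms(1), of j k] 3 assms(2) by (auto simp: t_def K_def)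
        then show ?thesis
          using True p0 tK(1) pq by (simp add: field_simps)
      next
        case False
        then have "t * (t\<^sup>2 - K\<^sup>2) = \<beta> * (2 * real n + 1) * t + \<beta> * K"
          using tau_eq[OF assms(1) _ assms(2), of n k] by (simp add: t_def K_def)
        then have "t * ((t + K) * (t - K)) = (p * p) * (t - K) + (q * q) * (t + K)"
          unfolding pq by (simp add: power2_eq_square algebra_simps)
        then have "t = ((p * p) * (t - K) + (q * q) * (t + K)) / ((t + K) * (t - K))"
          using tK False by (simp add: nonzero_eq_divide_eq)
        then show ?thesis
          using tK False by (simp add: add_divide_distrib)
      qed
      have eqs: "slot_coef \<beta> n k j 0 = of_real D" "slot_coef \<beta> n k j (-1) = \<i> * of_real (D * p / (t + K))"
        "slot_coef \<beta> n k j 1 = \<i> * of_real (D * q / (t - K))"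
        unfolding slot_coef_def if_not_P[OF 3(1)] if_not_P[OF 3(2)]
        by (simp_all add: Let_def t_def K_def D_def X_def p_def q_def)
      have r1: "(t - K) * (D * q / (t - K)) = q * D"
        using tK(1) by simp
      \<comment> \<open>The sign \<epsilon> differs from 1 only for n = 0, and then p = 0 makes both
        sides 0.\<close>
      have r2: "(t + \<epsilon> * K) * (D * p / (t + K)) = p * D"
        using tK(2) p0 by (cases "n = 0") (simp_all add: \<epsilon>_def)
      have r3: "t * D = p * (D * p / (t + K)) + q * (D * q / (t - K))"
        using arg_cong[OF sum, of "\<lambda>x. x * D"] by (simp add: algebra_simps)
      have r4: "(D * p / (t + K)) * (D * p / (t + K)) + D * D + (D * q / (t - K)) * (D * q / (t - K)) = 1"
      proof -
        have "(D * p / (t + K)) * (D * p / (t + K)) + D * D + (D * q / (t - K)) * (D * q / (t - K)) =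
          D * D * ((p * p) / (t + K)\<^sup>2 + 1 + (q * q) / (t - K)\<^sup>2)"
          by (simp add: power2_eq_square algebra_simps add_divide_distrib)
        also have "\<dots> = D * D * X" unfolding pq X_def by (simp add: algebra_simps)
        finally show ?thesis using D by simp
      qed
      have ii: "(\<i> * of_real x) * cnj (\<i> * of_real x) = of_real (x * x)" "\<i> * of_real x * (\<i> * of_real y) = - of_real (x * y)" for x y
        by (simp_all add: algebra_simps)
      show ?thesis
        unfolding eqs t_def[symmetric] K_def[symmetric] p_def[symmetric] q_def[symmetric] ii r1 r2
      proof (intro conjI)
        show "\<i> * complex_of_real t * complex_of_real D =
            complex_of_real p * (\<i> * complex_of_real (D * p / (t + K))) + complex_of_real q * (\<i> * complex_of_real (D * q / (t - K)))"
          using arg_cong[OF r3, of "\<lambda>x. \<i> * of_real x"] by (simp add: algebra_simps)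
        show "complex_of_real (D * p / (t + K) * (D * p / (t + K))) + complex_of_real D * cnj (complex_of_real D) +
            complex_of_real (D * q / (t - K) * (D * q / (t - K))) = 1"
          using arg_cong[OF r4, of complex_of_real] by simp
      qed simp_all
    qed
  qed
  then show "\<i> * of_real (tau \<beta> n k j - of_int k) * slot_coef \<beta> n k j 1 = - of_real (sqrt (\<beta> * (real n + 1))) * slot_coef \<beta> n k j 0"
    "\<i> * of_real (tau \<beta> n k j + \<epsilon> * of_int k) * slot_coef \<beta> n k j (-1) = - of_real (sqrt (\<beta> * real n)) * slot_coef \<beta> n k j 0"
    "\<i> * of_real (tau \<beta> n k j) * slot_coef \<beta> n k j 0 =
      of_real (sqrt (\<beta> * real n)) * slot_coef \<beta> n k j (-1) + of_real (sqrt (\<beta> * (real n + 1))) * slot_coef \<beta> n k j 1"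
    "(\<Sum>s\<in>signs. slot_coef \<beta> n k j s * cnj (slot_coef \<beta> n k j s)) = 1"
    by (simp_all add: add.assoc)
qed

text \<open>The usual argument for a skew-Hermitian matrix: multiplied by i (t - t'), the inner
  product of two rows vanishes by the eigenvector relations, and the eigenvalues are real and
  distinct.\<close>

lemma slot_coef_orthonormal:
  assumes "\<beta> > 0" "i \<in> signs" "j \<in> signs"
  shows "(\<Sum>s\<in>signs. slot_coef \<beta> n k i s * cnj (slot_coef \<beta> n k j s)) = (if i = j then 1 else 0)"
proof (cases "i = j")
  case True
  then show ?thesis using slot_coef_relations(4)[OF assms(1,2)] by simp
next
  case False
  show ?thesis
  proof (cases "n = 0 \<and> (i = 0 \<or> j = 0)")
    case True
    \<comment> \<open>The supports are disjoint: for n = 0 the row j = 0 lives on the slot -1, where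
      the rows j = -1, 1 have the factor sqrt 0.\<close>
    then show ?thesis
      using False by (auto simp: slot_coef_def Let_def)
  next
    case ne: False
    define t t' where "t = tau \<beta> n k i" and "t' = tau \<beta> n k j"
    define a c b where "a = slot_coef \<beta> n k i (-1)" and "c = slot_coef \<beta> n k i 0" and "b = slot_coef \<beta> n k i 1"
    define a' c' b' where "a' = cnj (slot_coef \<beta> n k j (-1))" and "c' = cnj (slot_coef \<beta> n k j 0)" and "b' = cnj (slot_coef \<beta> n k j 1)"
    define p q e K where "p = complex_of_real (sqrt (\<beta> * real n))" and "q = complex_of_real (sqrt (\<beta> * (real n + 1)))"
      and "e = complex_of_real (if n = 0 then - 1 else 1)" and "K = complex_of_int k"
    have r: "\<i> * (of_real t - K) * b = - q * c" "\<i> * (of_real t + e * K) * a = - p * c" "\<i> * of_real t * c = p * a + q * b"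
      using slot_coef_relations(1-3)[OF assms(1,2), of n k]
      by (simp_all add: t_def a_def b_def c_def p_def q_def e_def K_def)
    have "cnj (\<i> * (of_real t' - K) * cnj b') = cnj (- q * cnj c')" "cnj (\<i> * (of_real t' + e * K) * cnj a') = cnj (- p * cnj c')"
      "cnj (\<i> * of_real t' * cnj c') = cnj (p * cnj a' + q * cnj b')"
      using slot_coef_relations(1-3)[OF assms(1,3), of n k]
      by (simp_all add: t'_def a'_def b'_def c'_def p_def q_def e_def K_def)
    then have r': "- \<i> * (of_real t' - K) * b' = - q * c'" "- \<i> * (of_real t' + e * K) * a' = - p * c'" "- \<i> * of_real t' * c' = p * a' + q * b'"
      by (simp_all add: p_def q_def e_def K_def)
    have "\<i> * (of_real t - of_real t') * (a * a' + c * c' + b * b') =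
        (\<i> * (of_real t + e * K) * a) * a' + a * (- \<i> * (of_real t' + e * K) * a')
        + (\<i> * of_real t * c) * c' + c * (- \<i> * of_real t' * c')
        + (\<i> * (of_real t - K) * b) * b' + b * (- \<i> * (of_real t' - K) * b')"
      by (simp add: algebra_simps)
    also have "\<dots> = 0"
      unfolding r r' by (simp add: algebra_simps)
    finally have "\<i> * (of_real t - of_real t') * (a * a' + c * c' + b * b') = 0" .
    moreover have "t \<noteq> t'"
      using tau_inj[OF assms(1-3) False] ne by (auto simp: t_def t'_def)
    ultimately have "a * a' + c * c' + b * b' = 0"
      by simp
    then show ?thesis
      using False by (simp add: a_def b_def c_def a'_def b'_def c'_def add.assoc)
  qed
qed

text \<open>A square matrix with orthonormal rows has orthonormal columns. The map \<sigma>
  transports the index set to the type \<open>3\<close>, over which matrices are available.\<close>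

lemma slot_coef_orthonormal_columns:
  assumes "\<beta> > 0" "r \<in> signs" "s \<in> signs"
  shows "(\<Sum>j\<in>signs. slot_coef \<beta> n k j r * cnj (slot_coef \<beta> n k j s)) = (if r = s then 1 else 0)"
proof -
  define \<sigma> :: "3 \<Rightarrow> int" where "\<sigma> i = (if i = 1 then -1 else if i = 2 then 0 else 1)" for i
  have \<sigma>: "\<sigma> 1 = -1" "\<sigma> 2 = 0" "\<sigma> 3 = 1" "\<sigma> i \<in> signs" for i
    by (auto simp: \<sigma>_def)
  have sum: "(\<Sum>i\<in>UNIV. f (\<sigma> i)) = (\<Sum>s\<in>signs. f s)" for f :: "int \<Rightarrow> complex"
    by (simp add: sum_3 \<sigma> add.assoc)
  have inj: "\<sigma> i = \<sigma> j \<longleftrightarrow> i = j" for i j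
    using exhaust_3[of i] exhaust_3[of j] by (auto simp: \<sigma>_def split: if_splits)
  define A B :: "complex ^ 3 ^ 3" where "A = (\<chi> j s. slot_coef \<beta> n k (\<sigma> j) (\<sigma> s))"
    and "B = (\<chi> s j. cnj (slot_coef \<beta> n k (\<sigma> j) (\<sigma> s)))"
  have "A ** B = mat 1"
    using slot_coef_orthonormal[OF assms(1)] \<sigma>(4)
    by (simp add: vec_eq_iff matrix_matrix_mult_def A_def B_def mat_def inj sum[of "\<lambda>s. slot_coef \<beta> n k _ s * cnj (slot_coef \<beta> n k _ s)"])
  then have "B ** A = mat 1"
    by (rule matrix_left_right_inverse[THEN iffD1])
  moreover obtain i l where "r = \<sigma> i" "s = \<sigma> l"
    using assms(2,3) \<sigma>(1-3) by (metis insertE singletonD)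
  ultimately show ?thesis
    using sum[of "\<lambda>j. slot_coef \<beta> n k j r * cnj (slot_coef \<beta> n k j s)"]
    by (auto simp: vec_eq_iff matrix_matrix_mult_def A_def B_def mat_def inj mult.commute)
qed

lemma norm_slot_coef_le:
  assumes "\<beta> > 0" "j \<in> signs" "s \<in> signs"
  shows "norm (slot_coef \<beta> n k j s) \<le> 1"
    and "(\<Sum>s\<in>signs. (norm (slot_coef \<beta> n k j s))\<^sup>2) = 1"
proof -
  have "complex_of_real (\<Sum>s\<in>signs. (norm (slot_coef \<beta> n k j s))\<^sup>2) = 1"
    using slot_coef_relations(4)[OF assms(1,2), of n k] by (simp only: of_real_sum complex_norm_square)
  then show *: "(\<Sum>s\<in>signs. (norm (slot_coef \<beta> n k j s))\<^sup>2) = 1"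
    by (simp only: of_real_eq_1_iff)
  have "(norm (slot_coef \<beta> n k j s))\<^sup>2 \<le> 1"
    unfolding *[symmetric] using assms(3) by (intro member_le_sum) auto
  then show "norm (slot_coef \<beta> n k j s) \<le> 1"
    by (simp add: power_le_one_iff)
qed

section \<open>Density of the span of the slots\<close>

lemma square_integrable_iff_L2:
  "f \<in> L2 \<longleftrightarrow> periodic_snd f \<and> square_integrable f"
  by (auto simp: L2_def square_integrable_def)

lemma slot_eq_hermite_exp: "slot \<beta> n k s = (\<lambda>z. hermite_exp \<beta> (slot_index n s) k z *s slot_dir n s)"
  by (simp add: slot_def hermite_exp_def fun_eq_iff)

lemma vec3_norm_square: "(norm (v :: complex ^ 3))\<^sup>2 = (norm (v $ 1))\<^sup>2 + (norm (v $ 2))\<^sup>2 + (norm (v $ 3))\<^sup>2"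
  by (simp add: norm_vec_def L2_set_def sum_3 add_nonneg_nonneg)

lemma borel_measurable_vec_nth: "(\<lambda>v :: complex ^ 3. v $ i) \<in> borel_measurable borel"
  by (intro borel_measurable_continuous_onI continuous_intros)

lemma square_integrable_component:
  fixes f :: vfield
  assumes "square_integrable f"
  shows "square_integrable (\<lambda>z. f z $ i)"
proof (rule square_integrable_bound)
  show "(\<lambda>z. f z $ i) \<in> borel_measurable borel"
    using assms measurable_compose[OF _ borel_measurable_vec_nth] by (auto simp: square_integrable_def)
  show "integrable RT (\<lambda>z. (norm (f z))\<^sup>2)"
    using assms by (simp add: square_integrable_def)
qed (rule Finite_Cartesian_Product.norm_nth_le)

text \<open>Finite combinations in the very form that \<open>hilbert_basis\<close> asks for, a
  finite index set with coefficients; hence the small closure lemmas.\<close>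

definition field_span :: "'i set \<Rightarrow> ('i \<Rightarrow> vfield) \<Rightarrow> vfield set" where
  "field_span I e = {f. \<exists>F c. finite F \<and> F \<subseteq> I \<and> f = (\<lambda>z. \<Sum>i\<in>F. c i *s e i z)}"

lemma field_span_base: "i \<in> I \<Longrightarrow> e i \<in> field_span I e"
  unfolding field_span_def by (intro CollectI exI[of _ "{i}"] exI[of _ "\<lambda>_. 1"]) simp

lemma field_span_mult:
  assumes "f \<in> field_span I e"
  shows "(\<lambda>z. a *s f z) \<in> field_span I e"
proof -
  obtain F c where F: "finite F" "F \<subseteq> I" "f = (\<lambda>z. \<Sum>i\<in>F. c i *s e i z)"
    using assms by (auto simp: field_span_def)
  have "(\<lambda>z. a *s f z) = (\<lambda>z. \<Sum>i\<in>F. (a * c i) *s e i z)"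
    by (simp add: F(3) vec.scale_sum_right)
  then show ?thesis
    unfolding field_span_def using F(1,2) by (intro CollectI exI[of _ F] exI[of _ "\<lambda>i. a * c i"]) simp
qed

lemma field_span_add:
  assumes "f \<in> field_span I e" "g \<in> field_span I e"
  shows "(\<lambda>z. f z + g z) \<in> field_span I e"
proof -
  obtain F c where F: "finite F" "F \<subseteq> I" "f = (\<lambda>z. \<Sum>i\<in>F. c i *s e i z)"
    using assms by (auto simp: field_span_def)
  obtain G d where G: "finite G" "G \<subseteq> I" "g = (\<lambda>z. \<Sum>i\<in>G. d i *s e i z)"
    using assms by (auto simp: field_span_def)
  define h where "h i = (if i \<in> F then c i else 0) + (if i \<in> G then d i else 0)" for i
  have "f z + g z = (\<Sum>i\<in>F \<union> G. h i *s e i z)" for z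
  proof -
    have "f z = (\<Sum>i\<in>F \<union> G. (if i \<in> F then c i else 0) *s e i z)"
      unfolding F(3) using F(1) G(1) by (intro sum.mono_neutral_cong_left) auto
    moreover have "g z = (\<Sum>i\<in>F \<union> G. (if i \<in> G then d i else 0) *s e i z)"
      unfolding G(3) using F(1) G(1) by (intro sum.mono_neutral_cong_left) auto
    ultimately show ?thesis
      by (simp add: h_def vec.scale_left_distrib sum.distrib)
  qed
  then show ?thesis
    unfolding field_span_def using F G by (intro CollectI exI[of _ "F \<union> G"] exI[of _ h]) simp
qed

lemma field_span_zero: "(\<lambda>z. 0) \<in> field_span I e"
  unfolding field_span_def by (intro CollectI exI[of _ "{}"]) simp

lemma field_span_sum:
  assumes "finite A" "\<And>a. a \<in> A \<Longrightarrow> f a \<in> field_span I e"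
  shows "(\<lambda>z. \<Sum>a\<in>A. f a z) \<in> field_span I e"
  using assms
proof (induction A)
  case (insert a A)
  then show ?case
    by (simp add: field_span_add)
qed (simp add: field_span_zero)

abbreviation slot_span :: "real \<Rightarrow> vfield set" where
  "slot_span \<beta> \<equiv> field_span modes (\<lambda>(n, k, s). slot \<beta> n k s)"

lemma slot_span_base: "(n, k, s) \<in> modes \<Longrightarrow> slot \<beta> n k s \<in> slot_span \<beta>"
  using field_span_base[of "(n, k, s)" modes "\<lambda>(n, k, s). slot \<beta> n k s"] by simp

text \<open>The three slot directions form a basis of C^3, and each of them occurs with every
  Hermite index m: slot 0 at level m, slot -1 at level m + 1, and slot 1 at level m - 1.\<close>

lemma slot_span_hermite_exp: "(\<lambda>z. hermite_exp \<beta> m k z *s v) \<in> slot_span \<beta>"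
proof -
  have 0: "(\<lambda>z. hermite_exp \<beta> m k z *s vector [0, 1, 0]) \<in> slot_span \<beta>"
  proof -
    have "(\<lambda>z. of_real (sqrt (2 * pi)) *s slot \<beta> m k 0 z) \<in> slot_span \<beta>"
      by (intro field_span_mult slot_span_base) (simp add: modes_def)
    moreover have "of_real (sqrt (2 * pi)) *s slot \<beta> m k 0 z = hermite_exp \<beta> m k z *s vector [0, 1, 0]" for z
      by (simp add: slot_eq_hermite_exp slot_dir_def vec_eq_iff forall_3)
    ultimately show ?thesis by simp
  qed
  have 1: "(\<lambda>z. hermite_exp \<beta> m k z *s vector [1, 0, 1]) \<in> slot_span \<beta>"
  proof -
    \<comment> \<open>For m = 0 there is no level m - 1; the exceptional slot -1 at level 0 supplies
      exactly this field.\<close>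
    obtain n s where ns: "(n, k, s) \<in> modes" "slot_index n s = m" "s = 1 \<or> n = 0 \<and> s = -1"
    proof (cases m)
      case 0
      then show ?thesis using that[of 0 "-1"] by (simp add: modes_def)
    next
      case (Suc l)
      then show ?thesis using that[of l 1] by (simp add: modes_def)
    qed
    then have "(\<lambda>z. of_real (sqrt (4 * pi)) *s slot \<beta> n k s z) \<in> slot_span \<beta>"
      by (intro field_span_mult slot_span_base)
    moreover have "of_real (sqrt (4 * pi)) *s slot \<beta> n k s z = hermite_exp \<beta> m k z *s vector [1, 0, 1]" for z
      using ns by (auto simp: slot_eq_hermite_exp slot_dir_def vec_eq_iff forall_3)
    ultimately show ?thesis by simp
  qed
  have 2: "(\<lambda>z. hermite_exp \<beta> m k z *s vector [-1, 0, 1]) \<in> slot_span \<beta>"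
  proof -
    have "(\<lambda>z. of_real (sqrt (4 * pi)) *s slot \<beta> (Suc m) k (-1) z) \<in> slot_span \<beta>"
      by (intro field_span_mult slot_span_base) (simp add: modes_def)
    moreover have "of_real (sqrt (4 * pi)) *s slot \<beta> (Suc m) k (-1) z = hermite_exp \<beta> m k z *s vector [-1, 0, 1]" for z
      by (simp add: slot_eq_hermite_exp slot_dir_def vec_eq_iff forall_3)
    ultimately show ?thesis by simp
  qed
  have "(\<lambda>z. v $ 2 *s (hermite_exp \<beta> m k z *s vector [0, 1, 0]) + (((v $ 1 + v $ 3) / 2) *s (hermite_exp \<beta> m k z *s vector [1, 0, 1])
      + ((v $ 3 - v $ 1) / 2) *s (hermite_exp \<beta> m k z *s vector [-1, 0, 1]))) \<in> slot_span \<beta>"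
    by (intro field_span_add field_span_mult 0 1 2)
  moreover have "v $ 2 *s (hermite_exp \<beta> m k z *s vector [0, 1, 0]) + (((v $ 1 + v $ 3) / 2) *s (hermite_exp \<beta> m k z *s vector [1, 0, 1])
      + ((v $ 3 - v $ 1) / 2) *s (hermite_exp \<beta> m k z *s vector [-1, 0, 1])) = hermite_exp \<beta> m k z *s v" for z
    by (simp add: vec_eq_iff forall_3 field_simps)
  ultimately show ?thesis by simp
qed

lemma slot_span_hermite_span:
  assumes "u \<in> hermite_span \<beta>"
  shows "(\<lambda>z. u z *s v) \<in> slot_span \<beta>"
  using assms
proof induction
  case (hermite_span_base m k)
  then show ?case by (rule slot_span_hermite_exp)
next
  case (hermite_span_add u v)
  then show ?case by (simp only: vec.scale_left_distrib field_span_add)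
next
  case (hermite_span_mult u c)
  then show ?case by (simp only: vec.scale_scale[symmetric] field_span_mult)
qed

lemma slots_dense:
  fixes f :: vfield
  assumes "\<beta> > 0" "square_integrable f" "\<epsilon> > 0"
  shows "\<exists>g\<in>slot_span \<beta>. (\<integral>z. (norm (f z - g z))\<^sup>2 \<partial>RT) < \<epsilon>"
proof -
  have "hermite_approx \<beta> (\<lambda>z. f z $ i)" for i
    by (rule hermite_approx_all[OF assms(1) square_integrable_component[OF assms(2)]])
  then have "\<exists>u\<in>hermite_span \<beta>. (\<integral>z. (norm (f z $ i - u z))\<^sup>2 \<partial>RT) < \<epsilon> / 3" for i
    unfolding hermite_approx_def using divide_pos_pos[OF assms(3) zero_less_numeral[of "num.Bit1 num.One"]] by blast
  then obtain u where u: "\<And>i. u i \<in> hermite_span \<beta>" "\<And>i. (\<integral>z. (norm (f z $ i - u i z))\<^sup>2 \<partial>RT) < \<epsilon> / 3"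
    by metis
  define g :: vfield where "g z = u 1 z *s axis 1 1 + (u 2 z *s axis 2 1 + u 3 z *s axis 3 1)" for z
  have "g \<in> slot_span \<beta>"
    unfolding g_def[abs_def] by (intro field_span_add slot_span_hermite_span u)
  moreover have "(\<integral>z. (norm (f z - g z))\<^sup>2 \<partial>RT) < \<epsilon>"
  proof -
    have gi: "g z $ i = u i z" for z i
      using exhaust_3[of i] by (auto simp: g_def axis_def)
    have int: "integrable RT (\<lambda>z. (norm (f z $ i - u i z))\<^sup>2)" for i
      using square_integrable_diff[OF square_integrable_component[OF assms(2)] square_integrable_hermite_span[OF assms(1) u(1)]]
      by (simp add: square_integrable_def)
    have "(\<integral>z. (norm (f z - g z))\<^sup>2 \<partial>RT) =
       (\<integral>z. (norm (f z $ 1 - u 1 z))\<^sup>2 \<partial>RT) + (\<integral>z. (norm (f z $ 2 - u 2 z))\<^sup>2 \<partial>RT) + (\<integral>z. (norm (f z $ 3 - u 3 z))\<^sup>2 \<partial>RT)"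
      using int by (simp add: vec3_norm_square gi)
    also have "\<dots> < \<epsilon> / 3 + \<epsilon> / 3 + \<epsilon> / 3"
      by (intro add_strict_mono u)
    finally show ?thesis by simp
  qed
  ultimately show ?thesis by blast
qed

section \<open>Derivatives of the eigenvectors\<close>

text \<open>Derivatives in closed form. They serve as representatives of the weak derivatives, and
  they show that the components of the eigenvectors are test functions.\<close>

definition slot_pd :: "real \<Rightarrow> nat \<Rightarrow> nat \<Rightarrow> nat \<Rightarrow> int \<Rightarrow> int \<Rightarrow> vfield" where
  "slot_pd \<beta> a b n k s = (\<lambda>(x, y). ((\<i> * of_int k) ^ b * (of_real (dpsi \<beta> a (slot_index n s) x) * cis (of_int k * y))) *s slot_dir n s)"

definition Psi_pd :: "real \<Rightarrow> nat \<Rightarrow> nat \<Rightarrow> nat \<Rightarrow> int \<Rightarrow> int \<Rightarrow> vfield" where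
  "Psi_pd \<beta> a b n k j = (\<lambda>z. \<Sum>s\<in>signs. slot_coef \<beta> n k j s *s slot_pd \<beta> a b n k s z)"

lemma Psi_pd_zero: "\<beta> > 0 \<Longrightarrow> Psi_pd \<beta> 0 0 n k j = Psi \<beta> n k j"
  by (rule ext) (simp add: Psi_pd_def Psi_eq_sum_slots slot_pd_def slot_def split_beta')

lemma bounded_linear_vec_scale: "bounded_linear (\<lambda>c :: complex. c *s (v :: complex ^ 3))"
proof (rule bounded_linearI')
  show "(r *\<^sub>R c) *s v = r *\<^sub>R (c *s v)" for r and c :: complex
    by (simp add: vec_eq_iff)
qed (simp add: vec.scale_left_distrib)

lemma bounded_linear_vec_scale_right: "bounded_linear (\<lambda>v :: complex ^ 3. c *s v)"
proof (rule bounded_linearI')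
  show "c *s (r *\<^sub>R v) = r *\<^sub>R (c *s v)" for r and v :: "complex ^ 3"
    by (simp add: vec_eq_iff)
qed (simp add: vec.scale_right_distrib)

lemma norm_vec_scale: "norm (c *s (v :: complex ^ 3)) = norm c * norm v"
  by (rule power2_eq_imp_eq) (simp_all add: power_mult_distrib norm_vec_def L2_set_def sum_nonneg norm_mult sum_distrib_left)

lemma norm_slot_dir: "norm (slot_dir n s) = 1 / sqrt (2 * pi)"
proof -
  have n: "norm (vector [0, 1, 0] :: complex ^ 3) = 1" "norm (vector [1, 0, 1] :: complex ^ 3) = sqrt 2"
    "norm (vector [-1, 0, 1] :: complex ^ 3) = sqrt 2"
    by (simp_all add: norm_vec_def L2_set_def sum_3)
  have p4: "sqrt (4 * pi) = sqrt 2 * sqrt (2 * pi)"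
    by (subst real_sqrt_mult[symmetric]) simp
  have "norm (complex_of_real (1 / sqrt (4 * pi))) * sqrt 2 = 1 / sqrt (2 * pi)"
    unfolding norm_of_real p4 by simp
  moreover have "norm (complex_of_real (1 / sqrt (2 * pi))) = 1 / sqrt (2 * pi)"
    unfolding norm_of_real by simp
  moreover have "norm (slot_dir n s) = norm (complex_of_real (1 / sqrt (2 * pi))) \<or>
      norm (slot_dir n s) = norm (complex_of_real (1 / sqrt (4 * pi))) * sqrt 2"
    unfolding slot_dir_def by (cases "s = 0"; cases "s = -1 \<and> n \<noteq> 0") (simp_all only: norm_vec_scale n if_True if_False mult_1_right simp_thms)
  ultimately show ?thesis
    by metis
qed

lemma slot_pd_has_derivative1:
  assumes "\<beta> > 0"
  shows "((\<lambda>x. slot_pd \<beta> a b n k s (x, y)) has_vector_derivative slot_pd \<beta> (Suc a) b n k s (x, y)) (at x)"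
proof -
  have "((\<lambda>x. ((\<i> * of_int k) ^ b * (of_real (dpsi \<beta> a (slot_index n s) x) * cis (of_int k * y)))) has_vector_derivative
      (\<i> * of_int k) ^ b * (of_real (dpsi \<beta> (Suc a) (slot_index n s) x) * cis (of_int k * y))) (at x)"
    by (intro has_vector_derivative_mult_right has_vector_derivative_mult_left has_vector_derivative_of_real dpsi_has_derivative assms)
  from bounded_linear.has_vector_derivative[OF bounded_linear_vec_scale this, of "slot_dir n s"] show ?thesis
    by (simp only: slot_pd_def prod.case)
qed

lemma slot_pd_has_derivative2:
  "((\<lambda>y. slot_pd \<beta> a b n k s (x, y)) has_vector_derivative slot_pd \<beta> a (Suc b) n k s (x, y)) (at y)"
proof -
  have "((\<lambda>y. ((\<i> * of_int k) ^ b * (of_real (dpsi \<beta> a (slot_index n s) x) * cis (of_int k * y)))) has_vector_derivative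
      (\<i> * of_int k) ^ b * (of_real (dpsi \<beta> a (slot_index n s) x) * (\<i> * of_real (of_int k) * cis (of_int k * y)))) (at y)"
    by (intro has_vector_derivative_mult_right has_vector_derivative_cis)
  from bounded_linear.has_vector_derivative[OF bounded_linear_vec_scale this, of "slot_dir n s"] show ?thesis
    by (simp add: slot_pd_def mult_ac)
qed

lemma Psi_pd_has_derivative:
  assumes "\<beta> > 0"
  shows "((\<lambda>x. Psi_pd \<beta> a b n k j (x, y)) has_vector_derivative Psi_pd \<beta> (Suc a) b n k j (x, y)) (at x)"
    and "((\<lambda>y. Psi_pd \<beta> a b n k j (x, y)) has_vector_derivative Psi_pd \<beta> a (Suc b) n k j (x, y)) (at y)"
  unfolding Psi_pd_def
  by (intro has_vector_derivative_sum bounded_linear.has_vector_derivative[OF bounded_linear_vec_scale_right]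
      slot_pd_has_derivative1 slot_pd_has_derivative2 assms)+

lemma continuous_on_slot_pd:
  assumes "\<beta> > 0"
  shows "continuous_on A (slot_pd \<beta> a b n k s)"
proof -
  have "continuous_on A (\<lambda>z. dpsi \<beta> a (slot_index n s) (fst z))"
    by (rule continuous_on_compose2[OF continuous_on_dpsi[OF assms, of UNIV]]) (auto intro!: continuous_intros)
  then have "continuous_on A (\<lambda>z. (\<i> * of_int k) ^ b * (of_real (dpsi \<beta> a (slot_index n s) (fst z)) * cis (of_int k * snd z)))"
    by (intro continuous_intros)
  then show ?thesis
    unfolding slot_pd_def split_beta' by (rule bounded_linear.continuous_on[OF bounded_linear_vec_scale])
qed

lemma norm_slot_pd:
  "norm (slot_pd \<beta> a b n k s z) = \<bar>of_int k\<bar> ^ b * \<bar>dpsi \<beta> a (slot_index n s) (fst z)\<bar> / sqrt (2 * pi)"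
  by (simp add: slot_pd_def split_beta' norm_vec_scale norm_slot_dir norm_mult norm_power)

lemma gaussian_field_Psi_pd:
  assumes "\<beta> > 0"
  shows "gaussian_field (\<beta> / 4) (Psi_pd \<beta> a b n k j)"
proof -
  have s: "gaussian_field (\<beta> / 4) (\<lambda>z. slot_coef \<beta> n k j s *s slot_pd \<beta> a b n k s z)" if "s \<in> signs" for s
  proof -
    obtain K where K: "\<And>x. \<bar>dpsi \<beta> a (slot_index n s) x\<bar> \<le> K * exp (- (\<beta> / 4) * x\<^sup>2)"
      using dpsi_gaussian_bound[OF assms] by blast
    define c where "c = norm (slot_coef \<beta> n k j s) * (\<bar>of_int k\<bar> ^ b / sqrt (2 * pi))"
    have "norm (slot_coef \<beta> n k j s *s slot_pd \<beta> a b n k s z) \<le> (c * K) * exp (- (\<beta> / 4) * (fst z)\<^sup>2)" for z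
    proof -
      have "norm (slot_coef \<beta> n k j s *s slot_pd \<beta> a b n k s z) = c * \<bar>dpsi \<beta> a (slot_index n s) (fst z)\<bar>"
        by (simp add: norm_vec_scale norm_slot_pd c_def)
      also have "\<dots> \<le> c * (K * exp (- (\<beta> / 4) * (fst z)\<^sup>2))"
        by (intro mult_left_mono K) (simp add: c_def)
      finally show ?thesis by (simp only: mult.assoc)
    qed
    moreover have "continuous_on UNIV (\<lambda>z. slot_coef \<beta> n k j s *s slot_pd \<beta> a b n k s z)"
      by (rule bounded_linear.continuous_on[OF bounded_linear_vec_scale_right continuous_on_slot_pd[OF assms]])
    ultimately show ?thesis
      unfolding gaussian_field_def by blast
  qed
  have "Psi_pd \<beta> a b n k j = (\<lambda>z. slot_coef \<beta> n k j (-1) *s slot_pd \<beta> a b n k (-1) z +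
      (slot_coef \<beta> n k j 0 *s slot_pd \<beta> a b n k 0 z + slot_coef \<beta> n k j 1 *s slot_pd \<beta> a b n k 1 z))"
    by (simp add: Psi_pd_def)
  then show ?thesis
    using s by (simp only:) (intro gaussian_field_add; simp)
qed

lemma periodic_cis: "cis (of_int k * (y + 2 * pi)) = cis (of_int k * y)"
proof -
  have "cis (of_int k * (y + 2 * pi)) = cis (of_int k * y) * cis (2 * pi * of_int k)"
    by (simp add: cis_mult algebra_simps)
  then show ?thesis
    by (simp add: cis_multiple_2pi)
qed

lemma periodic_Psi_pd: "periodic_snd (Psi_pd \<beta> a b n k j)"
  by (simp add: periodic_snd_def Psi_pd_def slot_pd_def periodic_cis)

lemma periodic_Psi: "\<beta> > 0 \<Longrightarrow> periodic_snd (Psi \<beta> n k j)"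
  using periodic_Psi_pd[of \<beta> 0 0] by (simp add: Psi_pd_zero)

lemma dpsi_bound:
  assumes "\<beta> > 0"
  shows "\<exists>C>0. \<forall>n x. \<bar>dpsi \<beta> a n x\<bar> \<le> C * (1 + real n) powr (real a / 2)"
proof (induction a)
  case 0
  then show ?case
    using psi_bounded[OF assms] by simp
next
  case (Suc a)
  then obtain C where C: "C > 0" "\<And>n x. \<bar>dpsi \<beta> a n x\<bar> \<le> C * (1 + real n) powr (real a / 2)"
    by blast
  \<comment> \<open>The power of 2 pays for passing from the index n + 1 back to n.\<close>
  define B where "B = sqrt (\<beta> / 2) * (C * 2 powr (real a / 2))"
  have B: "B > 0" using assms C by (auto simp: B_def)
  have "\<bar>dpsi \<beta> (Suc a) n x\<bar> \<le> (2 * B) * (1 + real n) powr (real (Suc a) / 2)" for n x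
  proof -
    have e: "sqrt (\<beta> * t / 2) * \<bar>dpsi \<beta> a m x\<bar> \<le> B * (1 + real n) powr (real (Suc a) / 2)"
      if "0 \<le> t" "t \<le> 1 + real n" "real m \<le> 1 + real n" for m t
    proof -
      have "1 + real m \<le> 2 * (1 + real n)"
        using that by simp
      then have "(1 + real m) powr (real a / 2) \<le> (2 * (1 + real n)) powr (real a / 2)"
        by (intro powr_mono2) auto
      also have "\<dots> = 2 powr (real a / 2) * (1 + real n) powr (real a / 2)"
        by (rule powr_mult)
      finally have "C * (1 + real m) powr (real a / 2) \<le> C * (2 powr (real a / 2) * (1 + real n) powr (real a / 2))"
        using C by (intro mult_left_mono) auto
      then have 1: "\<bar>dpsi \<beta> a m x\<bar> \<le> C * (2 powr (real a / 2) * (1 + real n) powr (real a / 2))"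
        using C(2)[of m x] by (rule order_trans[rotated])
      have "sqrt (\<beta> * t / 2) = sqrt (\<beta> / 2) * sqrt t"
        by (simp add: real_sqrt_mult real_sqrt_divide)
      also have "\<dots> \<le> sqrt (\<beta> / 2) * sqrt (1 + real n)"
        using assms that by (intro mult_left_mono) auto
      also have "sqrt (1 + real n) = (1 + real n) powr (1 / 2)"
        by (simp add: powr_half_sqrt)
      finally have "sqrt (\<beta> * t / 2) * \<bar>dpsi \<beta> a m x\<bar> \<le>
          (sqrt (\<beta> / 2) * (1 + real n) powr (1 / 2)) * (C * (2 powr (real a / 2) * (1 + real n) powr (real a / 2)))"
        using 1 assms by (intro mult_mono) auto
      also have "\<dots> = B * ((1 + real n) powr (1 / 2) * (1 + real n) powr (real a / 2))"
        by (simp add: B_def)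
      also have "(1 + real n) powr (1 / 2) * (1 + real n) powr (real a / 2) = (1 + real n) powr (real (Suc a) / 2)"
        by (simp add: add_divide_distrib flip: powr_add)
      finally show ?thesis .
    qed
    have "\<bar>dpsi \<beta> (Suc a) n x\<bar> \<le> \<bar>sqrt (\<beta> * real n / 2) * dpsi \<beta> a (n - 1) x\<bar> + \<bar>sqrt (\<beta> * (real n + 1) / 2) * dpsi \<beta> a (Suc n) x\<bar>"
      unfolding dpsi.simps by (rule abs_triangle_ineq4)
    also have "\<dots> = sqrt (\<beta> * real n / 2) * \<bar>dpsi \<beta> a (n - 1) x\<bar> + sqrt (\<beta> * (real n + 1) / 2) * \<bar>dpsi \<beta> a (Suc n) x\<bar>"
      using assms by (simp add: abs_mult)
    also have "\<dots> \<le> B * (1 + real n) powr (real (Suc a) / 2) + B * (1 + real n) powr (real (Suc a) / 2)"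
      using e[of "real n" "n - 1"] e[of "real n + 1" "Suc n"] by (intro add_mono) auto
    finally show ?thesis by simp
  qed
  then show ?case
    using B by (intro exI[of _ "2 * B"]) auto
qed

lemma Psi_pd_bound:
  assumes "\<beta> > 0"
  shows "\<exists>C>0. \<forall>(n, k, j)\<in>modes. \<forall>z. norm (Psi_pd \<beta> a b n k j z) \<le> C * (1 + (of_int k)\<^sup>2 + real n) powr (real (a + b) / 2)"
proof -
  obtain C where C: "C > 0" "\<And>n x. \<bar>dpsi \<beta> a n x\<bar> \<le> C * (1 + real n) powr (real a / 2)"
    using dpsi_bound[OF assms] by blast
  define B where "B = C * 2 powr (real a / 2)"
  have B: "B > 0" using C by (simp add: B_def)
  have "norm (Psi_pd \<beta> a b n k j z) \<le> (3 * B) * (1 + (of_int k)\<^sup>2 + real n) powr (real (a + b) / 2)"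
    if j: "j \<in> signs" for n k j z
  proof -
    define N where "N = 1 + (real_of_int k)\<^sup>2 + real n"
    have N: "N > 0" by (simp add: N_def add_pos_nonneg)
    have s: "norm (slot_coef \<beta> n k j s *s slot_pd \<beta> a b n k s z) \<le> B * N powr (real (a + b) / 2)" if s: "s \<in> signs" for s
    proof -
      have kb: "\<bar>real_of_int k\<bar> ^ b \<le> N powr (real b / 2)"
      proof -
        have "\<bar>real_of_int k\<bar> = sqrt ((real_of_int k)\<^sup>2)" by simp
        also have "\<dots> \<le> sqrt N" by (intro real_sqrt_le_mono) (simp add: N_def)
        also have "\<dots> = N powr (1 / 2)" using N by (simp add: powr_half_sqrt)
        finally have "\<bar>real_of_int k\<bar> ^ b \<le> (N powr (1 / 2)) ^ b" by (rule power_mono) simp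
        also have "\<dots> = N powr (real b / 2)" using N by (simp add: powr_powr flip: powr_realpow)
        finally show ?thesis .
      qed
      have "real (slot_index n s) \<le> 1 + real n"
        using s by (auto simp: slot_index_def)
      then have "1 + real (slot_index n s) \<le> 2 * N"
        unfolding N_def distrib_left using zero_le_power2[of "real_of_int k"] of_nat_0_le_iff[of n] by linarith
      then have "(1 + real (slot_index n s)) powr (real a / 2) \<le> (2 * N) powr (real a / 2)"
        by (intro powr_mono2) auto
      also have "\<dots> = 2 powr (real a / 2) * N powr (real a / 2)"
        using N by (simp add: powr_mult)
      finally have "C * (1 + real (slot_index n s)) powr (real a / 2) \<le> C * (2 powr (real a / 2) * N powr (real a / 2))"
        using C by (intro mult_left_mono) auto
      then have d: "\<bar>dpsi \<beta> a (slot_index n s) (fst z)\<bar> \<le> B * N powr (real a / 2)"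
        using C(2)[of "slot_index n s" "fst z"] by (simp add: B_def)
      have "norm (slot_coef \<beta> n k j s *s slot_pd \<beta> a b n k s z) \<le> 1 * norm (slot_pd \<beta> a b n k s z)"
        unfolding norm_vec_scale by (intro mult_right_mono norm_slot_coef_le assms j s) auto
      also have "\<dots> \<le> \<bar>real_of_int k\<bar> ^ b * \<bar>dpsi \<beta> a (slot_index n s) (fst z)\<bar> / 1"
        unfolding norm_slot_pd mult_1 using pi_ge_two by (intro divide_left_mono) auto
      also have "\<dots> \<le> N powr (real b / 2) * (B * N powr (real a / 2))"
        unfolding div_by_1 using B by (intro mult_mono kb d) auto
      also have "\<dots> = B * N powr (real (a + b) / 2)"
        by (simp add: add_divide_distrib powr_add mult_ac)
      finally show ?thesis .
    qed
    have "norm (Psi_pd \<beta> a b n k j z) \<le> (\<Sum>s\<in>signs. B * N powr (real (a + b) / 2))"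
      unfolding Psi_pd_def by (rule sum_norm_le) (rule s)
    also have "\<dots> = (3 * B) * N powr (real (a + b) / 2)"
      by simp
    finally show ?thesis unfolding N_def .
  qed
  then show ?thesis
    using B by (intro exI[of _ "3 * B"]) (auto simp: modes_def)
qed

section \<open>Weak derivatives and Hoelder bounds\<close>

lemma Linf_norm_le:
  assumes "f \<in> borel_measurable borel" "\<And>z. norm (f z) \<le> C"
  shows "Linf_norm f \<le> ennreal C"
proof -
  have [measurable]: "f \<in> borel_measurable borel" by (rule assms)
  show ?thesis
    unfolding Linf_norm_def by (intro esssup_I AE_I2 ennreal_leI assms) measurable
qed

lemma Psi_pd_measurable: "\<beta> > 0 \<Longrightarrow> Psi_pd \<beta> a b n k j \<in> borel_measurable borel"
  using gaussian_field_Psi_pd[of \<beta>] by (auto simp: gaussian_field_def intro: borel_measurable_continuous_onI)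

lemma Psi_pd_Linf:
  assumes "\<beta> > 0"
  shows "Psi_pd \<beta> a b n k j \<in> Linf"
proof -
  obtain K where K: "\<And>z. norm (Psi_pd \<beta> a b n k j z) \<le> K * exp (- (\<beta> / 4) * (fst z)\<^sup>2)"
    using gaussian_field_Psi_pd[OF assms] unfolding gaussian_field_def by blast
  have "K \<ge> 0"
    using order_trans[OF norm_ge_zero K[of 0]] by simp
  then have "norm (Psi_pd \<beta> a b n k j z) \<le> K" for z
    using assms by (intro order_trans[OF K] mult_left_le) auto
  then have "Linf_norm (Psi_pd \<beta> a b n k j) \<le> ennreal K"
    by (intro Linf_norm_le Psi_pd_measurable assms)
  then show ?thesis
    unfolding Linf_def using periodic_Psi_pd Psi_pd_measurable[OF assms] by (auto intro: le_less_trans)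
qed

text \<open>Integration by parts removes first the derivatives in x_1 from the test function, down
  to \<open>pd 0 b\<close>, and then those in x_2; this order is imposed by the definition of
  \<open>pd\<close>.\<close>

lemma Psi_weak_deriv:
  assumes "\<beta> > 0"
  shows "is_weak_deriv a b (Psi \<beta> n k j) (Psi_pd \<beta> a b n k j)"
proof -
  have c: "\<beta> / 4 > 0" using assms by simp
  have 2: "(\<integral>z. pd 0 b \<phi> z *\<^sub>R Psi_pd \<beta> a' 0 n k j z \<partial>RT) = (- 1) ^ b *\<^sub>R (\<integral>z. \<phi> z *\<^sub>R Psi_pd \<beta> a' b n k j z \<partial>RT)"
    if "\<phi> \<in> schwartz_RT" for \<phi> a'
  proof -
    \<comment> \<open>The order d varies in the induction because each step moves one more
      derivative onto the field.\<close>
    have "(\<integral>z. pd 0 b \<phi> z *\<^sub>R Psi_pd \<beta> a' d n k j z \<partial>RT) = (- 1) ^ b *\<^sub>R (\<integral>z. \<phi> z *\<^sub>R Psi_pd \<beta> a' (b + d) n k j z \<partial>RT)" for d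
    proof (induction b arbitrary: d)
      case (Suc b)
      have "(\<integral>z. pd 0 (Suc b) \<phi> z *\<^sub>R Psi_pd \<beta> a' d n k j z \<partial>RT) = - (\<integral>z. pd 0 b \<phi> z *\<^sub>R Psi_pd \<beta> a' (Suc d) n k j z \<partial>RT)"
        by (rule test_integral_by_parts2[OF c that periodic_Psi_pd gaussian_field_Psi_pd[OF assms] gaussian_field_Psi_pd[OF assms] Psi_pd_has_derivative(2)[OF assms]])
      then show ?case
        by (simp add: Suc)
    qed simp
    from this[of 0] show ?thesis by simp
  qed
  have "(\<integral>z. pd a b \<phi> z *\<^sub>R Psi_pd \<beta> d 0 n k j z \<partial>RT) = (- 1) ^ (a + b) *\<^sub>R (\<integral>z. \<phi> z *\<^sub>R Psi_pd \<beta> (a + d) b n k j z \<partial>RT)"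
    if "\<phi> \<in> schwartz_RT" for \<phi> d
  proof (induction a arbitrary: d)
    case 0
    then show ?case using 2[OF that] by simp
  next
    case (Suc a)
    have "(\<integral>z. pd (Suc a) b \<phi> z *\<^sub>R Psi_pd \<beta> d 0 n k j z \<partial>RT) = - (\<integral>z. pd a b \<phi> z *\<^sub>R Psi_pd \<beta> (Suc d) 0 n k j z \<partial>RT)"
      by (rule test_integral_by_parts1[OF c that gaussian_field_Psi_pd[OF assms] gaussian_field_Psi_pd[OF assms] Psi_pd_has_derivative(1)[OF assms]])
    then show ?case
      by (simp add: Suc)
  qed
  from this[of _ 0] show ?thesis
    using Psi_pd_Linf[OF assms] unfolding is_weak_deriv_def Psi_pd_zero[OF assms, symmetric] by simp
qed

text \<open>Interpolation between the sup norms of a field and of its gradient.\<close>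

lemma hoelder_seminorm_le:
  fixes g :: vfield
  assumes "0 < \<theta>" "\<theta> < 1"
    and lip: "\<And>x y. norm (g x - g y) \<le> B * dist x y" and bd: "\<And>x. norm (g x) \<le> A"
  shows "hoelder_seminorm \<theta> g \<le> ennreal ((2 * A) powr (1 - \<theta>) * B powr \<theta>)"
  unfolding hoelder_seminorm_def
proof (rule SUP_least)
  fix p :: "(real \<times> real) \<times> (real \<times> real)" assume "p \<in> {(x, y). x \<noteq> y}"
  then obtain x y where p: "p = (x, y)" and ne: "x \<noteq> y" by auto
  define r D where "r = norm (g x - g y)" and "D = dist x y"
  have D: "D > 0" using ne by (simp add: D_def)
  have r: "0 \<le> r" "r \<le> 2 * A" "r \<le> B * D"
    using norm_triangle_ineq4[of "g x" "g y"] bd[of x] bd[of y] lip[of x y] by (auto simp: r_def D_def)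
  have "0 \<le> B * D"
    using r by linarith
  then have B: "B \<ge> 0"
    using D by (simp add: zero_le_mult_iff)
  have "r = r powr (1 - \<theta>) * r powr \<theta>"
    using r(1) by (simp flip: powr_add)
  also have "\<dots> \<le> (2 * A) powr (1 - \<theta>) * (B * D) powr \<theta>"
    using r assms by (intro mult_mono powr_mono2) auto
  also have "\<dots> = (2 * A) powr (1 - \<theta>) * B powr \<theta> * D powr \<theta>"
    using B D by (simp add: powr_mult)
  finally have "r / D powr \<theta> \<le> (2 * A) powr (1 - \<theta>) * B powr \<theta>"
    using D by (simp add: pos_divide_le_eq)
  then show "(case p of (x, y) \<Rightarrow> ennreal (norm (g x - g y) / dist x y powr \<theta>)) \<le> ennreal ((2 * A) powr (1 - \<theta>) * B powr \<theta>)"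
    unfolding p prod.case by (intro ennreal_leI) (simp add: r_def D_def)
qed

text \<open>The two points are joined by a path parallel to the axes; each of its two pieces is at
  most as long as the distance, whence the factor 2.\<close>

lemma Psi_pd_lipschitz:
  assumes "\<beta> > 0" and b1: "\<And>z. norm (Psi_pd \<beta> (Suc a) b n k j z) \<le> B" and b2: "\<And>z. norm (Psi_pd \<beta> a (Suc b) n k j z) \<le> B"
  shows "norm (Psi_pd \<beta> a b n k j x - Psi_pd \<beta> a b n k j y) \<le> (2 * B) * dist x y"
proof -
  obtain p q p' q' where xy: "x = (p, q)" "y = (p', q')" by (metis surj_pair)
  let ?g = "Psi_pd \<beta> a b n k j"
  have 1: "norm (?g (p, q) - ?g (p', q)) \<le> B * norm (p - p')"
  proof (rule differentiable_bound[of UNIV "\<lambda>t. ?g (t, q)"])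
    show "((\<lambda>t. ?g (t, q)) has_derivative (\<lambda>h. h *\<^sub>R Psi_pd \<beta> (Suc a) b n k j (t, q))) (at t within UNIV)" for t
      using Psi_pd_has_derivative(1)[OF assms(1)] by (simp add: has_vector_derivative_def)
    show "onorm (\<lambda>h. h *\<^sub>R Psi_pd \<beta> (Suc a) b n k j (t, q)) \<le> B" for t
    proof (rule onorm_le)
      show "norm (h *\<^sub>R Psi_pd \<beta> (Suc a) b n k j (t, q)) \<le> B * norm h" for h
        unfolding norm_scaleR mult.commute[of B] real_norm_def by (intro mult_left_mono b1) simp
    qed
  qed auto
  have 2: "norm (?g (p', q) - ?g (p', q')) \<le> B * norm (q - q')"
  proof (rule differentiable_bound[of UNIV "\<lambda>t. ?g (p', t)"])
    show "((\<lambda>t. ?g (p', t)) has_derivative (\<lambda>h. h *\<^sub>R Psi_pd \<beta> a (Suc b) n k j (p', t))) (at t within UNIV)" for t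
      using Psi_pd_has_derivative(2)[OF assms(1)] by (simp add: has_vector_derivative_def)
    show "onorm (\<lambda>h. h *\<^sub>R Psi_pd \<beta> a (Suc b) n k j (p', t)) \<le> B" for t
    proof (rule onorm_le)
      show "norm (h *\<^sub>R Psi_pd \<beta> a (Suc b) n k j (p', t)) \<le> B * norm h" for h
        unfolding norm_scaleR mult.commute[of B] real_norm_def by (intro mult_left_mono b2) simp
    qed
  qed auto
  have B: "B \<ge> 0" using order_trans[OF norm_ge_zero b1] .
  have "norm (?g x - ?g y) \<le> norm (?g (p, q) - ?g (p', q)) + norm (?g (p', q) - ?g (p', q'))"
    unfolding xy using norm_triangle_ineq[of "?g (p, q) - ?g (p', q)" "?g (p', q) - ?g (p', q')"] by simp
  also have "\<dots> \<le> B * norm (p - p') + B * norm (q - q')"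
    by (intro add_mono 1 2)
  also have "\<dots> \<le> B * dist x y + B * dist x y"
    unfolding xy dist_norm using norm_fst_le[of "p - p'" "q - q'"] norm_snd_le[of "q - q'" "p - p'"] B
    by (intro add_mono mult_left_mono) auto
  finally show ?thesis by simp
qed

lemma Psi_Wsinf_bound:
  assumes "\<beta> > 0" "s \<ge> 0"
  shows "\<exists>C>0. \<forall>(n, k, j)\<in>modes. Wsinf_norm s (Psi \<beta> n k j) \<le> ennreal (C * (1 + (of_int k)\<^sup>2 + real n) powr (s / 2))"
proof -
  define m \<theta> where "m = nat \<lfloor>s\<rfloor>" and "\<theta> = frac s"
  have m\<theta>: "s = real m + \<theta>" "0 \<le> \<theta>" "\<theta> < 1"
    using assms(2) by (auto simp: m_def \<theta>_def frac_def frac_lt_1[unfolded frac_def])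
  define P where "P a b C \<longleftrightarrow> C > 0 \<and> (\<forall>(n, k, j)\<in>modes. \<forall>z. norm (Psi_pd \<beta> a b n k j z) \<le> C * (1 + (of_int k)\<^sup>2 + real n) powr (real (a + b) / 2))"
    for a b C
  have "\<forall>a b. \<exists>C. P a b C"
    unfolding P_def using Psi_pd_bound[OF assms(1)] by blast
  then obtain C where CP: "\<And>a b. P a b (C a b)"
    by metis
  have C: "C a b > 0" "(n, k, j) \<in> modes \<Longrightarrow> norm (Psi_pd \<beta> a b n k j z) \<le> C a b * (1 + (of_int k)\<^sup>2 + real n) powr (real (a + b) / 2)" for a b n k j z
    using conjunct1[OF CP[of a b, unfolded P_def]] bspec[OF conjunct2[OF CP[of a b, unfolded P_def]], of "(n, k, j)"]
    unfolding prod.case by blast+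
  \<comment> \<open>The first summand bounds the sup norm, the second the Hoelder seminorm by
    interpolation with the derivatives of the next order.\<close>
  define D where "D a b = C a b + (2 * C a b) powr (1 - \<theta>) * (2 * max (C (Suc a) b) (C a (Suc b))) powr \<theta>" for a b
  have D: "D a b > 0" for a b
    using C by (auto simp: D_def add_pos_nonneg)
  define I where "I = {(a, b). a + b \<le> m}"
  have I: "finite I"
    by (rule finite_subset[of _ "{..m} \<times> {..m}"]) (auto simp: I_def)
  have "Wsinf_norm s (Psi \<beta> n k j) \<le> ennreal ((1 + (\<Sum>(a, b)\<in>I. D a b)) * (1 + (of_int k)\<^sup>2 + real n) powr (s / 2))"
    if mode: "(n, k, j) \<in> modes" for n k j
  proof -
    define N where "N = 1 + (real_of_int k)\<^sup>2 + real n"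
    have N: "N \<ge> 1" by (simp add: N_def)
    have t: "(INF g\<in>{g. is_weak_deriv a b (Psi \<beta> n k j) g}. Linf_norm g + (if a + b = m \<and> 0 < \<theta> then hoelder_seminorm \<theta> g else 0))
       \<le> ennreal (D a b * N powr (s / 2))" if ab: "a + b \<le> m" for a b
    proof -
      let ?g = "Psi_pd \<beta> a b n k j"
      define A where "A = C a b * N powr (real (a + b) / 2)"
      have A: "norm (?g z) \<le> A" for z
        unfolding A_def N_def by (rule C(2)[OF mode])
      have A0: "A \<ge> 0" using C(1)[of a b] by (simp add: A_def)
      \<comment> \<open>For an upper bound it suffices to insert one representative, the continuous
        derivative.\<close>
      have "(INF g\<in>{g. is_weak_deriv a b (Psi \<beta> n k j) g}. Linf_norm g + (if a + b = m \<and> 0 < \<theta> then hoelder_seminorm \<theta> g else 0))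
          \<le> Linf_norm ?g + (if a + b = m \<and> 0 < \<theta> then hoelder_seminorm \<theta> ?g else 0)"
        by (rule INF_lower) (simp add: Psi_weak_deriv[OF assms(1)])
      also have "\<dots> \<le> ennreal (C a b * N powr (s / 2)) + ennreal ((2 * C a b) powr (1 - \<theta>) * (2 * max (C (Suc a) b) (C a (Suc b))) powr \<theta> * N powr (s / 2))"
      proof (rule add_mono)
        have "A \<le> C a b * N powr (s / 2)"
          unfolding A_def using C(1)[of a b] N ab m\<theta> by (intro mult_left_mono powr_mono) auto
        then show "Linf_norm ?g \<le> ennreal (C a b * N powr (s / 2))"
          using Linf_norm_le[OF Psi_pd_measurable[OF assms(1)] A] by (meson ennreal_leI order_trans)
        show "(if a + b = m \<and> 0 < \<theta> then hoelder_seminorm \<theta> ?g else 0) \<le>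
            ennreal ((2 * C a b) powr (1 - \<theta>) * (2 * max (C (Suc a) b) (C a (Suc b))) powr \<theta> * N powr (s / 2))"
        proof (cases "a + b = m \<and> 0 < \<theta>")
          case True
          define E where "E = max (C (Suc a) b) (C a (Suc b))"
          have E: "E > 0" using C(1) by (simp add: E_def less_max_iff_disj)
          define B where "B = E * N powr (real (Suc m) / 2)"
          have "norm (Psi_pd \<beta> (Suc a) b n k j z) \<le> B" "norm (Psi_pd \<beta> a (Suc b) n k j z) \<le> B" for z
          proof -
            have "C (Suc a) b * N powr (real (Suc a + b) / 2) \<le> B" "C a (Suc b) * N powr (real (a + Suc b) / 2) \<le> B"
              unfolding B_def E_def using True by (auto intro!: mult_right_mono simp flip: of_nat_Suc simp: of_nat_add[symmetric] simp del: of_nat_add)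
            then show "norm (Psi_pd \<beta> (Suc a) b n k j z) \<le> B" "norm (Psi_pd \<beta> a (Suc b) n k j z) \<le> B"
              using C(2)[OF mode, of "Suc a" b z] C(2)[OF mode, of a "Suc b" z] unfolding N_def by linarith+
          qed
          from hoelder_seminorm_le[OF conjunct2[OF True] m\<theta>(3) Psi_pd_lipschitz[OF assms(1) this] A]
          have "hoelder_seminorm \<theta> ?g \<le> ennreal ((2 * A) powr (1 - \<theta>) * (2 * B) powr \<theta>)" .
          \<comment> \<open>The exponents add up to (m/2)(1 - \<theta>) + ((m + 1)/2) \<theta> = (m
            + \<theta>)/2 = s/2.\<close>
          also have "(2 * A) powr (1 - \<theta>) * (2 * B) powr \<theta> = (2 * C a b) powr (1 - \<theta>) * (2 * E) powr \<theta> * N powr (s / 2)"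
          proof -
            have 1: "(2 * A) powr (1 - \<theta>) = (2 * C a b) powr (1 - \<theta>) * N powr (real m / 2 * (1 - \<theta>))"
              using C(1)[of a b] N True unfolding A_def mult.assoc[symmetric] by (simp add: powr_mult powr_powr)
            have 2: "(2 * B) powr \<theta> = (2 * E) powr \<theta> * N powr (real (Suc m) / 2 * \<theta>)"
              using E N unfolding B_def mult.assoc[symmetric] by (simp add: powr_mult powr_powr)
            have "real m / 2 * (1 - \<theta>) + real (Suc m) / 2 * \<theta> = s / 2"
              unfolding m\<theta>(1) by (simp add: field_simps)
            then have 3: "N powr (real m / 2 * (1 - \<theta>)) * N powr (real (Suc m) / 2 * \<theta>) = N powr (s / 2)"
              by (simp only: powr_add[symmetric])
            show ?thesis
              unfolding 1 2 3[symmetric] by (simp only: mult_ac)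
          qed
          finally show ?thesis
            using True by (simp add: E_def)
        next
          case False
          show ?thesis
            unfolding if_not_P[OF False] by simp
        qed
      qed
      also have "\<dots> = ennreal (D a b * N powr (s / 2))"
        using C(1)[of a b] by (subst ennreal_plus[symmetric]) (auto simp: D_def distrib_right)
      finally show ?thesis .
    qed
    have "Wsinf_norm s (Psi \<beta> n k j) = (\<Sum>(a, b)\<in>I. INF g\<in>{g. is_weak_deriv a b (Psi \<beta> n k j) g}.
        Linf_norm g + (if a + b = m \<and> 0 < \<theta> then hoelder_seminorm \<theta> g else 0))"
      unfolding Wsinf_norm_def Let_def m_def \<theta>_def I_def by (rule refl)
    also have "\<dots> \<le> (\<Sum>(a, b)\<in>I. ennreal (D a b * N powr (s / 2)))"
      by (rule sum_mono) (use t in \<open>auto simp: I_def\<close>)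
    also have "\<dots> = ennreal (\<Sum>(a, b)\<in>I. D a b * N powr (s / 2))"
      using D by (subst sum_ennreal[symmetric]) (auto simp: split_beta' less_imp_le)
    also have "(\<Sum>(a, b)\<in>I. D a b * N powr (s / 2)) = (\<Sum>(a, b)\<in>I. D a b) * N powr (s / 2)"
      by (simp add: sum_distrib_right split_beta')
    \<comment> \<open>The added 1 makes the constant visibly positive.\<close>
    also have "ennreal \<dots> \<le> ennreal ((1 + (\<Sum>(a, b)\<in>I. D a b)) * N powr (s / 2))"
      by (intro ennreal_leI mult_right_mono) auto
    finally show ?thesis
      unfolding N_def .
  qed
  moreover have "1 + (\<Sum>(a, b)\<in>I. D a b) > 0"
    using D by (intro add_pos_nonneg sum_nonneg) (auto simp: less_imp_le)
  ultimately show ?thesis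
    by (intro exI[of _ "1 + (\<Sum>(a, b)\<in>I. D a b)"]) blast
qed

section \<open>Orthonormality and completeness\<close>

definition field_dot :: "complex ^ 3 \<Rightarrow> complex ^ 3 \<Rightarrow> complex" where
  "field_dot v w = (\<Sum>i\<in>UNIV. v $ i * cnj (w $ i))"

lemma L2_inner_eq: "L2_inner f g = (\<integral>z. field_dot (f z) (g z) \<partial>RT)"
  by (simp add: L2_inner_def field_dot_def)

lemma norm_field_dot_le: "norm (field_dot v w) \<le> (norm v)\<^sup>2 + (norm w)\<^sup>2"
proof -
  have *: "norm (a * cnj b) \<le> (norm a)\<^sup>2 + (norm b)\<^sup>2" for a b :: complex
    unfolding norm_mult complex_mod_cnj by (intro mult_le_sum_squares norm_ge_zero)
  have "norm (field_dot v w) \<le> norm (v $ 1 * cnj (w $ 1)) + norm (v $ 2 * cnj (w $ 2)) + norm (v $ 3 * cnj (w $ 3))"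
    unfolding field_dot_def sum_3 by (intro norm_triangle_mono order_refl)
  also have "\<dots> \<le> ((norm (v $ 1))\<^sup>2 + (norm (w $ 1))\<^sup>2) + ((norm (v $ 2))\<^sup>2 + (norm (w $ 2))\<^sup>2) + ((norm (v $ 3))\<^sup>2 + (norm (w $ 3))\<^sup>2)"
    by (intro add_mono *)
  finally show ?thesis
    by (simp add: vec3_norm_square)
qed

lemma field_dot_integrable:
  fixes f g :: vfield
  assumes "square_integrable f" "square_integrable g"
  shows "integrable RT (\<lambda>z. field_dot (f z) (g z))"
proof (rule Bochner_Integration.integrable_bound)
  show "integrable RT (\<lambda>z. (norm (f z))\<^sup>2 + (norm (g z))\<^sup>2)"
    using assms by (auto simp: square_integrable_def)
  show "AE z in RT. norm (field_dot (f z) (g z)) \<le> norm ((norm (f z))\<^sup>2 + (norm (g z))\<^sup>2)"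
    using norm_field_dot_le by (intro AE_I2) (simp add: add_nonneg_nonneg)
  have [measurable]: "(\<lambda>z. f z $ i) \<in> borel_measurable borel" "(\<lambda>z. g z $ i) \<in> borel_measurable borel" for i
    using square_integrable_component[OF assms(1)] square_integrable_component[OF assms(2)]
    by (auto simp: square_integrable_def)
  have "cnj \<in> borel_measurable borel"
    by (intro borel_measurable_continuous_onI continuous_intros)
  then have [measurable]: "(\<lambda>z. cnj (g z $ i)) \<in> borel_measurable borel" for i
    by (rule measurable_compose[rotated]) measurable
  have "(\<lambda>z. field_dot (f z) (g z)) \<in> borel_measurable borel"
    unfolding field_dot_def sum_3 by measurable
  then show "(\<lambda>z. field_dot (f z) (g z)) \<in> borel_measurable RT"
    by (rule borel_measurable_RT)
qed

lemma square_integrable_scale: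
  fixes f :: vfield
  assumes "square_integrable f"
  shows "square_integrable (\<lambda>z. c *s f z)"
proof -
  have "(\<lambda>v :: complex ^ 3. c *s v) \<in> borel_measurable borel"
    by (intro borel_measurable_continuous_onI linear_continuous_on bounded_linear_vec_scale_right)
  then have "(\<lambda>z. c *s f z) \<in> borel_measurable borel"
    using assms measurable_compose by (auto simp: square_integrable_def)
  then show ?thesis
    using assms by (simp add: square_integrable_def norm_vec_scale power_mult_distrib)
qed

lemma square_integrable_sum:
  fixes f :: "'i \<Rightarrow> vfield"
  assumes "finite A" "\<And>a. a \<in> A \<Longrightarrow> square_integrable (f a)"
  shows "square_integrable (\<lambda>z. \<Sum>a\<in>A. f a z)"
  using assms
proof (induction A)
  case (insert a A)
  then show ?case by (simp add: square_integrable_add)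
qed (simp add: square_integrable_def)

lemma L2_inner_sum_left:
  assumes "finite A" "\<And>a. a \<in> A \<Longrightarrow> square_integrable (f a)" "square_integrable g"
  shows "L2_inner (\<lambda>z. \<Sum>a\<in>A. c a *s f a z) g = (\<Sum>a\<in>A. c a * L2_inner (f a) g)"
proof -
  have "field_dot (\<Sum>a\<in>A. c a *s f a z) (g z) = (\<Sum>a\<in>A. c a * field_dot (f a z) (g z))" for z
    unfolding field_dot_def sum_3 by (simp add: sum_distrib_right sum.distrib distrib_left mult.assoc)
  then show ?thesis
    unfolding L2_inner_eq using assms by (simp add: field_dot_integrable)
qed

lemma L2_inner_sum_right:
  assumes "finite A" "\<And>a. a \<in> A \<Longrightarrow> square_integrable (f a)" "square_integrable g"
  shows "L2_inner g (\<lambda>z. \<Sum>a\<in>A. c a *s f a z) = (\<Sum>a\<in>A. cnj (c a) * L2_inner g (f a))"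
proof -
  have "field_dot (g z) (\<Sum>a\<in>A. c a *s f a z) = (\<Sum>a\<in>A. cnj (c a) * field_dot (g z) (f a z))" for z
    unfolding field_dot_def sum_3 by (simp add: sum_distrib_left sum.distrib distrib_left mult_ac)
  then show ?thesis
    unfolding L2_inner_eq using assms by (simp add: field_dot_integrable)
qed

lemma integral_cis_period:
  "(\<integral>y\<in>{0..<2 * pi}. cis (of_int k * y) \<partial>lborel) = (if k = 0 then 2 * pi else 0)"
proof (cases "k = 0")
  case True
  then show ?thesis
    by (simp add: set_lebesgue_integral_def scaleR_conv_of_real)
next
  case False
  have c: "continuous_on A (\<lambda>y. cis (of_int k * y))" for A
    by (intro continuous_intros)
  have [measurable]: "(\<lambda>y. cis (of_int k * y)) \<in> borel_measurable borel"
    by (intro borel_measurable_continuous_onI c)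
  have "(\<integral>y\<in>{0..<2 * pi}. cis (of_int k * y) \<partial>lborel) = (\<integral>y. indicator {0..2 * pi} y *\<^sub>R cis (of_int k * y) \<partial>lborel)"
    unfolding set_lebesgue_integral_def
  proof (rule integral_cong_AE)
    show "AE y in lborel. indicator {0..<2 * pi} y *\<^sub>R cis (of_int k * y) = indicator {0..2 * pi} y *\<^sub>R cis (of_int k * y)"
      using AE_lborel_singleton[of "2 * pi"] by eventually_elim (auto simp: indicator_def)
  qed measurable
  also have "\<dots> = cis (of_int k * (2 * pi)) / (\<i> * of_int k) - cis (of_int k * 0) / (\<i> * of_int k)"
  proof (rule integral_FTC_Icc[OF _ _ c])
    show "((\<lambda>y. cis (of_int k * y) / (\<i> * of_int k)) has_vector_derivative cis (of_int k * y)) (at y within {0..2 * pi})" for y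
    proof -
      have "((\<lambda>y. cis (of_int k * y) * inverse (\<i> * of_int k)) has_vector_derivative
          \<i> * of_real (of_int k) * cis (of_int k * y) * inverse (\<i> * of_int k)) (at y)"
        by (intro has_vector_derivative_mult_left has_vector_derivative_cis)
      moreover have "\<i> * of_real (of_int k) * cis (of_int k * y) * inverse (\<i> * of_int k) = cis (of_int k * y)"
        using False by (simp add: field_simps)
      ultimately show ?thesis
        unfolding divide_inverse by (metis has_vector_derivative_at_within)
    qed
  qed simp
  also have "\<dots> = 0"
    using cis_multiple_2pi[of "of_int k"] unfolding mult.commute[of "of_int k" "2 * pi"] by simp
  finally show ?thesis
    using False by (simp only: if_False of_real_0)
qed

lemma hermite_exp_inner:
  assumes "\<beta> > 0"
  shows "integrable RT (\<lambda>z. hermite_exp \<beta> m k z * cnj (hermite_exp \<beta> n l z))"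
    and "(\<integral>z. hermite_exp \<beta> m k z * cnj (hermite_exp \<beta> n l z) \<partial>RT) = (if m = n \<and> k = l then 2 * pi else 0)"
proof -
  have eq: "hermite_exp \<beta> m k z * cnj (hermite_exp \<beta> n l z) = of_real (psi \<beta> m (fst z) * psi \<beta> n (fst z)) * cis (of_int (k - l) * snd z)" for z
  proof -
    have "cis (of_int k * snd z) * cnj (cis (of_int l * snd z)) = cis (of_int (k - l) * snd z)"
      by (simp add: cis_cnj cis_mult left_diff_distrib)
    from arg_cong[OF this, of "\<lambda>c. of_real (psi \<beta> m (fst z) * psi \<beta> n (fst z)) * c"] show ?thesis
      by (simp add: hermite_exp_def split_beta' mult_ac)
  qed
  obtain K where K: "K \<ge> 0" "\<And>x. \<bar>psi \<beta> m x\<bar> \<le> K * exp (- (\<beta> / 4) * x\<^sup>2)" using psi_gaussian_bound[OF assms] by blast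
  obtain L where L: "\<And>x. \<bar>psi \<beta> n x\<bar> \<le> L" using psi_bounded[OF assms] by blast
  have L0: "L \<ge> 0" using order_trans[OF abs_ge_zero L] .
  show int: "integrable RT (\<lambda>z. hermite_exp \<beta> m k z * cnj (hermite_exp \<beta> n l z))"
  proof (rule integrable_RT_gaussian_bound)
    have "cnj \<in> borel_measurable borel"
      by (intro borel_measurable_continuous_onI continuous_intros)
    then have "(\<lambda>z. cnj (hermite_exp \<beta> n l z)) \<in> borel_measurable borel"
      by (rule measurable_compose[rotated]) (rule hermite_exp_measurable)
    then show "(\<lambda>z. hermite_exp \<beta> m k z * cnj (hermite_exp \<beta> n l z)) \<in> borel_measurable borel"
      by (intro borel_measurable_times hermite_exp_measurable)
    show "norm (hermite_exp \<beta> m k z * cnj (hermite_exp \<beta> n l z)) \<le> (K * L) * exp (- (\<beta> / 4) * (fst z)\<^sup>2)" for z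
      using mult_mono[OF K(2) L, of "fst z" "fst z"] K L0 unfolding eq norm_mult norm_of_real abs_mult norm_cis by (simp add: mult_ac)
  qed (use assms in simp)
  have "(\<integral>z. hermite_exp \<beta> m k z * cnj (hermite_exp \<beta> n l z) \<partial>RT) =
      (\<integral>x. (\<integral>y\<in>{0..<2 * pi}. of_real (psi \<beta> m x * psi \<beta> n x) * cis (of_int (k - l) * y) \<partial>lborel) \<partial>lborel)"
    unfolding integral_RT_iterated(1)[OF int] unfolding eq by (simp only: fst_conv snd_conv)
  also have "\<dots> = (\<integral>x. complex_of_real (psi \<beta> m x * psi \<beta> n x) * complex_of_real (if k - l = 0 then 2 * pi else 0) \<partial>lborel)"
    by (simp only: set_integral_mult_right integral_cis_period)
  also have "\<dots> = complex_of_real (\<integral>x. psi \<beta> m x * psi \<beta> n x \<partial>lborel) * complex_of_real (if k - l = 0 then 2 * pi else 0)"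
    by (simp only: integral_mult_left_zero integral_complex_of_real)
  also have "\<dots> = (if m = n \<and> k = l then 2 * pi else 0)"
    by (simp add: psi_orthonormal[OF assms])
  finally show "(\<integral>z. hermite_exp \<beta> m k z * cnj (hermite_exp \<beta> n l z) \<partial>RT) = (if m = n \<and> k = l then 2 * pi else 0)" .
qed

text \<open>Different slots can share a Hermite index, for instance slot -1 at level n and slot 1 at
  level n - 2, or the exceptional slot at level 0 and slot -1 at level 1. Their directions are then
  orthogonal, so the slots are orthogonal although the scalar functions are not.\<close>

lemma slot_dir_dot:
  assumes "s \<in> signs" "s' \<in> signs" "slot_index n s = slot_index n' s'"
  shows "field_dot (slot_dir n s) (slot_dir n' s') = (if n = n' \<and> s = s' then 1 / (2 * pi) else 0)"
proof -
  have p: "complex_of_real (sqrt (2 * pi)) * complex_of_real (sqrt (2 * pi)) = of_real (2 * pi)"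
    "complex_of_real (sqrt (4 * pi)) * complex_of_real (sqrt (4 * pi)) = of_real (4 * pi)"
    by (simp_all only: of_real_mult[symmetric] real_sqrt_mult_self) simp_all
  consider "s = 0 \<and> s' = 0" | "s = 0 \<and> s' \<noteq> 0 \<or> s \<noteq> 0 \<and> s' = 0" | "s \<noteq> 0" "s' \<noteq> 0"
    by blast
  then show ?thesis
  proof cases
    case 1
    then show ?thesis
      using assms(3) p by (simp add: field_dot_def sum_3 slot_dir_def)
  next
    case 2
    then show ?thesis
      by (auto simp: field_dot_def sum_3 slot_dir_def)
  next
    case 3
    define e e' where "e = (if s = -1 \<and> n \<noteq> 0 then - 1 else 1 :: real)" and "e' = (if s' = -1 \<and> n' \<noteq> 0 then - 1 else 1 :: real)"
    have d: "slot_dir n s = of_real (1 / sqrt (4 * pi)) *s vector [of_real e, 0, 1]" "slot_dir n' s' = of_real (1 / sqrt (4 * pi)) *s vector [of_real e', 0, 1]"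
      using 3 by (auto simp: slot_dir_def e_def e'_def)
    have "field_dot (slot_dir n s) (slot_dir n' s') = of_real ((e * e' + 1) / (4 * pi))"
      unfolding d field_dot_def sum_3 using p(2) by (simp add: field_simps)
    \<comment> \<open>Equal signs would force equal levels: the direction (-1, 0, 1) belongs to
      level index + 1, and (1, 0, 1) to level index - 1 or to the exceptional slot of index
      0.\<close>
    moreover have "e * e' = (if n = n' \<and> s = s' then 1 else -1)"
      using assms 3 by (auto simp: e_def e'_def slot_index_def)
    ultimately show ?thesis by simp
  qed
qed

lemma square_integrable_slot: "\<beta> > 0 \<Longrightarrow> square_integrable (slot \<beta> n k s)"
  unfolding slot_eq_hermite_exp
proof -
  assume b: "\<beta> > 0"
  have "(\<lambda>c :: complex. c *s slot_dir n s) \<in> borel_measurable borel"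
    by (intro borel_measurable_continuous_onI linear_continuous_on bounded_linear_vec_scale)
  then have "(\<lambda>z. hermite_exp \<beta> (slot_index n s) k z *s slot_dir n s) \<in> borel_measurable borel"
    by (rule measurable_compose[OF hermite_exp_measurable])
  then show "square_integrable (\<lambda>z. hermite_exp \<beta> (slot_index n s) k z *s slot_dir n s)"
    using square_integrable_hermite_exp[OF b, of "slot_index n s" k]
    by (simp add: square_integrable_def norm_vec_scale power_mult_distrib)
qed

lemma slots_orthonormal:
  assumes "\<beta> > 0" "s \<in> signs" "s' \<in> signs"
  shows "L2_inner (slot \<beta> n k s) (slot \<beta> n' k' s') = (if (n, k, s) = (n', k', s') then 1 else 0)"
proof -
  have "field_dot (slot \<beta> n k s z) (slot \<beta> n' k' s' z) =
      (hermite_exp \<beta> (slot_index n s) k z * cnj (hermite_exp \<beta> (slot_index n' s') k' z)) * field_dot (slot_dir n s) (slot_dir n' s')" for z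
    by (simp add: slot_eq_hermite_exp field_dot_def sum_3 algebra_simps)
  then have "L2_inner (slot \<beta> n k s) (slot \<beta> n' k' s') =
      (if slot_index n s = slot_index n' s' \<and> k = k' then 2 * pi else 0) * field_dot (slot_dir n s) (slot_dir n' s')"
    unfolding L2_inner_eq by (simp add: hermite_exp_inner[OF assms(1)])
  then show ?thesis
    using slot_dir_dot[OF assms(2,3), of n n'] by (auto split: if_splits)
qed

lemma Psi_eq: "\<beta> > 0 \<Longrightarrow> Psi \<beta> n k j = (\<lambda>z. \<Sum>s\<in>signs. slot_coef \<beta> n k j s *s slot \<beta> n k s z)"
  by (rule ext) (rule Psi_eq_sum_slots)

lemma square_integrable_Psi: "\<beta> > 0 \<Longrightarrow> square_integrable (Psi \<beta> n k j)"
  unfolding Psi_eq by (intro square_integrable_sum square_integrable_scale square_integrable_slot) auto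

lemma L2_inner_Psi_left:
  assumes "\<beta> > 0" "square_integrable g"
  shows "L2_inner (Psi \<beta> n k j) g = (\<Sum>s\<in>signs. slot_coef \<beta> n k j s * L2_inner (slot \<beta> n k s) g)"
  unfolding Psi_eq[OF assms(1)] by (rule L2_inner_sum_left) (use assms square_integrable_slot in auto)

lemma L2_inner_Psi_right:
  assumes "\<beta> > 0" "square_integrable g"
  shows "L2_inner g (Psi \<beta> n k j) = (\<Sum>s\<in>signs. cnj (slot_coef \<beta> n k j s) * L2_inner g (slot \<beta> n k s))"
  unfolding Psi_eq[OF assms(1)] by (rule L2_inner_sum_right) (use assms square_integrable_slot in auto)

lemma Psi_orthonormal:
  assumes "\<beta> > 0" "j \<in> signs" "j' \<in> signs"
  shows "L2_inner (Psi \<beta> n k j) (Psi \<beta> n' k' j') = (if (n, k, j) = (n', k', j') then 1 else 0)"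
proof -
  have "L2_inner (Psi \<beta> n k j) (Psi \<beta> n' k' j') =
      (\<Sum>s\<in>signs. slot_coef \<beta> n k j s * (\<Sum>s'\<in>signs. cnj (slot_coef \<beta> n' k' j' s') * L2_inner (slot \<beta> n k s) (slot \<beta> n' k' s')))"
    by (simp only: L2_inner_Psi_left[OF assms(1) square_integrable_Psi[OF assms(1)]]
        L2_inner_Psi_right[OF assms(1) square_integrable_slot[OF assms(1)]])
  also have "\<dots> = (if n = n' \<and> k = k' then \<Sum>s\<in>signs. slot_coef \<beta> n k j s * cnj (slot_coef \<beta> n k j' s) else 0)"
    using slots_orthonormal[OF assms(1)] by auto
  also have "\<dots> = (if (n, k, j) = (n', k', j') then 1 else 0)"
    using slot_coef_orthonormal[OF assms] by auto
  finally show ?thesis .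
qed

text \<open>The unitary matrix is inverted by its adjoint; this is how density passes from the slots
  to the eigenvectors.\<close>

lemma slot_eq_sum_Psi:
  assumes "\<beta> > 0" "s \<in> signs"
  shows "slot \<beta> n k s z = (\<Sum>j\<in>signs. cnj (slot_coef \<beta> n k j s) *s Psi \<beta> n k j z)"
proof -
  have "(\<Sum>j\<in>signs. cnj (slot_coef \<beta> n k j s) *s Psi \<beta> n k j z) =
      (\<Sum>j\<in>signs. \<Sum>r\<in>signs. (slot_coef \<beta> n k j r * cnj (slot_coef \<beta> n k j s)) *s slot \<beta> n k r z)"
    unfolding Psi_eq_sum_slots[OF assms(1)] by (simp only: vec.scale_sum_right vec.scale_scale mult.commute)
  also have "\<dots> = (\<Sum>r\<in>signs. (\<Sum>j\<in>signs. slot_coef \<beta> n k j r * cnj (slot_coef \<beta> n k j s)) *s slot \<beta> n k r z)"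
    by (subst sum.swap) (simp only: vec.scale_sum_left)
  also have "\<dots> = (\<Sum>r\<in>signs. (if r = s then 1 else 0) *s slot \<beta> n k r z)"
    by (intro sum.cong refl) (simp only: slot_coef_orthonormal_columns[OF assms(1) _ assms(2)])
  also have "\<dots> = slot \<beta> n k s z"
    using assms(2) by auto
  finally show ?thesis ..
qed

abbreviation Psi_span :: "real \<Rightarrow> vfield set" where
  "Psi_span \<beta> \<equiv> field_span modes (\<lambda>(n, k, j). Psi \<beta> n k j)"

lemma slot_span_subset_Psi_span:
  assumes "\<beta> > 0"
  shows "slot_span \<beta> \<subseteq> Psi_span \<beta>"
proof
  fix f assume "f \<in> slot_span \<beta>"
  then obtain F c where F: "finite F" "F \<subseteq> modes" "f = (\<lambda>z. \<Sum>i\<in>F. c i *s (case i of (n, k, s) \<Rightarrow> slot \<beta> n k s) z)"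
    by (auto simp: field_span_def)
  have Psi: "Psi \<beta> n k j \<in> Psi_span \<beta>" if "j \<in> signs" for n k j
    using field_span_base[of "(n, k, j)" modes "\<lambda>(n, k, j). Psi \<beta> n k j"] that by (simp add: modes_def)
  have "slot \<beta> n k s \<in> Psi_span \<beta>" if "s \<in> signs" for n k s
  proof -
    have "(\<lambda>z. \<Sum>j\<in>signs. cnj (slot_coef \<beta> n k j s) *s Psi \<beta> n k j z) \<in> Psi_span \<beta>"
      by (rule field_span_sum, simp, rule field_span_mult, rule Psi)
    moreover have "slot \<beta> n k s = (\<lambda>z. \<Sum>j\<in>signs. cnj (slot_coef \<beta> n k j s) *s Psi \<beta> n k j z)"
      by (rule ext) (rule slot_eq_sum_Psi[OF assms that])
    ultimately show ?thesis
      by (simp only:)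
  qed
  then have slot: "(case i of (n, k, s) \<Rightarrow> slot \<beta> n k s) \<in> Psi_span \<beta>" if "i \<in> F" for i
    using F(2) that by (cases i) (auto simp: modes_def)
  show "f \<in> Psi_span \<beta>"
    unfolding F(3) by (rule field_span_sum[OF F(1)], rule field_span_mult, rule slot)
qed

lemma hilbert_basis_Psi:
  assumes "\<beta> > 0"
  shows "hilbert_basis modes (\<lambda>(n, k, j). Psi \<beta> n k j)"
  unfolding hilbert_basis_def
proof (intro conjI ballI allI impI)
  fix i assume i: "i \<in> modes"
  show "(case i of (n, k, j) \<Rightarrow> Psi \<beta> n k j) \<in> L2"
    by (cases i) (simp add: square_integrable_iff_L2 square_integrable_Psi[OF assms] periodic_Psi[OF assms])
  fix i' assume i': "i' \<in> modes"
  show "L2_inner (case i of (n, k, j) \<Rightarrow> Psi \<beta> n k j) (case i' of (n, k, j) \<Rightarrow> Psi \<beta> n k j) = (if i = i' then 1 else 0)"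
  proof -
    obtain n k j where eq: "i = (n, k, j)" by (cases i)
    obtain n' k' j' where eq': "i' = (n', k', j')" by (cases i')
    have "j \<in> signs" "j' \<in> signs"
      using i i' unfolding eq eq' modes_def by auto
    then show ?thesis
      unfolding eq eq' prod.case by (rule Psi_orthonormal[OF assms])
  qed
next
  fix f :: vfield and \<epsilon> :: real assume f: "f \<in> L2" and e: "\<epsilon> > 0"
  have "square_integrable f"
    using f unfolding square_integrable_iff_L2 by blast
  then obtain g where g: "g \<in> slot_span \<beta>" "(\<integral>z. (norm (f z - g z))\<^sup>2 \<partial>RT) < \<epsilon>\<^sup>2"
    using slots_dense[OF assms _ zero_less_power[OF e]] by blast
  then obtain F c where F: "finite F" "F \<subseteq> modes" "g = (\<lambda>z. \<Sum>i\<in>F. c i *s (case i of (n, k, j) \<Rightarrow> Psi \<beta> n k j) z)"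
    using subsetD[OF slot_span_subset_Psi_span[OF assms] g(1)] by (auto simp: field_span_def)
  have "L2_norm (\<lambda>z. f z - g z) < \<epsilon>"
    unfolding L2_norm_def using real_sqrt_less_mono[OF g(2)] e by simp
  then have "L2_norm (\<lambda>z. f z - (\<Sum>i\<in>F. c i *s (case i of (n, k, j) \<Rightarrow> Psi \<beta> n k j) z)) < \<epsilon>"
    unfolding F(3) .
  then show "\<exists>F c. finite F \<and> F \<subseteq> modes \<and> L2_norm (\<lambda>z. f z - (\<Sum>i\<in>F. c i *s (case i of (n, k, j) \<Rightarrow> Psi \<beta> n k j) z)) < \<epsilon>"
    by (intro exI[of _ F] exI[of _ c] conjI F(1,2))
qed

text \<open>If g is a combination of slots, then f is orthogonal to g, and Pythagoras gives |f|^2 <=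
  |f - g|^2, which is arbitrarily small by density.\<close>

lemma L2_total:
  fixes f :: vfield
  assumes "\<beta> > 0" "square_integrable f" and orth: "\<And>n k s. s \<in> signs \<Longrightarrow> L2_inner f (slot \<beta> n k s) = 0"
  shows "AE z in RT. f z = 0"
proof -
  have le: "(\<integral>z. (norm (f z))\<^sup>2 \<partial>RT) \<le> \<epsilon>" if e: "\<epsilon> > 0" for \<epsilon>
  proof -
    obtain g where g: "g \<in> slot_span \<beta>" "(\<integral>z. (norm (f z - g z))\<^sup>2 \<partial>RT) < \<epsilon>"
      using slots_dense[OF assms(1,2) e] by blast
    then obtain F c where F: "finite F" "F \<subseteq> modes" "g = (\<lambda>z. \<Sum>i\<in>F. c i *s (case i of (n, k, s) \<Rightarrow> slot \<beta> n k s) z)"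
      unfolding field_span_def by blast
    have sq: "square_integrable (case i of (n, k, s) \<Rightarrow> slot \<beta> n k s)" for i
      by (cases i) (simp add: square_integrable_slot[OF assms(1)])
    have sg: "square_integrable g"
      unfolding F(3) by (intro square_integrable_sum square_integrable_scale sq F(1))
    have "L2_inner f g = (\<Sum>i\<in>F. cnj (c i) * L2_inner f (case i of (n, k, s) \<Rightarrow> slot \<beta> n k s))"
      unfolding F(3) by (rule L2_inner_sum_right[OF F(1) sq assms(2)])
    also have "\<dots> = 0"
      using F(2) by (intro sum.neutral) (auto simp: modes_def orth)
    finally have "Re (\<integral>z. field_dot (f z) (g z) \<partial>RT) = 0"
      by (simp add: L2_inner_eq)
    then have fg: "(\<integral>z. Re (field_dot (f z) (g z)) \<partial>RT) = 0"
      using field_dot_integrable[OF assms(2) sg] by simp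
    have pt: "(norm (f z - g z))\<^sup>2 = (norm (f z))\<^sup>2 + (norm (g z))\<^sup>2 - 2 * Re (field_dot (f z) (g z))" for z
    proof -
      have c: "(norm (a - b))\<^sup>2 = (norm a)\<^sup>2 + (norm b)\<^sup>2 - 2 * Re (a * cnj b)" for a b :: complex
        unfolding cmod_power2 by (simp add: power2_eq_square algebra_simps)
      show ?thesis
        unfolding vec3_norm_square field_dot_def sum_3 vector_minus_component c by simp
    qed
    have "(\<integral>z. (norm (f z - g z))\<^sup>2 \<partial>RT) = (\<integral>z. (norm (f z))\<^sup>2 \<partial>RT) + (\<integral>z. (norm (g z))\<^sup>2 \<partial>RT)"
      unfolding pt using assms(2) sg field_dot_integrable[OF assms(2) sg] fg by (simp add: square_integrable_def)
    moreover have "(\<integral>z. (norm (g z))\<^sup>2 \<partial>RT) \<ge> 0"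
      by simp
    ultimately show ?thesis
      using g(2) by linarith
  qed
  have "(\<integral>z. (norm (f z))\<^sup>2 \<partial>RT) \<le> 0"
    by (rule field_le_epsilon) (simp add: le)
  then have "(\<integral>z. (norm (f z))\<^sup>2 \<partial>RT) = 0"
    by (simp add: antisym)
  then have "AE z in RT. (norm (f z))\<^sup>2 = 0"
    using assms(2) by (subst (asm) integral_nonneg_eq_0_iff_AE) (auto simp: square_integrable_def)
  then show ?thesis
    by eventually_elim simp
qed

section \<open>Sobolev norms of the eigenvectors\<close>

text \<open>Makes the Hermite functions admissible in the definition of the Fourier transform.
  Testing with them alone already determines it, by totality.\<close>

lemma schwartz_R_psi:
  assumes "\<beta> > 0"
  shows "psi \<beta> n \<in> schwartz_R"
proof -
  have d: "(deriv ^^ m) (psi \<beta> n) = dpsi \<beta> m n" for m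
  proof (induction m)
    case 0
    show ?case unfolding funpow.simps id_apply by (rule psi_eq_dpsi)
  next
    case (Suc m)
    show ?case
      unfolding funpow.simps o_apply Suc by (rule ext) (rule DERIV_imp_deriv[OF dpsi_has_derivative[OF assms]])
  qed
  have "dpsi \<beta> m n differentiable_on UNIV" for m
    unfolding differentiable_on_def differentiable_def
    using dpsi_has_derivative[OF assms, of m n, unfolded has_field_derivative_def] by (blast intro: has_derivative_at_withinI)
  moreover have "bounded (range (\<lambda>x. x ^ p * dpsi \<beta> m n x))" for m p
  proof -
    obtain K where K: "K \<ge> 0" "\<And>x. \<bar>dpsi \<beta> m n x\<bar> \<le> K * exp (- (\<beta> / 4) * x\<^sup>2)"
      using dpsi_gaussian_bound[OF assms] by blast
    obtain M where M: "\<And>x. \<bar>poly (monom 1 p) x\<bar> * exp (- (\<beta> / 4) * x\<^sup>2) \<le> M"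
      using poly_times_gaussian_bounded[of "\<beta> / 4" "monom 1 p"] assms by auto
    have "norm (x ^ p * dpsi \<beta> m n x) \<le> K * M" for x
    proof -
      have "norm (x ^ p * dpsi \<beta> m n x) \<le> \<bar>x ^ p\<bar> * (K * exp (- (\<beta> / 4) * x\<^sup>2))"
        unfolding real_norm_def abs_mult by (intro mult_left_mono K) auto
      also have "\<dots> = K * (\<bar>poly (monom 1 p) x\<bar> * exp (- (\<beta> / 4) * x\<^sup>2))"
        by (simp add: poly_monom)
      also have "\<dots> \<le> K * M"
        by (intro mult_left_mono M K)
      finally show ?thesis .
    qed
    then show ?thesis
      unfolding bounded_iff by blast
  qed
  ultimately show ?thesis
    unfolding schwartz_R_def by (simp add: d)
qed

lemma schwartz_R_integrable:
  assumes "\<phi> \<in> schwartz_R"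
  shows "integrable lborel \<phi>"
proof -
  have "(deriv ^^ 0) \<phi> differentiable_on UNIV"
    using assms unfolding schwartz_R_def by blast
  then have "continuous_on UNIV \<phi>"
    by (simp add: differentiable_imp_continuous_on)
  then have [measurable]: "\<phi> \<in> borel_measurable borel"
    by (rule borel_measurable_continuous_onI)
  have "bounded (range (\<lambda>x. x ^ p * (deriv ^^ 0) \<phi> x))" for p
    using assms unfolding schwartz_R_def by blast
  from this[of 0] this[of 2] obtain A B where AB: "\<And>x. \<bar>\<phi> x\<bar> \<le> A" "\<And>x. \<bar>x\<^sup>2 * \<phi> x\<bar> \<le> B"
    unfolding bounded_iff by auto
  have "integrable lborel (\<lambda>x. (A + B) * inverse (1 + x\<^sup>2))"
    using integrable_inverse_1_plus_square by (intro integrable_mult_right) (simp add: set_integrable_def)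
  then show ?thesis
  proof (rule Bochner_Integration.integrable_bound)
    have "\<bar>\<phi> x\<bar> \<le> (A + B) * inverse (1 + x\<^sup>2)" for x
    proof -
      have "1 + x\<^sup>2 > 0" by (simp add: add_pos_nonneg)
      moreover have "\<bar>\<phi> x\<bar> * (1 + x\<^sup>2) \<le> A + B"
        using AB(1)[of x] AB(2)[of x] by (simp add: distrib_left abs_mult mult.commute)
      ultimately show ?thesis
        by (simp add: pos_le_divide_eq flip: divide_inverse)
    qed
    then show "AE x in lborel. norm (\<phi> x) \<le> norm ((A + B) * inverse (1 + x\<^sup>2))"
      unfolding real_norm_def by (intro AE_I2) (rule order_trans[OF _ abs_ge_self])
  qed simp
qed

text \<open>Fubini moves the transform from the test function to g; the kernel has modulus 1, so |g|
  |\<phi>| is an integrable majorant.\<close>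

lemma fourier_transform_swap:
  fixes \<phi> :: "real \<Rightarrow> real" and g :: "real \<Rightarrow> real"
  assumes \<phi>: "integrable lborel \<phi>" and g: "integrable lborel g"
  shows "integrable lborel (\<lambda>x. (\<integral>\<xi>. \<phi> \<xi> *\<^sub>R cis (- \<xi> * x) \<partial>lborel) * of_real (g x))"
    and "(\<integral>x. (\<integral>\<xi>. \<phi> \<xi> *\<^sub>R cis (- \<xi> * x) \<partial>lborel) * of_real (g x) \<partial>lborel) =
      (\<integral>\<xi>. \<phi> \<xi> *\<^sub>R (\<integral>x. of_real (g x) * cis (- \<xi> * x) \<partial>lborel) \<partial>lborel)"
proof -
  have [measurable]: "\<phi> \<in> borel_measurable borel" "g \<in> borel_measurable borel"
    using \<phi> g by auto
  have c: "(\<lambda>p :: real \<times> real. cis (- snd p * fst p)) \<in> borel_measurable (borel \<Otimes>\<^sub>M borel)"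
    unfolding borel_prod by (intro borel_measurable_continuous_onI continuous_intros)
  define h where "h x \<xi> = complex_of_real (g x * \<phi> \<xi>) * cis (- \<xi> * x)" for x \<xi>
  have hm: "case_prod h \<in> borel_measurable (lborel \<Otimes>\<^sub>M lborel)"
  proof -
    have "(\<lambda>p. complex_of_real (g (fst p) * \<phi> (snd p)) * cis (- snd p * fst p)) \<in> borel_measurable (borel \<Otimes>\<^sub>M borel)"
      using c by measurable
    then show ?thesis
      by (simp add: h_def split_beta' cong: measurable_cong_sets)
  qed
  have n: "norm (h x \<xi>) = \<bar>g x\<bar> * \<bar>\<phi> \<xi>\<bar>" for x \<xi>
    by (simp add: h_def norm_mult abs_mult)
  have int: "integrable (lborel \<Otimes>\<^sub>M lborel) (case_prod h)"
  proof (rule lborel_pair.Fubini_integrable[OF hm])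
    show "integrable lborel (\<lambda>x. \<integral>\<xi>. norm (case_prod h (x, \<xi>)) \<partial>lborel)"
      using g by (simp add: n)
    show "AE x in lborel. integrable lborel (\<lambda>\<xi>. case_prod h (x, \<xi>))"
    proof (rule AE_I2)
      fix x
      have "integrable lborel (\<lambda>\<xi>. g x * \<phi> \<xi>)"
        using \<phi> by simp
      then show "integrable lborel (\<lambda>\<xi>. case_prod h (x, \<xi>))"
      proof (rule Bochner_Integration.integrable_bound)
        have "(\<lambda>\<xi>. cis (- \<xi> * x)) \<in> borel_measurable lborel"
          by (simp, intro borel_measurable_continuous_onI continuous_intros)
        moreover have "(\<lambda>\<xi>. complex_of_real (g x * \<phi> \<xi>)) \<in> borel_measurable lborel"
          by measurable
        ultimately show "(\<lambda>\<xi>. case_prod h (x, \<xi>)) \<in> borel_measurable lborel"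
          unfolding h_def prod.case by (rule borel_measurable_times[rotated])
      qed (simp add: n abs_mult)
    qed
  qed
  have 1: "(\<integral>\<xi>. h x \<xi> \<partial>lborel) = (\<integral>\<xi>. \<phi> \<xi> *\<^sub>R cis (- \<xi> * x) \<partial>lborel) * of_real (g x)" for x
    unfolding integral_mult_left_zero[symmetric] by (rule Bochner_Integration.integral_cong) (simp_all add: h_def scaleR_conv_of_real mult_ac)
  have 2: "(\<integral>x. h x \<xi> \<partial>lborel) = \<phi> \<xi> *\<^sub>R (\<integral>x. of_real (g x) * cis (- \<xi> * x) \<partial>lborel)" for \<xi>
    unfolding integral_scaleR_right[symmetric] by (rule Bochner_Integration.integral_cong) (simp_all add: h_def scaleR_conv_of_real mult_ac)
  show "integrable lborel (\<lambda>x. (\<integral>\<xi>. \<phi> \<xi> *\<^sub>R cis (- \<xi> * x) \<partial>lborel) * of_real (g x))"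
    using lborel_pair.integrable_fst[OF int] by (simp add: 1)
  have "(\<integral>x. (\<integral>\<xi>. h x \<xi> \<partial>lborel) \<partial>lborel) = (\<integral>\<xi>. (\<integral>x. h x \<xi> \<partial>lborel) \<partial>lborel)"
    using lborel_pair.Fubini_integral[OF int] by simp
  then show "(\<integral>x. (\<integral>\<xi>. \<phi> \<xi> *\<^sub>R cis (- \<xi> * x) \<partial>lborel) * of_real (g x) \<partial>lborel) =
      (\<integral>\<xi>. \<phi> \<xi> *\<^sub>R (\<integral>x. of_real (g x) * cis (- \<xi> * x) \<partial>lborel) \<partial>lborel)"
    unfolding 1 2 .
qed

section \<open>Fourier transforms of the eigenvectors\<close>

definition psi_hat :: "real \<Rightarrow> nat \<Rightarrow> real \<Rightarrow> complex" where
  "psi_hat \<beta> m \<xi> = (- \<i>) ^ m * of_real (sqrt (2 * pi) * psi (1 / \<beta>) m \<xi>)"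

lemma psi_integrable: "\<beta> > 0 \<Longrightarrow> integrable lborel (psi \<beta> m)"
proof -
  assume b: "\<beta> > 0"
  obtain K where K: "\<And>x. \<bar>psi \<beta> m x\<bar> \<le> K * exp (- (\<beta> / 4) * x\<^sup>2)"
    using psi_gaussian_bound[OF b] by blast
  then show ?thesis
    using b by (intro integrable_gaussian_bound[of "\<beta> / 4" _ K]) auto
qed

text \<open>The pairing in \<open>is_fourier\<close> for one scalar slot: the integral over x_2
  keeps only the frequency l = k, and its value 2 pi cancels the normalising factor.\<close>

lemma hermite_exp_fourier:
  assumes "\<beta> > 0" "\<phi> \<in> schwartz_R"
  defines "w \<equiv> \<lambda>l z. 1 / (2 * pi) * (\<integral>\<xi>. \<phi> \<xi> *\<^sub>R cis (- \<xi> * fst z) \<partial>lborel) * cis (- of_int l * snd z)"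
  shows "integrable RT (\<lambda>z. w l z * hermite_exp \<beta> m k z)"
    and "(\<integral>z. w l z * hermite_exp \<beta> m k z \<partial>RT) = (if l = k then \<integral>\<xi>. \<phi> \<xi> *\<^sub>R psi_hat \<beta> m \<xi> \<partial>lborel else 0)"
proof -
  note \<phi> = schwartz_R_integrable[OF assms(2)]
  note g = psi_integrable[OF assms(1), of m]
  define v where "v x = (\<integral>\<xi>. \<phi> \<xi> *\<^sub>R cis (- \<xi> * x) \<partial>lborel)" for x
  have [measurable]: "\<phi> \<in> borel_measurable borel"
    using \<phi> by auto
  have c: "(\<lambda>p :: real \<times> real. cis (- snd p * fst p)) \<in> borel_measurable (borel \<Otimes>\<^sub>M borel)"
    unfolding borel_prod by (intro borel_measurable_continuous_onI continuous_intros)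
  have vm: "v \<in> borel_measurable borel"
  proof -
    have "(\<lambda>p. \<phi> (snd p) *\<^sub>R cis (- snd p * fst p)) \<in> borel_measurable (borel \<Otimes>\<^sub>M lborel)"
      using c by measurable
    then have "case_prod (\<lambda>x \<xi>. \<phi> \<xi> *\<^sub>R cis (- \<xi> * x)) \<in> borel_measurable (borel \<Otimes>\<^sub>M lborel)"
      by (simp add: split_beta')
    from sigma_finite_measure.borel_measurable_lebesgue_integral[OF sigma_finite_lborel this] show ?thesis
      unfolding v_def .
  qed
  define M where "M = (\<integral>\<xi>. \<bar>\<phi> \<xi>\<bar> \<partial>lborel)"
  have vM: "norm (v x) \<le> M" for x
  proof -
    have "norm (v x) \<le> (\<integral>\<xi>. norm (\<phi> \<xi> *\<^sub>R cis (- \<xi> * x)) \<partial>lborel)"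
      unfolding v_def by (rule integral_norm_bound)
    then show ?thesis by (simp add: M_def)
  qed
  have M: "M \<ge> 0" by (simp add: M_def)
  have eq: "w l z * hermite_exp \<beta> m k z = (1 / (2 * pi) * (v (fst z) * of_real (psi \<beta> m (fst z)))) * cis (of_int (k - l) * snd z)" for z
  proof -
    have "cis (- of_int l * snd z) * cis (of_int k * snd z) = cis (of_int (k - l) * snd z)"
      unfolding cis_mult by (simp add: algebra_simps)
    moreover have "a * b * c * (d * e) = (a * (b * d)) * (c * e)" for a b c d e :: complex
      by simp
    ultimately show ?thesis
      unfolding w_def v_def[symmetric] hermite_exp_def split_beta' by (simp only:)
  qed
  obtain K where K: "\<And>x. \<bar>psi \<beta> m x\<bar> \<le> K * exp (- (\<beta> / 4) * x\<^sup>2)"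
    using psi_gaussian_bound[OF assms(1)] by blast
  show int: "integrable RT (\<lambda>z. w l z * hermite_exp \<beta> m k z)"
  proof (rule integrable_RT_gaussian_bound)
    have f: "(fst :: real \<times> real \<Rightarrow> real) \<in> borel_measurable borel" and cs: "(\<lambda>z :: real \<times> real. cis (- of_int l * snd z)) \<in> borel_measurable borel"
      by (intro borel_measurable_continuous_onI continuous_intros)+
    show "(\<lambda>z. w l z * hermite_exp \<beta> m k z) \<in> borel_measurable borel"
      unfolding w_def v_def[symmetric]
      by (intro borel_measurable_times hermite_exp_measurable cs borel_measurable_const measurable_compose[OF f vm])
    show "norm (w l z * hermite_exp \<beta> m k z) \<le> (1 / (2 * pi) * (M * K)) * exp (- (\<beta> / 4) * (fst z)\<^sup>2)" for z
    proof -
      have "norm (w l z * hermite_exp \<beta> m k z) = 1 / (2 * pi) * (norm (v (fst z)) * \<bar>psi \<beta> m (fst z)\<bar>)"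
        unfolding eq norm_mult norm_of_real norm_cis by (simp add: norm_divide)
      also have "\<dots> \<le> 1 / (2 * pi) * (M * (K * exp (- (\<beta> / 4) * (fst z)\<^sup>2)))"
        by (intro mult_left_mono mult_mono vM K M) auto
      finally show ?thesis by (simp only: mult.assoc)
    qed
  qed (use assms in simp)
  have "(\<integral>z. w l z * hermite_exp \<beta> m k z \<partial>RT) =
      (\<integral>x. (\<integral>y\<in>{0..<2 * pi}. (1 / (2 * pi) * (v x * of_real (psi \<beta> m x))) * cis (of_int (k - l) * y) \<partial>lborel) \<partial>lborel)"
    unfolding integral_RT_iterated(1)[OF int] unfolding eq by (simp only: fst_conv snd_conv)
  also have "\<dots> = (\<integral>x. (v x * of_real (psi \<beta> m x)) * (1 / (2 * pi) * complex_of_real (if k - l = 0 then 2 * pi else 0)) \<partial>lborel)"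
    by (simp only: set_integral_mult_right integral_cis_period) (simp only: mult_ac)
  also have "\<dots> = (\<integral>x. v x * of_real (psi \<beta> m x) \<partial>lborel) * (1 / (2 * pi) * complex_of_real (if k - l = 0 then 2 * pi else 0))"
    by (simp only: integral_mult_left_zero)
  also have "(\<integral>x. v x * of_real (psi \<beta> m x) \<partial>lborel) = (\<integral>\<xi>. \<phi> \<xi> *\<^sub>R psi_hat \<beta> m \<xi> \<partial>lborel)"
    unfolding v_def fourier_transform_swap(2)[OF \<phi> g] psi_fourier[OF assms(1)] psi_hat_def ..
  finally show "(\<integral>z. w l z * hermite_exp \<beta> m k z \<partial>RT) = (if l = k then \<integral>\<xi>. \<phi> \<xi> *\<^sub>R psi_hat \<beta> m \<xi> \<partial>lborel else 0)"
    by auto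
qed

definition Psi_hat :: "real \<Rightarrow> nat \<Rightarrow> int \<Rightarrow> int \<Rightarrow> real \<Rightarrow> complex ^ 3" where
  "Psi_hat \<beta> n k j \<xi> = (\<Sum>s\<in>signs. (slot_coef \<beta> n k j s * psi_hat \<beta> (slot_index n s) \<xi>) *s slot_dir n s)"

text \<open>The cross terms vanish: for $n\ge1$ the directions are orthogonal, and for $n=0$ one of the slots $\pm1$ is empty.\<close>

lemma norm_Psi_hat:
  assumes "j \<in> signs"
  shows "(norm (Psi_hat \<beta> n k j \<xi>))\<^sup>2 = (\<Sum>s\<in>signs. (norm (slot_coef \<beta> n k j s))\<^sup>2 * (psi (1 / \<beta>) (slot_index n s) \<xi>)\<^sup>2)"
proof -
  define A where "A s = slot_coef \<beta> n k j s * psi_hat \<beta> (slot_index n s) \<xi>" for s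
  \<comment> \<open>The sign of the first component of the direction of the slot -1, which is
    exceptional at n = 0.\<close>
  define e where "e = (if n = 0 then 1 else - 1 :: complex)"
  define Y X where "Y = complex_of_real (1 / sqrt (4 * pi))" and "X = complex_of_real (1 / sqrt (2 * pi))"
  have Y: "(norm Y)\<^sup>2 = 1 / (4 * pi)" "(norm X)\<^sup>2 = 1 / (2 * pi)"
    unfolding X_def Y_def norm_of_real by (simp_all add: power_divide)
  have c: "Psi_hat \<beta> n k j \<xi> $ 1 = Y * (e * A (-1) + A 1)" "Psi_hat \<beta> n k j \<xi> $ 2 = X * A 0" "Psi_hat \<beta> n k j \<xi> $ 3 = Y * (A (-1) + A 1)"
  proof -
    have "Psi_hat \<beta> n k j \<xi> = A (-1) *s slot_dir n (-1) + (A 0 *s slot_dir n 0 + A 1 *s slot_dir n 1)"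
      by (simp add: Psi_hat_def A_def del: slot_index_simps)
    then show "Psi_hat \<beta> n k j \<xi> $ 1 = Y * (e * A (-1) + A 1)" "Psi_hat \<beta> n k j \<xi> $ 2 = X * A 0" "Psi_hat \<beta> n k j \<xi> $ 3 = Y * (A (-1) + A 1)"
      by (simp_all add: slot_dir_def e_def X_def Y_def algebra_simps add_divide_distrib)
  qed
  have par: "(norm (- a + b))\<^sup>2 + (norm (a + b))\<^sup>2 = 2 * ((norm a)\<^sup>2 + (norm b)\<^sup>2)" for a b :: complex
    unfolding cmod_power2 by (simp add: power2_eq_square algebra_simps)
  have sum: "(norm (e * A (-1) + A 1))\<^sup>2 + (norm (A (-1) + A 1))\<^sup>2 = 2 * ((norm (A (-1)))\<^sup>2 + (norm (A 1))\<^sup>2)"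
  proof (cases "n = 0")
    case True
    then have "A (-1) = 0 \<or> A 1 = 0"
      by (auto simp: A_def slot_coef_def Let_def)
    then show ?thesis
      using True by (auto simp: e_def)
  next
    case False
    then show ?thesis
      using par[of "A (-1)" "A 1"] by (simp add: e_def)
  qed
  have nA: "(norm (A s))\<^sup>2 = 2 * pi * ((norm (slot_coef \<beta> n k j s))\<^sup>2 * (psi (1 / \<beta>) (slot_index n s) \<xi>)\<^sup>2)" for s
    by (simp add: A_def psi_hat_def norm_mult norm_power power_mult_distrib del: of_real_mult)
  have "(norm (Psi_hat \<beta> n k j \<xi>))\<^sup>2 = 1 / (4 * pi) * ((norm (e * A (-1) + A 1))\<^sup>2 + (norm (A (-1) + A 1))\<^sup>2) + 1 / (2 * pi) * (norm (A 0))\<^sup>2"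
    unfolding vec3_norm_square c norm_mult power_mult_distrib Y by (simp add: algebra_simps)
  also have "\<dots> = 1 / (2 * pi) * ((norm (A (-1)))\<^sup>2 + (norm (A 0))\<^sup>2 + (norm (A 1))\<^sup>2)"
    unfolding sum by (simp add: field_simps)
  also have "\<dots> = (\<Sum>s\<in>signs. (norm (slot_coef \<beta> n k j s))\<^sup>2 * (psi (1 / \<beta>) (slot_index n s) \<xi>)\<^sup>2)"
    unfolding nA by (simp add: field_simps)
  finally show ?thesis .
qed

lemma Psi_hat_measurable: "Psi_hat \<beta> n k j \<in> borel_measurable borel"
proof -
  have 1: "psi_hat \<beta> m \<in> borel_measurable borel" for m
    unfolding psi_hat_def by measurable
  have 2: "(\<lambda>c :: complex. (a * c) *s (v :: complex ^ 3)) \<in> borel_measurable borel" for a v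
    by (intro borel_measurable_continuous_onI bounded_linear.continuous_on[OF bounded_linear_vec_scale] continuous_intros)
  show ?thesis
    unfolding Psi_hat_def by (intro borel_measurable_sum measurable_compose[OF 1 2])
qed

lemma Psi_hat_square_integrable:
  assumes "\<beta> > 0" "j \<in> signs"
  shows "integrable lborel (\<lambda>\<xi>. (norm (Psi_hat \<beta> n k j \<xi>))\<^sup>2)"
proof -
  have "integrable lborel (\<lambda>\<xi>. (psi (1 / \<beta>) m \<xi>)\<^sup>2)" for m
    using psi_moment_integrable[of "1 / \<beta>" 0 m] assms by simp
  then show ?thesis
    unfolding norm_Psi_hat[OF assms(2)] by (intro Bochner_Integration.integrable_sum integrable_mult_right)
qed

lemma is_fourier_Psi:
  assumes "\<beta> > 0" "j \<in> signs"
  shows "is_fourier (Psi \<beta> n k j) (\<lambda>\<xi> l. if l = k then Psi_hat \<beta> n k j \<xi> else 0)"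
  unfolding is_fourier_def
proof (intro conjI allI ballI)
  show "Psi \<beta> n k j \<in> L2"
    unfolding square_integrable_iff_L2 using periodic_Psi square_integrable_Psi assms by blast
  fix l
  show "(\<lambda>\<xi>. if l = k then Psi_hat \<beta> n k j \<xi> else 0) \<in> borel_measurable borel"
    using Psi_hat_measurable[of \<beta> n k j] by (cases "l = k") auto
  show "integrable lborel (\<lambda>\<xi>. (norm (if l = k then Psi_hat \<beta> n k j \<xi> else 0))\<^sup>2)"
    using Psi_hat_square_integrable[OF assms] by (cases "l = k") auto
  fix \<phi> assume \<phi>: "\<phi> \<in> schwartz_R"
  define w where "w z = 1 / (2 * pi) * (\<integral>\<xi>. \<phi> \<xi> *\<^sub>R cis (- \<xi> * fst z) \<partial>lborel) * cis (- of_int l * snd z)" for z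
  note hf = hermite_exp_fourier[OF assms(1) \<phi>, where l = l and k = k, folded w_def]
  have ph: "integrable lborel (\<lambda>\<xi>. \<phi> \<xi> *\<^sub>R psi_hat \<beta> m \<xi>)" for m
  proof -
    obtain C where C: "\<And>x. \<bar>psi (1 / \<beta>) m x\<bar> \<le> C"
      using psi_bounded[of "1 / \<beta>"] assms by auto
    have [measurable]: "\<phi> \<in> borel_measurable borel"
      using schwartz_R_integrable[OF \<phi>] by auto
    have "integrable lborel (\<lambda>\<xi>. (sqrt (2 * pi) * C) * \<phi> \<xi>)"
      using schwartz_R_integrable[OF \<phi>] by simp
    then show ?thesis
    proof (rule Bochner_Integration.integrable_bound)
      have "norm (\<phi> \<xi> *\<^sub>R psi_hat \<beta> m \<xi>) \<le> norm ((sqrt (2 * pi) * C) * \<phi> \<xi>)" for \<xi>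
      proof -
        define c where "c = sqrt (2 * pi) * C"
        have "norm (psi_hat \<beta> m \<xi>) = sqrt (2 * pi) * \<bar>psi (1 / \<beta>) m \<xi>\<bar>"
          unfolding psi_hat_def norm_mult norm_power norm_of_real by (simp add: abs_mult)
        also have "\<dots> \<le> c"
          unfolding c_def by (intro mult_left_mono C) simp
        finally have "\<bar>\<phi> \<xi>\<bar> * norm (psi_hat \<beta> m \<xi>) \<le> \<bar>\<phi> \<xi>\<bar> * \<bar>c\<bar>"
          by (intro mult_left_mono) auto
        also have "\<dots> = norm (c * \<phi> \<xi>)"
          unfolding real_norm_def abs_mult by (rule mult.commute)
        finally show ?thesis
          unfolding norm_scaleR c_def .
      qed
      then show "AE \<xi> in lborel. norm (\<phi> \<xi> *\<^sub>R psi_hat \<beta> m \<xi>) \<le> norm ((sqrt (2 * pi) * C) * \<phi> \<xi>)"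
        by (intro AE_I2)
      show "(\<lambda>\<xi>. \<phi> \<xi> *\<^sub>R psi_hat \<beta> m \<xi>) \<in> borel_measurable lborel"
        unfolding psi_hat_def by measurable
    qed
  qed
  define V where "V s = slot_coef \<beta> n k j s *s slot_dir n s" for s
  have "(\<integral>z. w z *s Psi \<beta> n k j z \<partial>RT) = (\<integral>z. (\<Sum>s\<in>signs. (w z * hermite_exp \<beta> (slot_index n s) k z) *s V s) \<partial>RT)"
    unfolding Psi_eq_sum_slots[OF assms(1)] slot_eq_hermite_exp vec.scale_sum_right V_def
    by (intro Bochner_Integration.integral_cong refl sum.cong) (simp add: mult_ac)
  also have "\<dots> = (\<Sum>s\<in>signs. (\<integral>z. w z * hermite_exp \<beta> (slot_index n s) k z \<partial>RT) *s V s)"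
    using hf(1) by (subst Bochner_Integration.integral_sum) (auto intro!: integrable_bounded_linear[OF bounded_linear_vec_scale] simp: integral_bounded_linear[OF bounded_linear_vec_scale])
  also have "\<dots> = (if l = k then \<Sum>s\<in>signs. (\<integral>\<xi>. \<phi> \<xi> *\<^sub>R psi_hat \<beta> (slot_index n s) \<xi> \<partial>lborel) *s V s else 0)"
    unfolding hf(2) by simp
  also have "(\<Sum>s\<in>signs. (\<integral>\<xi>. \<phi> \<xi> *\<^sub>R psi_hat \<beta> (slot_index n s) \<xi> \<partial>lborel) *s V s) =
      (\<integral>\<xi>. (\<Sum>s\<in>signs. (\<phi> \<xi> *\<^sub>R psi_hat \<beta> (slot_index n s) \<xi>) *s V s) \<partial>lborel)"
    using ph by (subst Bochner_Integration.integral_sum) (auto intro!: integrable_bounded_linear[OF bounded_linear_vec_scale] simp: integral_bounded_linear[OF bounded_linear_vec_scale])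
  also have "\<dots> = (\<integral>\<xi>. \<phi> \<xi> *\<^sub>R Psi_hat \<beta> n k j \<xi> \<partial>lborel)"
    unfolding Psi_hat_def V_def scaleR_sum_right
    by (intro Bochner_Integration.integral_cong refl sum.cong) (simp add: vec_eq_iff scaleR_conv_of_real[where x = "x :: complex" for x] mult_ac)
  finally show "(\<integral>\<xi>. \<phi> \<xi> *\<^sub>R (if l = k then Psi_hat \<beta> n k j \<xi> else 0) \<partial>lborel) =
      (\<integral>z. (1 / (2 * pi) * (\<integral>\<xi>. \<phi> \<xi> *\<^sub>R cis (- \<xi> * fst z) \<partial>lborel) * cis (- of_int l * snd z)) *s Psi \<beta> n k j z \<partial>RT)"
    unfolding w_def[symmetric] by (cases "l = k") auto
qed

section \<open>Uniqueness of the Fourier transform\<close>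

lemma psi_scaleR_integrable:
  fixes D :: "real \<Rightarrow> complex ^ 3"
  assumes "\<beta> > 0" "D \<in> borel_measurable borel" "integrable lborel (\<lambda>x. (norm (D x))\<^sup>2)"
  shows "integrable lborel (\<lambda>x. psi \<beta> m x *\<^sub>R D x)"
proof (rule Bochner_Integration.integrable_bound)
  show "integrable lborel (\<lambda>x. (psi \<beta> m x)\<^sup>2 + (norm (D x))\<^sup>2)"
    using psi_moment_integrable[OF assms(1), of 0 m] assms(3) by simp
  show "AE x in lborel. norm (psi \<beta> m x *\<^sub>R D x) \<le> norm ((psi \<beta> m x)\<^sup>2 + (norm (D x))\<^sup>2)"
    using mult_le_sum_squares[OF abs_ge_zero norm_ge_zero] by (intro AE_I2) (simp add: add_nonneg_nonneg)
  show "(\<lambda>x. psi \<beta> m x *\<^sub>R D x) \<in> borel_measurable lborel"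
    using assms(2) by simp
qed

lemma bounded_linear_field_dot: "bounded_linear (\<lambda>v. field_dot v w)"
proof
  show "field_dot (u + v) w = field_dot u w + field_dot v w" for u v
    by (simp add: field_dot_def sum_3 algebra_simps)
  show "field_dot (r *\<^sub>R v) w = r *\<^sub>R field_dot v w" for r v
    by (simp add: field_dot_def sum_3 algebra_simps)
  have "norm (field_dot v w) \<le> norm v * (\<Sum>i\<in>UNIV. norm (w $ i))" for v
  proof -
    have "norm (field_dot v w) \<le> (\<Sum>i\<in>UNIV. norm (v $ i) * norm (w $ i))"
      unfolding field_dot_def by (rule order_trans[OF norm_sum]) (simp add: norm_mult)
    also have "\<dots> \<le> (\<Sum>i\<in>UNIV. norm v * norm (w $ i))"
      by (intro sum_mono mult_right_mono Finite_Cartesian_Product.norm_nth_le) simp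
    finally show ?thesis by (simp add: sum_distrib_left)
  qed
  then show "\<exists>K. \<forall>v. norm (field_dot v w) \<le> norm v * K"
    by blast
qed

text \<open>The field $z\mapsto D(z_1)$ on the strip is orthogonal to all slots, so totality of the slots carries over to the line.\<close>

lemma hermite_total:
  fixes D :: "real \<Rightarrow> complex ^ 3"
  assumes "\<beta> > 0" "D \<in> borel_measurable borel" "integrable lborel (\<lambda>x. (norm (D x))\<^sup>2)"
    and orth: "\<And>m. (\<integral>x. psi \<beta> m x *\<^sub>R D x \<partial>lborel) = 0"
  shows "AE x in lborel. D x = 0"
proof -
  have "(fst :: real \<times> real \<Rightarrow> real) \<in> borel_measurable borel"
    by (intro borel_measurable_continuous_onI continuous_intros)
  then have "(\<lambda>z :: real \<times> real. D (fst z)) \<in> borel_measurable borel"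
    using assms(2) by (rule measurable_compose)
  then have sq: "square_integrable (\<lambda>z. D (fst z))"
    unfolding square_integrable_def using integrable_RT_fst[OF assms(3)] by simp
  have "L2_inner (\<lambda>z. D (fst z)) (slot \<beta> n k s) = 0" for n k s
  proof -
    define v where "v = slot_dir n s"
    have pt: "field_dot (D x) (slot \<beta> n k s (x, y)) = (of_real (psi \<beta> (slot_index n s) x) * field_dot (D x) v) * cis (of_int (- k) * y)" for x y
      by (simp add: field_dot_def slot_def v_def sum_3 cis_cnj[symmetric] algebra_simps)
    have "L2_inner (\<lambda>z. D (fst z)) (slot \<beta> n k s) =
        (\<integral>x. (\<integral>y\<in>{0..<2 * pi}. field_dot (D x) (slot \<beta> n k s (x, y)) \<partial>lborel) \<partial>lborel)"
      unfolding L2_inner_eq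
      by (subst integral_RT_iterated(1)[OF field_dot_integrable[OF sq square_integrable_slot[OF assms(1)]]]) simp
    also have "\<dots> = (\<integral>x. (of_real (psi \<beta> (slot_index n s) x) * field_dot (D x) v) * of_real (if - k = 0 then 2 * pi else 0) \<partial>lborel)"
      by (simp only: pt set_integral_mult_right integral_cis_period)
    also have "\<dots> = (\<integral>x. field_dot (psi \<beta> (slot_index n s) x *\<^sub>R D x) v \<partial>lborel) * of_real (if - k = 0 then 2 * pi else 0)"
      unfolding integral_mult_left_zero
      by (simp only: linear_scale[OF bounded_linear.linear[OF bounded_linear_field_dot]] scaleR_conv_of_real[where x = "x :: complex" for x])
    also have "\<dots> = field_dot (\<integral>x. psi \<beta> (slot_index n s) x *\<^sub>R D x \<partial>lborel) v * of_real (if - k = 0 then 2 * pi else 0)"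
      by (subst integral_bounded_linear[OF bounded_linear_field_dot psi_scaleR_integrable[OF assms(1-3)]]) (rule refl)
    also have "\<dots> = 0"
      unfolding orth by (simp add: field_dot_def)
    finally show ?thesis .
  qed
  then have "AE z in RT. D (fst z) = 0"
    by (intro L2_total[OF assms(1) sq])
  then have "(\<integral>z. (norm (D (fst z)))\<^sup>2 \<partial>RT) = 0"
    by (intro integral_eq_zero_AE) (auto elim: eventually_mono)
  moreover have "(\<integral>z. (norm (D (fst z)))\<^sup>2 \<partial>RT) = (\<integral>x. 2 * pi * (norm (D x))\<^sup>2 \<partial>lborel)"
    by (subst integral_RT_iterated(1)[OF integrable_RT_fst[OF assms(3)]]) (simp add: set_lebesgue_integral_def)
  ultimately have "(\<integral>x. (norm (D x))\<^sup>2 \<partial>lborel) = 0"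
    by simp
  then have "AE x in lborel. (norm (D x))\<^sup>2 = 0"
    using assms(3) by (subst (asm) integral_nonneg_eq_0_iff_AE) auto
  then show ?thesis
    by eventually_elim simp
qed

text \<open>At each frequency k the difference of two transforms is square integrable and orthogonal
  to all Hermite functions. Any parameter would do for these; it is 1.\<close>

lemma is_fourier_unique:
  assumes "is_fourier f F" "is_fourier f G"
  shows "AE \<xi> in lborel. F \<xi> k = G \<xi> k"
proof -
  have m: "(\<lambda>\<xi>. F \<xi> k) \<in> borel_measurable borel" "(\<lambda>\<xi>. G \<xi> k) \<in> borel_measurable borel"
    and i: "integrable lborel (\<lambda>\<xi>. (norm (F \<xi> k))\<^sup>2)" "integrable lborel (\<lambda>\<xi>. (norm (G \<xi> k))\<^sup>2)"
    using assms unfolding is_fourier_def by blast+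
  have "(\<integral>\<xi>. psi 1 n \<xi> *\<^sub>R F \<xi> k \<partial>lborel) = (\<integral>\<xi>. psi 1 n \<xi> *\<^sub>R G \<xi> k \<partial>lborel)" for n
    using assms schwartz_R_psi[of 1 n] unfolding is_fourier_def by simp
  then have orth: "(\<integral>\<xi>. psi 1 n \<xi> *\<^sub>R (F \<xi> k - G \<xi> k) \<partial>lborel) = 0" for n
    unfolding scaleR_right_diff_distrib
    using psi_scaleR_integrable[OF _ m(1) i(1), of 1 n] psi_scaleR_integrable[OF _ m(2) i(2), of 1 n] by simp
  have "integrable lborel (\<lambda>\<xi>. (norm (F \<xi> k - G \<xi> k))\<^sup>2)"
  proof (rule Bochner_Integration.integrable_bound)
    show "integrable lborel (\<lambda>\<xi>. 2 * ((norm (F \<xi> k))\<^sup>2 + (norm (G \<xi> k))\<^sup>2))"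
      using i by simp
    have "(norm (F \<xi> k - G \<xi> k))\<^sup>2 \<le> 2 * ((norm (F \<xi> k))\<^sup>2 + (norm (G \<xi> k))\<^sup>2)" for \<xi>
      using norm_add_square_le[of "F \<xi> k" "- G \<xi> k"] by simp
    then show "AE \<xi> in lborel. norm ((norm (F \<xi> k - G \<xi> k))\<^sup>2) \<le> norm (2 * ((norm (F \<xi> k))\<^sup>2 + (norm (G \<xi> k))\<^sup>2))"
      by (intro AE_I2) (simp add: add_nonneg_nonneg)
  qed (use m in measurable)
  from hermite_total[OF zero_less_one borel_measurable_diff[OF m] this orth] have "AE \<xi> in lborel. F \<xi> k - G \<xi> k = 0" .
  then show ?thesis
    by eventually_elim simp
qed

text \<open>By uniqueness all members of the set under the infimum give the same integral, so one
  transform suffices to compute the norm. The lower bound in H^s depends on this.\<close>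

lemma Hs_norm_eq:
  assumes "is_fourier f F"
  shows "Hs_norm s f = ennreal_sqrt (\<integral>\<^sup>+k. (\<integral>\<^sup>+\<xi>. ennreal ((1 + \<xi>\<^sup>2 + (of_int k)\<^sup>2) powr s * (norm (F \<xi> k))\<^sup>2) \<partial>lborel) \<partial>count_space UNIV)"
proof -
  have "(\<integral>\<^sup>+k. (\<integral>\<^sup>+\<xi>. ennreal ((1 + \<xi>\<^sup>2 + (of_int k)\<^sup>2) powr s * (norm (G \<xi> k))\<^sup>2) \<partial>lborel) \<partial>count_space UNIV) =
      (\<integral>\<^sup>+k. (\<integral>\<^sup>+\<xi>. ennreal ((1 + \<xi>\<^sup>2 + (of_int k)\<^sup>2) powr s * (norm (F \<xi> k))\<^sup>2) \<partial>lborel) \<partial>count_space UNIV)"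
    if "is_fourier f G" for G
  proof (rule nn_integral_cong, rule nn_integral_cong_AE)
    fix k
    show "AE \<xi> in lborel. ennreal ((1 + \<xi>\<^sup>2 + (of_int k)\<^sup>2) powr s * (norm (G \<xi> k))\<^sup>2) = ennreal ((1 + \<xi>\<^sup>2 + (of_int k)\<^sup>2) powr s * (norm (F \<xi> k))\<^sup>2)"
      using is_fourier_unique[OF that assms, of k] by eventually_elim simp
  qed
  then have "(INF G\<in>{G. is_fourier f G}. \<integral>\<^sup>+k. (\<integral>\<^sup>+\<xi>. ennreal ((1 + \<xi>\<^sup>2 + (of_int k)\<^sup>2) powr s * (norm (G \<xi> k))\<^sup>2) \<partial>lborel) \<partial>count_space UNIV) =
      (\<integral>\<^sup>+k. (\<integral>\<^sup>+\<xi>. ennreal ((1 + \<xi>\<^sup>2 + (of_int k)\<^sup>2) powr s * (norm (F \<xi> k))\<^sup>2) \<partial>lborel) \<partial>count_space UNIV)"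
    using assms by (intro INF_eq_const) blast+
  then show ?thesis
    unfolding Hs_norm_def by (rule arg_cong)
qed

lemma Hs_norm_Psi:
  assumes "\<beta> > 0" "j \<in> signs" "s \<ge> 0"
  shows "Hs_norm s (Psi \<beta> n k j) = ennreal (sqrt (\<Sum>r\<in>signs. (norm (slot_coef \<beta> n k j r))\<^sup>2 *
    (\<integral>\<xi>. sobolev_weight s (of_int k) \<xi> * (psi (1 / \<beta>) (slot_index n r) \<xi>)\<^sup>2 \<partial>lborel)))"
proof -
  define a where "a r = (norm (slot_coef \<beta> n k j r))\<^sup>2" for r
  define w where "w r \<xi> = sobolev_weight s (of_int k) \<xi> * (psi (1 / \<beta>) (slot_index n r) \<xi>)\<^sup>2" for r \<xi>
  have w0: "w r \<xi> \<ge> 0" for r \<xi>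
    by (simp add: w_def sobolev_weight_def)
  have wi: "integrable lborel (w r)" for r
    using sobolev_weight_moment[of "1 / \<beta>" s] assms unfolding w_def by auto
  define X where "X = (\<Sum>r\<in>signs. a r * (\<integral>\<xi>. w r \<xi> \<partial>lborel))"
  \<comment> \<open>Only the frequency l = k contributes, so the sum over the integers has a single
    term.\<close>
  have inner: "(\<integral>\<^sup>+\<xi>. ennreal ((1 + \<xi>\<^sup>2 + (of_int l)\<^sup>2) powr s * (norm (if l = k then Psi_hat \<beta> n k j \<xi> else 0))\<^sup>2) \<partial>lborel) =
      ennreal X * indicator {k} l" for l
  proof (cases "l = k")
    case True
    have "(1 + \<xi>\<^sup>2 + (of_int k)\<^sup>2) powr s * (norm (Psi_hat \<beta> n k j \<xi>))\<^sup>2 = (\<Sum>r\<in>signs. a r * w r \<xi>)" for \<xi>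
      unfolding norm_Psi_hat[OF assms(2)] sobolev_weight_def[symmetric] sum_distrib_left
      by (intro sum.cong refl) (simp add: a_def w_def)
    then have "(\<integral>\<^sup>+\<xi>. ennreal ((1 + \<xi>\<^sup>2 + (of_int k)\<^sup>2) powr s * (norm (Psi_hat \<beta> n k j \<xi>))\<^sup>2) \<partial>lborel) =
        (\<integral>\<^sup>+\<xi>. ennreal (\<Sum>r\<in>signs. a r * w r \<xi>) \<partial>lborel)"
      by (simp only:)
    also have "\<dots> = ennreal (\<integral>\<xi>. (\<Sum>r\<in>signs. a r * w r \<xi>) \<partial>lborel)"
      by (intro nn_integral_eq_integral AE_I2 sum_nonneg mult_nonneg_nonneg w0 Bochner_Integration.integrable_sum integrable_mult_right wi)
        (simp add: a_def)
    also have "(\<integral>\<xi>. (\<Sum>r\<in>signs. a r * w r \<xi>) \<partial>lborel) = X"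
      unfolding X_def using wi by (subst Bochner_Integration.integral_sum) auto
    finally show ?thesis
      using True by simp
  qed simp
  have "(\<integral>\<^sup>+l. ennreal X * indicator {k} l \<partial>count_space UNIV) = ennreal X"
    by (subst nn_integral_cmult_indicator) auto
  moreover have "X \<ge> 0"
    unfolding X_def by (intro sum_nonneg mult_nonneg_nonneg integral_nonneg_AE AE_I2 w0) (simp add: a_def)
  ultimately show ?thesis
    unfolding Hs_norm_eq[OF is_fourier_Psi[OF assms(1,2)]] inner X_def[symmetric]
    by (simp add: ennreal_sqrt_def a_def[symmetric] w_def[symmetric] X_def[symmetric])
qed

lemma sqrt_powr: "x \<ge> 0 \<Longrightarrow> sqrt (x powr s) = x powr (s / 2)"
  by (rule real_sqrt_unique) (simp_all add: power2_eq_square flip: powr_add)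

text \<open>The squared norm is a convex combination, with weights |slot_coef|^2, of Sobolev moments
  with indices n - 1, n or n + 1. For each of these, 1 + k^2 + index agrees with N up to a factor 2,
  so the bounds for Hermite functions carry over.\<close>

lemma Psi_Hs_bound:
  assumes "\<beta> > 0" "s \<ge> 0"
  shows "\<exists>C>0. \<forall>(n, k, j)\<in>modes.
    ennreal (inverse C * (1 + (of_int k)\<^sup>2 + real n) powr (s / 2)) \<le> Hs_norm s (Psi \<beta> n k j) \<and>
    Hs_norm s (Psi \<beta> n k j) \<le> ennreal (C * (1 + (of_int k)\<^sup>2 + real n) powr (s / 2))"
proof -
  define I where "I m k = (\<integral>\<xi>. sobolev_weight s (of_int k) \<xi> * (psi (1 / \<beta>) m \<xi>)\<^sup>2 \<partial>lborel)" for m and k :: int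
  obtain A where A: "A > 0" "\<And>m k. I m k \<le> A * (1 + (of_int k)\<^sup>2 + real m) powr s"
    using sobolev_weight_moment[of "1 / \<beta>" s] assms unfolding I_def by auto
  obtain c where c: "c > 0" "\<And>m k. c * (1 + (of_int k)\<^sup>2 + real m) powr s \<le> I m k"
    using sobolev_weight_moment_lower[of "1 / \<beta>" s] assms unfolding I_def by auto
  \<comment> \<open>The first entry gives the upper bound; the second is the inverse of the lower
    constant, as C also enters through \<open>inverse C\<close>.\<close>
  define C where "C = max (sqrt (A * 2 powr s)) (inverse (sqrt (c / 2 powr s)))"
  have C: "C > 0" "sqrt (A * 2 powr s) \<le> C" "inverse C \<le> sqrt (c / 2 powr s)"
  proof -
    have p: "sqrt (A * 2 powr s) > 0" "sqrt (c / 2 powr s) > 0"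
      using A(1) c(1) by simp_all
    then show "C > 0" "sqrt (A * 2 powr s) \<le> C"
      by (auto simp: C_def less_max_iff_disj)
    have "inverse (sqrt (c / 2 powr s)) \<le> C"
      by (simp add: C_def)
    from le_imp_inverse_le[OF this] p show "inverse C \<le> sqrt (c / 2 powr s)"
      by simp
  qed
  have "ennreal (inverse C * (1 + (of_int k)\<^sup>2 + real n) powr (s / 2)) \<le> Hs_norm s (Psi \<beta> n k j) \<and>
    Hs_norm s (Psi \<beta> n k j) \<le> ennreal (C * (1 + (of_int k)\<^sup>2 + real n) powr (s / 2))"
    if j: "j \<in> signs" for n k j
  proof -
    define N where "N = 1 + (real_of_int k)\<^sup>2 + real n"
    have N: "N \<ge> 1" by (simp add: N_def)
    define a where "a r = (norm (slot_coef \<beta> n k j r))\<^sup>2" for r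
    have a: "a r \<ge> 0" "(\<Sum>r\<in>signs. a r) = 1" for r
      unfolding a_def using norm_slot_coef_le(2)[OF assms(1) j, of 0] by simp_all
    have idx: "real (slot_index n r) \<le> real n + 1" "real n \<le> real (slot_index n r) + 1" if "r \<in> signs" for r
      using that by auto
    have I: "c / 2 powr s * N powr s \<le> I (slot_index n r) k" "I (slot_index n r) k \<le> A * 2 powr s * N powr s" if r: "r \<in> signs" for r
    proof -
      define M where "M = 1 + (real_of_int k)\<^sup>2 + real (slot_index n r)"
      have MN: "M \<ge> 1" "N \<le> 2 * M" "M \<le> 2 * N"
        unfolding M_def N_def distrib_left using idx[OF r] zero_le_power2[of "real_of_int k"] by linarith+
      have "N powr s \<le> 2 powr s * M powr s" "M powr s \<le> 2 powr s * N powr s"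
        unfolding powr_mult[symmetric] using MN N assms(2) by (intro powr_mono2; simp)+
      then have "c / 2 powr s * N powr s \<le> c * M powr s" "A * M powr s \<le> A * (2 powr s * N powr s)"
        using c(1) A(1) by (simp_all add: field_simps)
      then show "c / 2 powr s * N powr s \<le> I (slot_index n r) k" "I (slot_index n r) k \<le> A * 2 powr s * N powr s"
        using c(2)[of k "slot_index n r"] A(2)[of "slot_index n r" k] unfolding M_def by (simp_all add: mult.assoc)
    qed
    define X where "X = (\<Sum>r\<in>signs. a r * I (slot_index n r) k)"
    have "(\<Sum>r\<in>signs. a r * (c / 2 powr s * N powr s)) \<le> X"
      unfolding X_def by (intro sum_mono mult_left_mono I a)
    then have lo: "c / 2 powr s * N powr s \<le> X"
      unfolding sum_distrib_right[symmetric] a(2) by simp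
    have "X \<le> (\<Sum>r\<in>signs. a r * (A * 2 powr s * N powr s))"
      unfolding X_def by (intro sum_mono mult_left_mono I a)
    then have up: "X \<le> A * 2 powr s * N powr s"
      unfolding sum_distrib_right[symmetric] a(2) by simp
    have N2: "N powr (s / 2) \<ge> 0" and sN: "sqrt (N powr s) = N powr (s / 2)"
      using N by (simp_all add: sqrt_powr)
    have H: "Hs_norm s (Psi \<beta> n k j) = ennreal (sqrt X)"
      unfolding Hs_norm_Psi[OF assms(1) j assms(2)] X_def a_def I_def ..
    have "inverse C * N powr (s / 2) \<le> sqrt (c / 2 powr s) * N powr (s / 2)"
      using C(3) N2 by (rule mult_right_mono)
    also have "\<dots> = sqrt (c / 2 powr s * N powr s)"
      unfolding real_sqrt_mult sN ..
    also have "\<dots> \<le> sqrt X"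
      using lo by (rule real_sqrt_le_mono)
    finally have 1: "inverse C * N powr (s / 2) \<le> sqrt X" .
    have "sqrt X \<le> sqrt (A * 2 powr s * N powr s)"
      using up by (rule real_sqrt_le_mono)
    also have "\<dots> = sqrt (A * 2 powr s) * N powr (s / 2)"
      unfolding real_sqrt_mult[of "A * 2 powr s"] sN ..
    also have "\<dots> \<le> C * N powr (s / 2)"
      using C(2) N2 by (rule mult_right_mono)
    finally have 2: "sqrt X \<le> C * N powr (s / 2)" .
    show ?thesis
      unfolding H N_def[symmetric] using 1 2 by (intro conjI ennreal_leI)
  qed
  then show ?thesis
    using C(1) by (intro exI[of _ C]) (auto simp: modes_def)
qed

section \<open>The eigenvalue equation and the eigenspaces\<close>

lemma Psi_pd_components:
  assumes "\<beta> > 0"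
  defines "e \<equiv> \<lambda>n. if n = 0 then - 1 else 1 :: complex"
  shows "Psi_pd \<beta> a b n k j z $ 1 = (\<i> * of_int k) ^ b * cis (of_int k * snd z) / of_real (sqrt (4 * pi)) *
      (- (e n * slot_coef \<beta> n k j (-1) * of_real (dpsi \<beta> a (n - 1) (fst z))) + slot_coef \<beta> n k j 1 * of_real (dpsi \<beta> a (Suc n) (fst z)))"
    and "Psi_pd \<beta> a b n k j z $ 2 = (\<i> * of_int k) ^ b * cis (of_int k * snd z) / of_real (sqrt (2 * pi)) *
      (slot_coef \<beta> n k j 0 * of_real (dpsi \<beta> a n (fst z)))"
    and "Psi_pd \<beta> a b n k j z $ 3 = (\<i> * of_int k) ^ b * cis (of_int k * snd z) / of_real (sqrt (4 * pi)) *
      (slot_coef \<beta> n k j (-1) * of_real (dpsi \<beta> a (n - 1) (fst z)) + slot_coef \<beta> n k j 1 * of_real (dpsi \<beta> a (Suc n) (fst z)))"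
  by (simp_all add: Psi_pd_def slot_pd_def split_beta' slot_dir_def e_def divide_inverse algebra_simps)

text \<open>The three scalar equations of $L\Psi=i\tau\Psi$.\<close>

lemma Psi_pd_eigen:
  fixes n :: nat and k :: int
  assumes "\<beta> > 0" "j \<in> signs"
  defines "t \<equiv> \<i> * of_real (tau \<beta> n k j)"
  shows "Psi_pd \<beta> 1 0 n k j z $ 2 + Psi_pd \<beta> 0 1 n k j z $ 3 = t * Psi_pd \<beta> 0 0 n k j z $ 1"
    and "of_real (\<beta> * fst z) * Psi_pd \<beta> 0 0 n k j z $ 3 + Psi_pd \<beta> 1 0 n k j z $ 1 = t * Psi_pd \<beta> 0 0 n k j z $ 2"
    and "- (of_real (\<beta> * fst z) * Psi_pd \<beta> 0 0 n k j z $ 2) + Psi_pd \<beta> 0 1 n k j z $ 1 = t * Psi_pd \<beta> 0 0 n k j z $ 3"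
proof -
  define a c b where "a = slot_coef \<beta> n k j (-1)" and "c = slot_coef \<beta> n k j 0" and "b = slot_coef \<beta> n k j 1"
  define g h where "g = complex_of_real (sqrt (\<beta> * real n))" and "h = complex_of_real (sqrt (\<beta> * (real n + 1)))"
  define e where "e = (if n = 0 then - 1 else 1 :: complex)"
  define K where "K = complex_of_int k"
  define S X where "S = complex_of_real (sqrt 2)" and "X = complex_of_real (sqrt (2 * pi))"
  define P Q R where "P = complex_of_real (psi \<beta> (n - 1) (fst z))" and "Q = complex_of_real (psi \<beta> (Suc n) (fst z))" and "R = complex_of_real (psi \<beta> n (fst z))"
  define P' Q' R' where "P' = complex_of_real (dpsi \<beta> 1 (n - 1) (fst z))" and "Q' = complex_of_real (dpsi \<beta> 1 (Suc n) (fst z))" and "R' = complex_of_real (dpsi \<beta> 1 n (fst z))"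
  define x where "x = complex_of_real (\<beta> * fst z)"
  define E where "E = cis (of_int k * snd z)"
  have nz: "S \<noteq> 0" "X \<noteq> 0" and SS: "S * S = 2" by (simp_all add: S_def X_def flip: of_real_mult)
  have Y: "complex_of_real (sqrt (4 * pi)) = S * X"
    unfolding S_def X_def of_real_mult[symmetric] by (subst real_sqrt_mult[symmetric]) simp
  have ee: "e * e = 1" by (simp add: e_def)
  have r: "(t - \<i> * K) * b = - h * c" "(t + e * \<i> * K) * a = - g * c" "t * c = g * a + h * b"
  proof -
    have e: "complex_of_real (if n = 0 then - 1 else 1) = e"
      by (simp add: e_def)
    note rel = slot_coef_relations(1-3)[OF assms(1,2), of n k, unfolded of_real_add of_real_diff of_real_mult of_real_of_int_eq e]
    show "(t - \<i> * K) * b = - h * c"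
      using rel(1) unfolding t_def b_def c_def h_def K_def of_real_mult by (simp only: right_diff_distrib)
    show "(t + e * \<i> * K) * a = - g * c"
      using rel(2) unfolding t_def a_def c_def g_def K_def of_real_mult by (simp only: distrib_left mult_ac)
    show "t * c = g * a + h * b"
      using rel(3) unfolding t_def a_def b_def c_def g_def h_def of_real_mult .
  qed
  have half: "sqrt 2 * sqrt (y / 2) = sqrt y" "sqrt (y / 2) + sqrt (y / 2) = sqrt 2 * sqrt y" for y :: real
    by (simp_all add: real_sqrt_divide field_simps)
  have dR: "S * R' = g * P - h * Q" and xR: "S * (x * R) = g * P + h * Q"
  proof -
    have "sqrt 2 * dpsi \<beta> 1 n (fst z) = sqrt (\<beta> * real n) * psi \<beta> (n - 1) (fst z) - sqrt (\<beta> * (real n + 1)) * psi \<beta> (Suc n) (fst z)"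
      unfolding One_nat_def dpsi.simps right_diff_distrib mult.assoc[symmetric] half(1) ..
    from arg_cong[OF this, of complex_of_real] show "S * R' = g * P - h * Q"
      by (simp add: S_def R'_def g_def h_def P_def Q_def del: dpsi.simps One_nat_def)
    have "sqrt 2 * (\<beta> * fst z * psi \<beta> n (fst z)) = sqrt (\<beta> * real n) * psi \<beta> (n - 1) (fst z) + sqrt (\<beta> * (real n + 1)) * psi \<beta> (Suc n) (fst z)"
      unfolding mult_psi[OF assms(1)] distrib_left mult.assoc[symmetric] half(1) ..
    from arg_cong[OF this, of complex_of_real] show "S * (x * R) = g * P + h * Q"
      by (simp add: S_def x_def R_def g_def h_def P_def Q_def)
  qed
  have xQ: "x * Q + Q' = S * h * R"
  proof -
    have "sqrt (\<beta> * (real n + 1) / 2) + sqrt (\<beta> * (real n + 1) / 2) = sqrt 2 * sqrt (\<beta> * (real n + 1))"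
      by (rule half(2))
    moreover have "\<beta> * fst z * psi \<beta> (Suc n) (fst z) + dpsi \<beta> 1 (Suc n) (fst z) = (sqrt (\<beta> * (real n + 1) / 2) + sqrt (\<beta> * (real n + 1) / 2)) * psi \<beta> n (fst z)"
      unfolding mult_psi[OF assms(1)] by (simp add: algebra_simps)
    ultimately have "\<beta> * fst z * psi \<beta> (Suc n) (fst z) + dpsi \<beta> 1 (Suc n) (fst z) = sqrt 2 * sqrt (\<beta> * (real n + 1)) * psi \<beta> n (fst z)"
      by (simp only:)
    from arg_cong[OF this, of complex_of_real] show ?thesis
      by (simp add: x_def Q_def Q'_def S_def h_def R_def del: dpsi.simps One_nat_def)
  qed
  \<comment> \<open>At n = 0, P is psi 0 itself and the identity becomes beta x psi 0 + psi 0' = 0;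
    the sign e accounts for this exception.\<close>
  have xP: "x * P - e * P' = S * g * R"
  proof (cases n)
    case 0
    have "\<beta> * fst z * psi \<beta> 0 (fst z) + dpsi \<beta> 1 0 (fst z) = 0"
      unfolding mult_psi[OF assms(1)] by simp
    from arg_cong[OF this, of complex_of_real] show ?thesis
      using 0 by (simp add: x_def P_def P'_def e_def g_def del: dpsi.simps One_nat_def)
  next
    case (Suc m)
    have "sqrt (\<beta> * real n / 2) + sqrt (\<beta> * real n / 2) = sqrt 2 * sqrt (\<beta> * real n)"
      by (rule half(2))
    moreover have "\<beta> * fst z * psi \<beta> (n - 1) (fst z) - dpsi \<beta> 1 (n - 1) (fst z) = (sqrt (\<beta> * real n / 2) + sqrt (\<beta> * real n / 2)) * psi \<beta> n (fst z)"
      unfolding mult_psi[OF assms(1)] using Suc by (simp add: algebra_simps)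
    ultimately have "\<beta> * fst z * psi \<beta> (n - 1) (fst z) - dpsi \<beta> 1 (n - 1) (fst z) = sqrt 2 * sqrt (\<beta> * real n) * psi \<beta> n (fst z)"
      by (simp only:)
    from arg_cong[OF this, of complex_of_real] show ?thesis
      using Suc by (simp add: x_def P_def P'_def S_def g_def R_def e_def del: dpsi.simps One_nat_def)
  qed
  note comp = Psi_pd_components[OF assms(1), folded e_def a_def b_def c_def]
  have f: "Psi_pd \<beta> 0 0 n k j z $ 1 = E / (S * X) * (- (e * a * P) + b * Q)" "Psi_pd \<beta> 0 0 n k j z $ 2 = E / X * (c * R)"
    "Psi_pd \<beta> 0 0 n k j z $ 3 = E / (S * X) * (a * P + b * Q)"
    unfolding comp Y[symmetric] by (simp_all add: E_def X_def P_def Q_def R_def a_def b_def c_def e_def)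
  have f1: "Psi_pd \<beta> 1 0 n k j z $ 1 = E / (S * X) * (- (e * a * P') + b * Q')" "Psi_pd \<beta> 1 0 n k j z $ 2 = E / X * (c * R')"
    unfolding comp Y[symmetric] by (simp_all add: E_def X_def P'_def Q'_def R'_def a_def b_def c_def e_def del: dpsi.simps One_nat_def)
  have f2: "Psi_pd \<beta> 0 1 n k j z $ 1 = \<i> * K * E / (S * X) * (- (e * a * P) + b * Q)"
    "Psi_pd \<beta> 0 1 n k j z $ 3 = \<i> * K * E / (S * X) * (a * P + b * Q)"
    unfolding comp Y[symmetric] by (simp_all add: E_def X_def P_def Q_def a_def b_def c_def e_def K_def)
  have R': "R' = (g * P - h * Q) / S" and xR': "x * R = (g * P + h * Q) / S"
    using dR xR nz by (simp_all add: field_simps)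
  have k1: "c * h = - ((t - \<i> * K) * b)" "c * g = - ((t + e * \<i> * K) * a)"
    using r by (simp_all add: mult.commute)
  show "Psi_pd \<beta> 1 0 n k j z $ 2 + Psi_pd \<beta> 0 1 n k j z $ 3 = t * Psi_pd \<beta> 0 0 n k j z $ 1"
  proof -
    \<comment> \<open>The sign e differs from 1 only at n = 0, where g = 0.\<close>
    have ge: "c * g = e * (c * g)"
      by (simp add: e_def g_def)
    have "c * (g * P - h * Q) + \<i> * K * (a * P + b * Q) = (c * g + \<i> * K * a) * P + (- (c * h) + \<i> * K * b) * Q"
      by (simp add: algebra_simps)
    also have "\<dots> = (e * (- ((t + e * \<i> * K) * a)) + \<i> * K * a) * P + ((t - \<i> * K) * b + \<i> * K * b) * Q"
      by (subst ge, unfold k1) simp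
    also have "\<dots> = t * (- (e * a * P) + b * Q) + (1 - e * e) * \<i> * K * a * P"
      by (simp add: algebra_simps)
    finally have "c * (g * P - h * Q) + \<i> * K * (a * P + b * Q) = t * (- (e * a * P) + b * Q)"
      unfolding ee by simp
    moreover have "E / X * (c * R') + \<i> * K * E / (S * X) * (a * P + b * Q) = E / (S * X) * (c * (g * P - h * Q) + \<i> * K * (a * P + b * Q))"
      unfolding R' using nz by (simp add: field_simps)
    ultimately show ?thesis
      unfolding f f1 f2 by (simp only: mult.left_commute[of t])
  qed
  show "of_real (\<beta> * fst z) * Psi_pd \<beta> 0 0 n k j z $ 3 + Psi_pd \<beta> 1 0 n k j z $ 1 = t * Psi_pd \<beta> 0 0 n k j z $ 2"
  proof -
    have "x * (E / (S * X) * (a * P + b * Q)) + E / (S * X) * (- (e * a * P') + b * Q') = E / (S * X) * (a * (x * P - e * P') + b * (x * Q + Q'))"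
      by (simp add: algebra_simps)
    also have "\<dots> = E / (S * X) * (S * ((g * a + h * b) * R))"
      unfolding xP xQ by (simp add: algebra_simps)
    also have "\<dots> = t * (E / X * (c * R))"
      unfolding r(3)[symmetric] using nz by simp
    finally show ?thesis
      unfolding f f1 x_def .
  qed
  show "- (of_real (\<beta> * fst z) * Psi_pd \<beta> 0 0 n k j z $ 2) + Psi_pd \<beta> 0 1 n k j z $ 1 = t * Psi_pd \<beta> 0 0 n k j z $ 3"
  proof -
    have "- (c * (g * P + h * Q)) + \<i> * K * (- (e * a * P) + b * Q) = (- (c * g) - e * \<i> * K * a) * P + (- (c * h) + \<i> * K * b) * Q"
      by (simp add: algebra_simps)
    also have "\<dots> = t * (a * P + b * Q)"
      unfolding k1 by (simp add: algebra_simps)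
    finally have "- (c * (g * P + h * Q)) + \<i> * K * (- (e * a * P) + b * Q) = t * (a * P + b * Q)" .
    moreover have "- (E / X * (c * ((g * P + h * Q) / S))) + \<i> * K * E / (S * X) * (- (e * a * P) + b * Q) =
        E / (S * X) * (- (c * (g * P + h * Q)) + \<i> * K * (- (e * a * P) + b * Q))"
      using nz by (simp add: field_simps)
    ultimately have "- (E / X * (c * ((g * P + h * Q) / S))) + \<i> * K * E / (S * X) * (- (e * a * P) + b * Q) = t * (E / (S * X) * (a * P + b * Q))"
      by (simp only: mult.left_commute[of t])
    moreover have "x * (E / X * (c * R)) = E / X * (c * (x * R))"
      by (simp add: mult_ac)
    ultimately show ?thesis
      unfolding f f2 x_def[symmetric] xR' by simp
  qed
qed

section \<open>The eigenvalue equation in the weak sense\<close>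

lemma square_integrable_gaussian_field:
  fixes f :: "real \<times> real \<Rightarrow> 'a::{banach, second_countable_topology}"
  assumes "gaussian_field c f" "c > 0"
  shows "square_integrable f"
proof -
  obtain K where "\<And>z. norm (f z) \<le> K * exp (- c * (fst z)\<^sup>2)"
    using assms(1) unfolding gaussian_field_def by blast
  then show ?thesis
    using assms by (intro square_integrable_gaussian_bound[OF assms(2), of _ K] borel_measurable_continuous_onI)
      (auto simp: gaussian_field_def)
qed

lemma gaussian_field_linear:
  assumes "gaussian_field c f" "bounded_linear l"
  shows "gaussian_field c (\<lambda>z. l (f z))"
proof -
  interpret bounded_linear l by fact
  obtain K where K: "\<And>z. norm (f z) \<le> K * exp (- c * (fst z)\<^sup>2)"
    using assms(1) unfolding gaussian_field_def by blast
  obtain B where B: "B > 0" "\<And>v. norm (l v) \<le> norm v * B"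
    using pos_bounded by blast
  have "norm (l (f z)) \<le> (K * B) * exp (- c * (fst z)\<^sup>2)" for z
  proof -
    have "norm (l (f z)) \<le> (K * exp (- c * (fst z)\<^sup>2)) * B"
      by (rule order_trans[OF B(2) mult_right_mono[OF K]]) (use B(1) in simp)
    then show ?thesis by (simp only: mult_ac)
  qed
  moreover have "continuous_on UNIV (\<lambda>z. l (f z))"
    using assms(1) by (intro continuous_on) (simp add: gaussian_field_def)
  ultimately show ?thesis
    unfolding gaussian_field_def by blast
qed

lemma square_integrable_Psi_pd_component:
  assumes "\<beta> > 0"
  shows "square_integrable (\<lambda>z. Psi_pd \<beta> a b n k j z $ i)"
  by (rule square_integrable_gaussian_field[OF gaussian_field_linear[OF gaussian_field_Psi_pd[OF assms] bounded_linear_vec_nth]])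
     (use assms in simp)

lemma test_by_parts_component:
  assumes "\<beta> > 0" "\<phi> \<in> schwartz_RT"
  shows "(\<integral>z. pd 1 0 \<phi> z *\<^sub>R Psi_pd \<beta> a b n k j z $ i \<partial>RT) = - (\<integral>z. \<phi> z *\<^sub>R Psi_pd \<beta> (Suc a) b n k j z $ i \<partial>RT)"
    and "(\<integral>z. pd 0 1 \<phi> z *\<^sub>R Psi_pd \<beta> a b n k j z $ i \<partial>RT) = - (\<integral>z. \<phi> z *\<^sub>R Psi_pd \<beta> a (Suc b) n k j z $ i \<partial>RT)"
proof -
  have c: "\<beta> / 4 > 0" using assms by simp
  note g = gaussian_field_linear[OF gaussian_field_Psi_pd[OF assms(1)] bounded_linear_vec_nth]
  note d = Psi_pd_has_derivative[OF assms(1), THEN bounded_linear.has_vector_derivative[OF bounded_linear_vec_nth]]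
  have p: "periodic_snd (\<lambda>z. Psi_pd \<beta> a b n k j z $ i)"
    using periodic_Psi_pd[of \<beta> a b n k j] by (simp add: periodic_snd_def)
  show "(\<integral>z. pd 1 0 \<phi> z *\<^sub>R Psi_pd \<beta> a b n k j z $ i \<partial>RT) = - (\<integral>z. \<phi> z *\<^sub>R Psi_pd \<beta> (Suc a) b n k j z $ i \<partial>RT)"
    using test_integral_by_parts1[OF c assms(2) g g d(1), of 0 0] by simp
  show "(\<integral>z. pd 0 1 \<phi> z *\<^sub>R Psi_pd \<beta> a b n k j z $ i \<partial>RT) = - (\<integral>z. \<phi> z *\<^sub>R Psi_pd \<beta> a (Suc b) n k j z $ i \<partial>RT)"
    using test_integral_by_parts2[OF c assms(2) p g g d(2), of 0] by simp
qed

lemma test_times_integrable: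
  assumes "\<beta> > 0" "\<phi> \<in> schwartz_RT"
  shows "integrable RT (\<lambda>z. pd a' b' \<phi> z *\<^sub>R Psi_pd \<beta> a b n k j z $ i)"
  by (rule gaussian_field_integrable[OF gaussian_field_scaleR[OF schwartz_RT_pd(1,2)[OF assms(2)]
        gaussian_field_linear[OF gaussian_field_Psi_pd[OF assms(1)] bounded_linear_vec_nth]]])
     (use assms in simp)

lemma L_graph_Psi:
  assumes "\<beta> > 0" "j \<in> signs"
  shows "L_graph \<beta> (Psi \<beta> n k j) (\<lambda>z. (\<i> * of_real (tau \<beta> n k j)) *s Psi \<beta> n k j z)"
proof -
  define t where "t = \<i> * complex_of_real (tau \<beta> n k j)"
  let ?P = "\<lambda>a b z. Psi_pd \<beta> a b n k j z"
  note eig = Psi_pd_eigen[where n = n and k = k, OF assms, folded t_def]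
  have sq: "square_integrable (?P 0 0)"
    by (rule square_integrable_gaussian_field[OF gaussian_field_Psi_pd[OF assms(1)]]) (use assms in simp)
  have L2: "?P 0 0 \<in> L2" "(\<lambda>z. t *s ?P 0 0 z) \<in> L2"
  proof -
    show "?P 0 0 \<in> L2"
      unfolding square_integrable_iff_L2 using sq periodic_Psi_pd by blast
    have "gaussian_field (\<beta> / 4) (\<lambda>z. t *s ?P 0 0 z)"
      by (rule gaussian_field_linear[OF gaussian_field_Psi_pd[OF assms(1)] bounded_linear_vec_scale_right])
    then show "(\<lambda>z. t *s ?P 0 0 z) \<in> L2"
      unfolding square_integrable_iff_L2 using square_integrable_gaussian_field[of "\<beta> / 4" "\<lambda>z. t *s ?P 0 0 z"] assms(1)
        periodic_Psi_pd[of \<beta> 0 0 n k j] by (simp add: periodic_snd_def)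
  qed
  show ?thesis
    unfolding L_graph_def Psi_pd_zero[OF assms(1), symmetric] t_def[symmetric]
  proof (intro conjI L2 ballI)
    fix \<phi> assume \<phi>: "\<phi> \<in> schwartz_RT"
    note bp = test_by_parts_component[OF assms(1) \<phi>]
    have int: "integrable RT (\<lambda>z. pd a' b' \<phi> z *\<^sub>R ?P a b z $ i)" for a' b' a b i
      by (rule test_times_integrable[OF assms(1) \<phi>])
    have int0: "integrable RT (\<lambda>z. \<phi> z *\<^sub>R ?P a b z $ i)" for a b i
      using int[of 0 0] by simp
    have x: "(\<beta> * fst z * \<phi> z) *\<^sub>R (c :: complex) = \<phi> z *\<^sub>R (of_real (\<beta> * fst z) * c)" for z c
      by (simp add: scaleR_conv_of_real)
    \<comment> \<open>The factor x_1 is eliminated through the pointwise eigenvalue equation. What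
      remains are test functions times derivatives of the field, whose integrability is
      known.\<close>
    have x3: "(\<beta> * fst z * \<phi> z) *\<^sub>R ?P 0 0 z $ 3 = \<phi> z *\<^sub>R (t * ?P 0 0 z $ 2) - \<phi> z *\<^sub>R ?P 1 0 z $ 1" for z
      unfolding x scaleR_right_diff_distrib[symmetric] eig(2)[of z, symmetric] by simp
    have x2: "- ((\<beta> * fst z * \<phi> z) *\<^sub>R ?P 0 0 z $ 2) = \<phi> z *\<^sub>R (t * ?P 0 0 z $ 3) - \<phi> z *\<^sub>R ?P 0 1 z $ 1" for z
      unfolding x scaleR_right_diff_distrib[symmetric] scaleR_minus_right[symmetric] eig(3)[of z, symmetric] by simp
    have tint: "integrable RT (\<lambda>z. \<phi> z *\<^sub>R (t * ?P 0 0 z $ i))" for i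
      unfolding mult_scaleR_right[symmetric] by (intro integrable_mult_right int0)
    have "(\<integral>z. - (pd 1 0 \<phi> z *\<^sub>R ?P 0 0 z $ 2) - pd 0 1 \<phi> z *\<^sub>R ?P 0 0 z $ 3 \<partial>RT) =
        - (\<integral>z. pd 1 0 \<phi> z *\<^sub>R ?P 0 0 z $ 2 \<partial>RT) - (\<integral>z. pd 0 1 \<phi> z *\<^sub>R ?P 0 0 z $ 3 \<partial>RT)"
      using int[of 1 0 0 0 2] int[of 0 1 0 0 3] by simp
    also have "\<dots> = (\<integral>z. \<phi> z *\<^sub>R ?P 1 0 z $ 2 + \<phi> z *\<^sub>R ?P 0 1 z $ 3 \<partial>RT)"
      unfolding bp using int0[of 1 0 2] int0[of 0 1 3] by simp
    also have "\<dots> = (\<integral>z. \<phi> z *\<^sub>R (t *s ?P 0 0 z) $ 1 \<partial>RT)"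
      unfolding scaleR_right_distrib[symmetric] eig(1) vector_smult_component ..
    finally show "(\<integral>z. - (pd 1 0 \<phi> z *\<^sub>R ?P 0 0 z $ 2) - pd 0 1 \<phi> z *\<^sub>R ?P 0 0 z $ 3 \<partial>RT) = (\<integral>z. \<phi> z *\<^sub>R (t *s ?P 0 0 z) $ 1 \<partial>RT)" .
    show "(\<integral>z. (\<beta> * fst z * \<phi> z) *\<^sub>R ?P 0 0 z $ 3 - pd 1 0 \<phi> z *\<^sub>R ?P 0 0 z $ 1 \<partial>RT) = (\<integral>z. \<phi> z *\<^sub>R (t *s ?P 0 0 z) $ 2 \<partial>RT)"
      unfolding x3 vector_smult_component using int[of 1 0 0 0 1] int0[of 1 0 1] tint[of 2] bp(1)[where a = 0 and b = 0 and n = n and k = k and j = j and i = 1] by simp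
    show "(\<integral>z. - ((\<beta> * fst z * \<phi> z) *\<^sub>R ?P 0 0 z $ 2) - pd 0 1 \<phi> z *\<^sub>R ?P 0 0 z $ 1 \<partial>RT) = (\<integral>z. \<phi> z *\<^sub>R (t *s ?P 0 0 z) $ 3 \<partial>RT)"
      unfolding x2 vector_smult_component using int[of 0 1 0 0 1] int0[of 0 1 1] tint[of 3] bp(2)[where a = 0 and b = 0 and n = n and k = k and j = j and i = 1] by simp
  qed
qed

lemma bounded_linear_differentiable:
  "bounded_linear l \<Longrightarrow> f differentiable (at z) \<Longrightarrow> (\<lambda>z. l (f z)) differentiable (at z)"
  unfolding differentiable_def using bounded_linear.has_derivative by blast

lemma Psi_pd_differentiable:
  assumes "\<beta> > 0"
  shows "Psi_pd \<beta> a b n k j differentiable (at z)"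
proof -
  have s: "slot_pd \<beta> a b n k s differentiable (at z)" for s
  proof -
    have 1: "(\<lambda>z. complex_of_real (dpsi \<beta> a (slot_index n s) (fst z))) differentiable (at z)"
    proof -
      have "(dpsi \<beta> a (slot_index n s) has_derivative (\<lambda>h. h * dpsi \<beta> (Suc a) (slot_index n s) (fst z))) (at (fst z))"
        using dpsi_has_derivative[OF assms, of a "slot_index n s" "fst z"] by (simp add: has_field_derivative_def mult_commute_abs del: dpsi.simps)
      from has_derivative_compose[OF has_derivative_fst[OF has_derivative_ident] this]
      have "((\<lambda>z. dpsi \<beta> a (slot_index n s) (fst z)) has_derivative (\<lambda>h. fst h * dpsi \<beta> (Suc a) (slot_index n s) (fst z))) (at z)" .
      from has_derivative_of_real[OF this] show ?thesis
        unfolding differentiable_def by blast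
    qed
    have 2: "(\<lambda>z :: real \<times> real. cis (of_int k * snd z)) differentiable (at z)"
      using has_derivative_compose[OF has_derivative_snd[OF has_derivative_ident]
          has_vector_derivative_cis[of "of_int k" "snd z", unfolded has_vector_derivative_def]]
      unfolding differentiable_def by blast
    have "(\<lambda>z. (\<i> * of_int k) ^ b * (of_real (dpsi \<beta> a (slot_index n s) (fst z)) * cis (of_int k * snd z))) differentiable (at z)"
      by (intro differentiable_mult differentiable_const 1 2)
    from bounded_linear_differentiable[OF bounded_linear_vec_scale this] show ?thesis
      unfolding slot_pd_def split_beta' .
  qed
  show ?thesis
    unfolding Psi_pd_def
    by (rule differentiable_sum) (use bounded_linear_differentiable[OF bounded_linear_vec_scale_right s] in blast)+
qed

lemma pd_linear_Psi:
  fixes l :: "complex ^ 3 \<Rightarrow> real"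
  assumes "\<beta> > 0" "bounded_linear l"
  shows "pd a b (\<lambda>z. l (Psi \<beta> n k j z)) = (\<lambda>z. l (Psi_pd \<beta> a b n k j z))"
proof -
  note d = Psi_pd_has_derivative[OF assms(1), THEN bounded_linear.has_vector_derivative[OF assms(2)],
      unfolded has_real_derivative_iff_has_vector_derivative[symmetric], THEN DERIV_imp_deriv]
  have 2: "(pd2 ^^ b) (\<lambda>z. l (Psi \<beta> n k j z)) = (\<lambda>z. l (Psi_pd \<beta> 0 b n k j z))" for b
  proof (induction b)
    case 0
    then show ?case by (simp add: Psi_pd_zero[OF assms(1)])
  next
    case (Suc b)
    then show ?case by (simp add: pd2_def d(2) split_beta')
  qed
  have "(pd1 ^^ a) (\<lambda>z. l (Psi_pd \<beta> 0 b n k j z)) = (\<lambda>z. l (Psi_pd \<beta> a b n k j z))"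
    by (induction a) (simp_all add: pd1_def d(1) split_beta')
  then show ?thesis
    by (simp add: pd_def 2)
qed

text \<open>The functional is real because test functions are; it will be the real or the imaginary
  part of a component.\<close>

lemma schwartz_linear_Psi:
  fixes l :: "complex ^ 3 \<Rightarrow> real"
  assumes "\<beta> > 0" "bounded_linear l"
  shows "(\<lambda>z. l (Psi \<beta> n k j z)) \<in> schwartz_RT"
  unfolding schwartz_RT_def
proof (intro CollectI conjI allI, unfold pd_linear_Psi[OF assms])
  show "periodic_snd (\<lambda>z. l (Psi \<beta> n k j z))"
    using periodic_Psi[OF assms(1), of n k j] by (simp add: periodic_snd_def)
  show "(\<lambda>z. l (Psi_pd \<beta> a b n k j z)) differentiable_on UNIV" for a b
    unfolding differentiable_on_def using bounded_linear_differentiable[OF assms(2) Psi_pd_differentiable[OF assms(1)]] by blast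
  show "bounded (range (\<lambda>z. fst z ^ p * l (Psi_pd \<beta> a b n k j z)))" for a b p
  proof -
    obtain K where K: "\<And>z. norm (l (Psi_pd \<beta> a b n k j z)) \<le> K * exp (- (\<beta> / 4) * (fst z)\<^sup>2)"
      using gaussian_field_linear[OF gaussian_field_Psi_pd[OF assms(1)] assms(2)] unfolding gaussian_field_def by blast
    obtain M where M: "\<And>x. \<bar>poly (monom 1 p) x\<bar> * exp (- (\<beta> / 4) * x\<^sup>2) \<le> M"
      using poly_times_gaussian_bounded[of "\<beta> / 4" "monom 1 p"] assms(1) by auto
    have K0: "K \<ge> 0"
      using order_trans[OF norm_ge_zero K[of 0]] by simp
    have "norm (fst z ^ p * l (Psi_pd \<beta> a b n k j z)) \<le> K * M" for z
    proof -
      have "norm (fst z ^ p * l (Psi_pd \<beta> a b n k j z)) \<le> \<bar>fst z ^ p\<bar> * (K * exp (- (\<beta> / 4) * (fst z)\<^sup>2))"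
        unfolding norm_mult by (intro mult_mono K) auto
      also have "\<dots> = K * (\<bar>poly (monom 1 p) (fst z)\<bar> * exp (- (\<beta> / 4) * (fst z)\<^sup>2))"
        by (simp add: poly_monom)
      also have "\<dots> \<le> K * M"
        by (intro mult_left_mono M K0)
      finally show ?thesis .
    qed
    then show ?thesis
      unfolding bounded_iff by blast
  qed
qed

lemma is_eigenvector_Psi:
  assumes "\<beta> > 0" "j \<in> signs"
  shows "is_eigenvector \<beta> (\<i> * of_real (tau \<beta> n k j)) (Psi \<beta> n k j)"
proof -
  have "\<not> (AE z in RT. Psi \<beta> n k j z = 0)"
  proof
    assume "AE z in RT. Psi \<beta> n k j z = 0"
    then have "L2_inner (Psi \<beta> n k j) (Psi \<beta> n k j) = 0"
      unfolding L2_inner_eq by (intro integral_eq_zero_AE) (auto elim!: eventually_mono simp: field_dot_def)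
    then show False
      using Psi_orthonormal[OF assms(1,2,2), of n k n k] by simp
  qed
  then show ?thesis
    unfolding is_eigenvector_def eigenspace_def using L_graph_Psi[OF assms] by blast
qed

section \<open>Skew-adjointness and finite-dimensional eigenspaces\<close>

lemma square_integrable_scaleR_integrable:
  fixes u h :: "real \<times> real \<Rightarrow> complex"
  assumes "square_integrable u" "square_integrable h"
  shows "integrable RT (\<lambda>z. Re (u z) *\<^sub>R h z)" and "integrable RT (\<lambda>z. Im (u z) *\<^sub>R h z)"
proof -
  have m: "u \<in> borel_measurable borel" "h \<in> borel_measurable borel"
    using assms by (auto simp: square_integrable_def)
  have i: "integrable RT (\<lambda>z. (norm (u z))\<^sup>2 + (norm (h z))\<^sup>2)"
    using assms by (auto simp: square_integrable_def)
  have "(\<lambda>z. l (u z) *\<^sub>R h z) \<in> borel_measurable RT" if "l \<in> borel_measurable borel" for l :: "complex \<Rightarrow> real"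
    by (rule borel_measurable_RT) (intro borel_measurable_scaleR measurable_compose[OF m(1) that] m)
  moreover have "Re \<in> borel_measurable borel" "Im \<in> borel_measurable borel"
    by (intro borel_measurable_continuous_onI continuous_intros)+
  ultimately have mm: "(\<lambda>z. Re (u z) *\<^sub>R h z) \<in> borel_measurable RT" "(\<lambda>z. Im (u z) *\<^sub>R h z) \<in> borel_measurable RT"
    by blast+
  have b: "norm (r *\<^sub>R h z) \<le> norm ((norm (u z))\<^sup>2 + (norm (h z))\<^sup>2)" if "\<bar>r\<bar> \<le> norm (u z)" for r z
  proof -
    have "norm (r *\<^sub>R h z) \<le> norm (u z) * norm (h z)"
      using that by (simp add: mult_right_mono)
    also have "\<dots> \<le> (norm (u z))\<^sup>2 + (norm (h z))\<^sup>2"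
      by (intro mult_le_sum_squares norm_ge_zero)
    finally show ?thesis by simp
  qed
  show "integrable RT (\<lambda>z. Re (u z) *\<^sub>R h z)"
    by (rule Bochner_Integration.integrable_bound[OF i mm(1)]) (intro AE_I2 b abs_Re_le_cmod)
  show "integrable RT (\<lambda>z. Im (u z) *\<^sub>R h z)"
    by (rule Bochner_Integration.integrable_bound[OF i mm(2)]) (intro AE_I2 b abs_Im_le_cmod)
qed

lemma cnj_mult_eq: "cnj u * h = Re u *\<^sub>R h - \<i> * (Im u *\<^sub>R h)"
  by (simp add: complex_eq_iff algebra_simps)

lemma cnj_mult_integral:
  assumes "square_integrable u" "square_integrable h"
  shows "integrable RT (\<lambda>z. cnj (u z) * h z)"
    and "(\<integral>z. cnj (u z) * h z \<partial>RT) = (\<integral>z. Re (u z) *\<^sub>R h z \<partial>RT) - \<i> * (\<integral>z. Im (u z) *\<^sub>R h z \<partial>RT)"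
proof -
  note i = square_integrable_scaleR_integrable(1)[OF assms] integrable_mult_right[OF square_integrable_scaleR_integrable(2)[OF assms], of \<i>]
  show "integrable RT (\<lambda>z. cnj (u z) * h z)"
    unfolding cnj_mult_eq by (rule Bochner_Integration.integrable_diff[OF i])
  show "(\<integral>z. cnj (u z) * h z \<partial>RT) = (\<integral>z. Re (u z) *\<^sub>R h z \<partial>RT) - \<i> * (\<integral>z. Im (u z) *\<^sub>R h z \<partial>RT)"
    unfolding cnj_mult_eq Bochner_Integration.integral_diff[OF i] integral_mult_right_zero ..
qed

text \<open>The adjoint relation $\langle Lf,\Psi\rangle=-\langle f,L\Psi\rangle$; the components of $\Psi$ are themselves test functions.\<close>

lemma eigenspace_inner_Psi:
  assumes "\<beta> > 0" "j \<in> signs" "f \<in> eigenspace \<beta> \<mu>" "\<i> * of_real (tau \<beta> n k j) \<noteq> \<mu>"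
  shows "L2_inner f (Psi \<beta> n k j) = 0"
proof -
  define t where "t = \<i> * complex_of_real (tau \<beta> n k j)"
  define P where "P a b i z = Psi_pd \<beta> a b n k j z $ i" for a b i z
  note eig = Psi_pd_eigen[where n = n and k = k, OF assms(1,2), folded t_def P_def]
  have L: "L_graph \<beta> f (\<lambda>z. \<mu> *s f z)"
    using assms(3) by (simp add: eigenspace_def)
  then have "square_integrable f"
    by (simp add: L_graph_def square_integrable_iff_L2)
  then have sf: "square_integrable (\<lambda>z. f z $ i)" for i
    by (rule square_integrable_component)
  have sP: "square_integrable (P a b i)" for a b i
    unfolding P_def by (rule square_integrable_Psi_pd_component[OF assms(1)])
  \<comment> \<open>Multiplication by x_1 preserves square integrability here because the eigenvalue
    equation expresses the product by other derivatives of the eigenvector.\<close>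
  have sX: "square_integrable (\<lambda>z. of_real (\<beta> * fst z) * P 0 0 3 z)" "square_integrable (\<lambda>z. of_real (\<beta> * fst z) * P 0 0 2 z)"
  proof -
    have "of_real (\<beta> * fst z) * P 0 0 3 z = t * P 0 0 2 z - P 1 0 1 z" for z
      unfolding eig(2)[of z, symmetric] by simp
    then show "square_integrable (\<lambda>z. of_real (\<beta> * fst z) * P 0 0 3 z)"
      by (simp only: square_integrable_diff square_integrable_mult sP)
    have "of_real (\<beta> * fst z) * P 0 0 2 z = P 0 1 1 z - t * P 0 0 3 z" for z
      unfolding eig(3)[of z, symmetric] by simp
    then show "square_integrable (\<lambda>z. of_real (\<beta> * fst z) * P 0 0 2 z)"
      by (simp only: square_integrable_diff square_integrable_mult sP)
  qed
  define B where "B u i = (\<integral>z. cnj (u z) * f z $ i \<partial>RT)" for u i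
  have T: "B (P 1 0 1) 2 + B (P 0 1 1) 3 = - \<mu> * B (P 0 0 1) 1"
    "B (\<lambda>z. of_real (\<beta> * fst z) * P 0 0 2 z) 3 - B (P 1 0 2) 1 = \<mu> * B (P 0 0 2) 2"
    "B (\<lambda>z. of_real (\<beta> * fst z) * P 0 0 3 z) 2 + B (P 0 1 3) 1 = - \<mu> * B (P 0 0 3) 3"
  proof -
    \<comment> \<open>Test functions are real, so the equation for f is tested with real and
      imaginary parts separately; l stands for either. They are recombined as Re - i Im, the complex
      conjugate.\<close>
    define J where "J l u i = (\<integral>z. l (u z) *\<^sub>R f z $ i \<partial>RT)" for l :: "complex \<Rightarrow> real" and u i
    have J: "J l (P 1 0 1) 2 + J l (P 0 1 1) 3 = - \<mu> * J l (P 0 0 1) 1"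
      "J l (\<lambda>z. of_real (\<beta> * fst z) * P 0 0 2 z) 3 - J l (P 1 0 2) 1 = \<mu> * J l (P 0 0 2) 2"
      "J l (\<lambda>z. of_real (\<beta> * fst z) * P 0 0 3 z) 2 + J l (P 0 1 3) 1 = - \<mu> * J l (P 0 0 3) 3"
      if l: "bounded_linear l" and int: "\<And>u i. square_integrable u \<Longrightarrow> integrable RT (\<lambda>z. l (u z) *\<^sub>R f z $ i)" for l :: "complex \<Rightarrow> real"
    proof -
      have li: "bounded_linear (\<lambda>v :: complex ^ 3. l (v $ i))" for i
        by (rule bounded_linear_compose[OF l bounded_linear_vec_nth])
      define \<phi> where "\<phi> i z = l (P 0 0 i z)" for i z
      have \<phi>: "\<phi> i \<in> schwartz_RT" for i
        using schwartz_linear_Psi[OF assms(1) li, where n = n and k = k and j = j and ?i1 = i] unfolding \<phi>_def P_def Psi_pd_zero[OF assms(1)] .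
      have pd: "pd a b (\<phi> i) = (\<lambda>z. l (P a b i z))" for a b i
        using pd_linear_Psi[OF assms(1) li, where n = n and k = k and j = j and ?i1 = i] unfolding \<phi>_def P_def Psi_pd_zero[OF assms(1)] .
      have lx: "l (of_real (\<beta> * fst z) * w) = \<beta> * fst z * l w" for z w
        using linear_scale[OF bounded_linear.linear[OF l], of "\<beta> * fst z" w] by (simp add: scaleR_conv_of_real)
      have \<mu>: "(\<integral>z. l (P 0 0 i z) *\<^sub>R (\<mu> *s f z) $ i \<partial>RT) = \<mu> * (\<integral>z. l (P 0 0 i z) *\<^sub>R f z $ i \<partial>RT)" for i
        unfolding vector_smult_component mult_scaleR_right[symmetric] by (rule integral_mult_right_zero)
      note G = L[unfolded L_graph_def, THEN conjunct2, THEN conjunct2, rule_format, OF \<phi>, unfolded pd]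
      have m: "(\<integral>z. - a z - b z \<partial>RT) = - ((\<integral>z. a z \<partial>RT) + (\<integral>z. b z \<partial>RT))"
        if "integrable RT a" "integrable RT b" for a b :: "real \<times> real \<Rightarrow> complex"
        using that by simp
      have "- (J l (P 1 0 1) 2 + J l (P 0 1 1) 3) = \<mu> * J l (P 0 0 1) 1"
        using G[of 1, THEN conjunct1] unfolding \<phi>_def \<mu> m[OF int[OF sP] int[OF sP]] J_def .
      then show "J l (P 1 0 1) 2 + J l (P 0 1 1) 3 = - \<mu> * J l (P 0 0 1) 1"
        by (simp only: minus_equation_iff mult_minus_left)
      show "J l (\<lambda>z. of_real (\<beta> * fst z) * P 0 0 2 z) 3 - J l (P 1 0 2) 1 = \<mu> * J l (P 0 0 2) 2"
        using G[of 2, THEN conjunct2, THEN conjunct1] Bochner_Integration.integral_diff[OF int[OF sX(2)] int[OF sP]]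
        unfolding \<phi>_def \<mu> J_def lx by simp
      have "- (J l (\<lambda>z. of_real (\<beta> * fst z) * P 0 0 3 z) 2 + J l (P 0 1 3) 1) = \<mu> * J l (P 0 0 3) 3"
        using G[of 3, THEN conjunct2, THEN conjunct2] m[OF int[OF sX(1)] int[OF sP]] unfolding \<phi>_def \<mu> J_def lx by simp
      then show "J l (\<lambda>z. of_real (\<beta> * fst z) * P 0 0 3 z) 2 + J l (P 0 1 3) 1 = - \<mu> * J l (P 0 0 3) 3"
        by (simp only: minus_equation_iff mult_minus_left)
    qed
    note re = J[OF bounded_linear_Re square_integrable_scaleR_integrable(1)[OF _ sf]]
      and im = J[OF bounded_linear_Im square_integrable_scaleR_integrable(2)[OF _ sf]]
    have c: "(a1 - \<i> * a2) + (b1 - \<i> * b2) = - \<mu> * (d1 - \<i> * d2)"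
      if "a1 + b1 = - \<mu> * d1" "a2 + b2 = - \<mu> * d2" for a1 a2 b1 b2 d1 d2
    proof -
      have "(a1 - \<i> * a2) + (b1 - \<i> * b2) = (a1 + b1) - \<i> * (a2 + b2)"
        by (simp add: algebra_simps)
      then show ?thesis
        unfolding that by (simp add: algebra_simps)
    qed
    have c': "(a1 - \<i> * a2) - (b1 - \<i> * b2) = \<mu> * (d1 - \<i> * d2)"
      if "a1 - b1 = \<mu> * d1" "a2 - b2 = \<mu> * d2" for a1 a2 b1 b2 d1 d2
    proof -
      have "(a1 - \<i> * a2) - (b1 - \<i> * b2) = (a1 - b1) - \<i> * (a2 - b2)"
        by (simp add: algebra_simps)
      then show ?thesis
        unfolding that by (simp add: algebra_simps)
    qed
    have Be: "B u i = J Re u i - \<i> * J Im u i" if "square_integrable u" for u i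
      unfolding B_def J_def by (rule cnj_mult_integral(2)[OF that sf])
    show "B (P 1 0 1) 2 + B (P 0 1 1) 3 = - \<mu> * B (P 0 0 1) 1"
      unfolding Be[OF sP] by (rule c[OF re(1) im(1)])
    show "B (\<lambda>z. of_real (\<beta> * fst z) * P 0 0 2 z) 3 - B (P 1 0 2) 1 = \<mu> * B (P 0 0 2) 2"
      unfolding Be[OF sP] Be[OF sX(2)] by (rule c'[OF re(2) im(2)])
    show "B (\<lambda>z. of_real (\<beta> * fst z) * P 0 0 3 z) 2 + B (P 0 1 3) 1 = - \<mu> * B (P 0 0 3) 3"
      unfolding Be[OF sP] Be[OF sX(1)] by (rule c[OF re(3) im(3)])
  qed
  have Bi: "integrable RT (\<lambda>z. cnj (u z) * f z $ i)" if "square_integrable u" for u i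
    by (rule cnj_mult_integral(1)[OF that sf])
  have Badd: "B u i + B v i = B (\<lambda>z. u z + v z) i" "B u i - B v i = B (\<lambda>z. u z - v z) i"
    if "square_integrable u" "square_integrable v" for u v i
    unfolding B_def using Bi[OF that(1), of i] Bi[OF that(2), of i] by (simp_all add: distrib_right left_diff_distrib)
  have Bt: "B (\<lambda>z. t * u z) i = - t * B u i" for u i
  proof -
    \<comment> \<open>The eigenvalue t is imaginary as tau is real. This sign makes the equations D
      match those in T.\<close>
    have "cnj t = - t" by (simp add: t_def)
    then show ?thesis unfolding B_def by (simp add: mult.assoc)
  qed
  have D: "B (P 1 0 2) 1 + B (P 0 1 3) 1 = - t * B (P 0 0 1) 1"
    "B (\<lambda>z. of_real (\<beta> * fst z) * P 0 0 3 z) 2 + B (P 1 0 1) 2 = - t * B (P 0 0 2) 2"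
    "B (P 0 1 1) 3 - B (\<lambda>z. of_real (\<beta> * fst z) * P 0 0 2 z) 3 = - t * B (P 0 0 3) 3"
  proof -
    show "B (P 1 0 2) 1 + B (P 0 1 3) 1 = - t * B (P 0 0 1) 1"
      unfolding Badd(1)[OF sP sP] eig(1) Bt ..
    show "B (\<lambda>z. of_real (\<beta> * fst z) * P 0 0 3 z) 2 + B (P 1 0 1) 2 = - t * B (P 0 0 2) 2"
      unfolding Badd(1)[OF sX(1) sP] eig(2) Bt ..
    have "P 0 1 1 z - of_real (\<beta> * fst z) * P 0 0 2 z = t * P 0 0 3 z" for z
      using eig(3)[of z] by simp
    then show "B (P 0 1 1) 3 - B (\<lambda>z. of_real (\<beta> * fst z) * P 0 0 2 z) 3 = - t * B (P 0 0 3) 3"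
      unfolding Badd(2)[OF sP sX(2)] Bt[symmetric] by (simp only:)
  qed
  define S where "S = B (P 0 0 1) 1 + B (P 0 0 2) 2 + B (P 0 0 3) 3"
  \<comment> \<open>T groups the six pairings by the component of Psi, D by the component of f.
    Regrouping gives \<mu> S = t S, and t differs from \<mu>.\<close>
  have "\<mu> * S = - (B (P 1 0 1) 2 + B (P 0 1 1) 3) + (B (\<lambda>z. of_real (\<beta> * fst z) * P 0 0 2 z) 3 - B (P 1 0 2) 1)
      - (B (\<lambda>z. of_real (\<beta> * fst z) * P 0 0 3 z) 2 + B (P 0 1 3) 1)"
    unfolding T S_def by (simp add: algebra_simps)
  also have "\<dots> = - (B (P 1 0 2) 1 + B (P 0 1 3) 1) - (B (\<lambda>z. of_real (\<beta> * fst z) * P 0 0 3 z) 2 + B (P 1 0 1) 2)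
      - (B (P 0 1 1) 3 - B (\<lambda>z. of_real (\<beta> * fst z) * P 0 0 2 z) 3)"
    by simp
  also have "\<dots> = t * S"
    unfolding D S_def by (simp add: algebra_simps)
  finally have "S = 0"
    using assms(4) by (simp add: t_def)
  moreover have "L2_inner f (Psi \<beta> n k j) = S"
    unfolding L2_inner_eq field_dot_def sum_3 S_def B_def Psi_pd_zero[OF assms(1), symmetric] P_def[symmetric]
    using Bi[OF sP] by (simp add: mult.commute)
  ultimately show ?thesis by simp
qed

lemma L2_inner_diff_left:
  assumes "square_integrable f" "square_integrable g" "square_integrable h"
  shows "L2_inner (\<lambda>z. f z - g z) h = L2_inner f h - L2_inner g h"
proof -
  have "field_dot (f z - g z) (h z) = field_dot (f z) (h z) - field_dot (g z) (h z)" for z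
    by (simp add: field_dot_def sum_3 algebra_simps)
  then show ?thesis
    unfolding L2_inner_eq using assms by (simp add: field_dot_integrable)
qed

lemma finite_dim_eigenspace:
  assumes "\<beta> > 0" "\<mu> \<noteq> 0"
  shows "finite_dim (eigenspace \<beta> \<mu>)"
proof -
  define I where "I = {(n, k, j). (n, k, j) \<in> modes \<and> \<i> * of_real (tau \<beta> n k j) = \<mu>}"
  define e where "e = (\<lambda>(n, k, j). Psi \<beta> n k j)"
  \<comment> \<open>If \<mu> is not of the form i tau, the set I is empty; otherwise it is a fibre
    of tau over a nonzero real number.\<close>
  have fin: "finite I"
  proof (cases "I = {}")
    case False
    then obtain t where t: "\<mu> = \<i> * complex_of_real t"
      unfolding I_def by auto
    then have "t \<noteq> 0"
      using assms(2) by auto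
    have "I = {(n, k, j). (n, k, j) \<in> modes \<and> tau \<beta> n k j = t}"
      unfolding I_def t by auto
    then show ?thesis
      using finite_tau_fiber[OF assms(1) \<open>t \<noteq> 0\<close>] by simp
  qed simp
  have sq: "square_integrable (e i)" for i
    by (cases i) (simp add: e_def square_integrable_Psi[OF assms(1)])
  have on: "L2_inner (e i) (e i') = (if i = i' then 1 else 0)" if "i \<in> modes" "i' \<in> modes" for i i'
    using that Psi_orthonormal[OF assms(1)] by (cases i; cases i') (auto simp: e_def modes_def)
  have Im: "I \<subseteq> modes"
    by (auto simp: I_def)
  \<comment> \<open>\<open>finite_dim\<close> sums over a set of fields, not over indices, so
    different modes must give different fields; orthonormality ensures it.\<close>
  have inj: "inj_on e I"
  proof (rule inj_onI)
    fix i i' assume i: "i \<in> I" "i' \<in> I" "e i = e i'"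
    then have "L2_inner (e i) (e i') = 1"
      using on[of i i] Im by auto
    then have "(if i = i' then 1 else 0) = (1 :: complex)"
      unfolding on[OF subsetD[OF Im i(1)] subsetD[OF Im i(2)]] .
    then show "i = i'"
      by (simp split: if_splits)
  qed
  have "\<exists>c. AE z in RT. f z = (\<Sum>b\<in>e ` I. c b *s b z)" if f: "f \<in> eigenspace \<beta> \<mu>" for f
  proof -
    have sf: "square_integrable f"
      using f by (simp add: eigenspace_def L_graph_def square_integrable_iff_L2)
    \<comment> \<open>The orthogonal projection onto the span of the modes in I. The rest f - p is
      orthogonal to these by construction and to all other modes by
      \<open>eigenspace_inner_Psi\<close>.\<close>
    define p where "p z = (\<Sum>i\<in>I. L2_inner f (e i) *s e i z)" for z
    have sp: "square_integrable p"
      unfolding p_def by (intro square_integrable_sum square_integrable_scale sq fin)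
    have 1: "L2_inner (\<lambda>z. f z - p z) (e i) = 0" if i: "i \<in> modes" for i
    proof -
      have "L2_inner p (e i) = (\<Sum>i'\<in>I. L2_inner f (e i') * L2_inner (e i') (e i))"
        unfolding p_def by (rule L2_inner_sum_left[OF fin sq sq])
      also have "\<dots> = (\<Sum>i'\<in>I. if i' = i then L2_inner f (e i) else 0)"
        using Im i by (intro sum.cong) (auto simp: on)
      also have "\<dots> = L2_inner f (e i)"
      proof (cases "i \<in> I")
        case False
        obtain n k j where "i = (n, k, j)" by (cases i)
        then have "L2_inner f (e i) = 0"
          using i False eigenspace_inner_Psi[OF assms(1) _ f, of j n k] by (auto simp: I_def e_def modes_def)
        then show ?thesis using fin by simp
      qed (use fin in simp)
      finally show ?thesis
        unfolding L2_inner_diff_left[OF sf sp sq] by simp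
    qed
    have sfp: "square_integrable (\<lambda>z. f z - p z)"
      by (rule square_integrable_diff[OF sf sp])
    have "L2_inner (\<lambda>z. f z - p z) (slot \<beta> n k s) = 0" if "s \<in> signs" for n k s
    proof -
      have "slot \<beta> n k s = (\<lambda>z. \<Sum>j\<in>signs. cnj (slot_coef \<beta> n k j s) *s Psi \<beta> n k j z)"
        by (rule ext) (rule slot_eq_sum_Psi[OF assms(1) that])
      moreover have "L2_inner (\<lambda>z. f z - p z) (Psi \<beta> n k j) = 0" if "j \<in> signs" for j
        using 1[of "(n, k, j)"] that by (simp add: e_def modes_def)
      moreover have "L2_inner (\<lambda>z. f z - p z) (\<lambda>z. \<Sum>j\<in>signs. cnj (slot_coef \<beta> n k j s) *s Psi \<beta> n k j z) =
          (\<Sum>j\<in>signs. cnj (cnj (slot_coef \<beta> n k j s)) * L2_inner (\<lambda>z. f z - p z) (Psi \<beta> n k j))"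
        by (rule L2_inner_sum_right[OF _ square_integrable_Psi[OF assms(1)] sfp]) simp
      ultimately show ?thesis by simp
    qed
    then have "AE z in RT. f z - p z = 0"
      by (intro L2_total[OF assms(1) sfp])
    then have "AE z in RT. f z = (\<Sum>b\<in>e ` I. L2_inner f b *s b z)"
      by eventually_elim (simp add: p_def sum.reindex[OF inj])
    then show ?thesis by (rule exI[of _ "L2_inner f"])
  qed
  moreover have "e ` I \<subseteq> eigenspace \<beta> \<mu>"
    using L_graph_Psi[OF assms(1)] by (auto simp: e_def I_def eigenspace_def modes_def)
  ultimately show ?thesis
    unfolding finite_dim_def using fin by blast
qed

lemma Psi_Linf_bound:
  assumes "\<beta> > 0"
  shows "\<exists>C>0. \<forall>(n, k, j)\<in>modes. Linf_norm (Psi \<beta> n k j) \<le> ennreal C"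
proof -
  obtain C where C: "C > 0" "\<forall>(n, k, j)\<in>modes. \<forall>z. norm (Psi_pd \<beta> 0 0 n k j z) \<le> C * (1 + (of_int k)\<^sup>2 + real n) powr (real (0 + 0) / 2)"
    using Psi_pd_bound[OF assms, of 0 0] by blast
  have "Linf_norm (Psi \<beta> n k j) \<le> ennreal C" if "(n, k, j) \<in> modes" for n k j
  proof (rule Linf_norm_le)
    show "Psi \<beta> n k j \<in> borel_measurable borel"
      using square_integrable_Psi[OF assms] by (simp add: square_integrable_def)
    have "0 < 1 + (real_of_int k)\<^sup>2 + real n"
      by (simp add: add_pos_nonneg)
    then show "norm (Psi \<beta> n k j z) \<le> C" for z
      using C(2) that by (cases z) (auto simp: Psi_pd_zero[OF assms] dest!: bspec[where x = "(n, k, j)"])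
  qed
  then show ?thesis
    using C(1) by blast
qed

theorem proposition2p2p3:
  fixes \<beta> :: real
  assumes "\<beta> > 0"
  shows "hilbert_basis modes (\<lambda>(n, k, j). Psi \<beta> n k j) \<and>
    (\<forall>(n, k, j)\<in>modes. is_eigenvector \<beta> (\<i> * of_real (tau \<beta> n k j)) (Psi \<beta> n k j)) \<and>
    (\<exists>C :: real \<Rightarrow> real. (\<forall>s\<ge>0. C s > 0) \<and>
      (\<forall>s\<ge>0. \<forall>(n, k, j)\<in>modes.
        Linf_norm (Psi \<beta> n k j) \<le> ennreal (C 0) \<and>
        Wsinf_norm s (Psi \<beta> n k j)
          \<le> ennreal (C s * (1 + (of_int k)\<^sup>2 + real n) powr (s / 2)) \<and>
        ennreal (inverse (C s) * (1 + (of_int k)\<^sup>2 + real n) powr (s / 2))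
          \<le> Hs_norm s (Psi \<beta> n k j) \<and>
        Hs_norm s (Psi \<beta> n k j)
          \<le> ennreal (C s * (1 + (of_int k)\<^sup>2 + real n) powr (s / 2)))) \<and>
    (\<forall>\<mu>. \<mu> \<noteq> 0 \<and> is_eigenvalue \<beta> \<mu> \<longrightarrow> finite_dim (eigenspace \<beta> \<mu>))"
proof (intro conjI)
  show "hilbert_basis modes (\<lambda>(n, k, j). Psi \<beta> n k j)"
    by (rule hilbert_basis_Psi[OF assms])
  show "\<forall>(n, k, j)\<in>modes. is_eigenvector \<beta> (\<i> * of_real (tau \<beta> n k j)) (Psi \<beta> n k j)"
    using is_eigenvector_Psi[OF assms] by (auto simp: modes_def)
  show "\<forall>\<mu>. \<mu> \<noteq> 0 \<and> is_eigenvalue \<beta> \<mu> \<longrightarrow> finite_dim (eigenspace \<beta> \<mu>)"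
    using finite_dim_eigenspace[OF assms] by blast
  define N where "N n k = 1 + (real_of_int k)\<^sup>2 + real n" for n k
  obtain A where A: "A > 0" "\<And>n k j. (n, k, j) \<in> modes \<Longrightarrow> Linf_norm (Psi \<beta> n k j) \<le> ennreal A"
    using Psi_Linf_bound[OF assms] by blast
  have "\<exists>B>0. \<forall>(n, k, j)\<in>modes. Wsinf_norm s (Psi \<beta> n k j) \<le> ennreal (B * N n k powr (s / 2))" if "s \<ge> 0" for s
    using Psi_Wsinf_bound[OF assms that] unfolding N_def .
  then obtain B where B: "\<And>s. s \<ge> 0 \<Longrightarrow> B s > 0"
    "\<And>s n k j. s \<ge> 0 \<Longrightarrow> (n, k, j) \<in> modes \<Longrightarrow> Wsinf_norm s (Psi \<beta> n k j) \<le> ennreal (B s * N n k powr (s / 2))"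
    by (metis (no_types, lifting) case_prodD)
  have "\<exists>D>0. \<forall>(n, k, j)\<in>modes. ennreal (inverse D * N n k powr (s / 2)) \<le> Hs_norm s (Psi \<beta> n k j) \<and>
      Hs_norm s (Psi \<beta> n k j) \<le> ennreal (D * N n k powr (s / 2))" if "s \<ge> 0" for s
    using Psi_Hs_bound[OF assms that] unfolding N_def .
  then obtain D where D: "\<And>s. s \<ge> 0 \<Longrightarrow> D s > 0"
    "\<And>s n k j. s \<ge> 0 \<Longrightarrow> (n, k, j) \<in> modes \<Longrightarrow> ennreal (inverse (D s) * N n k powr (s / 2)) \<le> Hs_norm s (Psi \<beta> n k j)"
    "\<And>s n k j. s \<ge> 0 \<Longrightarrow> (n, k, j) \<in> modes \<Longrightarrow> Hs_norm s (Psi \<beta> n k j) \<le> ennreal (D s * N n k powr (s / 2))"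
    by (metis (no_types, lifting) case_prodD)
  \<comment> \<open>One constant for all estimates: enlarging it weakens the upper bounds and,
    through its inverse, also the lower one.\<close>
  define C where "C s = max A (max (B s) (D s))" for s
  have C: "A \<le> C s" "B s \<le> C s" "D s \<le> C s" "C s > 0" for s
    using A(1) by (auto simp: C_def less_max_iff_disj)
  have mono: "ennreal (a * N n k powr (s / 2)) \<le> ennreal (b * N n k powr (s / 2))" if "a \<le> b" for a b n k s
    using that by (intro ennreal_leI mult_right_mono) auto
  have "Linf_norm (Psi \<beta> n k j) \<le> ennreal (C 0) \<and>
      Wsinf_norm s (Psi \<beta> n k j) \<le> ennreal (C s * N n k powr (s / 2)) \<and>
      ennreal (inverse (C s) * N n k powr (s / 2)) \<le> Hs_norm s (Psi \<beta> n k j) \<and>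
      Hs_norm s (Psi \<beta> n k j) \<le> ennreal (C s * N n k powr (s / 2))" if s: "s \<ge> 0" and m: "(n, k, j) \<in> modes" for s n k j
  proof (intro conjI)
    show "Linf_norm (Psi \<beta> n k j) \<le> ennreal (C 0)"
      by (rule order_trans[OF A(2)[OF m] ennreal_leI[OF C(1)]])
    show "Wsinf_norm s (Psi \<beta> n k j) \<le> ennreal (C s * N n k powr (s / 2))"
      by (rule order_trans[OF B(2)[OF s m] mono[OF C(2)]])
    show "ennreal (inverse (C s) * N n k powr (s / 2)) \<le> Hs_norm s (Psi \<beta> n k j)"
      by (rule order_trans[OF mono[OF le_imp_inverse_le[OF C(3) D(1)[OF s]]] D(2)[OF s m]])
    show "Hs_norm s (Psi \<beta> n k j) \<le> ennreal (C s * N n k powr (s / 2))"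
      by (rule order_trans[OF D(3)[OF s m] mono[OF C(3)]])
  qed
  then show "\<exists>C :: real \<Rightarrow> real. (\<forall>s\<ge>0. C s > 0) \<and>
      (\<forall>s\<ge>0. \<forall>(n, k, j)\<in>modes.
        Linf_norm (Psi \<beta> n k j) \<le> ennreal (C 0) \<and>
        Wsinf_norm s (Psi \<beta> n k j)
          \<le> ennreal (C s * (1 + (of_int k)\<^sup>2 + real n) powr (s / 2)) \<and>
        ennreal (inverse (C s) * (1 + (of_int k)\<^sup>2 + real n) powr (s / 2))
          \<le> Hs_norm s (Psi \<beta> n k j) \<and>
        Hs_norm s (Psi \<beta> n k j)
          \<le> ennreal (C s * (1 + (of_int k)\<^sup>2 + real n) powr (s / 2)))"
    unfolding N_def using C(4) by (intro exI[of _ C]) blast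
qed

end
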